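(* Let $Y/X$ be an abelian covering of connected graphs with Galois group $\Gamma$. Put $R=\mathbb{Z}[\Gamma]$, $N_\Gamma=\sum_{\gamma\in\Gamma}\gamma$ and $\overline R=R/(N_\Gamma)$, and let $\overline{Z_{Y/X}}\in\overline R$ be the image of $Z_{Y/X}\in R$. Then $$\mathrm{Fitt}_{\overline R}\bigl(\overline R\otimes_R\mathrm{Jac}(Y)\bigr)=\overline{Z_{Y/X}}\;\mathrm{Fitt}^{[1]}_{\overline R}\bigl(\mathbb{Z}/(\#\Gamma)\mathbb{Z}\bigr)$$ as ideals of $\overline R$, where $\Gamma$ acts trivially on $\mathbb{Z}/(\#\Gamma)\mathbb{Z}$.
   Context: Graphs. A graph $X$ consists of a finite set $V_X$ (vertices), a finite set $\mathbb{E}_X$ (edges), a map $e\mapsto\overline e$ on $\mathbb{E}_X$ with $\overline e\ne e$ and $\overline{\overline e}=e$, and maps $s,t:\mathbb{E}_X\to V_X$ with $s(\overline e)=t(e)$, $t(\overline e)=s(e)$ (multi-edges and loops are allowed). Put $\mathbb{E}_{X,v}=\{e\in\mathbb{E}_X\mid s(e)=v\}$. For a connected graph $X$: $\mathrm{Div}(X)=\bigoplus_{v\in V_X}\mathbb{Z}[v]$; $\deg_X:\mathrm{Div}(X)\to\mathbb{Z}$ sends every $[v]$ to $1$; $\mathrm{Div}^0(X)=\ker\deg_X$; the Laplacian $\mathcal{L}_X:\mathrm{Div}(X)\to\mathrm{Div}(X)$ is $\mathcal{L}_X([v])=(\#\mathbb{E}_{X,v})[v]-\sum_{e\in\mathbb{E}_{X,v}}[t(e)]$,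 whose image lies in $\mathrm{Div}^0(X)$; $\mathrm{Jac}(X)=\mathrm{Div}^0(X)/\mathcal{L}_X(\mathrm{Div}(X))$. Coverings. A covering $Y/X$ of connected graphs is a surjective morphism of graphs $\pi:Y\to X$ that is locally an isomorphism (it induces bijections $\mathbb{E}_{Y,w}\to\mathbb{E}_{X,\pi(w)}$). Its degree is $\#\pi^{-1}(v)$ for any $v\in V_X$. Its Galois group $\Gamma$ is the group of automorphisms of $Y$ compatible with $\pi$. The covering is Galois if $\#\Gamma$ equals the degree, and abelian if it is Galois and $\Gamma$ is abelian. Then $\mathrm{Div}(Y)$ is a free $\mathbb{Z}[\Gamma]$-module, $\mathcal{L}_Y$ is $\mathbb{Z}[\Gamma]$-linear, $\mathrm{Jac}(Y)$ is a $\mathbb{Z}[\Gamma]$-module, and (for $\Gamma$ abelian) $Z_{Y/X}=\det_{\mathbb{Z}[\Gamma]}(\mathcal{L}_Y\mid\mathrm{Div}(Y))\in\mathbb{Z}[\Gamma]$. Fitting ideals and the shift. Let $A$ be a commutative ring and $\mathrm{Frac}(A)$ its total ring of fractions. For a finitely generated $A$-module $M$, $\mathrm{Fitt}_A(M)$ is the initial Fitting ideal (generated by all $n\times n$ minors of a presentation matrix with $n$ generators). An $A$-module is torsion if each of its elements is annihilated by a non-zero-divisor of $A$. Let $\mathcal{P}_A$ be the category of finitely presented torsion $A$-modules of projective dimension $\le 1$; for $P\in\mathcal{P}_A$ the ideal $\mathrm{Fitt}_A(P)$ is invertible as a fractional ideal. For a finitely presented torsion $A$-module $M$, choose an exact sequence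 $0\to N\to P\to M\to 0$ with $P\in\mathcal{P}_A$ and set $\mathrm{Fitt}^{[1]}_A(M)=\mathrm{Fitt}_A(P)^{-1}\mathrm{Fitt}_A(N)\subset\mathrm{Frac}(A)$; this fractional ideal is independent of the choice. *)

theory Defs
  imports
    "HOL-Algebra.Bij"
    "HOL-Algebra.Free_Abelian_Groups"
    "HOL-Algebra.Ideal_Product"
    "HOL-Algebra.IntRing"
    "HOL-Algebra.Module"
    "HOL-Combinatorics.Permutations"
    "Graph_Theory.Digraph_Component"
    "Graph_Theory.Bidirected_Digraph"
begin

section \<open>Graphs, coverings and Galois groups\<close>

text \<open>
  Graphs are finite multigraphs with loops, given by their oriented edges: source and target are
  \<open>tail\<close> and \<open>head\<close>, and the fixed-point free edge inversion is \<open>bar\<close>.  By the convention of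
  \<open>bidirected_digraph\<close>, \<open>bar\<close> is a total function that is the identity off the edge set; this
  merely normalises its irrelevant values.
\<close>

definition connected_graph :: "('v, 'e) pre_digraph \<Rightarrow> ('e \<Rightarrow> 'e) \<Rightarrow> bool" where
  "connected_graph X bar \<longleftrightarrow> fin_digraph X \<and> bidirected_digraph X bar \<and> connected X"

definition graph_morphism ::
  "('w, 'f) pre_digraph \<Rightarrow> ('f \<Rightarrow> 'f) \<Rightarrow> ('v, 'e) pre_digraph \<Rightarrow> ('e \<Rightarrow> 'e) \<Rightarrow>
    ('w \<Rightarrow> 'v) \<Rightarrow> ('f \<Rightarrow> 'e) \<Rightarrow> bool" where
  "graph_morphism Y invY X invX pV pE \<longleftrightarrow>
     pV \<in> verts Y \<rightarrow> verts X \<and> pE \<in> arcs Y \<rightarrow> arcs X \<and>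
     (\<forall>e \<in> arcs Y. tail X (pE e) = pV (tail Y e) \<and> head X (pE e) = pV (head Y e) \<and>
                    pE (invY e) = invX (pE e))"

definition graph_covering ::
  "('w, 'f) pre_digraph \<Rightarrow> ('f \<Rightarrow> 'f) \<Rightarrow> ('v, 'e) pre_digraph \<Rightarrow> ('e \<Rightarrow> 'e) \<Rightarrow>
    ('w \<Rightarrow> 'v) \<Rightarrow> ('f \<Rightarrow> 'e) \<Rightarrow> bool" where
  "graph_covering Y invY X invX pV pE \<longleftrightarrow>
     connected_graph Y invY \<and> connected_graph X invX \<and>
     graph_morphism Y invY X invX pV pE \<and>
     pV ` verts Y = verts X \<and> pE ` arcs Y = arcs X \<and>
     (\<forall>w \<in> verts Y. bij_betw pE (out_arcs Y w) (out_arcs X (pV w)))"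

text \<open>
  An automorphism is a pair of permutations of the vertices and of the edges, each normalised to
  \<open>undefined\<close> off its domain as in \<^const>\<open>BijGroup\<close>, so that distinct elements of the group are
  distinct automorphisms.
\<close>

definition galois_group ::
  "('w, 'f) pre_digraph \<Rightarrow> ('f \<Rightarrow> 'f) \<Rightarrow> ('w \<Rightarrow> 'v) \<Rightarrow> ('f \<Rightarrow> 'e) \<Rightarrow>
    (('w \<Rightarrow> 'w) \<times> ('f \<Rightarrow> 'f)) monoid" where
  "galois_group Y invY pV pE =
     (BijGroup (verts Y) \<times>\<times> BijGroup (arcs Y))
       \<lparr>carrier := {(gV, gE). gV \<in> Bij (verts Y) \<and> gE \<in> Bij (arcs Y) \<and>
                      graph_morphism Y invY Y invY gV gE \<and>
                      (\<forall>w \<in> verts Y. pV (gV w) = pV w) \<and> (\<forall>e \<in> arcs Y. pE (gE e) = pE e)}\<rparr>"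

text \<open>The degree of a covering is the common cardinality of its (vertex) fibres.\<close>

definition abelian_covering ::
  "('w, 'f) pre_digraph \<Rightarrow> ('f \<Rightarrow> 'f) \<Rightarrow> ('v, 'e) pre_digraph \<Rightarrow> ('e \<Rightarrow> 'e) \<Rightarrow>
    ('w \<Rightarrow> 'v) \<Rightarrow> ('f \<Rightarrow> 'e) \<Rightarrow> bool" where
  "abelian_covering Y invY X invX pV pE \<longleftrightarrow>
     graph_covering Y invY X invX pV pE \<and>
     (\<forall>v \<in> verts X. card (carrier (galois_group Y invY pV pE)) = card {w \<in> verts Y. pV w = v}) \<and>
     comm_group (galois_group Y invY pV pE)"


section \<open>Modules over a commutative ring\<close>

text \<open>
  Modules are \<^typ>\<open>('a, 'm) module\<close> records.  These inherit the fields \<open>mult\<close> and \<open>one\<close> from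
  rings, which play no role for modules and are left \<open>undefined\<close>.
\<close>

definition module_hom :: "'a ring \<Rightarrow> ('a, 'm) module \<Rightarrow> ('a, 'n) module \<Rightarrow> ('m \<Rightarrow> 'n) set" where
  "module_hom A M N = {f. f \<in> carrier M \<rightarrow> carrier N \<and>
     (\<forall>x \<in> carrier M. \<forall>y \<in> carrier M. f (x \<oplus>\<^bsub>M\<^esub> y) = f x \<oplus>\<^bsub>N\<^esub> f y) \<and>
     (\<forall>a \<in> carrier A. \<forall>x \<in> carrier M. f (a \<odot>\<^bsub>M\<^esub> x) = a \<odot>\<^bsub>N\<^esub> f x)}"

text \<open>Exactness of \<open>0 \<rightarrow> N \<rightarrow> P \<rightarrow> M \<rightarrow> 0\<close> with maps \<open>i\<close> and \<open>p\<close>.\<close>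

definition short_exact ::
  "'a ring \<Rightarrow> ('a, 'n) module \<Rightarrow> ('a, 'p) module \<Rightarrow> ('a, 'm) module \<Rightarrow> ('n \<Rightarrow> 'p) \<Rightarrow> ('p \<Rightarrow> 'm) \<Rightarrow> bool"
  where
  "short_exact A N P M i p \<longleftrightarrow>
     Module.module A N \<and> Module.module A P \<and> Module.module A M \<and>
     i \<in> module_hom A N P \<and> p \<in> module_hom A P M \<and>
     inj_on i (carrier N) \<and> p ` carrier P = carrier M \<and>
     i ` carrier N = {x \<in> carrier P. p x = \<zero>\<^bsub>M\<^esub>}"

definition quotient_module :: "('a, 'm) module \<Rightarrow> 'm set \<Rightarrow> ('a, 'm set) module" where
  "quotient_module M N =
     \<lparr>carrier = a_rcosets\<^bsub>M\<^esub> N, monoid.mult = undefined, one = undefined, zero = N, add = set_add M,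
      smult = (\<lambda>a X. \<Union>x \<in> X. N +>\<^bsub>M\<^esub> (a \<odot>\<^bsub>M\<^esub> x))\<rparr>"

definition free_module :: "'a ring \<Rightarrow> 's set \<Rightarrow> ('a, 's \<Rightarrow> 'a) module" where
  "free_module A S =
     \<lparr>carrier = {f. (\<forall>s \<in> S. f s \<in> carrier A) \<and> (\<forall>s. s \<notin> S \<longrightarrow> f s = \<zero>\<^bsub>A\<^esub>) \<and>
                    finite {s. f s \<noteq> \<zero>\<^bsub>A\<^esub>}},
      monoid.mult = undefined, one = undefined, zero = (\<lambda>_. \<zero>\<^bsub>A\<^esub>),
      add = (\<lambda>f g s. f s \<oplus>\<^bsub>A\<^esub> g s), smult = (\<lambda>a f s. a \<otimes>\<^bsub>A\<^esub> f s)\<rparr>"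

definition lincomb :: "('a, 'm) module \<Rightarrow> nat \<Rightarrow> (nat \<Rightarrow> 'a) \<Rightarrow> (nat \<Rightarrow> 'm) \<Rightarrow> 'm" where
  "lincomb M n c g = (\<Oplus>\<^bsub>M\<^esub>i \<in> {..<n}. c i \<odot>\<^bsub>M\<^esub> g i)"

text \<open>
  Projective means direct summand of a free module.  The index type of the free module is no
  restriction: if \<open>P\<close> is a direct summand of any free module at all, then it is one of the free
  module on the underlying set of \<open>P\<close>.
\<close>

definition projective_module :: "'a ring \<Rightarrow> ('a, 'm) module \<Rightarrow> bool" where
  "projective_module A P \<longleftrightarrow> Module.module A P \<and>
     (\<exists>(S :: 'm set) i p. i \<in> module_hom A P (free_module A S) \<and>
        p \<in> module_hom A (free_module A S) P \<and> (\<forall>x \<in> carrier P. p (i x) = x))"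

text \<open>
  Again the types are no restriction: if \<open>M\<close> has projective dimension at most one, then by
  Schanuel's lemma the free module on the underlying set of \<open>M\<close> and the kernel of its canonical
  map onto \<open>M\<close> form such a resolution.
\<close>

definition proj_dim_le_1 :: "'a ring \<Rightarrow> ('a, 'm) module \<Rightarrow> bool" where
  "proj_dim_le_1 A M \<longleftrightarrow>
     (\<exists>(P1 :: ('a, 'm \<Rightarrow> 'a) module) (P0 :: ('a, 'm \<Rightarrow> 'a) module) i p.
        projective_module A P1 \<and> projective_module A P0 \<and> short_exact A P1 P0 M i p)"

definition non_zero_divisors :: "'a ring \<Rightarrow> 'a set" where
  "non_zero_divisors A =
     {s \<in> carrier A. \<forall>a \<in> carrier A. s \<otimes>\<^bsub>A\<^esub> a = \<zero>\<^bsub>A\<^esub> \<longrightarrow> a = \<zero>\<^bsub>A\<^esub>}"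

definition torsion_module :: "'a ring \<Rightarrow> ('a, 'm) module \<Rightarrow> bool" where
  "torsion_module A M \<longleftrightarrow> Module.module A M \<and>
     (\<forall>x \<in> carrier M. \<exists>s \<in> non_zero_divisors A. s \<odot>\<^bsub>M\<^esub> x = \<zero>\<^bsub>M\<^esub>)"


section \<open>Fitting ideals\<close>

definition ring_det :: "'a ring \<Rightarrow> nat \<Rightarrow> (nat \<Rightarrow> nat \<Rightarrow> 'a) \<Rightarrow> 'a" where
  "ring_det A n B =
     (\<Oplus>\<^bsub>A\<^esub>\<sigma> \<in> {\<sigma>. \<sigma> permutes {..<n}}. [sign \<sigma>] \<cdot>\<^bsub>A\<^esub> (\<Otimes>\<^bsub>A\<^esub>i \<in> {..<n}. B i (\<sigma> i)))"

text \<open>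
  A presentation of \<open>M\<close>: generators \<open>g 0, \<dots>, g (n - 1)\<close> and a (possibly infinite) set \<open>H\<close> of
  rows, the rows of the presentation matrix, that generates the module of relations between them.
\<close>

definition presentation ::
  "'a ring \<Rightarrow> ('a, 'm) module \<Rightarrow> nat \<Rightarrow> (nat \<Rightarrow> 'm) \<Rightarrow> (nat \<Rightarrow> 'a) set \<Rightarrow> bool" where
  "presentation A M n g H \<longleftrightarrow>
     g \<in> {..<n} \<rightarrow> carrier M \<and>
     (\<forall>x \<in> carrier M. \<exists>c \<in> carrier (free_module A {..<n}). x = lincomb M n c g) \<and>
     (\<lambda>N. submodule N A (free_module A {..<n})) hull H =
       {c \<in> carrier (free_module A {..<n}). lincomb M n c g = \<zero>\<^bsub>M\<^esub>}"

definition finitely_presented :: "'a ring \<Rightarrow> ('a, 'm) module \<Rightarrow> bool" where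
  "finitely_presented A M \<longleftrightarrow> Module.module A M \<and> (\<exists>n g H. finite H \<and> presentation A M n g H)"

text \<open>
  The ideal generated by the maximal minors of a presentation matrix; by Fitting's lemma it does
  not depend on the presentation, whence the definite description.  The index map \<open>B\<close> selects
  \<open>n\<close> rows; selections with repeated rows contribute only zero.
\<close>

definition Fitt :: "'a ring \<Rightarrow> ('a, 'm) module \<Rightarrow> 'a set" where
  "Fitt A M = (THE I. \<exists>n g H. presentation A M n g H \<and>
     I = Idl\<^bsub>A\<^esub> {ring_det A n B | B. \<forall>i<n. B i \<in> H})"


section \<open>Total ring of fractions and the shifted Fitting ideal\<close>

definition fraction :: "'a ring \<Rightarrow> 'a \<Rightarrow> 'a \<Rightarrow> ('a \<times> 'a) set" where
  "fraction A a s = {(b, t). b \<in> carrier A \<and> t \<in> non_zero_divisors A \<and> a \<otimes>\<^bsub>A\<^esub> t = b \<otimes>\<^bsub>A\<^esub> s}"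

definition Frac :: "'a ring \<Rightarrow> ('a \<times> 'a) set ring" where
  "Frac A =
     \<lparr>carrier = {fraction A a s | a s. a \<in> carrier A \<and> s \<in> non_zero_divisors A},
      monoid.mult = (\<lambda>x y. \<Union>(a, s) \<in> x. \<Union>(b, t) \<in> y. fraction A (a \<otimes>\<^bsub>A\<^esub> b) (s \<otimes>\<^bsub>A\<^esub> t)),
      one = fraction A \<one>\<^bsub>A\<^esub> \<one>\<^bsub>A\<^esub>,
      zero = fraction A \<zero>\<^bsub>A\<^esub> \<one>\<^bsub>A\<^esub>,
      add = (\<lambda>x y. \<Union>(a, s) \<in> x. \<Union>(b, t) \<in> y.
               fraction A (a \<otimes>\<^bsub>A\<^esub> t \<oplus>\<^bsub>A\<^esub> b \<otimes>\<^bsub>A\<^esub> s) (s \<otimes>\<^bsub>A\<^esub> t))\<rparr>"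

definition to_Frac :: "'a ring \<Rightarrow> 'a \<Rightarrow> ('a \<times> 'a) set" where
  "to_Frac A a = fraction A a \<one>\<^bsub>A\<^esub>"

text \<open>
  The multiplicative monoid of fractional ideals; its unit is \<open>A\<close> inside \<open>Frac A\<close>.  An ideal
  \<open>I\<close> of \<open>A\<close> becomes a fractional ideal as \<open>to_Frac A ` I\<close>; for products, \<^const>\<open>ideal_prod\<close>
  (sums of products) is taken inside \<open>Frac A\<close>.
\<close>

definition fractional_ideals :: "'a ring \<Rightarrow> ('a \<times> 'a) set set monoid" where
  "fractional_ideals A =
     \<lparr>carrier = {J. subgroup J (add_monoid (Frac A)) \<and>
                    (\<forall>a \<in> carrier A. \<forall>x \<in> J. to_Frac A a \<otimes>\<^bsub>Frac A\<^esub> x \<in> J) \<and>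
                    (\<exists>d \<in> non_zero_divisors A. \<forall>x \<in> J.
                       to_Frac A d \<otimes>\<^bsub>Frac A\<^esub> x \<in> to_Frac A ` carrier A)},
      monoid.mult = ideal_prod (Frac A),
      one = to_Frac A ` carrier A\<rparr>"

definition class_P :: "'a ring \<Rightarrow> ('a, 'm) module \<Rightarrow> bool" where
  "class_P A P \<longleftrightarrow> finitely_presented A P \<and> torsion_module A P \<and> proj_dim_le_1 A P"

text \<open>
  The shift is independent of the chosen sequence \<open>0 \<rightarrow> N \<rightarrow> P \<rightarrow> M \<rightarrow> 0\<close>, whence the definite
  description.  The carrier type of \<open>N\<close> and \<open>P\<close> is no restriction: \<open>N\<close> and \<open>P\<close> are finitely
  generated, hence isomorphic to quotients of free modules of finite rank, whose elements are
  cosets of type \<^typ>\<open>(nat \<Rightarrow> 'a) set\<close>.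
\<close>

definition Fitt_shift :: "'a ring \<Rightarrow> ('a, 'm) module \<Rightarrow> ('a \<times> 'a) set set" where
  "Fitt_shift A M = (THE J.
     \<exists>(N :: ('a, (nat \<Rightarrow> 'a) set) module) (P :: ('a, (nat \<Rightarrow> 'a) set) module) i p.
       class_P A P \<and> short_exact A N P M i p \<and>
       J = inv\<^bsub>fractional_ideals A\<^esub> (to_Frac A ` Fitt A P)
             \<otimes>\<^bsub>fractional_ideals A\<^esub> (to_Frac A ` Fitt A N))"


section \<open>Determinants of endomorphisms of free modules\<close>

definition is_basis :: "'a ring \<Rightarrow> ('a, 'm) module \<Rightarrow> nat \<Rightarrow> (nat \<Rightarrow> 'm) \<Rightarrow> bool" where
  "is_basis A M n b \<longleftrightarrow> b \<in> {..<n} \<rightarrow> carrier M \<and>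
     (\<forall>x \<in> carrier M. \<exists>!c. c \<in> carrier (free_module A {..<n}) \<and> x = lincomb M n c b)"

definition endo_det :: "'a ring \<Rightarrow> ('a, 'm) module \<Rightarrow> ('m \<Rightarrow> 'm) \<Rightarrow> 'a" where
  "endo_det A M f = (THE d. \<exists>n b C. is_basis A M n b \<and>
     (\<forall>i<n. \<forall>j<n. C i j \<in> carrier A) \<and>
     (\<forall>j<n. f (b j) = lincomb M n (\<lambda>i. C i j) b) \<and> d = ring_det A n C)"


section \<open>Extension of scalars\<close>

text \<open>
  \<open>base_change A B \<phi> M\<close> is \<open>B \<otimes>\<^sub>A M\<close> for a ring homomorphism \<open>\<phi>\<close> from \<open>A\<close> to \<open>B\<close>: the free
  abelian group on the pairs \<open>(b, m)\<close> modulo the bilinearity and balancing relations, with \<open>B\<close>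
  acting on the first component.
\<close>

definition tensor_relations ::
  "'a ring \<Rightarrow> 'b ring \<Rightarrow> ('a \<Rightarrow> 'b) \<Rightarrow> ('a, 'm) module \<Rightarrow> ('b \<times> 'm \<Rightarrow>\<^sub>0 int) set" where
  "tensor_relations A B \<phi> M =
     {frag_of (b \<oplus>\<^bsub>B\<^esub> c, m) - frag_of (b, m) - frag_of (c, m)
        | b c m. b \<in> carrier B \<and> c \<in> carrier B \<and> m \<in> carrier M} \<union>
     {frag_of (b, m \<oplus>\<^bsub>M\<^esub> l) - frag_of (b, m) - frag_of (b, l)
        | b m l. b \<in> carrier B \<and> m \<in> carrier M \<and> l \<in> carrier M} \<union>
     {frag_of (b \<otimes>\<^bsub>B\<^esub> \<phi> a, m) - frag_of (b, a \<odot>\<^bsub>M\<^esub> m)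
        | a b m. a \<in> carrier A \<and> b \<in> carrier B \<and> m \<in> carrier M}"

definition base_change ::
  "'a ring \<Rightarrow> 'b ring \<Rightarrow> ('a \<Rightarrow> 'b) \<Rightarrow> ('a, 'm) module \<Rightarrow> ('b, ('b \<times> 'm \<Rightarrow>\<^sub>0 int) set) module" where
  "base_change A B \<phi> M =
     quotient_module
       \<lparr>carrier = carrier (free_Abelian_group (carrier B \<times> carrier M)),
        monoid.mult = undefined, one = undefined, zero = 0, add = (+),
        smult = (\<lambda>b. frag_extend (\<lambda>(c, m). frag_of (b \<otimes>\<^bsub>B\<^esub> c, m)))\<rparr>
       (generate (free_Abelian_group (carrier B \<times> carrier M)) (tensor_relations A B \<phi> M))"

text \<open>An \<open>A\<close>-module annihilated by the ideal \<open>I\<close>, regarded as a module over \<open>A Quot I\<close>.\<close>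

definition descend_module :: "('a, 'm) module \<Rightarrow> ('a set, 'm) module" where
  "descend_module M =
     \<lparr>carrier = carrier M, monoid.mult = undefined, one = undefined, zero = zero M, add = add M,
      smult = (\<lambda>X m. the_elem ((\<lambda>a. a \<odot>\<^bsub>M\<^esub> m) ` X))\<rparr>"


section \<open>Group rings and Jacobians\<close>

definition group_ring :: "'g monoid \<Rightarrow> ('g \<Rightarrow>\<^sub>0 int) ring" where
  "group_ring G =
     \<lparr>carrier = carrier (free_Abelian_group (carrier G)),
      monoid.mult = (\<lambda>x y. frag_extend (\<lambda>g. frag_extend (\<lambda>h. frag_of (g \<otimes>\<^bsub>G\<^esub> h)) y) x),
      one = frag_of \<one>\<^bsub>G\<^esub>, zero = 0, add = (+)\<rparr>"

definition norm_element :: "'g monoid \<Rightarrow> 'g \<Rightarrow>\<^sub>0 int" where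
  "norm_element G = (\<Sum>g \<in> carrier G. frag_of g)"

text \<open>The degree of a divisor, and also the augmentation of a group ring element.\<close>

definition frag_deg :: "('a \<Rightarrow>\<^sub>0 int) \<Rightarrow> int" where
  "frag_deg x = (\<Sum>a \<in> Poly_Mapping.keys x. Poly_Mapping.lookup x a)"

text \<open>The abelian group \<open>B\<close> as a module over a group ring, the group acting trivially.\<close>

definition trivial_module :: "('b, 'z) ring_scheme \<Rightarrow> ('g \<Rightarrow>\<^sub>0 int, 'b) module" where
  "trivial_module B =
     \<lparr>carrier = carrier B, monoid.mult = undefined, one = undefined, zero = zero B, add = add B,
      smult = (\<lambda>r z. [frag_deg r] \<cdot>\<^bsub>B\<^esub> z)\<rparr>"

text \<open>
  \<open>Div Y\<close> is a module over the group ring of any group of automorphisms of \<open>Y\<close> (pairs, acting on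
  vertices through the first component).
\<close>

definition Div :: "('w, 'f) pre_digraph \<Rightarrow> (('w \<Rightarrow> 'w) \<times> ('f \<Rightarrow> 'f) \<Rightarrow>\<^sub>0 int, 'w \<Rightarrow>\<^sub>0 int) module" where
  "Div Y =
     \<lparr>carrier = carrier (free_Abelian_group (verts Y)),
      monoid.mult = undefined, one = undefined, zero = 0, add = (+),
      smult = (\<lambda>r d. frag_extend (\<lambda>g. frag_extend (\<lambda>w. frag_of (fst g w)) d) r)\<rparr>"

definition Div0 :: "('w, 'f) pre_digraph \<Rightarrow> (('w \<Rightarrow> 'w) \<times> ('f \<Rightarrow> 'f) \<Rightarrow>\<^sub>0 int, 'w \<Rightarrow>\<^sub>0 int) module" where
  "Div0 Y = Div Y\<lparr>carrier := {d \<in> carrier (Div Y). frag_deg d = 0}\<rparr>"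

definition laplacian :: "('w, 'f) pre_digraph \<Rightarrow> ('w \<Rightarrow>\<^sub>0 int) \<Rightarrow> ('w \<Rightarrow>\<^sub>0 int)" where
  "laplacian Y = frag_extend (\<lambda>w.
     frag_cmul (int (card (out_arcs Y w))) (frag_of w) - (\<Sum>e \<in> out_arcs Y w. frag_of (head Y e)))"

definition Jac ::
  "('w, 'f) pre_digraph \<Rightarrow> (('w \<Rightarrow> 'w) \<times> ('f \<Rightarrow> 'f) \<Rightarrow>\<^sub>0 int, ('w \<Rightarrow>\<^sub>0 int) set) module" where
  "Jac Y = quotient_module (Div0 Y) (laplacian Y ` carrier (Div Y))"

end

theory Submission
  imports Defs "Jordan_Normal_Form.Determinant"
begin

text \<open>
  Write \<open>B = R/(N)\<close>, let \<open>n\<close> be the order of the Galois group, and let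
  \<open>P = Div Y / (L Div Y + N Div Y)\<close>, a module over \<open>B\<close>.  The group acts simply transitively on the
  fibres, so one vertex from every fibre gives a basis of \<open>Div Y\<close> over \<open>R\<close>, and \<open>P\<close> is presented by
  the reduction of a square matrix of \<open>L\<close>.  By the maximum principle the Laplacian is invertible
  up to a non-zero integer on divisors of degree zero, and integers are non-zero-divisors of \<open>B\<close>;
  hence the presentation matrix is injective and the Fitting ideal of \<open>P\<close> is generated by the image
  of \<open>Z\<close>.  The degree map gives an exact sequence \<open>0 \<rightarrow> B \<otimes> Jac Y \<rightarrow> P \<rightarrow> \<int>/n \<rightarrow> 0\<close>: if
  \<open>L x + N y\<close> has degree zero then so has \<open>y\<close>, which makes the first map injective.  Such a sequence
  computes the shifted Fitting ideal.

  That the shift does not depend on the sequence rests on \<open>Fitt Q = Fitt N * Fitt P\<close> for short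
  exact sequences \<open>0 \<rightarrow> N \<rightarrow> Q \<rightarrow> P \<rightarrow> 0\<close> with \<open>P\<close> of projective dimension at most one: two sequences
  for the same module are compared through a fibre product.  Determinant identities over an
  arbitrary commutative ring are specialised from a polynomial ring over the integers.
\<close>

section \<open>Determinants\<close>

text \<open>Projective dimension enters only through \<open>resolved\<close>: a non-zero-divisor
  killing the generators, and a dual basis of the module of relations. \<open>class_P\<close> yields
  it for the sequences in the definition of the shift, a square presentation yields it for
  \<open>P\<close>. So \<open>P\<close> is compared with those sequences as it stands, without being
  moved to the carrier type that the definition prescribes.

  The obstacle in the product formula is that the relations of the quotient form a projective module
  \<open>K\<close> that need not be free, so a block triangular relation matrix with one square
  block per term is not at hand. The lift of relations to the middle term is a linear map
  \<open>s\<close> on \<open>K\<close> only; in general it is not given by a matrix on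
  \<open>F m\<close>. But \<open>d\<close> maps \<open>F m\<close> into \<open>K\<close>, so
  \<open>d\<close> times \<open>s\<close> has a matrix. The correction by \<open>s\<close> becomes a
  column operation once the first \<open>n\<close> columns are scaled by \<open>d\<close>, and the
  factor \<open>d [^] n\<close> cancels.\<close>

type_synonym poly_ring = "(nat \<Rightarrow>\<^sub>0 nat) \<Rightarrow>\<^sub>0 int"

text \<open>The source is a ring given by its type, the target a record with a carrier: this
  predicate is the bridge between the two styles.\<close>

definition eval_hom :: "('a, 'b) ring_scheme \<Rightarrow> (poly_ring \<Rightarrow> 'a) \<Rightarrow> bool" where
  "eval_hom A h \<longleftrightarrow> (\<forall>x. h x \<in> carrier A) \<and> (\<forall>x y. h (x + y) = h x \<oplus>\<^bsub>A\<^esub> h y) \<and>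
     (\<forall>x y. h (x * y) = h x \<otimes>\<^bsub>A\<^esub> h y) \<and> h 1 = \<one>\<^bsub>A\<^esub>"

context cring
begin

text \<open>The polynomial ring is the free abelian group on its monomials, so the evaluation of
  monomials extends additively. The extension is multiplicative because evaluation of monomials is;
  this passes to polynomials one argument at a time.\<close>

lemma eval_hom_exists:
  assumes v: "\<And>k. v k \<in> carrier R"
  obtains h where "eval_hom R h" "\<And>k. h (Poly_Mapping.single (Poly_Mapping.single k 1) 1) = v k"
proof -
  define f where "f = (\<lambda>m :: nat \<Rightarrow>\<^sub>0 nat. \<Otimes>k\<in>Poly_Mapping.keys m. v k [^] Poly_Mapping.lookup m k)"
  \<comment> \<open>Variables that do not occur have exponent 0, so the product may run over any
    larger finite set. Two monomials can then be compared over a common set of variables.\<close>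
  have f_sup: "f m = (\<Otimes>k\<in>K. v k [^] Poly_Mapping.lookup m k)"
    if "finite K" "Poly_Mapping.keys m \<subseteq> K" for K m
    unfolding f_def by (rule finprod_mono_neutral_cong_left) (use that v in \<open>auto simp: in_keys_iff\<close>)
  have f_add: "f (m + m') = f m \<otimes> f m'" for m m'
  proof -
    define K where "K = Poly_Mapping.keys m \<union> Poly_Mapping.keys m'"
    have "Poly_Mapping.keys (m + m') \<subseteq> K" by (simp add: K_def keys_add)
    then have *: "f (m + m') = (\<Otimes>k\<in>K. v k [^] Poly_Mapping.lookup (m + m') k)"
      by (intro f_sup) (auto simp: K_def)
    have "f m = (\<Otimes>k\<in>K. v k [^] Poly_Mapping.lookup m k)" "f m' = (\<Otimes>k\<in>K. v k [^] Poly_Mapping.lookup m' k)"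
      by (intro f_sup; auto simp: K_def)+
    then show ?thesis unfolding *
      by (simp add: lookup_add nat_pow_mult[symmetric] v finprod_multf)
  qed
  have f_cl: "f m \<in> carrier R" for m unfolding f_def by (rule finprod_closed) (use v in auto)
  have cg: "comm_group (add_monoid R)" by (rule a_comm_group)
  obtain h where h: "h \<in> hom (free_Abelian_group UNIV) (add_monoid R)"
    and hf: "\<And>m. h (frag_of m) = f m"
    using comm_group.free_Abelian_group_universal[OF cg, of f UNIV] f_cl by auto
  have h_cl: "h x \<in> carrier R" for x using h by (auto simp: hom_def Pi_def)
  have h_add: "h (x + y) = h x \<oplus> h y" for x y using h by (auto simp: hom_def)
  have h_diff: "h (x - y) = h x \<ominus> h y" for x y
    using h_add[of "x - y" y] h_cl by (simp add: minus_eq a_assoc r_neg)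
  have h0: "h 0 = \<zero>" using h_diff[of 0 0] h_cl by (simp add: minus_eq r_neg)
  have mult1: "h (x * frag_of m) = h x \<otimes> f m" for x m
    using subset_UNIV[of "Poly_Mapping.keys x"]
  proof (induction x rule: frag_induction)
    case zero show ?case by (simp add: h0 f_cl)
  next
    case (one m') show ?case by (simp add: mult_single hf f_add)
  next
    case (diff a b)
    then show ?case using h_cl f_cl by (simp add: left_diff_distrib h_diff minus_eq l_distr l_minus)
  qed
  have mult: "h (x * y) = h x \<otimes> h y" for x y
    using subset_UNIV[of "Poly_Mapping.keys y"]
  proof (induction y rule: frag_induction)
    case zero show ?case by (simp add: h0 h_cl)
  next
    case (one m) show ?case by (simp add: mult1 hf)
  next
    case (diff a b)
    then show ?case using h_cl by (simp add: right_diff_distrib h_diff minus_eq r_distr r_minus)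
  qed
  have one: "h 1 = \<one>" using hf[of 0] by (simp add: f_def)
  show thesis
  proof (rule that)
    show "eval_hom R h" using h_cl h_add mult one by (auto simp: eval_hom_def)
    fix k
    show "h (Poly_Mapping.single (Poly_Mapping.single k 1) 1) = v k"
      using v by (simp add: hf f_def)
  qed
qed

text \<open>Each element of the finite set is made the value of a variable. The normalisation
  \<open>L \<zero> = 0\<close> keeps the zero entries of a matrix zero after lifting, so that block
  shapes survive.\<close>

lemma eval_hom_lift:
  assumes "finite F" "F \<subseteq> carrier R"
  obtains h L where "eval_hom R h" "\<And>a. a \<in> F \<Longrightarrow> h (L a) = a" "L \<zero> = 0"
proof -
  obtain xs where xs: "set xs = F" using assms(1) finite_list by blast
  define v where "v = (\<lambda>k. if k < length xs then xs ! k else \<zero>)"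
  have "v k \<in> carrier R" for k using xs assms(2) by (auto simp: v_def)
  then obtain h where h: "eval_hom R h"
      "\<And>k. h (Poly_Mapping.single (Poly_Mapping.single k 1) 1) = v k"
    using eval_hom_exists by blast
  have "\<exists>x. h x = a" if "a \<in> F" for a
    using that xs h(2) by (metis in_set_conv_nth v_def)
  moreover have "h 0 = \<zero>" 
  proof -
    have "h (0 + 0) = h 0 \<oplus> h 0" "h 0 \<in> carrier R" using h(1) unfolding eval_hom_def by blast+
    then show ?thesis by (metis add.l_cancel_one' add_0)
  qed
  ultimately have "h (if a = \<zero> then 0 else SOME x. h x = a) = a" if "a \<in> F" for a
    using that by (auto intro: someI_ex)
  then show thesis using that[OF h(1), of "\<lambda>a. if a = \<zero> then 0 else SOME x. h x = a"] by simp
qed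

context
  fixes h assumes h: "eval_hom R h"
begin

lemma eval_closed [simp, intro]: "h x \<in> carrier R"
  and eval_add: "h (x + y) = h x \<oplus> h y"
  and eval_mult: "h (x * y) = h x \<otimes> h y"
  and eval_one: "h 1 = \<one>"
  using h unfolding eval_hom_def by blast+

lemma eval_zero: "h 0 = \<zero>"
  using eval_add[of 0 0] by (metis add.l_cancel_one' add_0 eval_closed)

lemma eval_uminus: "h (- x) = \<ominus> h x"
  using eval_add[of "- x" x] by (simp add: eval_zero minus_equality)

lemma eval_diff: "h (x - y) = h x \<ominus> h y"
  using eval_add[of x "- y"] by (simp add: eval_uminus minus_eq)

lemma eval_sum: "h (sum f S) = (\<Oplus>i\<in>S. h (f i))"
proof (cases "finite S")
  case True then show ?thesis
    by (induction rule: finite_induct) (auto simp: eval_zero eval_add)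
qed (simp add: eval_zero)

lemma eval_prod: "h (prod f S) = (\<Otimes>i\<in>S. h (f i))"
proof (cases "finite S")
  case True then show ?thesis
    by (induction rule: finite_induct) (auto simp: eval_one eval_mult)
qed (simp add: eval_one)

lemma eval_power: "h (x ^ n) = h x [^] (n::nat)"
  by (induction n) (auto simp: eval_one eval_mult m_comm)

lemmas eval_simps = eval_add eval_mult eval_one eval_zero eval_uminus eval_diff eval_sum eval_prod eval_power

end
end

section \<open>Determinants over commutative rings given by their type\<close>

definition detf :: "nat \<Rightarrow> (nat \<Rightarrow> nat \<Rightarrow> 'a) \<Rightarrow> 'a :: comm_ring_1" where
  "detf n M = det (mat n n (\<lambda>(i, j). M i j))"

text \<open>Brings the determinant to the shape of \<open>ring_det\<close>, through which a
  homomorphism can be pushed term by term.\<close>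

lemma detf_leibniz:
  "detf n M = (\<Sum>\<sigma> | \<sigma> permutes {..<n}. of_int (sign \<sigma>) * (\<Prod>i<n. M i (\<sigma> i)))"
proof -
  have "detf n M = (\<Sum>\<sigma> | \<sigma> permutes {..<n}. of_int (sign \<sigma>) * (\<Prod>i<n. mat n n (\<lambda>(i, j). M i j) $$ (i, \<sigma> i)))"
    unfolding detf_def det_def by (simp add: lessThan_atLeast0)
  also have "\<dots> = (\<Sum>\<sigma> | \<sigma> permutes {..<n}. of_int (sign \<sigma>) * (\<Prod>i<n. M i (\<sigma> i)))"
  proof (intro sum.cong refl arg_cong2[where f = "(*)"] prod.cong)
    fix \<sigma> i assume "\<sigma> \<in> {\<sigma>. \<sigma> permutes {..<n}}" "i \<in> {..<n}"
    then show "mat n n (\<lambda>(i, j). M i j) $$ (i, \<sigma> i) = M i (\<sigma> i)"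
      using permutes_in_image[of \<sigma> "{..<n}" i] by simp
  qed
  finally show ?thesis .
qed

lemma detf_cong: "(\<And>i j. i < n \<Longrightarrow> j < n \<Longrightarrow> M i j = M' i j) \<Longrightarrow> detf n M = detf n M'"
  unfolding detf_def by (rule arg_cong[of _ _ det]) auto

lemma detf_mult: "detf n (\<lambda>i j. \<Sum>k<n. A i k * B k j) = detf n A * detf n B"
proof -
  have "mat n n (\<lambda>(i, j). \<Sum>k<n. A i k * B k j) = mat n n (\<lambda>(i, j). A i j) * mat n n (\<lambda>(i, j). B i j)"
    by (rule eq_matI) (auto simp: scalar_prod_def lessThan_atLeast0)
  then show ?thesis unfolding detf_def by (simp add: det_mult[of _ n])
qed

lemma detf_transpose: "detf n (\<lambda>i j. M j i) = detf n M"
proof -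
  have "mat n n (\<lambda>(i, j). M j i) = (mat n n (\<lambda>(i, j). M i j))\<^sup>T" by (rule eq_matI) auto
  then show ?thesis unfolding detf_def using det_transpose by (metis mat_carrier)
qed

lemma detf_one: "detf n (\<lambda>i j. if i = j then 1 else 0) = (1 :: 'a :: comm_ring_1)"
proof -
  have "mat n n (\<lambda>(i, j). if i = j then 1 else 0) = (1\<^sub>m n :: 'a mat)" by (rule eq_matI) auto
  then show ?thesis unfolding detf_def by simp
qed

lemma detf_diag: "detf n (\<lambda>i j. if i = j then d else 0) = (d :: 'a :: comm_ring_1) ^ n"
proof -
  have "mat n n (\<lambda>(i, j). if i = j then d else 0) = d \<cdot>\<^sub>m (1\<^sub>m n :: 'a mat)" by (rule eq_matI) auto
  then show ?thesis unfolding detf_def by (simp add: det_smult)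
qed

lemma detf_laplace_last:
  "detf (Suc n) M =
     (\<Sum>i<Suc n. M i n * ((-1) ^ (i + n) * detf n (\<lambda>a b. M (if a < i then a else Suc a) b)))"
proof -
  let ?A = "mat (Suc n) (Suc n) (\<lambda>(i, j). M i j)"
  have "mat_delete ?A i n = mat n n (\<lambda>(a, b). M (if a < i then a else Suc a) b)" for i
    by (rule eq_matI) (auto simp: mat_delete_def)
  then show ?thesis
    unfolding detf_def
    by (subst laplace_expansion_column[of _ "Suc n" n]) (auto simp: cofactor_def intro!: sum.cong)
qed

lemma detf_block_lower:
  fixes M :: "nat \<Rightarrow> nat \<Rightarrow> 'a :: idom"
  assumes "\<And>i j. i < n \<Longrightarrow> n \<le> j \<Longrightarrow> j < n + m \<Longrightarrow> M i j = 0"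
  shows "detf (n + m) M = detf n M * detf m (\<lambda>i j. M (n + i) (n + j))"
proof -
  have "mat (n + m) (n + m) (\<lambda>(i, j). M i j) = four_block_mat (mat n n (\<lambda>(i, j). M i j)) (0\<^sub>m n m)
     (mat m n (\<lambda>(i, j). M (n + i) j)) (mat m m (\<lambda>(i, j). M (n + i) (n + j)))"
    by (rule eq_matI) (use assms in \<open>auto simp: four_block_mat_def\<close>)
  then show ?thesis unfolding detf_def
    by (simp add: det_four_block_mat_upper_right_zero[of _ n _ m])
qed

lemma detf_block_upper:
  fixes M :: "nat \<Rightarrow> nat \<Rightarrow> 'a :: idom"
  assumes "\<And>i j. j < n \<Longrightarrow> n \<le> i \<Longrightarrow> i < n + m \<Longrightarrow> M i j = 0"
  shows "detf (n + m) M = detf n M * detf m (\<lambda>i j. M (n + i) (n + j))"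
proof -
  have "detf (n + m) (\<lambda>i j. M j i) = detf n (\<lambda>i j. M j i) * detf m (\<lambda>i j. M (n + j) (n + i))"
    by (rule detf_block_lower) (rule assms)
  then show ?thesis
    unfolding detf_transpose[of "n + m" M] detf_transpose[of n M]
      detf_transpose[of m "\<lambda>i j. M (n + i) (n + j)"] .
qed

lemma detf_adj:
  obtains adj where "\<And>i k. i < n \<Longrightarrow> k < n \<Longrightarrow> (\<Sum>j<n. M i j * adj j k) = (if i = k then detf n M else 0)"
proof -
  let ?A = "mat n n (\<lambda>(i, j). M i j)"
  have A: "?A \<in> carrier_mat n n" by simp
  have "(\<Sum>j<n. M i j * adj_mat ?A $$ (j, k)) = (if i = k then detf n M else 0)" if "i < n" "k < n" for i k
  proof -
    have "(?A * adj_mat ?A) $$ (i, k) = (\<Sum>j<n. M i j * adj_mat ?A $$ (j, k))"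
      using that adj_mat(1)[OF A] by (auto simp: scalar_prod_def lessThan_atLeast0)
    moreover have "(?A * adj_mat ?A) $$ (i, k) = (if i = k then detf n M else 0)"
      using that by (simp add: adj_mat(2)[OF A] detf_def)
    ultimately show ?thesis by simp
  qed
  then show thesis by (rule that)
qed

text \<open>The factor multiplying \<open>u (\<sigma> i)\<close> does not involve row
  \<open>i\<close>; linearity in that row can be read off.\<close>

lemma detf_row_expand:
  assumes i: "i < n"
  shows "detf n (M(i := u)) =
    (\<Sum>\<sigma> | \<sigma> permutes {..<n}. u (\<sigma> i) * (of_int (sign \<sigma>) * (\<Prod>k\<in>{..<n} - {i}. M k (\<sigma> k))))"
proof -
  have *: "(\<Prod>k<n. (M(i := u)) k (\<sigma> k)) = u (\<sigma> i) * (\<Prod>k\<in>{..<n} - {i}. M k (\<sigma> k))" for \<sigma>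
  proof -
    have "(\<Prod>k<n. (M(i := u)) k (\<sigma> k)) = (M(i := u)) i (\<sigma> i) * (\<Prod>k\<in>{..<n} - {i}. (M(i := u)) k (\<sigma> k))"
      using i by (intro prod.remove) auto
    also have "(\<Prod>k\<in>{..<n} - {i}. (M(i := u)) k (\<sigma> k)) = (\<Prod>k\<in>{..<n} - {i}. M k (\<sigma> k))"
      by (rule prod.cong) auto
    finally show ?thesis by simp
  qed
  show ?thesis unfolding detf_leibniz * by (rule sum.cong) (simp_all add: mult.left_commute)
qed

lemma detf_row_add:
  assumes "i < n"
  shows "detf n (M(i := \<lambda>j. v j + w j)) = detf n (M(i := v)) + detf n (M(i := w))"
  by (simp add: detf_row_expand[OF assms] distrib_right sum.distrib)

lemma detf_row_smult:
  assumes "i < n"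
  shows "detf n (M(i := \<lambda>j. c * v j)) = c * detf n (M(i := v))"
  by (simp add: detf_row_expand[OF assms] sum_distrib_left mult.assoc)

lemma sum_lessThan_add:
  fixes f :: "nat \<Rightarrow> 'a :: comm_monoid_add"
  shows "(\<Sum>t<n + m. f t) = (\<Sum>t<n. f t) + (\<Sum>t<m. f (n + t))"
  by (induction m) (auto simp: add.assoc)

text \<open>The left matrix is the right one multiplied from the right by a block triangular matrix:
  diagonal blocks \<open>d\<close> times the identity and the identity, with \<open>S\<close> below
  the diagonal. That factor has determinant \<open>d ^ n\<close>.\<close>

lemma detf_scale_columns:
  fixes a :: "nat \<Rightarrow> nat \<Rightarrow> 'a :: idom"
  shows "detf (n + m) (\<lambda>i j. if j < n then d * a i j + (\<Sum>l<m. k i l * S l j) else k i (j - n)) =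
     d ^ n * detf (n + m) (\<lambda>i j. if j < n then a i j else k i (j - n))"
proof -
  let ?M = "\<lambda>i j. if j < n then a i j else k i (j - n)"
  let ?C = "\<lambda>i j. if j < n then (if i < n then (if i = j then d else 0) else S (i - n) j)
      else if i = j then 1 else 0"
  have "detf (n + m) (\<lambda>i j. if j < n then d * a i j + (\<Sum>l<m. k i l * S l j) else k i (j - n)) =
     detf (n + m) (\<lambda>i j. \<Sum>t<n + m. ?M i t * ?C t j)"
  proof (rule detf_cong)
    fix i j assume j: "j < n + m"
    show "(if j < n then d * a i j + (\<Sum>l<m. k i l * S l j) else k i (j - n)) = (\<Sum>t<n + m. ?M i t * ?C t j)"
    proof (cases "j < n")
      case True
      have "(\<Sum>t<n. ?M i t * ?C t j) = (\<Sum>t<n. if t = j then d * a i t else 0)"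
        by (rule sum.cong) (use True in auto)
      moreover have "(\<Sum>t<m. ?M i (n + t) * ?C (n + t) j) = (\<Sum>t<m. k i t * S t j)"
        by (rule sum.cong) (use True in auto)
      ultimately show ?thesis unfolding sum_lessThan_add using True by simp
    next
      case False
      then obtain j' where j': "j = n + j'" "j' < m"
        using j by (metis le_add_diff_inverse nat_add_left_cancel_less not_le_imp_less)
      have "(\<Sum>t<n. ?M i t * ?C t j) = 0"
        by (rule sum.neutral) (use False in auto)
      moreover have "(\<Sum>t<m. ?M i (n + t) * ?C (n + t) j) = (\<Sum>t<m. if t = j' then k i t else 0)"
        by (rule sum.cong) (use j' in auto)
      ultimately show ?thesis unfolding sum_lessThan_add using j' by simp
    qed
  qed
  also have "\<dots> = detf (n + m) ?M * detf (n + m) ?C" by (rule detf_mult)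
  also have "detf (n + m) ?C = d ^ n"
  proof -
    have "detf (n + m) ?C = detf n ?C * detf m (\<lambda>i j. ?C (n + i) (n + j))"
      by (rule detf_block_lower) auto
    moreover have "detf n ?C = d ^ n" by (subst detf_diag[symmetric]) (rule detf_cong, auto)
    moreover have "detf m (\<lambda>i j. ?C (n + i) (n + j)) = 1" by (simp add: detf_one)
    ultimately show ?thesis by simp
  qed
  finally show ?thesis by (simp add: mult.commute)
qed

text \<open>A product of two block triangular matrices: the first has blocks 1, \<open>- T\<close>,
  0, \<open>k\<close>, the second 1, 0, \<open>U\<close>, 1, read row by row. The second factor has
  determinant 1. The product is the matrix behind Fitting's lemma on changing generators by
  \<open>T\<close> and \<open>U\<close>.\<close>

lemma detf_fitting:
  fixes k :: "nat \<Rightarrow> nat \<Rightarrow> 'a :: idom"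
  shows "detf (m + n) (\<lambda>i j. if i < m then (if j < m then (if i = j then 1 else 0) - (\<Sum>l<n. T i l * U l j) else - T i (j - m))
      else (if j < m then (\<Sum>l<n. k (i - m) l * U l j) else k (i - m) (j - m))) = detf n k"
proof -
  let ?P = "\<lambda>i j. if i < m then (if j < m then (if i = j then 1 else 0) else - T i (j - m))
      else (if j < m then 0 else k (i - m) (j - m))"
  let ?Q = "\<lambda>i j. if j < m then (if i < m then (if i = j then 1 else 0) else U (i - m) j)
      else (if i = j then 1 else 0)"
  have "detf (m + n) (\<lambda>i j. if i < m then (if j < m then (if i = j then 1 else 0) - (\<Sum>l<n. T i l * U l j) else - T i (j - m))
      else (if j < m then (\<Sum>l<n. k (i - m) l * U l j) else k (i - m) (j - m))) =
      detf (m + n) (\<lambda>i j. \<Sum>t<m + n. ?P i t * ?Q t j)"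
  proof (rule detf_cong)
    fix i j assume j: "j < m + n"
    show "(if i < m then (if j < m then (if i = j then 1 else 0) - (\<Sum>l<n. T i l * U l j) else - T i (j - m))
      else (if j < m then (\<Sum>l<n. k (i - m) l * U l j) else k (i - m) (j - m))) = (\<Sum>t<m + n. ?P i t * ?Q t j)"
    proof (cases "j < m")
      case True
      have "(\<Sum>t<m. ?P i t * ?Q t j) = (\<Sum>t<m. if t = j then (if i < m then (if i = j then 1 else 0) else 0) else 0)"
        by (rule sum.cong) (use True in auto)
      moreover have "(\<Sum>t<n. ?P i (m + t) * ?Q (m + t) j) =
          (\<Sum>t<n. if i < m then - (T i t * U t j) else k (i - m) t * U t j)"
        by (rule sum.cong) (use True in auto)
      ultimately show ?thesis unfolding sum_lessThan_add using True by (auto simp: sum_negf)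
    next
      case False
      then obtain j' where j': "j = m + j'" "j' < n"
        using j by (metis le_add_diff_inverse nat_add_left_cancel_less not_le_imp_less)
      have "(\<Sum>t<m. ?P i t * ?Q t j) = 0"
        by (rule sum.neutral) (use False in auto)
      moreover have "(\<Sum>t<n. ?P i (m + t) * ?Q (m + t) j) =
          (\<Sum>t<n. if t = j' then (if i < m then - T i t else k (i - m) t) else 0)"
        by (rule sum.cong) (use j' in auto)
      ultimately show ?thesis unfolding sum_lessThan_add using j' by auto
    qed
  qed
  also have "\<dots> = detf (m + n) ?P * detf (m + n) ?Q" by (rule detf_mult)
  also have "detf (m + n) ?Q = 1"
  proof -
    have "detf (m + n) ?Q = detf m ?Q * detf n (\<lambda>i j. ?Q (m + i) (m + j))"
      by (rule detf_block_lower) auto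
    moreover have "detf m ?Q = 1" by (subst detf_one[symmetric, of m]) (rule detf_cong, auto)
    moreover have "detf n (\<lambda>i j. ?Q (m + i) (m + j)) = 1" by (simp add: detf_one)
    ultimately show ?thesis by simp
  qed
  also have "detf (m + n) ?P = detf n k"
  proof -
    have "detf (m + n) ?P = detf m ?P * detf n (\<lambda>i j. ?P (m + i) (m + j))"
      by (rule detf_block_upper) auto
    moreover have "detf m ?P = 1" by (subst detf_one[symmetric, of m]) (rule detf_cong, auto)
    ultimately show ?thesis by simp
  qed
  finally show ?thesis by simp
qed

section \<open>Determinant identities specialised to rings with a carrier\<close>

locale plain_cring = cring A for A :: "'a ring" (structure)
begin

lemma eval_of_int_sign:
  assumes "eval_hom A h" 
  shows "h (of_int (sign \<sigma>) * x) = [sign \<sigma>] \<cdot> h x"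
proof (cases "sign \<sigma> = 1")
  case True
  then show ?thesis using eval_closed[OF assms] by simp
next
  case False
  then have s: "sign \<sigma> = -1" by (auto simp: sign_def split: if_splits)
  have "add_pow A (- 1 :: int) (h x) = \<ominus> add_pow A (1 :: int) (h x)"
    using eval_closed[OF assms] by (rule add.int_pow_neg)
  then show ?thesis unfolding s using eval_closed[OF assms] by (simp add: eval_uminus[OF assms])
qed

text \<open>A homomorphism commutes with the sums and products of the Leibniz formula. The
  identities for \<open>ring_det\<close> below are obtained by lifting the entries to polynomials,
  using the identity for \<open>detf\<close>, and mapping back.\<close>

lemma ring_det_eval:
  assumes h: "eval_hom A h" and M: "\<And>i j. i < n \<Longrightarrow> j < n \<Longrightarrow> M i j = h (N i j)"
  shows "ring_det A n M = h (detf n N)"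
proof -
  note cl = eval_closed[OF h]
  have "ring_det A n M = (\<Oplus>\<sigma>\<in>{\<sigma>. \<sigma> permutes {..<n}}. h (of_int (sign \<sigma>) * (\<Prod>i<n. N i (\<sigma> i))))"
    unfolding ring_det_def
  proof (rule finsum_cong')
    fix \<sigma> assume "\<sigma> \<in> {\<sigma>. \<sigma> permutes {..<n}}"
    then have "M i (\<sigma> i) = h (N i (\<sigma> i))" if "i < n" for i
      using permutes_in_image[of \<sigma> "{..<n}" i] that by (auto simp: M)
    then have "(\<Otimes>i\<in>{..<n}. M i (\<sigma> i)) = (\<Otimes>i\<in>{..<n}. h (N i (\<sigma> i)))"
      by (intro finprod_cong') (auto simp: cl)
    then show "[sign \<sigma>] \<cdot> (\<Otimes>i\<in>{..<n}. M i (\<sigma> i)) = h (of_int (sign \<sigma>) * (\<Prod>i<n. N i (\<sigma> i)))"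
      by (simp only: eval_of_int_sign[OF h] eval_prod[OF h])
  qed (simp_all add: cl)
  then show ?thesis by (simp only: detf_leibniz eval_sum[OF h])
qed

abbreviation mat_in :: "nat \<Rightarrow> nat \<Rightarrow> (nat \<Rightarrow> nat \<Rightarrow> 'a) \<Rightarrow> bool" where
  "mat_in p q M \<equiv> (\<forall>i<p. \<forall>j<q. M i j \<in> carrier A)"

text \<open>An identity between two matrices can be specialised only if one homomorphism lifts both
  at once.\<close>

lemma eval_hom_two_matrices:
  assumes "mat_in p q M" "mat_in p' q' M'"
  obtains h N N' where "eval_hom A h" "\<And>i j. i < p \<Longrightarrow> j < q \<Longrightarrow> M i j = h (N i j)"
    "\<And>i j. i < p' \<Longrightarrow> j < q' \<Longrightarrow> M' i j = h (N' i j)"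
    "\<And>i j. M i j = \<zero> \<Longrightarrow> N i j = 0" "\<And>i j. M' i j = \<zero> \<Longrightarrow> N' i j = 0"
proof -
  let ?F = "(\<lambda>(i, j). M i j) ` ({..<p} \<times> {..<q}) \<union> (\<lambda>(i, j). M' i j) ` ({..<p'} \<times> {..<q'})"
  have fin: "finite ?F" by (intro finite_UnI finite_imageI finite_cartesian_product) simp_all
  have sub: "?F \<subseteq> carrier A" using assms by auto
  obtain h L where h: "eval_hom A h" and L: "\<And>a. a \<in> ?F \<Longrightarrow> h (L a) = a" and L0: "L \<zero> = 0"
    by (rule eval_hom_lift[OF fin sub]) (rule that)
  show thesis
  proof (rule that[of h "\<lambda>i j. L (M i j)" "\<lambda>i j. L (M' i j)"])
    show "M i j = h (L (M i j))" if "i < p" "j < q" for i j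
    proof -
      have "M i j \<in> (\<lambda>(i, j). M i j) ` ({..<p} \<times> {..<q})" using that by (intro image_eqI[of _ _ "(i, j)"]) auto
      then show ?thesis by (intro L[symmetric]) blast
    qed
    show "M' i j = h (L (M' i j))" if "i < p'" "j < q'" for i j
    proof -
      have "M' i j \<in> (\<lambda>(i, j). M' i j) ` ({..<p'} \<times> {..<q'})" using that by (intro image_eqI[of _ _ "(i, j)"]) auto
      then show ?thesis by (intro L[symmetric]) blast
    qed
  qed (simp_all only: h L0)
qed

lemma eval_hom_matrix:
  assumes "mat_in p q M"
  obtains h N where "eval_hom A h" "\<And>i j. i < p \<Longrightarrow> j < q \<Longrightarrow> M i j = h (N i j)"
    "\<And>i j. M i j = \<zero> \<Longrightarrow> N i j = 0"
  by (rule eval_hom_two_matrices[OF assms assms]) (rule that)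

lemma eval_hom_three_matrices:
  assumes "mat_in p q M" "mat_in p' q' M'" "mat_in p'' q'' M''" "d \<in> carrier A"
  obtains h N N' N'' e where "eval_hom A h" "\<And>i j. i < p \<Longrightarrow> j < q \<Longrightarrow> M i j = h (N i j)"
    "\<And>i j. i < p' \<Longrightarrow> j < q' \<Longrightarrow> M' i j = h (N' i j)"
    "\<And>i j. i < p'' \<Longrightarrow> j < q'' \<Longrightarrow> M'' i j = h (N'' i j)" "d = h e"
proof -
  let ?F = "(\<lambda>(i, j). M i j) ` ({..<p} \<times> {..<q}) \<union> (\<lambda>(i, j). M' i j) ` ({..<p'} \<times> {..<q'})
     \<union> (\<lambda>(i, j). M'' i j) ` ({..<p''} \<times> {..<q''}) \<union> {d}"
  have fin: "finite ?F" by (intro finite_UnI finite_imageI finite_cartesian_product) simp_all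
  have sub: "?F \<subseteq> carrier A" using assms by auto
  obtain h L where h: "eval_hom A h" and L: "\<And>a. a \<in> ?F \<Longrightarrow> h (L a) = a" and L0: "L \<zero> = 0"
    by (rule eval_hom_lift[OF fin sub]) (rule that)
  show thesis
  proof (rule that[of h "\<lambda>i j. L (M i j)" "\<lambda>i j. L (M' i j)" "\<lambda>i j. L (M'' i j)" "L d"])
    show "M i j = h (L (M i j))" if "i < p" "j < q" for i j
    proof -
      have "M i j \<in> (\<lambda>(i, j). M i j) ` ({..<p} \<times> {..<q})" using that by (intro image_eqI[of _ _ "(i, j)"]) auto
      then show ?thesis by (intro L[symmetric]) blast
    qed
    show "M' i j = h (L (M' i j))" if "i < p'" "j < q'" for i j
    proof -
      have "M' i j \<in> (\<lambda>(i, j). M' i j) ` ({..<p'} \<times> {..<q'})" using that by (intro image_eqI[of _ _ "(i, j)"]) auto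
      then show ?thesis by (intro L[symmetric]) blast
    qed
    show "M'' i j = h (L (M'' i j))" if "i < p''" "j < q''" for i j
    proof -
      have "M'' i j \<in> (\<lambda>(i, j). M'' i j) ` ({..<p''} \<times> {..<q''})" using that by (intro image_eqI[of _ _ "(i, j)"]) auto
      then show ?thesis by (intro L[symmetric]) blast
    qed
    show "d = h (L d)" by (intro L[symmetric]) simp
  qed (rule h)
qed

lemma ring_det_closed: 
  assumes "mat_in n n M" shows "ring_det A n M \<in> carrier A"
proof -
  obtain h N where "eval_hom A h" "\<And>i j. i < n \<Longrightarrow> j < n \<Longrightarrow> M i j = h (N i j)"
    by (rule eval_hom_matrix[OF assms]) (rule that)
  then show ?thesis using ring_det_eval[of h n M N] by simp
qed

lemma ring_det_cong: 
  assumes "mat_in n n M" "\<And>i j. i < n \<Longrightarrow> j < n \<Longrightarrow> M' i j = M i j"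
  shows "ring_det A n M' = ring_det A n M"
proof -
  obtain h N where h: "eval_hom A h" "\<And>i j. i < n \<Longrightarrow> j < n \<Longrightarrow> M i j = h (N i j)"
    by (rule eval_hom_matrix[OF assms(1)]) (rule that)
  then have "ring_det A n M = h (detf n N)" by (rule ring_det_eval)
  moreover have "ring_det A n M' = h (detf n N)" by (rule ring_det_eval[OF h(1)]) (simp add: assms(2) h(2))
  ultimately show ?thesis by simp
qed

lemma ring_det_mult:
  assumes X: "mat_in n n X" and Y: "mat_in n n Y"
  shows "ring_det A n (\<lambda>i j. \<Oplus>k\<in>{..<n}. X i k \<otimes> Y k j) = ring_det A n X \<otimes> ring_det A n Y"
proof -
  obtain h x y where h: "eval_hom A h" and x: "\<And>i j. i < n \<Longrightarrow> j < n \<Longrightarrow> X i j = h (x i j)"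
    and y: "\<And>i j. i < n \<Longrightarrow> j < n \<Longrightarrow> Y i j = h (y i j)"
    by (rule eval_hom_two_matrices[OF X Y]) (rule that)
  note ev = eval_simps[OF h]
  have "ring_det A n (\<lambda>i j. \<Oplus>k\<in>{..<n}. X i k \<otimes> Y k j) = h (detf n (\<lambda>i j. \<Sum>k<n. x i k * y k j))"
  proof (rule ring_det_eval[OF h])
    fix i j assume ij: "i < n" "j < n"
    show "(\<Oplus>k\<in>{..<n}. X i k \<otimes> Y k j) = h (\<Sum>k<n. x i k * y k j)"
      unfolding ev by (rule finsum_cong') (use ij h in \<open>auto simp: x y\<close>)
  qed
  then show ?thesis
    unfolding detf_mult ev by (simp add: ring_det_eval[OF h x] ring_det_eval[OF h y])
qed

lemma ring_det_transpose:
  assumes X: "mat_in n n X"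
  shows "ring_det A n (\<lambda>i j. X j i) = ring_det A n X"
proof -
  obtain h x where h: "eval_hom A h" and x: "\<And>i j. i < n \<Longrightarrow> j < n \<Longrightarrow> X i j = h (x i j)"
    by (rule eval_hom_matrix[OF X]) (rule that)
  have "ring_det A n (\<lambda>i j. X j i) = h (detf n (\<lambda>i j. x j i))"
    by (rule ring_det_eval[OF h]) (simp add: x)
  then show ?thesis
    unfolding detf_transpose[of n x] by (simp add: ring_det_eval[OF h x])
qed

lemma ring_det_diag:
  assumes "d \<in> carrier A"
  shows "ring_det A n (\<lambda>i j. if i = j then d else \<zero>) = d [^] n"
proof -
  \<comment> \<open>A matrix with one entry, so that the lifting lemma for matrices supplies a
    preimage of the scalar \<open>d\<close>.\<close>
  have "mat_in 1 1 (\<lambda>_ _. d)" using assms by simp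
  then obtain h N where h: "eval_hom A h" and N: "\<And>i j. i < (1::nat) \<Longrightarrow> j < (1::nat) \<Longrightarrow> d = h (N i j)"
    by (rule eval_hom_matrix) (rule that)
  define x where "x = N 0 0"
  have x: "d = h x" using N[of 0 0] by (simp add: x_def)
  have "ring_det A n (\<lambda>i j. if i = j then d else \<zero>) = h (detf n (\<lambda>i j. if i = j then x else 0))"
    by (rule ring_det_eval[OF h]) (simp add: x eval_zero[OF h])
  then show ?thesis unfolding detf_diag by (simp add: eval_power[OF h] x)
qed

lemma ring_det_row_add:
  assumes M: "mat_in n n M" and i: "i < n" and v: "\<And>j. j < n \<Longrightarrow> v j \<in> carrier A" "\<And>j. j < n \<Longrightarrow> w j \<in> carrier A"
  shows "ring_det A n (M(i := \<lambda>j. v j \<oplus> w j)) = ring_det A n (M(i := v)) \<oplus> ring_det A n (M(i := w))"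
proof -
  \<comment> \<open>The two vectors become the rows of one matrix, to be lifted together with
    \<open>M\<close>.\<close>
  define W where "W = (\<lambda>i::nat. if i = 0 then v else w)"
  have "mat_in 2 n W" using v by (auto simp: W_def)
  then obtain h N V where h: "eval_hom A h" and N: "\<And>i j. i < n \<Longrightarrow> j < n \<Longrightarrow> M i j = h (N i j)"
    and V: "\<And>i j. i < 2 \<Longrightarrow> j < n \<Longrightarrow> W i j = h (V i j)"
    by (rule eval_hom_two_matrices[OF M]) (rule that)
  have V': "\<And>j. j < n \<Longrightarrow> v j = h (V 0 j)" "\<And>j. j < n \<Longrightarrow> w j = h (V 1 j)"
    using V[of 0] V[of 1] by (simp_all add: W_def)
  have "ring_det A n (M(i := \<lambda>j. v j \<oplus> w j)) = h (detf n (N(i := \<lambda>j. V 0 j + V 1 j)))"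
    by (rule ring_det_eval[OF h]) (auto simp: N V' eval_add[OF h])
  moreover have "ring_det A n (M(i := v)) = h (detf n (N(i := V 0)))"
    by (rule ring_det_eval[OF h]) (auto simp: N V')
  moreover have "ring_det A n (M(i := w)) = h (detf n (N(i := V 1)))"
    by (rule ring_det_eval[OF h]) (auto simp: N V')
  ultimately show ?thesis by (simp add: detf_row_add[OF i] eval_add[OF h])
qed

lemma ring_det_row_smult:
  assumes M: "mat_in n n M" and i: "i < n" and v: "\<And>j. j < n \<Longrightarrow> v j \<in> carrier A" "c \<in> carrier A"
  shows "ring_det A n (M(i := \<lambda>j. c \<otimes> v j)) = c \<otimes> ring_det A n (M(i := v))"
proof -
  define W where "W = (\<lambda>i::nat. if i = 0 then v else (\<lambda>_. c))"
  have "mat_in 2 n W" using v by (auto simp: W_def)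
  note lift = eval_hom_three_matrices[OF M this this v(2)]
  obtain h N V e where h: "eval_hom A h" and N: "\<And>i j. i < n \<Longrightarrow> j < n \<Longrightarrow> M i j = h (N i j)"
    and V: "\<And>i j. i < 2 \<Longrightarrow> j < n \<Longrightarrow> W i j = h (V i j)" and c: "c = h e"
    by (rule lift) (rule that)
  have V': "\<And>j. j < n \<Longrightarrow> v j = h (V 0 j)"
    using V[of 0] by (simp add: W_def)
  have "ring_det A n (M(i := \<lambda>j. c \<otimes> v j)) = h (detf n (N(i := \<lambda>j. e * V 0 j)))"
    by (rule ring_det_eval[OF h]) (auto simp: N V' c eval_mult[OF h])
  moreover have "ring_det A n (M(i := v)) = h (detf n (N(i := V 0)))"
    by (rule ring_det_eval[OF h]) (auto simp: N V')
  ultimately show ?thesis by (simp add: detf_row_smult[OF i] eval_mult[OF h] c)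
qed

text \<open>Expansion along the last column writes the determinant as a combination of the minors
  that omit this column.\<close>

lemma ring_det_laplace_mem:
  assumes M: "mat_in (Suc n) (Suc n) M" and I: "ideal I A"
    and minor: "\<And>i. i \<le> n \<Longrightarrow> ring_det A n (\<lambda>a b. M (if a < i then a else Suc a) b) \<in> I"
  shows "ring_det A (Suc n) M \<in> I"
proof -
  obtain h N where h: "eval_hom A h" and N: "\<And>i j. i < Suc n \<Longrightarrow> j < Suc n \<Longrightarrow> M i j = h (N i j)"
    by (rule eval_hom_matrix[OF M]) (rule that)
  have "h (detf n (\<lambda>a b. N (if a < i then a else Suc a) b)) \<in> I" if "i \<le> n" for i
  proof -
    have "ring_det A n (\<lambda>a b. M (if a < i then a else Suc a) b) = h (detf n (\<lambda>a b. N (if a < i then a else Suc a) b))"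
      by (rule ring_det_eval[OF h]) (use N in auto)
    then show ?thesis using minor[OF that] by simp
  qed
  then have mem: "h (N i n * ((-1) ^ (i + n) * detf n (\<lambda>a b. N (if a < i then a else Suc a) b))) \<in> I" if "i < Suc n" for i
    using that by (simp add: eval_mult[OF h] eval_closed[OF h] ideal.I_l_closed[OF I])
  have "ring_det A (Suc n) M = h (detf (Suc n) N)" by (rule ring_det_eval[OF h N])
  also have "\<dots> = (\<Oplus>i\<in>{..<Suc n}. h (N i n * ((-1) ^ (i + n) * detf n (\<lambda>a b. N (if a < i then a else Suc a) b))))"
    by (simp only: detf_laplace_last eval_sum[OF h])
  also have "\<dots> \<in> I"
  proof -
    have "finite S \<Longrightarrow> S \<subseteq> {..<Suc n} \<Longrightarrow> (\<Oplus>i\<in>S. h (N i n * ((-1) ^ (i + n) * detf n (\<lambda>a b. N (if a < i then a else Suc a) b)))) \<in> I" for S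
    proof (induction S rule: finite_induct)
      case empty
      then show ?case using I by (simp add: additive_subgroup.zero_closed ideal_def)
    next
      case (insert x F)
      then show ?case using mem[of x] 
        by (subst finsum_insert) (auto simp: eval_closed[OF h] additive_subgroup.a_closed[OF ideal.axioms(1)[OF I]])
    qed
    then show ?thesis by blast
  qed
  finally show ?thesis .
qed

lemma ring_det_block_lower:
  assumes M: "mat_in (n + m) (n + m) M" and z: "\<And>i j. i < n \<Longrightarrow> n \<le> j \<Longrightarrow> j < n + m \<Longrightarrow> M i j = \<zero>"
  shows "ring_det A (n + m) M = ring_det A n M \<otimes> ring_det A m (\<lambda>i j. M (n + i) (n + j))"
proof -
  obtain h N where h: "eval_hom A h" and N: "\<And>i j. i < n + m \<Longrightarrow> j < n + m \<Longrightarrow> M i j = h (N i j)"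
    and N0: "\<And>i j. M i j = \<zero> \<Longrightarrow> N i j = 0"
    by (rule eval_hom_matrix[OF M]) (rule that)
  have "ring_det A (n + m) M = h (detf (n + m) N)" by (rule ring_det_eval[OF h N])
  \<comment> \<open>The block of zeros is inherited by the lifted matrix because zero entries are
    lifted to zero.\<close>
  also have "detf (n + m) N = detf n N * detf m (\<lambda>i j. N (n + i) (n + j))"
    by (rule detf_block_lower) (simp add: N0 z)
  also have "h \<dots> = ring_det A n M \<otimes> ring_det A m (\<lambda>i j. M (n + i) (n + j))"
    unfolding eval_mult[OF h] 
    by (intro arg_cong2[where f = "(\<otimes>)"] ring_det_eval[OF h, symmetric]) (auto simp: N)
  finally show ?thesis .
qed

lemma ring_det_scale_columns:
  assumes a: "mat_in (n + m) n a" and k: "mat_in (n + m) m k" and S: "mat_in m n S" and d: "d \<in> carrier A"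
  shows "ring_det A (n + m) (\<lambda>i j. if j < n then d \<otimes> a i j \<oplus> (\<Oplus>l\<in>{..<m}. k i l \<otimes> S l j) else k i (j - n)) =
     d [^] n \<otimes> ring_det A (n + m) (\<lambda>i j. if j < n then a i j else k i (j - n))"
proof -
  obtain h a' k' S' d' where h: "eval_hom A h" and a': "\<And>i j. i < n + m \<Longrightarrow> j < n \<Longrightarrow> a i j = h (a' i j)"
    and k': "\<And>i j. i < n + m \<Longrightarrow> j < m \<Longrightarrow> k i j = h (k' i j)"
    and S': "\<And>i j. i < m \<Longrightarrow> j < n \<Longrightarrow> S i j = h (S' i j)" and d': "d = h d'"
    by (rule eval_hom_three_matrices[OF a k S d]) (rule that)
  note ev = eval_simps[OF h]
  have "ring_det A (n + m) (\<lambda>i j. if j < n then d \<otimes> a i j \<oplus> (\<Oplus>l\<in>{..<m}. k i l \<otimes> S l j) else k i (j - n)) =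
     h (detf (n + m) (\<lambda>i j. if j < n then d' * a' i j + (\<Sum>l<m. k' i l * S' l j) else k' i (j - n)))"
  proof (rule ring_det_eval[OF h])
    fix i j assume ij: "i < n + m" "j < n + m"
    have "(\<Oplus>l\<in>{..<m}. k i l \<otimes> S l j) = (\<Oplus>l\<in>{..<m}. h (k' i l) \<otimes> h (S' l j))" if "j < n"
      by (rule finsum_cong') (use ij that h in \<open>auto simp: k' S'\<close>)
    then show "(if j < n then d \<otimes> a i j \<oplus> (\<Oplus>l\<in>{..<m}. k i l \<otimes> S l j) else k i (j - n)) =
      h (if j < n then d' * a' i j + (\<Sum>l<m. k' i l * S' l j) else k' i (j - n))"
      using ij by (simp add: ev a' k' d')
  qed
  also have "\<dots> = d [^] n \<otimes> h (detf (n + m) (\<lambda>i j. if j < n then a' i j else k' i (j - n)))"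
    by (simp only: detf_scale_columns[of n m d' a' k' S'] eval_mult[OF h] eval_power[OF h] d')
  also have "h (detf (n + m) (\<lambda>i j. if j < n then a' i j else k' i (j - n))) =
      ring_det A (n + m) (\<lambda>i j. if j < n then a i j else k i (j - n))"
    by (rule ring_det_eval[OF h, symmetric]) (auto simp: a' k')
  finally show ?thesis .
qed

lemma ring_det_fitting:
  assumes T: "mat_in m n T" and U: "mat_in n m U" and k: "mat_in n n k"
  shows "ring_det A (m + n) (\<lambda>i j. if i < m then (if j < m then (if i = j then \<one> else \<zero>) \<ominus> (\<Oplus>l\<in>{..<n}. T i l \<otimes> U l j) else \<ominus> T i (j - m))
      else (if j < m then (\<Oplus>l\<in>{..<n}. k (i - m) l \<otimes> U l j) else k (i - m) (j - m))) = ring_det A n k"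
proof -
  obtain h T' U' k' where h: "eval_hom A h" and T': "\<And>i j. i < m \<Longrightarrow> j < n \<Longrightarrow> T i j = h (T' i j)"
    and U': "\<And>i j. i < n \<Longrightarrow> j < m \<Longrightarrow> U i j = h (U' i j)"
    and k': "\<And>i j. i < n \<Longrightarrow> j < n \<Longrightarrow> k i j = h (k' i j)"
    by (rule eval_hom_three_matrices[OF T U k zero_closed]) (rule that)
  note ev = eval_simps[OF h]
  have "ring_det A (m + n) (\<lambda>i j. if i < m then (if j < m then (if i = j then \<one> else \<zero>) \<ominus> (\<Oplus>l\<in>{..<n}. T i l \<otimes> U l j) else \<ominus> T i (j - m))
      else (if j < m then (\<Oplus>l\<in>{..<n}. k (i - m) l \<otimes> U l j) else k (i - m) (j - m))) =
     h (detf (m + n) (\<lambda>i j. if i < m then (if j < m then (if i = j then 1 else 0) - (\<Sum>l<n. T' i l * U' l j) else - T' i (j - m))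
      else (if j < m then (\<Sum>l<n. k' (i - m) l * U' l j) else k' (i - m) (j - m))))"
  proof (rule ring_det_eval[OF h])
    fix i j assume ij: "i < m + n" "j < m + n"
    have "(\<Oplus>l\<in>{..<n}. T i l \<otimes> U l j) = (\<Oplus>l\<in>{..<n}. h (T' i l) \<otimes> h (U' l j))" if "j < m" "i < m"
      by (rule finsum_cong') (use ij that h in \<open>auto simp: T' U'\<close>)
    moreover have "(\<Oplus>l\<in>{..<n}. k (i - m) l \<otimes> U l j) = (\<Oplus>l\<in>{..<n}. h (k' (i - m) l) \<otimes> h (U' l j))" if "j < m" "\<not> i < m"
      by (rule finsum_cong') (use ij that h in \<open>auto simp: k' U'\<close>)
    ultimately show "(if i < m then (if j < m then (if i = j then \<one> else \<zero>) \<ominus> (\<Oplus>l\<in>{..<n}. T i l \<otimes> U l j) else \<ominus> T i (j - m))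
      else (if j < m then (\<Oplus>l\<in>{..<n}. k (i - m) l \<otimes> U l j) else k (i - m) (j - m))) = 
      h (if i < m then (if j < m then (if i = j then 1 else 0) - (\<Sum>l<n. T' i l * U' l j) else - T' i (j - m))
      else (if j < m then (\<Sum>l<n. k' (i - m) l * U' l j) else k' (i - m) (j - m)))"
      using ij by (simp add: ev T' k')
  qed
  then show ?thesis unfolding detf_fitting[of m n T' U' k'] by (simp add: ring_det_eval[OF h k'])
qed

lemma ring_det_adj:
  assumes M: "mat_in n n M"
  obtains adj where "\<And>i j. adj i j \<in> carrier A"
    "\<And>i k. i < n \<Longrightarrow> k < n \<Longrightarrow> (\<Oplus>j\<in>{..<n}. M i j \<otimes> adj j k) = (if i = k then ring_det A n M else \<zero>)"
proof -
  obtain h N where h: "eval_hom A h" and N: "\<And>i j. i < n \<Longrightarrow> j < n \<Longrightarrow> M i j = h (N i j)"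
    by (rule eval_hom_matrix[OF M]) (rule that)
  obtain adj where adj: "\<And>i k. i < n \<Longrightarrow> k < n \<Longrightarrow> (\<Sum>j<n. N i j * adj j k) = (if i = k then detf n N else 0)"
    using detf_adj by blast
  show thesis
  proof (rule that)
    fix i k assume ik: "i < n" "k < n"
    have "(\<Oplus>j\<in>{..<n}. M i j \<otimes> h (adj j k)) = (\<Oplus>j\<in>{..<n}. h (N i j) \<otimes> h (adj j k))"
      by (rule finsum_cong') (use ik h in \<open>auto simp: N\<close>)
    also have "\<dots> = h (\<Sum>j<n. N i j * adj j k)" by (simp only: eval_simps[OF h])
    finally show "(\<Oplus>j\<in>{..<n}. M i j \<otimes> h (adj j k)) = (if i = k then ring_det A n M else \<zero>)"
      using ik by (simp add: adj ring_det_eval[OF h N] eval_zero[OF h])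
  qed (use h in auto)
qed

text \<open>The rows in \<open>S\<close> have their non-zero entries in fewer than
  \<open>card S\<close> columns, so every permutation sends some row of \<open>S\<close> to a column
  where its entry is zero. Each Leibniz term vanishes.\<close>

lemma ring_det_zero_block:
  assumes M: "mat_in n n M" and S: "S \<subseteq> {..<n}" "finite T" "card T < card S"
    and z: "\<And>i j. i \<in> S \<Longrightarrow> j < n \<Longrightarrow> j \<notin> T \<Longrightarrow> M i j = \<zero>"
  shows "ring_det A n M = \<zero>"
proof -
  obtain h N where h: "eval_hom A h" and N: "\<And>i j. i < n \<Longrightarrow> j < n \<Longrightarrow> M i j = h (N i j)"
    and N0: "\<And>i j. M i j = \<zero> \<Longrightarrow> N i j = 0"
    by (rule eval_hom_matrix[OF M]) (rule that)
  have "(\<Prod>i<n. N i (\<sigma> i)) = 0" if \<sigma>: "\<sigma> permutes {..<n}" for \<sigma>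
  proof -
    have "\<not> \<sigma> ` S \<subseteq> T"
    proof
      assume "\<sigma> ` S \<subseteq> T"
      then have "card (\<sigma> ` S) \<le> card T" using S by (intro card_mono)
      moreover have "card (\<sigma> ` S) = card S"
        using permutes_inj[OF \<sigma>] by (intro card_image) (auto simp: inj_on_def)
      ultimately show False using S by simp
    qed
    then obtain i where i: "i \<in> S" "\<sigma> i \<notin> T" by auto
    then have "\<sigma> i < n" using permutes_in_image[OF \<sigma>, of i] S by auto
    then have "N i (\<sigma> i) = 0" using i z N0 by simp
    then show ?thesis using i S by (intro prod_zero) auto
  qed
  then have "detf n N = 0" unfolding detf_leibniz by (intro sum.neutral) auto
  then show ?thesis using ring_det_eval[OF h N] by (simp add: eval_zero[OF h])
qed

text \<open>Choosing rows, possibly with repetition, is multiplication from the left by a matrix of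
  zeros and ones, whose determinant is \<open>c\<close>. For membership in ideals the value of
  \<open>c\<close> is irrelevant.\<close>

lemma ring_det_select_rows:
  assumes M: "mat_in n n M" and f: "\<And>i. i < n \<Longrightarrow> f i < n"
  obtains c where "c \<in> carrier A" "ring_det A n (\<lambda>i. M (f i)) = c \<otimes> ring_det A n M"
proof -
  let ?P = "\<lambda>i k. if k = f i then \<one> else \<zero>"
  have P: "mat_in n n ?P" by simp
  have "ring_det A n (\<lambda>i. M (f i)) = ring_det A n (\<lambda>i j. \<Oplus>k\<in>{..<n}. ?P i k \<otimes> M k j)"
  proof (rule ring_det_cong[symmetric])
    fix i j assume ij: "i < n" "j < n"
    have "(\<Oplus>k\<in>{..<n}. ?P i k \<otimes> M k j) = (\<Oplus>k\<in>{..<n}. if f i = k then M k j else \<zero>)"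
      by (rule finsum_cong') (use ij M in auto)
    also have "\<dots> = M (f i) j"
      using finsum_singleton[of "f i" "{..<n}" "\<lambda>k. M k j"] ij M f by auto
    finally show "(\<Oplus>k\<in>{..<n}. ?P i k \<otimes> M k j) = M (f i) j" .
  qed (use M f in auto)
  then show thesis unfolding ring_det_mult[OF P M] by (rule that[OF ring_det_closed[OF P]])
qed

end

section \<open>Modules, relations and presentations\<close>

locale lmod = Module.module A M for A :: "'a ring" (structure) and M :: "('a, 'm) module" (structure)

sublocale lmod \<subseteq> plain_cring A
  by unfold_locales

lemma lmodI: "Module.module A M \<Longrightarrow> lmod A M"
  by (simp add: lmod_def)

lemma lmodD: "lmod A M \<Longrightarrow> Module.module A M"
  by (simp add: lmod_def)

lemma lmod_moduleI:
  fixes A :: "'a ring" (structure) and M :: "('a, 'm) module"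
  assumes "cring A"
    and "\<And>x y. x \<in> carrier M \<Longrightarrow> y \<in> carrier M \<Longrightarrow> x \<oplus>\<^bsub>M\<^esub> y \<in> carrier M"
    and "\<zero>\<^bsub>M\<^esub> \<in> carrier M"
    and "\<And>x y z. x \<in> carrier M \<Longrightarrow> y \<in> carrier M \<Longrightarrow> z \<in> carrier M \<Longrightarrow> (x \<oplus>\<^bsub>M\<^esub> y) \<oplus>\<^bsub>M\<^esub> z = x \<oplus>\<^bsub>M\<^esub> (y \<oplus>\<^bsub>M\<^esub> z)"
    and "\<And>x y. x \<in> carrier M \<Longrightarrow> y \<in> carrier M \<Longrightarrow> x \<oplus>\<^bsub>M\<^esub> y = y \<oplus>\<^bsub>M\<^esub> x"
    and "\<And>x. x \<in> carrier M \<Longrightarrow> \<zero>\<^bsub>M\<^esub> \<oplus>\<^bsub>M\<^esub> x = x"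
    and "\<And>x. x \<in> carrier M \<Longrightarrow> \<exists>y\<in>carrier M. y \<oplus>\<^bsub>M\<^esub> x = \<zero>\<^bsub>M\<^esub>"
    and "\<And>a x. a \<in> carrier A \<Longrightarrow> x \<in> carrier M \<Longrightarrow> a \<odot>\<^bsub>M\<^esub> x \<in> carrier M"
    and "\<And>a b x. a \<in> carrier A \<Longrightarrow> b \<in> carrier A \<Longrightarrow> x \<in> carrier M \<Longrightarrow> (a \<oplus> b) \<odot>\<^bsub>M\<^esub> x = (a \<odot>\<^bsub>M\<^esub> x) \<oplus>\<^bsub>M\<^esub> (b \<odot>\<^bsub>M\<^esub> x)"
    and "\<And>a x y. a \<in> carrier A \<Longrightarrow> x \<in> carrier M \<Longrightarrow> y \<in> carrier M \<Longrightarrow> a \<odot>\<^bsub>M\<^esub> (x \<oplus>\<^bsub>M\<^esub> y) = (a \<odot>\<^bsub>M\<^esub> x) \<oplus>\<^bsub>M\<^esub> (a \<odot>\<^bsub>M\<^esub> y)"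
    and "\<And>a b x. a \<in> carrier A \<Longrightarrow> b \<in> carrier A \<Longrightarrow> x \<in> carrier M \<Longrightarrow> (a \<otimes> b) \<odot>\<^bsub>M\<^esub> x = a \<odot>\<^bsub>M\<^esub> (b \<odot>\<^bsub>M\<^esub> x)"
    and "\<And>x. x \<in> carrier M \<Longrightarrow> \<one> \<odot>\<^bsub>M\<^esub> x = x"
  shows "lmod A M"
  by (intro lmodI moduleI abelian_groupI assms)

definition rel :: "'a ring \<Rightarrow> ('a, 'm) module \<Rightarrow> nat \<Rightarrow> (nat \<Rightarrow> 'm) \<Rightarrow> (nat \<Rightarrow> 'a) set" where
  "rel A M n g = {c \<in> carrier (free_module A {..<n}). lincomb M n c g = \<zero>\<^bsub>M\<^esub>}"

definition generates :: "'a ring \<Rightarrow> ('a, 'm) module \<Rightarrow> nat \<Rightarrow> (nat \<Rightarrow> 'm) \<Rightarrow> bool" where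
  "generates A M n g \<longleftrightarrow> g \<in> {..<n} \<rightarrow> carrier M \<and>
     (\<forall>x\<in>carrier M. \<exists>c\<in>carrier (free_module A {..<n}). x = lincomb M n c g)"

abbreviation span :: "'a ring \<Rightarrow> ('a, 'm) module \<Rightarrow> 'm set \<Rightarrow> 'm set" where
  "span A M H \<equiv> (\<lambda>N. submodule N A M) hull H"

lemma presentation_iff:
  "presentation A M n g H \<longleftrightarrow> generates A M n g \<and> span A (free_module A {..<n}) H = rel A M n g"
  by (auto simp: presentation_def generates_def rel_def)

definition std_vec :: "'a ring \<Rightarrow> nat \<Rightarrow> nat \<Rightarrow> 'a" where
  "std_vec A i j = (if j = i then \<one>\<^bsub>A\<^esub> else \<zero>\<^bsub>A\<^esub>)"

section \<open>Free modules\<close>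

context plain_cring
begin

abbreviation "F (n :: nat) \<equiv> free_module A {..<n}"

lemma free_simps [simp]:
  "f \<oplus>\<^bsub>free_module A S\<^esub> g = (\<lambda>s. f s \<oplus> g s)"
  "\<zero>\<^bsub>free_module A S\<^esub> = (\<lambda>_. \<zero>)"
  "a \<odot>\<^bsub>free_module A S\<^esub> f = (\<lambda>s. a \<otimes> f s)"
  by (simp_all add: free_module_def)

lemma free_carrier:
  "f \<in> carrier (free_module A S) \<longleftrightarrow>
     (\<forall>s. f s \<in> carrier A) \<and> (\<forall>s. s \<notin> S \<longrightarrow> f s = \<zero>) \<and> finite {s. f s \<noteq> \<zero>}"
proof -
  have "f s \<in> carrier A" if "\<forall>s\<in>S. f s \<in> carrier A" "\<forall>s. s \<notin> S \<longrightarrow> f s = \<zero>" for s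
    using that by (cases "s \<in> S") auto
  then show ?thesis by (auto simp: free_module_def)
qed

lemma F_carrier: "c \<in> carrier (F n) \<longleftrightarrow> (\<forall>i. c i \<in> carrier A) \<and> (\<forall>i. n \<le> i \<longrightarrow> c i = \<zero>)"
proof -
  have "finite {s. c s \<noteq> \<zero>}" if "\<forall>i. n \<le> i \<longrightarrow> c i = \<zero>"
    by (rule finite_subset[of _ "{..<n}"]) (use that not_le in auto)
  then show ?thesis by (auto simp: free_carrier not_less)
qed

lemma F_closed [simp]: "c \<in> carrier (F n) \<Longrightarrow> c i \<in> carrier A"
  by (simp add: F_carrier)

lemma free_lmod: "lmod A (free_module A S)"
proof (rule lmod_moduleI)
  fix x y assume xy: "x \<in> carrier (free_module A S)" "y \<in> carrier (free_module A S)"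
  have "{s. x s \<oplus> y s \<noteq> \<zero>} \<subseteq> {s. x s \<noteq> \<zero>} \<union> {s. y s \<noteq> \<zero>}" by auto
  moreover have "finite {s. x s \<noteq> \<zero>}" "finite {s. y s \<noteq> \<zero>}" using xy by (simp_all only: free_carrier)
  ultimately have "finite {s. x s \<oplus> y s \<noteq> \<zero>}" by (blast intro: finite_subset finite_UnI)
  then show "x \<oplus>\<^bsub>free_module A S\<^esub> y \<in> carrier (free_module A S)" using xy by (auto simp: free_carrier)
  show "x \<oplus>\<^bsub>free_module A S\<^esub> y = y \<oplus>\<^bsub>free_module A S\<^esub> x" using xy by (auto simp: free_carrier a_comm)
next
  fix x assume x: "x \<in> carrier (free_module A S)"
  have "(\<lambda>s. \<ominus> x s) \<in> carrier (free_module A S)"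
  proof -
    have "{s. \<ominus> x s \<noteq> \<zero>} \<subseteq> {s. x s \<noteq> \<zero>}" by auto
    moreover have "finite {s. x s \<noteq> \<zero>}" using x by (simp only: free_carrier)
    ultimately have "finite {s. \<ominus> x s \<noteq> \<zero>}" by (rule finite_subset)
    then show ?thesis using x by (auto simp: free_carrier)
  qed
  moreover have "(\<lambda>s. \<ominus> x s) \<oplus>\<^bsub>free_module A S\<^esub> x = \<zero>\<^bsub>free_module A S\<^esub>"
    using x by (auto simp: free_carrier l_neg)
  ultimately show "\<exists>y\<in>carrier (free_module A S). y \<oplus>\<^bsub>free_module A S\<^esub> x = \<zero>\<^bsub>free_module A S\<^esub>" by blast
next
  fix a x assume ax: "a \<in> carrier A" "x \<in> carrier (free_module A S)"
  have "{s. a \<otimes> x s \<noteq> \<zero>} \<subseteq> {s. x s \<noteq> \<zero>}" using ax by auto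
  moreover have "finite {s. x s \<noteq> \<zero>}" using ax by (simp only: free_carrier)
  ultimately have "finite {s. a \<otimes> x s \<noteq> \<zero>}" by (rule finite_subset)
  then show "a \<odot>\<^bsub>free_module A S\<^esub> x \<in> carrier (free_module A S)" using ax by (auto simp: free_carrier)
qed (auto simp: free_carrier a_assoc l_distr r_distr m_assoc is_cring)

lemma std_vec_F: "i < n \<Longrightarrow> std_vec A i \<in> carrier (F n)"
  by (auto simp: std_vec_def F_carrier)

lemma rows_mat_in: "(\<And>i. i < n \<Longrightarrow> B i \<in> carrier (F m)) \<Longrightarrow> mat_in n m B"
  by (intro allI impI F_closed)

end

section \<open>Submodules, spans and linear combinations\<close>

context lmod
begin

text \<open>Closure under negation is closure under multiplication by
  \<open>\<ominus> \<one>\<close>.\<close>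

lemma submodule_iff:
  "submodule N A M \<longleftrightarrow> N \<subseteq> carrier M \<and> \<zero>\<^bsub>M\<^esub> \<in> N \<and>
     (\<forall>x\<in>N. \<forall>y\<in>N. x \<oplus>\<^bsub>M\<^esub> y \<in> N) \<and> (\<forall>a\<in>carrier A. \<forall>x\<in>N. a \<odot>\<^bsub>M\<^esub> x \<in> N)"
    (is "?L \<longleftrightarrow> ?R")
proof
  assume L: ?L
  have "\<zero>\<^bsub>M\<^esub> \<in> N" using L subgroup.one_closed[OF submodule.axioms(1)] by fastforce
  then show ?R using L submoduleE[OF L] by blast
next
  assume R: ?R
  show ?L
  proof (rule submoduleI)
    fix a assume a: "a \<in> N"
    then have "a \<in> carrier M" using R by blast
    then have "\<ominus>\<^bsub>M\<^esub> a = (\<ominus> \<one>) \<odot>\<^bsub>M\<^esub> a" by (simp add: smult_l_minus)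
    then show "\<ominus>\<^bsub>M\<^esub> a \<in> N" using R a by simp
  qed (use R in auto)
qed

lemma submodule_carrier: "submodule (carrier M) A M"
  by (auto simp: submodule_iff)

lemma span_submodule:
  assumes "H \<subseteq> carrier M" shows "submodule (span A M H) A M"
proof -
  have "H \<subseteq> N \<Longrightarrow> submodule N A M \<Longrightarrow> span A M H \<subseteq> N" for N by (rule hull_minimal)
  then have c: "span A M H \<subseteq> carrier M" using assms submodule_carrier by blast
  then show ?thesis unfolding hull_def
    by (subst submodule_iff) (auto simp: submodule_iff)
qed

lemma span_subset_iff:
  assumes "submodule N A M" shows "span A M H \<subseteq> N \<longleftrightarrow> H \<subseteq> N"
  by (rule subset_hull) (rule assms)

lemma span_carrier: "H \<subseteq> carrier M \<Longrightarrow> span A M H \<subseteq> carrier M"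
  by (simp add: span_subset_iff submodule_carrier)

lemma lincomb_closed:
  "(\<And>i. i < n \<Longrightarrow> c i \<in> carrier A) \<Longrightarrow> g \<in> {..<n} \<rightarrow> carrier M \<Longrightarrow> lincomb M n c g \<in> carrier M"
  unfolding lincomb_def by (rule M.finsum_closed) auto

lemma lincomb_0 [simp]: "lincomb M 0 c g = \<zero>\<^bsub>M\<^esub>"
  by (simp add: lincomb_def)

lemma lincomb_Suc:
  "(\<And>i. i < Suc n \<Longrightarrow> c i \<in> carrier A) \<Longrightarrow> g \<in> {..<Suc n} \<rightarrow> carrier M \<Longrightarrow>
     lincomb M (Suc n) c g = c n \<odot>\<^bsub>M\<^esub> g n \<oplus>\<^bsub>M\<^esub> lincomb M n c g"
  unfolding lincomb_def lessThan_Suc by (subst M.finsum_insert) auto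

lemma lincomb_cong:
  assumes "\<And>i. i < n \<Longrightarrow> c i \<in> carrier A" "g \<in> {..<n} \<rightarrow> carrier M"
    and "\<And>i. i < n \<Longrightarrow> c' i = c i" "\<And>i. i < n \<Longrightarrow> g' i = g i"
  shows "lincomb M n c' g' = lincomb M n c g"
  unfolding lincomb_def by (rule M.finsum_cong') (use assms in auto)

lemma lincomb_add:
  assumes "\<And>i. i < n \<Longrightarrow> c i \<in> carrier A" "\<And>i. i < n \<Longrightarrow> d i \<in> carrier A" "g \<in> {..<n} \<rightarrow> carrier M"
  shows "lincomb M n (\<lambda>i. c i \<oplus> d i) g = lincomb M n c g \<oplus>\<^bsub>M\<^esub> lincomb M n d g"
proof -
  have "lincomb M n (\<lambda>i. c i \<oplus> d i) g = (\<Oplus>\<^bsub>M\<^esub>i\<in>{..<n}. c i \<odot>\<^bsub>M\<^esub> g i \<oplus>\<^bsub>M\<^esub> d i \<odot>\<^bsub>M\<^esub> g i)"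
    unfolding lincomb_def by (rule M.finsum_cong') (use assms in \<open>auto simp: smult_l_distr Pi_iff\<close>)
  also have "\<dots> = lincomb M n c g \<oplus>\<^bsub>M\<^esub> lincomb M n d g"
    unfolding lincomb_def by (rule M.finsum_addf) (use assms in auto)
  finally show ?thesis .
qed

lemma lincomb_smult:
  assumes "\<And>i. i < n \<Longrightarrow> c i \<in> carrier A" "a \<in> carrier A" "g \<in> {..<n} \<rightarrow> carrier M"
  shows "lincomb M n (\<lambda>i. a \<otimes> c i) g = a \<odot>\<^bsub>M\<^esub> lincomb M n c g"
proof -
  have "a \<odot>\<^bsub>M\<^esub> lincomb M n c g = (\<Oplus>\<^bsub>M\<^esub>i\<in>{..<n}. a \<odot>\<^bsub>M\<^esub> (c i \<odot>\<^bsub>M\<^esub> g i))"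
    unfolding lincomb_def by (rule finsum_smult_ldistr) (use assms in auto)
  also have "\<dots> = lincomb M n (\<lambda>i. a \<otimes> c i) g"
    unfolding lincomb_def by (rule M.finsum_cong') (use assms in \<open>auto simp: smult_assoc1 Pi_iff\<close>)
  finally show ?thesis ..
qed

lemma lincomb_zero: 
  assumes "g \<in> {..<n} \<rightarrow> carrier M" "\<And>i. i < n \<Longrightarrow> c i = \<zero>"
  shows "lincomb M n c g = \<zero>\<^bsub>M\<^esub>"
proof -
  have "lincomb M n c g = (\<Oplus>\<^bsub>M\<^esub>i\<in>{..<n}. \<zero>\<^bsub>M\<^esub>)"
    unfolding lincomb_def by (rule M.finsum_cong') (use assms in \<open>auto simp: Pi_iff\<close>)
  then show ?thesis by simp
qed

lemma lincomb_neg: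
  assumes "\<And>i. i < n \<Longrightarrow> c i \<in> carrier A" "g \<in> {..<n} \<rightarrow> carrier M"
  shows "lincomb M n (\<lambda>i. \<ominus> c i) g = \<ominus>\<^bsub>M\<^esub> lincomb M n c g"
proof -
  have "lincomb M n (\<lambda>i. \<ominus> c i) g \<oplus>\<^bsub>M\<^esub> lincomb M n c g = lincomb M n (\<lambda>i. \<ominus> c i \<oplus> c i) g"
    by (subst lincomb_add) (use assms in auto)
  also have "\<dots> = \<zero>\<^bsub>M\<^esub>" by (rule lincomb_zero) (use assms in \<open>auto simp: R.l_neg\<close>)
  finally show ?thesis using assms by (intro M.minus_equality[symmetric] lincomb_closed) auto
qed

lemma lincomb_std_vec:
  assumes "i < n" "g \<in> {..<n} \<rightarrow> carrier M"
  shows "lincomb M n (std_vec A i) g = g i"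
proof -
  have "lincomb M n (std_vec A i) g = (\<Oplus>\<^bsub>M\<^esub>j\<in>{..<n}. if i = j then g j else \<zero>\<^bsub>M\<^esub>)"
    unfolding lincomb_def by (rule M.finsum_cong') (use assms in \<open>auto simp: std_vec_def Pi_iff\<close>)
  then show ?thesis using M.finsum_singleton[of i "{..<n}" g] assms by auto
qed

lemma lincomb_split:
  assumes "\<And>i. i < n + m \<Longrightarrow> c i \<in> carrier A" "g \<in> {..<n + m} \<rightarrow> carrier M"
  shows "lincomb M (n + m) c g = lincomb M n c g \<oplus>\<^bsub>M\<^esub> lincomb M m (\<lambda>j. c (n + j)) (\<lambda>j. g (n + j))"
  using assms
proof (induction m)
  case 0
  then show ?case by (simp add: lincomb_closed)
next
  case (Suc m)
  have 1: "lincomb M (Suc (n + m)) c g = c (n + m) \<odot>\<^bsub>M\<^esub> g (n + m) \<oplus>\<^bsub>M\<^esub> lincomb M (n + m) c g"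
    by (rule lincomb_Suc) (use Suc.prems in auto)
  have 2: "lincomb M (Suc m) (\<lambda>j. c (n + j)) (\<lambda>j. g (n + j)) =
      c (n + m) \<odot>\<^bsub>M\<^esub> g (n + m) \<oplus>\<^bsub>M\<^esub> lincomb M m (\<lambda>j. c (n + j)) (\<lambda>j. g (n + j))"
    by (rule lincomb_Suc) (use Suc.prems in auto)
  have 3: "lincomb M (n + m) c g = lincomb M n c g \<oplus>\<^bsub>M\<^esub> lincomb M m (\<lambda>j. c (n + j)) (\<lambda>j. g (n + j))"
    by (rule Suc.IH) (use Suc.prems in auto)
  have cl: "c (n + m) \<odot>\<^bsub>M\<^esub> g (n + m) \<in> carrier M" "lincomb M n c g \<in> carrier M"
      "lincomb M m (\<lambda>j. c (n + j)) (\<lambda>j. g (n + j)) \<in> carrier M"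
    using Suc.prems by (auto intro!: lincomb_closed smult_closed)
  show ?case unfolding add_Suc_right 1 2 3 using cl by (simp add: M.a_lcomm)
qed

text \<open>Substitution multiplies the row of coefficients by the matrix \<open>U\<close>; this is
  how a change of generators becomes a matrix product.\<close>

lemma lincomb_lincomb:
  assumes "\<And>i. i < n \<Longrightarrow> c i \<in> carrier A" "mat_in n m U" "g \<in> {..<m} \<rightarrow> carrier M"
  shows "lincomb M n c (\<lambda>i. lincomb M m (U i) g) = lincomb M m (\<lambda>j. \<Oplus>i\<in>{..<n}. c i \<otimes> U i j) g"
  using assms(1,2)
proof (induction n)
  case 0
  then show ?case by (simp add: lincomb_zero assms(3))
next
  case (Suc n)
  have cl: "(\<lambda>i. lincomb M m (U i) g) \<in> {..<Suc n} \<rightarrow> carrier M"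
    using Suc.prems assms(3) by (auto intro!: lincomb_closed)
  have "lincomb M (Suc n) c (\<lambda>i. lincomb M m (U i) g) =
      c n \<odot>\<^bsub>M\<^esub> lincomb M m (U n) g \<oplus>\<^bsub>M\<^esub> lincomb M n c (\<lambda>i. lincomb M m (U i) g)"
    by (rule lincomb_Suc) (use Suc.prems cl in auto)
  also have "lincomb M n c (\<lambda>i. lincomb M m (U i) g) = lincomb M m (\<lambda>j. \<Oplus>i\<in>{..<n}. c i \<otimes> U i j) g"
    by (rule Suc.IH) (use Suc.prems in auto)
  also have "c n \<odot>\<^bsub>M\<^esub> lincomb M m (U n) g = lincomb M m (\<lambda>j. c n \<otimes> U n j) g"
    by (rule lincomb_smult[symmetric]) (use Suc.prems assms(3) in auto)
  also have "lincomb M m (\<lambda>j. c n \<otimes> U n j) g \<oplus>\<^bsub>M\<^esub> lincomb M m (\<lambda>j. \<Oplus>i\<in>{..<n}. c i \<otimes> U i j) g =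
      lincomb M m (\<lambda>j. c n \<otimes> U n j \<oplus> (\<Oplus>i\<in>{..<n}. c i \<otimes> U i j)) g"
    by (rule lincomb_add[symmetric]) (use Suc.prems assms(3) in \<open>auto intro!: R.finsum_closed\<close>)
  also have "\<dots> = lincomb M m (\<lambda>j. \<Oplus>i\<in>{..<Suc n}. c i \<otimes> U i j) g"
    by (rule lincomb_cong[symmetric]) (use Suc.prems assms(3) in \<open>auto simp: lessThan_Suc Pi_iff intro!: R.finsum_closed\<close>)
  finally show ?case .
qed

lemma rel_submodule:
  assumes "g \<in> {..<n} \<rightarrow> carrier M"
  shows "submodule (rel A M n g) A (F n)"
proof -
  interpret Fn: lmod A "F n" by (rule free_lmod)
  show ?thesis
    unfolding Fn.submodule_iff
  proof (intro conjI ballI)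
    show "rel A M n g \<subseteq> carrier (F n)" by (auto simp: rel_def)
    show "\<zero>\<^bsub>F n\<^esub> \<in> rel A M n g"
      using Fn.M.zero_closed lincomb_zero[OF assms, of "\<lambda>_. \<zero>"] by (simp add: rel_def)
    fix x assume x: "x \<in> rel A M n g"
    then have x': "x \<in> carrier (F n)" "lincomb M n x g = \<zero>\<^bsub>M\<^esub>" by (auto simp: rel_def)
    show "x \<oplus>\<^bsub>F n\<^esub> y \<in> rel A M n g" if y: "y \<in> rel A M n g" for y
    proof -
      have y': "y \<in> carrier (F n)" "lincomb M n y g = \<zero>\<^bsub>M\<^esub>" using y by (auto simp: rel_def)
      have "lincomb M n (\<lambda>s. x s \<oplus> y s) g = \<zero>\<^bsub>M\<^esub>"
        by (subst lincomb_add) (use x' y' assms in auto)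
      then show ?thesis using Fn.M.a_closed[OF x'(1) y'(1)] by (simp add: rel_def)
    qed
    show "a \<odot>\<^bsub>F n\<^esub> x \<in> rel A M n g" if a: "a \<in> carrier A" for a
    proof -
      have "lincomb M n (\<lambda>s. a \<otimes> x s) g = \<zero>\<^bsub>M\<^esub>"
        by (subst lincomb_smult) (use x' a assms in auto)
      then show ?thesis using Fn.smult_closed[OF a x'(1)] by (simp add: rel_def)
    qed
  qed
qed

lemma presentation_rel: "generates A M n g \<Longrightarrow> presentation A M n g (rel A M n g)"
  by (simp add: presentation_iff hull_same rel_submodule generates_def)

end

section \<open>Module homomorphisms\<close>

context plain_cring
begin

lemma hom_closed: "f \<in> module_hom A M N \<Longrightarrow> x \<in> carrier M \<Longrightarrow> f x \<in> carrier N"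
  and hom_add: "f \<in> module_hom A M N \<Longrightarrow> x \<in> carrier M \<Longrightarrow> y \<in> carrier M \<Longrightarrow> f (x \<oplus>\<^bsub>M\<^esub> y) = f x \<oplus>\<^bsub>N\<^esub> f y"
  and hom_smult: "f \<in> module_hom A M N \<Longrightarrow> a \<in> carrier A \<Longrightarrow> x \<in> carrier M \<Longrightarrow> f (a \<odot>\<^bsub>M\<^esub> x) = a \<odot>\<^bsub>N\<^esub> f x"
  by (auto simp: module_hom_def)

lemma hom_zero:
  assumes "lmod A M" "lmod A N" "f \<in> module_hom A M N"
  shows "f \<zero>\<^bsub>M\<^esub> = \<zero>\<^bsub>N\<^esub>"
proof -
  interpret M: lmod A M by fact
  interpret N: lmod A N by fact
  have "f (\<zero> \<odot>\<^bsub>M\<^esub> \<zero>\<^bsub>M\<^esub>) = \<zero> \<odot>\<^bsub>N\<^esub> f \<zero>\<^bsub>M\<^esub>" by (rule hom_smult[OF assms(3)]) auto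
  then show ?thesis using hom_closed[OF assms(3)] by simp
qed

lemma hom_neg:
  assumes "lmod A M" "lmod A N" "f \<in> module_hom A M N" "x \<in> carrier M"
  shows "f (\<ominus>\<^bsub>M\<^esub> x) = \<ominus>\<^bsub>N\<^esub> f x"
proof -
  interpret M: lmod A M by fact
  interpret N: lmod A N by fact
  have "f ((\<ominus> \<one>) \<odot>\<^bsub>M\<^esub> x) = (\<ominus> \<one>) \<odot>\<^bsub>N\<^esub> f x" by (rule hom_smult[OF assms(3)]) (use assms in auto)
  then show ?thesis using hom_closed[OF assms(3)] assms(4) by (simp add: M.smult_l_minus N.smult_l_minus)
qed

lemma hom_lincomb:
  assumes "lmod A M" "lmod A N" "f \<in> module_hom A M N"
    and "\<And>i. i < n \<Longrightarrow> c i \<in> carrier A" "g \<in> {..<n} \<rightarrow> carrier M"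
  shows "f (lincomb M n c g) = lincomb N n c (\<lambda>i. f (g i))"
  using assms(4,5)
proof (induction n)
  case 0
  interpret M: lmod A M by fact
  interpret N: lmod A N by fact
  show ?case using hom_zero[OF assms(1-3)] by simp
next
  case (Suc n)
  interpret M: lmod A M by fact
  interpret N: lmod A N by fact
  have "f (lincomb M (Suc n) c g) = f (c n \<odot>\<^bsub>M\<^esub> g n \<oplus>\<^bsub>M\<^esub> lincomb M n c g)"
    by (subst M.lincomb_Suc) (use Suc.prems in auto)
  also have "\<dots> = c n \<odot>\<^bsub>N\<^esub> f (g n) \<oplus>\<^bsub>N\<^esub> f (lincomb M n c g)"
    using Suc.prems by (subst hom_add[OF assms(3)]) (auto simp: hom_smult[OF assms(3)] Pi_iff intro!: M.lincomb_closed)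
  also have "f (lincomb M n c g) = lincomb N n c (\<lambda>i. f (g i))"
    by (rule Suc.IH) (use Suc.prems in auto)
  also have "c n \<odot>\<^bsub>N\<^esub> f (g n) \<oplus>\<^bsub>N\<^esub> lincomb N n c (\<lambda>i. f (g i)) = lincomb N (Suc n) c (\<lambda>i. f (g i))"
    by (rule N.lincomb_Suc[symmetric]) (use Suc.prems hom_closed[OF assms(3)] in auto)
  finally show ?case .
qed

lemma F_expand:
  assumes "c \<in> carrier (F n)"
  shows "c = lincomb (F n) n c (std_vec A)"
proof (rule ext)
  fix j
  interpret Fn: lmod A "F n" by (rule free_lmod)
  have u: "std_vec A \<in> {..<n} \<rightarrow> carrier (F n)" by (auto intro: std_vec_F)
  have "m \<le> n \<Longrightarrow> lincomb (F n) m c (std_vec A) j = (if j < m then c j else \<zero>)" for m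
  proof (induction m)
    case (Suc m)
    have "lincomb (F n) (Suc m) c (std_vec A) = (\<lambda>j. c m \<otimes> std_vec A m j \<oplus> lincomb (F n) m c (std_vec A) j)"
      using Suc.prems assms u by (subst Fn.lincomb_Suc) (auto simp: Pi_iff)
    moreover have "std_vec A m j = (if j = m then \<one> else \<zero>)" by (simp add: std_vec_def)
    ultimately show ?case
      using Suc assms by (auto simp: less_Suc_eq)
  qed simp
  then show "c j = lincomb (F n) n c (std_vec A) j"
    using assms by (auto simp: F_carrier not_less)
qed

lemma hom_F_eq:
  assumes "lmod A M" "f \<in> module_hom A (F n) M" "c \<in> carrier (F n)"
  shows "f c = lincomb M n c (\<lambda>i. f (std_vec A i))"
proof -
  have "f c = f (lincomb (F n) n c (std_vec A))" using F_expand[OF assms(3)] by simp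
  also have "\<dots> = lincomb M n c (\<lambda>i. f (std_vec A i))"
    by (rule hom_lincomb[OF free_lmod assms(1,2)]) (use assms(3) in \<open>auto intro: std_vec_F\<close>)
  finally show ?thesis .
qed

lemma lincomb_hom:
  assumes "lmod A M" "g \<in> {..<n} \<rightarrow> carrier M"
  shows "(\<lambda>c. lincomb M n c g) \<in> module_hom A (F n) M"
proof -
  interpret M: lmod A M by fact
  show ?thesis unfolding module_hom_def
    using assms(2) by (auto intro!: M.lincomb_closed simp: M.lincomb_add M.lincomb_smult)
qed

end

section \<open>Fitting ideals\<close>

text \<open>The ideal inside the definite description of \<open>Fitt\<close>, for one fixed set of
  rows.\<close>

definition minor_ideal :: "'a ring \<Rightarrow> nat \<Rightarrow> (nat \<Rightarrow> 'a) set \<Rightarrow> 'a set" where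
  "minor_ideal A n H = Idl\<^bsub>A\<^esub> {ring_det A n B | B. \<forall>i<n. B i \<in> H}"

context plain_cring
begin

lemma minors_closed:
  assumes "H \<subseteq> carrier (F n)" shows "{ring_det A n B | B. \<forall>i<n. B i \<in> H} \<subseteq> carrier A"
  using assms by (auto intro!: ring_det_closed)

lemma minor_ideal_ideal: "H \<subseteq> carrier (F n) \<Longrightarrow> ideal (minor_ideal A n H) A"
  unfolding minor_ideal_def by (intro genideal_ideal minors_closed)

lemma minor_ideal_mem:
  assumes "H \<subseteq> carrier (F n)" "\<And>i. i < n \<Longrightarrow> B i \<in> H"
  shows "ring_det A n B \<in> minor_ideal A n H"
  unfolding minor_ideal_def using genideal_self[OF minors_closed[OF assms(1)]] assms(2) by blast

lemma minor_ideal_subset: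
  assumes "ideal I A" "\<And>B. (\<And>i. i < n \<Longrightarrow> B i \<in> H) \<Longrightarrow> ring_det A n B \<in> I"
  shows "minor_ideal A n H \<subseteq> I"
  unfolding minor_ideal_def by (rule genideal_minimal[OF assms(1)]) (use assms(2) in blast)

text \<open>With the other rows fixed, the vectors whose determinant lies in \<open>I\<close> form a
  submodule, since the determinant is linear in each row. Rows from \<open>H\<close> are replaced by
  rows from the span one at a time; the induction is on the number \<open>k\<close> of leading rows
  already replaced.\<close>

lemma det_span_mem:
  assumes I: "ideal I A" and H: "H \<subseteq> carrier (F n)"
    and base: "\<And>B. (\<And>i. i < n \<Longrightarrow> B i \<in> H) \<Longrightarrow> ring_det A n B \<in> I"
    and B: "\<And>i. i < n \<Longrightarrow> B i \<in> span A (F n) H"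
  shows "ring_det A n B \<in> I"
proof -
  interpret Fn: lmod A "F n" by (rule free_lmod)
  have HS: "H \<subseteq> span A (F n) H" by (rule hull_subset)
  have SC: "span A (F n) H \<subseteq> carrier (F n)" by (rule Fn.span_carrier[OF H])
  have "k \<le> n \<Longrightarrow> (\<And>i. i < k \<Longrightarrow> B i \<in> span A (F n) H) \<Longrightarrow> (\<And>i. k \<le> i \<Longrightarrow> i < n \<Longrightarrow> B i \<in> H) \<Longrightarrow>
      ring_det A n B \<in> I" for k B
  proof (induction k arbitrary: B)
    case 0
    show ?case by (rule base) (use 0 in auto)
  next
    case (Suc k)
    have row: "B i \<in> carrier (F n)" if "i < n" for i
      using Suc.prems(2)[of i] Suc.prems(3)[of i] that H SC by (cases "i < Suc k") auto
    then have Bm: "mat_in n n B" by (rule rows_mat_in)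
    have k: "k < n" using Suc.prems(1) by simp
    define N where "N = {v \<in> carrier (F n). ring_det A n (B(k := v)) \<in> I}"
    have "submodule N A (F n)"
      unfolding Fn.submodule_iff
    proof (intro conjI ballI)
      show "N \<subseteq> carrier (F n)" by (auto simp: N_def)
      have z: "(\<lambda>_. \<zero>) \<in> carrier (F n)" by (simp add: F_carrier)
      have "ring_det A n (B(k := \<lambda>j. \<zero> \<otimes> \<zero>)) = \<zero> \<otimes> ring_det A n (B(k := \<lambda>j. \<zero>))"
        by (rule ring_det_row_smult[OF Bm k]) auto
      moreover have "ring_det A n (B(k := \<lambda>j. \<zero>)) \<in> carrier A"
        by (rule ring_det_closed) (use Bm in auto)
      ultimately show "\<zero>\<^bsub>F n\<^esub> \<in> N"
        using z additive_subgroup.zero_closed[OF ideal.axioms(1)[OF I]] by (simp add: N_def)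
      fix x assume x: "x \<in> N"
      then have xc: "x \<in> carrier (F n)" by (simp add: N_def)
      show "x \<oplus>\<^bsub>F n\<^esub> y \<in> N" if y: "y \<in> N" for y
      proof -
        have yc: "y \<in> carrier (F n)" using y by (simp add: N_def)
        have "ring_det A n (B(k := \<lambda>j. x j \<oplus> y j)) = ring_det A n (B(k := x)) \<oplus> ring_det A n (B(k := y))"
          by (rule ring_det_row_add[OF Bm k]) (use xc yc in auto)
        then show ?thesis
          using x y Fn.M.a_closed[OF xc yc] additive_subgroup.a_closed[OF ideal.axioms(1)[OF I]] by (simp add: N_def)
      qed
      show "a \<odot>\<^bsub>F n\<^esub> x \<in> N" if a: "a \<in> carrier A" for a
      proof -
        have "ring_det A n (B(k := \<lambda>j. a \<otimes> x j)) = a \<otimes> ring_det A n (B(k := x))"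
          by (rule ring_det_row_smult[OF Bm k]) (use xc a in auto)
        then show ?thesis
          using x Fn.smult_closed[OF a xc] ideal.I_l_closed[OF I] a by (simp add: N_def)
      qed
    qed
    moreover have "H \<subseteq> N"
    proof
      fix v assume v: "v \<in> H"
      have "ring_det A n (B(k := v)) \<in> I"
        by (rule Suc.IH) (use Suc.prems v in auto)
      then show "v \<in> N" using v H by (auto simp: N_def)
    qed
    ultimately have "span A (F n) H \<subseteq> N" using Fn.span_subset_iff by blast
    then have "B k \<in> N" using Suc.prems(2)[of k] by auto
    then show ?case by (simp add: N_def)
  qed
  from this[of n B] show ?thesis using B by auto
qed

text \<open>Allows passing between a generating set of relations and the full relation
  module.\<close>

lemma minor_ideal_span:
  assumes "H \<subseteq> carrier (F n)"
  shows "minor_ideal A n (span A (F n) H) = minor_ideal A n H"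
proof
  interpret Fn: lmod A "F n" by (rule free_lmod)
  note SC = Fn.span_carrier[OF assms]
  show "minor_ideal A n (span A (F n) H) \<subseteq> minor_ideal A n H"
    by (rule minor_ideal_subset[OF minor_ideal_ideal[OF assms]],
        rule det_span_mem[OF minor_ideal_ideal[OF assms] assms minor_ideal_mem[OF assms]])
  show "minor_ideal A n H \<subseteq> minor_ideal A n (span A (F n) H)"
    by (rule minor_ideal_subset[OF minor_ideal_ideal[OF SC]], rule minor_ideal_mem[OF SC])
       (rule hull_inc)
qed

text \<open>Laplace expansion along all but the first \<open>q\<close> columns.\<close>

lemma det_minor_mem:
  assumes I: "ideal I A" and W: "W \<subseteq> carrier (F q)"
    and base: "\<And>B. (\<And>i. i < q \<Longrightarrow> B i \<in> W) \<Longrightarrow> ring_det A q B \<in> I"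
    and M: "mat_in (q + p) (q + p) M" "\<And>i. i < q + p \<Longrightarrow> \<exists>w\<in>W. \<forall>j<q. M i j = w j"
  shows "ring_det A (q + p) M \<in> I"
  using M
proof (induction p arbitrary: M)
  case 0
  then obtain B where B: "\<And>i. i < q \<Longrightarrow> B i \<in> W" "\<And>i j. i < q \<Longrightarrow> j < q \<Longrightarrow> M i j = B i j"
    by (simp add: Bex_def) metis
  have "mat_in q q B" by (intro allI impI F_closed[OF subsetD[OF W B(1)]])
  then have "ring_det A q M = ring_det A q B"
    by (rule ring_det_cong) (rule B(2))
  then show ?case using base[OF B(1)] by simp
next
  case (Suc p)
  have "ring_det A (Suc (q + p)) M \<in> I"
  proof (rule ring_det_laplace_mem[OF _ I])
    show "mat_in (Suc (q + p)) (Suc (q + p)) M" using Suc.prems(1) by simp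
    fix i assume "i \<le> q + p"
    show "ring_det A (q + p) (\<lambda>a b. M (if a < i then a else Suc a) b) \<in> I"
      by (rule Suc.IH) (use Suc.prems in auto)
  qed
  then show ?case by simp
qed

text \<open>Each row is the sum of a row supported in the first \<open>n\<close> columns and a row
  supported in the last \<open>m\<close> ones. By \<open>det_span_mem\<close> rows of one pure type
  suffice. Unless exactly \<open>n\<close> of them are of the first type, too many rows live in too
  few columns and the determinant is zero; otherwise sorting the rows gives a block matrix.\<close>

lemma det_two_blocks_mem:
  assumes I: "ideal I A" and W1: "submodule W1 A (F n)" and W2: "submodule W2 A (F m)"
    and base: "\<And>h k. (\<And>i. i < n \<Longrightarrow> h i \<in> W1) \<Longrightarrow> (\<And>i. i < m \<Longrightarrow> k i \<in> W2) \<Longrightarrow>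
      ring_det A n h \<otimes> ring_det A m k \<in> I"
    and h: "\<And>i. i < n + m \<Longrightarrow> h i \<in> W1" and k: "\<And>i. i < n + m \<Longrightarrow> k i \<in> W2"
  shows "ring_det A (n + m) (\<lambda>i j. if j < n then h i j else k i (j - n)) \<in> I"
proof -
  interpret Fn: lmod A "F n" by (rule free_lmod)
  interpret Fm: lmod A "F m" by (rule free_lmod)
  interpret Fnm: lmod A "F (n + m)" by (rule free_lmod)
  have W1c: "W1 \<subseteq> carrier (F n)" and W2c: "W2 \<subseteq> carrier (F m)"
    using W1 W2 by (auto simp: Fn.submodule_iff Fm.submodule_iff)
  have c1: "h i j \<in> carrier A" if "h i \<in> W1" for h :: "nat \<Rightarrow> nat \<Rightarrow> 'a" and i j
    by (rule F_closed[OF subsetD[OF W1c that]])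
  have c2: "k i j \<in> carrier A" if "k i \<in> W2" for k :: "nat \<Rightarrow> nat \<Rightarrow> 'a" and i j
    by (rule F_closed[OF subsetD[OF W2c that]])
  define l where "l = (\<lambda>h :: nat \<Rightarrow> 'a. \<lambda>j. if j < n then h j else \<zero>)"
  define r where "r = (\<lambda>k :: nat \<Rightarrow> 'a. \<lambda>j. if j < n then \<zero> else k (j - n))"
  have lc: "l h \<in> carrier (F (n + m))" if "h \<in> W1" for h
    using that W1c by (auto simp: l_def F_carrier)
  have rc: "r k \<in> carrier (F (n + m))" if "k \<in> W2" for k
    using that W2c by (auto simp: r_def F_carrier)
  let ?H = "l ` W1 \<union> r ` W2"
  have Hc: "?H \<subseteq> carrier (F (n + m))" using lc rc by auto
  note sp = Fnm.span_submodule[OF Hc]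
  have det_H: "ring_det A (n + m) B \<in> I" if B: "\<And>i. i < n + m \<Longrightarrow> B i \<in> ?H" for B
  proof -
    have Bm: "mat_in (n + m) (n + m) B" using B Hc by (intro allI impI F_closed[of _ "n + m"]) blast
    have I0: "\<zero> \<in> I" using additive_subgroup.zero_closed[OF ideal.axioms(1)[OF I]] .
    \<comment> \<open>A zero row may be of both types; it is counted in \<open>S\<close>. Rows
      outside \<open>S\<close> are then of the second type.\<close>
    define S where "S = {i. i < n + m \<and> B i \<in> l ` W1}"
    have S: "S \<subseteq> {..<n + m}" by (auto simp: S_def)
    have fS: "finite S" by (rule finite_subset[OF S]) simp
    have inS: "B i j = \<zero>" if "i \<in> S" "\<not> j < n" for i j using that by (auto simp: S_def l_def)
    have outS: "B i j = \<zero>" if "i < n + m" "i \<notin> S" "j < n" for i j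
      using that B[of i] by (auto simp: S_def r_def)
    consider "card S > n" | "card S < n" | "card S = n" by linarith
    then show ?thesis
    proof cases
      case 1
      have "ring_det A (n + m) B = \<zero>"
        by (rule ring_det_zero_block[OF Bm S, of "{..<n}"]) (use 1 inS in auto)
      then show ?thesis using I0 by simp
    next
      case 2
      have "card ({..<n + m} - S) = n + m - card S" using S fS by (simp add: card_Diff_subset)
      then have "card {n..<n + m} < card ({..<n + m} - S)" using 2 by simp
      then have "ring_det A (n + m) B = \<zero>"
        by (intro ring_det_zero_block[OF Bm, of "{..<n + m} - S" "{n..<n + m}"]) (use outS in auto)
      then show ?thesis using I0 by simp
    next
      case 3
      have "card ({..<n + m} - S) = m" using S fS 3 by (simp add: card_Diff_subset)
      then obtain b where b: "bij_betw b {n..<n + m} ({..<n + m} - S)"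
        using finite_same_card_bij[of "{n..<n + m}" "{..<n + m} - S"] by auto
      obtain a where a: "bij_betw a {..<n} S"
        using finite_same_card_bij[of "{..<n}" S] 3 fS by auto
      define e where "e = (\<lambda>i. if i < n then a i else b i)"
      have e1: "bij_betw e {..<n} S" using a by (subst bij_betw_cong[of _ e a]) (auto simp: e_def)
      have e2: "bij_betw e {n..<n + m} ({..<n + m} - S)" using b by (subst bij_betw_cong[of _ e b]) (auto simp: e_def)
      have "bij_betw e ({..<n} \<union> {n..<n + m}) (S \<union> ({..<n + m} - S))"
        by (rule bij_betw_combine[OF e1 e2]) auto
      moreover have "{..<n} \<union> {n..<n + m} = {..<n + m}" "S \<union> ({..<n + m} - S) = {..<n + m}" using S by auto
      ultimately have e: "bij_betw e {..<n + m} {..<n + m}" by simp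
      \<comment> \<open>The rows of \<open>B\<close> are recovered from the sorted matrix by the
        inverse reordering. So its determinant is a multiple of the sorted one, and the sign of the
        reordering need not be computed.\<close>
      define f where "f = inv_into {..<n + m} e"
      have f: "f i < n + m" "e (f i) = i" if "i < n + m" for i
        using that bij_betw_inv_into[OF e] bij_betw_inv_into_right[OF e] by (auto simp: f_def bij_betw_def)
      have eS: "e i \<in> S" if "i < n" for i using e1 that by (auto simp: bij_betw_def)
      have eS': "e i < n + m" "e i \<notin> S" if "n \<le> i" "i < n + m" for i using e2 that by (auto simp: bij_betw_def)
      have elt: "e i < n + m" if "i < n + m" for i using e that by (auto simp: bij_betw_def)
      let ?N = "\<lambda>i. B (e i)"
      have Nm: "mat_in (n + m) (n + m) ?N" using Bm elt by auto
      obtain c where c: "c \<in> carrier A" "ring_det A (n + m) (\<lambda>i. ?N (f i)) = c \<otimes> ring_det A (n + m) ?N"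
        using ring_det_select_rows[OF Nm, of f] f(1) by blast
      have "ring_det A (n + m) (\<lambda>i. ?N (f i)) = ring_det A (n + m) B"
        by (rule ring_det_cong[OF Bm]) (simp add: f)
      moreover have "ring_det A (n + m) ?N = ring_det A n ?N \<otimes> ring_det A m (\<lambda>i j. ?N (n + i) (n + j))"
        by (rule ring_det_block_lower[OF Nm]) (use eS inS in auto)
      moreover have "ring_det A n ?N \<otimes> ring_det A m (\<lambda>i j. ?N (n + i) (n + j)) \<in> I"
      proof -
        have "\<exists>h\<in>W1. ?N i = l h" if "i < n" for i using eS[OF that] by (auto simp: S_def)
        then obtain h' where h': "\<And>i. i < n \<Longrightarrow> h' i \<in> W1" "\<And>i. i < n \<Longrightarrow> ?N i = l (h' i)" by metis
        have "\<exists>k\<in>W2. ?N (n + i) = r k" if "i < m" for i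
          using eS'[of "n + i"] B[of "e (n + i)"] that by (auto simp: S_def)
        then obtain k' where k': "\<And>i. i < m \<Longrightarrow> k' i \<in> W2" "\<And>i. i < m \<Longrightarrow> ?N (n + i) = r (k' i)" by metis
        have "ring_det A n ?N = ring_det A n h'"
          by (rule ring_det_cong) (use h' c1 in \<open>auto simp: l_def\<close>)
        moreover have "ring_det A m (\<lambda>i j. ?N (n + i) (n + j)) = ring_det A m k'"
          by (rule ring_det_cong) (use k' c2 in \<open>auto simp: r_def\<close>)
        ultimately show ?thesis using base[OF h'(1) k'(1)] by simp
      qed
      ultimately have "ring_det A (n + m) ?N \<in> I" "ring_det A (n + m) B = c \<otimes> ring_det A (n + m) ?N"
        using c(2) by simp_all
      then show ?thesis using ideal.I_l_closed[OF I _ c(1)] by simp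
    qed
  qed
  show ?thesis
  proof (rule det_span_mem[OF I Hc det_H])
    fix i assume i: "i < n + m"
    have "l (h i) \<oplus>\<^bsub>F (n + m)\<^esub> r (k i) \<in> span A (F (n + m)) ?H"
      using h[OF i] k[OF i] by (intro Fnm.submoduleE(5)[OF sp] hull_inc) auto
    moreover have "l (h i) \<oplus>\<^bsub>F (n + m)\<^esub> r (k i) = (\<lambda>j. if j < n then h i j else k i (j - n))"
      using h[OF i] k[OF i] c1 c2 by (auto simp: l_def r_def)
    ultimately show "(\<lambda>j. if j < n then h i j else k i (j - n)) \<in> span A (F (n + m)) ?H" by simp
  qed
qed

end

section \<open>Fitting's lemma\<close>

context lmod
begin

lemma rel_carrier: "rel A M n g \<subseteq> carrier (F n)"
  by (auto simp: rel_def)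

lemma generatesD: "generates A M n g \<Longrightarrow> g \<in> {..<n} \<rightarrow> carrier M"
  unfolding generates_def by (rule conjunct1)

lemma generatesE:
  assumes "generates A M n g" "\<And>i. i < m \<Longrightarrow> x i \<in> carrier M"
  obtains T where "\<And>i. i < m \<Longrightarrow> T i \<in> carrier (F n)" "\<And>i. i < m \<Longrightarrow> x i = lincomb M n (T i) g"
proof -
  have "\<forall>i. \<exists>t. i < m \<longrightarrow> t \<in> carrier (F n) \<and> x i = lincomb M n t g"
    using assms by (auto simp: generates_def)
  then obtain T where "\<forall>i. i < m \<longrightarrow> T i \<in> carrier (F n) \<and> x i = lincomb M n (T i) g"
    by (rule choice[THEN exE])
  then show thesis using that by blast
qed

text \<open>In each row of the matrix \<open>?M\<close> the first \<open>m\<close> entries form a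
  relation of \<open>g'\<close>: a generator \<open>g' i\<close> minus its expression through
  \<open>g\<close> and back, or a relation of \<open>g\<close> rewritten in terms of
  \<open>g'\<close>. By \<open>ring_det_fitting\<close> its determinant is that of \<open>B\<close>,
  and expansion along the last \<open>n\<close> columns expresses it through \<open>m\<close> by
  \<open>m\<close> minors of relations of \<open>g'\<close>.\<close>

lemma minor_ideal_generators_subset:
  assumes g: "generates A M n g" and g': "generates A M m g'"
  shows "minor_ideal A n (rel A M n g) \<subseteq> minor_ideal A m (rel A M m g')"
proof (rule minor_ideal_subset[OF minor_ideal_ideal[OF rel_carrier]])
  fix B assume B: "\<And>i. i < n \<Longrightarrow> B i \<in> rel A M n g"
  note gc = generatesD[OF g] and gc' = generatesD[OF g']
  obtain T where T: "\<And>i. i < m \<Longrightarrow> T i \<in> carrier (F n)" "\<And>i. i < m \<Longrightarrow> g' i = lincomb M n (T i) g"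
  proof (rule generatesE[OF g, of m g'])
    show "g' i \<in> carrier M" if "i < m" for i using gc' that by auto
  qed (rule that)
  obtain U where U: "\<And>i. i < n \<Longrightarrow> U i \<in> carrier (F m)" "\<And>i. i < n \<Longrightarrow> g i = lincomb M m (U i) g'"
  proof (rule generatesE[OF g', of n g])
    show "g i \<in> carrier M" if "i < n" for i using gc that by auto
  qed (rule that)
  have Bc: "\<And>i. i < n \<Longrightarrow> B i \<in> carrier (F n)" "\<And>i. i < n \<Longrightarrow> lincomb M n (B i) g = \<zero>\<^bsub>M\<^esub>"
    using B by (auto simp: rel_def)
  have Tm: "mat_in m n T" by (intro allI impI F_closed[OF T(1)])
  have Um: "mat_in n m U" by (intro allI impI F_closed[OF U(1)])
  have Bm: "mat_in n n B" by (intro allI impI F_closed[OF Bc(1)])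
  \<comment> \<open>Multiplication by \<open>U\<close> turns coefficients with respect to
    \<open>g\<close> into coefficients with respect to \<open>g'\<close>. The cut-off at
    \<open>m\<close> keeps the result in \<open>F m\<close>.\<close>
  have comp: "lincomb M m (\<lambda>j. if j < m then \<Oplus>l\<in>{..<n}. t l \<otimes> U l j else \<zero>) g' = lincomb M n t g"
    if t: "t \<in> carrier (F n)" for t
  proof -
    have Uc: "(\<lambda>i. lincomb M m (U i) g') \<in> {..<n} \<rightarrow> carrier M"
      by (rule funcsetI) (simp add: lincomb_closed[OF F_closed[OF U(1)] gc'])
    have "lincomb M n t g = lincomb M n t (\<lambda>i. lincomb M m (U i) g')"
      by (rule lincomb_cong[OF F_closed[OF t] Uc refl U(2)])
    also have "\<dots> = lincomb M m (\<lambda>j. \<Oplus>l\<in>{..<n}. t l \<otimes> U l j) g'"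
      by (rule lincomb_lincomb) (use t Um gc' in auto)
    also have "\<dots> = lincomb M m (\<lambda>j. if j < m then \<Oplus>l\<in>{..<n}. t l \<otimes> U l j else \<zero>) g'"
      by (rule lincomb_cong) (use t Um gc' in \<open>auto intro!: R.finsum_closed\<close>)
    finally show ?thesis ..
  qed
  have comp_c: "(\<lambda>j. if j < m then \<Oplus>l\<in>{..<n}. t l \<otimes> U l j else \<zero>) \<in> carrier (F m)"
    if "t \<in> carrier (F n)" for t
  proof -
    have "(\<Oplus>l\<in>{..<n}. t l \<otimes> U l j) \<in> carrier A" if "j < m" for j
      by (rule R.finsum_closed) (use F_closed[OF \<open>t \<in> carrier (F n)\<close>] Um that in auto)
    then show ?thesis by (simp add: F_carrier)
  qed
  let ?M = "\<lambda>i j. if i < m then (if j < m then (if i = j then \<one> else \<zero>) \<ominus> (\<Oplus>l\<in>{..<n}. T i l \<otimes> U l j) else \<ominus> T i (j - m))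
      else (if j < m then (\<Oplus>l\<in>{..<n}. B (i - m) l \<otimes> U l j) else B (i - m) (j - m))"
  have "ring_det A (m + n) ?M \<in> minor_ideal A m (rel A M m g')"
  proof (rule det_minor_mem[OF minor_ideal_ideal[OF rel_carrier] rel_carrier minor_ideal_mem[OF rel_carrier]])
    show "mat_in (m + n) (m + n) ?M"
    proof (intro allI impI)
      fix i j assume ij: "i < m + n" "j < m + n"
      have "(\<Oplus>l\<in>{..<n}. T i l \<otimes> U l j) \<in> carrier A" if "i < m" "j < m"
        by (rule R.finsum_closed) (use Tm Um that in auto)
      moreover have "(\<Oplus>l\<in>{..<n}. B (i - m) l \<otimes> U l j) \<in> carrier A" if "\<not> i < m" "j < m"
        by (rule R.finsum_closed) (use Bm Um that ij in auto)
      moreover have "j - m < n" if "\<not> j < m" using that ij by simp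
      ultimately show "?M i j \<in> carrier A" using Tm Bm ij by (cases "i < m"; cases "j < m") simp_all
    qed
    fix i assume i: "i < m + n"
    show "\<exists>w\<in>rel A M m g'. \<forall>j<m. ?M i j = w j"
    proof (cases "i < m")
      case True
      define d where "d = (\<lambda>j. if j < m then \<Oplus>l\<in>{..<n}. T i l \<otimes> U l j else \<zero>)"
      let ?w = "\<lambda>j. std_vec A i j \<oplus> \<ominus> d j"
      have c: "d \<in> carrier (F m)" unfolding d_def by (rule comp_c[OF T(1)[OF True]])
      note dj = F_closed[OF c] and sj = F_closed[OF std_vec_F[OF True]]
      have "lincomb M m ?w g' = lincomb M m (std_vec A i) g' \<oplus>\<^bsub>M\<^esub> lincomb M m (\<lambda>j. \<ominus> d j) g'"
        by (rule lincomb_add[OF sj _ gc']) (rule R.a_inv_closed[OF dj])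
      also have "lincomb M m (\<lambda>j. \<ominus> d j) g' = \<ominus>\<^bsub>M\<^esub> lincomb M m d g'"
        by (rule lincomb_neg[OF dj gc'])
      also have "lincomb M m d g' = g' i" using comp[OF T(1)[OF True]] T(2)[OF True] by (simp add: d_def)
      also have "lincomb M m (std_vec A i) g' = g' i" by (rule lincomb_std_vec[OF True gc'])
      also have "g' i \<oplus>\<^bsub>M\<^esub> \<ominus>\<^bsub>M\<^esub> g' i = \<zero>\<^bsub>M\<^esub>"
        by (rule M.r_neg[OF funcset_mem[OF gc']]) (simp add: True)
      finally have w0: "lincomb M m ?w g' = \<zero>\<^bsub>M\<^esub>" .
      have "?w j \<in> carrier A" for j by (rule R.a_closed[OF sj R.a_inv_closed[OF dj]])
      moreover have "?w j = \<zero>" if "m \<le> j" for j using that True by (simp add: d_def std_vec_def)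
      ultimately have "?w \<in> carrier (F m)" by (simp only: F_carrier) blast
      then have wr: "?w \<in> rel A M m g'" using w0 by (simp only: rel_def mem_Collect_eq)
      show ?thesis
      proof (rule bexI[OF _ wr], intro allI impI)
        fix j assume "j < m"
        then show "?M i j = ?w j" using True by (simp add: std_vec_def a_minus_def d_def)
      qed
    next
      case False
      let ?w = "\<lambda>j. if j < m then \<Oplus>l\<in>{..<n}. B (i - m) l \<otimes> U l j else \<zero>"
      have im: "i - m < n" using False i by simp
      have wr: "?w \<in> rel A M m g'" unfolding rel_def
        by (rule CollectI, rule conjI[OF comp_c[OF Bc(1)[OF im]] trans[OF comp[OF Bc(1)[OF im]] Bc(2)[OF im]]])
      show ?thesis by (rule bexI[OF _ wr]) (use False in simp)
    qed
  qed
  then show "ring_det A n B \<in> minor_ideal A m (rel A M m g')"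
    unfolding ring_det_fitting[OF Tm Um Bm] .
qed

end

context lmod
begin
text \<open>Any two systems of generators give the same ideal, by the two inclusions just proved, so
  the definite description selects the ideal of the presentation at hand.\<close>

lemma Fitt_eq:
  assumes "presentation A M n g H"
  shows "Fitt A M = minor_ideal A n H"
proof -
  have key: "minor_ideal A n' H' = minor_ideal A n' (rel A M n' g')" if "presentation A M n' g' H'" for n' g' H'
  proof -
    have eq: "span A (F n') H' = rel A M n' g'" using that unfolding presentation_iff by (rule conjunct2)
    have "H' \<subseteq> span A (F n') H'" by (rule hull_subset)
    then have "H' \<subseteq> carrier (F n')" unfolding eq by (rule order_trans[OF _ rel_carrier])
    from minor_ideal_span[OF this] show ?thesis unfolding eq by (rule sym)
  qed
  show ?thesis unfolding Fitt_def
  proof (rule the_equality)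
    show "\<exists>n' g' H'. presentation A M n' g' H' \<and> minor_ideal A n H = Idl {ring_det A n' B |B. \<forall>i<n'. B i \<in> H'}"
      unfolding minor_ideal_def by (rule exI, rule exI, rule exI, rule conjI[OF assms refl])
    fix I assume "\<exists>n g H. presentation A M n g H \<and> I = Idl {ring_det A n B |B. \<forall>i<n. B i \<in> H}"
    then obtain n' g' H' where p: "presentation A M n' g' H'"
      and I0: "I = Idl {ring_det A n' B |B. \<forall>i<n'. B i \<in> H'}"
      by (elim exE conjE) (rule that)
    have I: "I = minor_ideal A n' H'" unfolding minor_ideal_def by (rule I0)
    have "generates A M n g" "generates A M n' g'"
      using p assms unfolding presentation_iff by (simp_all only:)
    then show "I = minor_ideal A n H"
      unfolding I key[OF p] key[OF assms] by (intro equalityI minor_ideal_generators_subset)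
  qed
qed

lemma Fitt_rel: "generates A M n g \<Longrightarrow> Fitt A M = minor_ideal A n (rel A M n g)"
  by (rule Fitt_eq[OF presentation_rel])

lemma Fitt_ideal: "generates A M n g \<Longrightarrow> ideal (Fitt A M) A"
  by (simp add: Fitt_rel minor_ideal_ideal rel_carrier)

end

text \<open>Moves the guard under the quantifier, as \<open>choice\<close> requires for a family
  that is constrained only below a bound.\<close>

lemma exists_if: "(P \<Longrightarrow> \<exists>t. Q t) \<Longrightarrow> \<exists>t. P \<longrightarrow> Q t"
  by blast

section \<open>Multiplicativity of Fitting ideals in short exact sequences\<close>

definition join :: "nat \<Rightarrow> (nat \<Rightarrow> 'x) \<Rightarrow> (nat \<Rightarrow> 'x) \<Rightarrow> nat \<Rightarrow> 'x" where
  "join n a b t = (if t < n then a t else b (t - n))"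

text \<open>
  The module \<open>P\<close> is annihilated by a non-zero-divisor, and the relations between its generators
  form a finitely generated projective module: \<open>\<kappa>\<close> and \<open>\<sigma>\<close> are a dual basis.
\<close>

definition resolved_by ::
  "'a ring \<Rightarrow> ('a, 'm) module \<Rightarrow> nat \<Rightarrow> (nat \<Rightarrow> 'm) \<Rightarrow> 'a \<Rightarrow> nat \<Rightarrow> (nat \<Rightarrow> nat \<Rightarrow> 'a) \<Rightarrow> ((nat \<Rightarrow> 'a) \<Rightarrow> nat \<Rightarrow> 'a) \<Rightarrow> bool"
  where
  "resolved_by A P m g d l \<kappa> \<sigma> \<longleftrightarrow> generates A P m g \<and> d \<in> non_zero_divisors A \<and>
     (\<forall>j<m. d \<odot>\<^bsub>P\<^esub> g j = \<zero>\<^bsub>P\<^esub>) \<and> (\<forall>i<l. \<kappa> i \<in> rel A P m g) \<and>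
     \<sigma> \<in> module_hom A ((free_module A {..<m})\<lparr>carrier := rel A P m g\<rparr>) (free_module A {..<l}) \<and>
     (\<forall>x\<in>rel A P m g. lincomb (free_module A {..<m}) l (\<sigma> x) \<kappa> = x)"

definition resolved :: "'a ring \<Rightarrow> ('a, 'm) module \<Rightarrow> bool" where
  "resolved A P \<longleftrightarrow> (\<exists>m g d l \<kappa> \<sigma>. resolved_by A P m g d l \<kappa> \<sigma>)"

context lmod
begin

lemma lincomb_join:
  assumes "\<And>i. i < n \<Longrightarrow> a i \<in> carrier A" "\<And>i. i < m \<Longrightarrow> b i \<in> carrier A"
    and "g \<in> {..<n} \<rightarrow> carrier M" "h \<in> {..<m} \<rightarrow> carrier M"
  shows "lincomb M (n + m) (join n a b) (join n g h) = lincomb M n a g \<oplus>\<^bsub>M\<^esub> lincomb M m b h"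
proof -
  have ca: "join n a b i \<in> carrier A" if "i < n + m" for i
    using that assms(1)[of i] assms(2)[of "i - n"] by (auto simp: join_def)
  have cg: "join n g h \<in> {..<n + m} \<rightarrow> carrier M"
  proof (rule funcsetI)
    fix i assume "i \<in> {..<n + m}"
    then show "join n g h i \<in> carrier M"
      using funcset_mem[OF assms(3), of i] funcset_mem[OF assms(4), of "i - n"] by (auto simp: join_def)
  qed
  have "lincomb M n (join n a b) (join n g h) = lincomb M n a g"
    by (rule lincomb_cong) (use assms in \<open>auto simp: join_def\<close>)
  moreover have "lincomb M m (\<lambda>j. join n a b (n + j)) (\<lambda>j. join n g h (n + j)) = lincomb M m b h"
    by (rule lincomb_cong) (use assms in \<open>auto simp: join_def\<close>)
  ultimately show ?thesis using lincomb_split[OF ca cg] by simp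
qed

lemma submodule_lmod: "submodule N A M \<Longrightarrow> lmod A (M\<lparr>carrier := N\<rparr>)"
  by (rule lmodI) (rule submodule.submodule_is_module[OF _ lmodD[OF lmod_axioms]])

lemma lincomb_restrict:
  assumes N: "submodule N A M" and "\<And>i. i < n \<Longrightarrow> c i \<in> carrier A" "g \<in> {..<n} \<rightarrow> N"
  shows "lincomb (M\<lparr>carrier := N\<rparr>) n c g = lincomb M n c g"
proof -
  interpret N: lmod A "M\<lparr>carrier := N\<rparr>" by (rule submodule_lmod[OF N])
  have NM: "N \<subseteq> carrier M" using N by (simp add: submodule_iff)
  show ?thesis using assms(2,3)
  proof (induction n)
    case (Suc n)
    have "lincomb (M\<lparr>carrier := N\<rparr>) (Suc n) c g = c n \<odot>\<^bsub>M\<^esub> g n \<oplus>\<^bsub>M\<^esub> lincomb (M\<lparr>carrier := N\<rparr>) n c g"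
      using Suc.prems by (subst N.lincomb_Suc) auto
    moreover have "lincomb M (Suc n) c g = c n \<odot>\<^bsub>M\<^esub> g n \<oplus>\<^bsub>M\<^esub> lincomb M n c g"
      by (rule lincomb_Suc) (use Suc.prems NM in auto)
    moreover have "lincomb (M\<lparr>carrier := N\<rparr>) n c g = lincomb M n c g"
      by (rule Suc.IH) (use Suc.prems in auto)
    ultimately show ?case by simp
  qed simp
qed

end

context plain_cring
begin

lemma nzd_closed: "d \<in> non_zero_divisors A \<Longrightarrow> d \<in> carrier A"
  by (simp add: non_zero_divisors_def)

lemma nzd_cancel: 
  assumes "d \<in> non_zero_divisors A" "x \<in> carrier A" "y \<in> carrier A" "d \<otimes> x = d \<otimes> y"
  shows "x = y"
proof -
  have d: "d \<in> carrier A" using assms(1) by (rule nzd_closed)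
  have "d \<otimes> (x \<ominus> y) = \<zero>" using assms d by (simp add: minus_eq r_distr r_minus r_neg)
  then have "x \<ominus> y = \<zero>" using assms(1-3) unfolding non_zero_divisors_def by blast
  then have "x \<ominus> y \<oplus> y = y" using assms(3) by simp
  then show ?thesis using assms(2,3) by (simp add: minus_eq a_assoc l_neg)
qed

lemma nzd_mult: 
  assumes "d \<in> non_zero_divisors A" "e \<in> non_zero_divisors A" shows "d \<otimes> e \<in> non_zero_divisors A"
proof -
  have "d \<in> carrier A" "e \<in> carrier A" using assms by (auto simp: nzd_closed)
  moreover have "a = \<zero>" if a: "a \<in> carrier A" "d \<otimes> e \<otimes> a = \<zero>" for a
  proof -
    have "d \<otimes> (e \<otimes> a) = \<zero>" using a calculation by (simp add: m_assoc)
    then have "e \<otimes> a = \<zero>" using assms(1) a(1) calculation(2) unfolding non_zero_divisors_def by blast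
    then show ?thesis using assms(2) a(1) unfolding non_zero_divisors_def by blast
  qed
  ultimately show ?thesis unfolding non_zero_divisors_def by blast
qed

lemma nzd_one: "\<one> \<in> non_zero_divisors A"
  by (simp add: non_zero_divisors_def)

lemma nzd_pow: "d \<in> non_zero_divisors A \<Longrightarrow> d [^] (n::nat) \<in> non_zero_divisors A"
  by (induction n) (simp_all add: nzd_one nzd_mult)

lemma lincomb_F_apply:
  assumes "\<And>i. i < m \<Longrightarrow> c i \<in> carrier A" "v \<in> {..<m} \<rightarrow> carrier (F n)"
  shows "lincomb (F n) m c v j = (\<Oplus>l\<in>{..<m}. c l \<otimes> v l j)"
  using assms
proof (induction m)
  case 0
  then show ?case
    using lmod.lincomb_0[OF free_lmod, where c = c and g = v] by simp
next
  case (Suc m)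
  have vc: "v l j \<in> carrier A" if "l < Suc m" for l
    using F_closed[of "v l" n j] funcset_mem[OF Suc.prems(2), of l] that by simp
  have "lincomb (F n) (Suc m) c v = (\<lambda>j. c m \<otimes> v m j \<oplus> lincomb (F n) m c v j)"
    using lmod.lincomb_Suc[OF free_lmod Suc.prems] by simp
  then have "lincomb (F n) (Suc m) c v j = c m \<otimes> v m j \<oplus> lincomb (F n) m c v j" by simp
  also have "lincomb (F n) m c v j = (\<Oplus>l\<in>{..<m}. c l \<otimes> v l j)"
    by (rule Suc.IH) (use Suc.prems in auto)
  finally show ?case using Suc.prems(1) vc by (simp add: lessThan_Suc Pi_iff)
qed

lemma ideal_colon:
  assumes J: "ideal J A" and Y: "Y \<subseteq> carrier A"
  shows "ideal {x \<in> carrier A. \<forall>y\<in>Y. x \<otimes> y \<in> J} A"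
proof (rule idealI)
  have Yc: "y \<in> Y \<Longrightarrow> y \<in> carrier A" for y using Y by auto
  note Ja = additive_subgroup.zero_closed[OF ideal.axioms(1)[OF J]] additive_subgroup.a_closed[OF ideal.axioms(1)[OF J]]
    additive_subgroup.a_inv_closed[OF ideal.axioms(1)[OF J]]
  show "ring A" by (rule ring_axioms)
  show "subgroup {x \<in> carrier A. \<forall>y\<in>Y. x \<otimes> y \<in> J} (add_monoid A)"
  proof (rule add.subgroupI)
    show "{x \<in> carrier A. \<forall>y\<in>Y. x \<otimes> y \<in> J} \<noteq> {}" using Ja(1) Yc by (auto intro!: exI[of _ \<zero>])
  qed (use Ja Yc in \<open>auto simp: l_distr l_minus\<close>)
  show "x \<otimes> a \<in> {x \<in> carrier A. \<forall>y\<in>Y. x \<otimes> y \<in> J}"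
    if "a \<in> {x \<in> carrier A. \<forall>y\<in>Y. x \<otimes> y \<in> J}" "x \<in> carrier A" for a x
    using that Yc ideal.I_l_closed[OF J] by (simp add: m_assoc)
  then show "a \<otimes> x \<in> {x \<in> carrier A. \<forall>y\<in>Y. x \<otimes> y \<in> J}"
    if "a \<in> {x \<in> carrier A. \<forall>y\<in>Y. x \<otimes> y \<in> J}" "x \<in> carrier A" for a x
    using that m_comm[of a x] by simp
qed

text \<open>Two uses of the colon ideal extend the condition from generators to the generated
  ideals, one factor at a time.\<close>

lemma ideal_prod_genideal_subset:
  assumes J: "ideal J A" and X: "X \<subseteq> carrier A" and Y: "Y \<subseteq> carrier A"
    and XY: "\<And>x y. x \<in> X \<Longrightarrow> y \<in> Y \<Longrightarrow> x \<otimes> y \<in> J"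
  shows "ideal_prod A (Idl X) (Idl Y) \<subseteq> J"
proof
  have 1: "x \<otimes> y \<in> J" if "x \<in> Idl X" "y \<in> Y" for x y
  proof -
    have "Idl X \<subseteq> {x \<in> carrier A. \<forall>y\<in>Y. x \<otimes> y \<in> J}"
      by (rule genideal_minimal[OF ideal_colon[OF J Y]]) (use X XY in auto)
    then show ?thesis using that by auto
  qed
  have Xc: "Idl X \<subseteq> carrier A" using genideal_ideal[OF X] by (rule additive_subgroup.a_subset[OF ideal.axioms(1)])
  have 2: "x \<otimes> y \<in> J" if "x \<in> Idl X" "y \<in> Idl Y" for x y
  proof -
    have "Idl Y \<subseteq> {y \<in> carrier A. \<forall>x\<in>Idl X. y \<otimes> x \<in> J}"
    proof (rule genideal_minimal[OF ideal_colon[OF J Xc]])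
      show "Y \<subseteq> {y \<in> carrier A. \<forall>x\<in>Idl X. y \<otimes> x \<in> J}"
        using 1 Y Xc by (auto simp: m_comm[of _ "_"] subset_iff) (metis m_comm)
    qed
    then have "y \<otimes> x \<in> J" "y \<in> carrier A" using that by auto
    then show ?thesis using m_comm[of x y] Xc that by auto
  qed
  fix z assume "z \<in> ideal_prod A (Idl X) (Idl Y)"
  then show "z \<in> J"
    by (induction rule: ideal_prod.induct) (auto intro: 2 additive_subgroup.a_closed[OF ideal.axioms(1)[OF J]])
qed

lemma short_exactD:
  assumes "short_exact A N P M i p"
  shows "lmod A N" "lmod A P" "lmod A M" "i \<in> module_hom A N P" "p \<in> module_hom A P M"
    "inj_on i (carrier N)" "p ` carrier P = carrier M" "i ` carrier N = {x \<in> carrier P. p x = \<zero>\<^bsub>M\<^esub>}"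
  using assms unfolding short_exact_def lmod_def by simp_all

text \<open>The generators of \<open>Q\<close> are the images of those of \<open>N\<close>, followed
  by lifts of those of \<open>P\<close>. A vector with parts \<open>a\<close> and \<open>b\<close>
  is a relation of \<open>Q\<close> exactly when \<open>b\<close> is a relation of \<open>P\<close>
  and \<open>a + s b\<close> is one of \<open>N\<close>. Block matrices built from such rows give
  one inclusion, and removing \<open>s\<close> from arbitrary relation matrices gives the
  other.\<close>

lemma Fitt_short_exact:
  assumes ex: "short_exact A N Q P i p" and N: "generates A N n gN" and res: "resolved A P"
  shows "Fitt A Q = ideal_prod A (Fitt A N) (Fitt A P) \<and> (\<exists>n g. generates A Q n g)"
proof -
  note ex' = short_exactD[OF ex]
  interpret N: lmod A N by (rule ex'(1))
  interpret Q: lmod A Q by (rule ex'(2))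
  interpret P: lmod A P by (rule ex'(3))
  from res obtain m g d l \<kappa> \<sigma> where r: "resolved_by A P m g d l \<kappa> \<sigma>" unfolding resolved_def by (elim exE) (rule that)
  let ?K = "rel A P m g"
  from r have g: "generates A P m g" and d: "d \<in> non_zero_divisors A"
    and dg: "\<And>j. j < m \<Longrightarrow> d \<odot>\<^bsub>P\<^esub> g j = \<zero>\<^bsub>P\<^esub>" and \<kappa>: "\<And>i. i < l \<Longrightarrow> \<kappa> i \<in> ?K"
    and \<sigma>: "\<sigma> \<in> module_hom A ((F m)\<lparr>carrier := ?K\<rparr>) (F l)"
    and \<sigma>\<kappa>: "\<And>x. x \<in> ?K \<Longrightarrow> lincomb (F m) l (\<sigma> x) \<kappa> = x"
    unfolding resolved_by_def by simp_all
  note gc = P.generatesD[OF g] and gNc = N.generatesD[OF N] and dc = nzd_closed[OF d]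
  have Kc: "x \<in> carrier (F m)" if "x \<in> ?K" for x using that P.rel_carrier by blast
  interpret Fm: lmod A "F m" by (rule free_lmod)
  interpret Fl: lmod A "F l" by (rule free_lmod)
  interpret Fn: lmod A "F n" by (rule free_lmod)
  have Ksub: "submodule ?K A (F m)" by (rule P.rel_submodule[OF gc])
  interpret K: lmod A "(F m)\<lparr>carrier := ?K\<rparr>" by (rule Fm.submodule_lmod[OF Ksub])
  have ic: "i x \<in> carrier Q" if "x \<in> carrier N" for x using hom_closed[OF ex'(4) that] .
  have pc: "p x \<in> carrier P" if "x \<in> carrier Q" for x using hom_closed[OF ex'(5) that] .
  have ker: "\<exists>z\<in>carrier N. i z = x" if "x \<in> carrier Q" "p x = \<zero>\<^bsub>P\<^esub>" for x
  proof -
    have "x \<in> i ` carrier N" unfolding ex'(8) using that by simp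
    then show ?thesis by auto
  qed
  have pi0: "p (i z) = \<zero>\<^bsub>P\<^esub>" if "z \<in> carrier N" for z
    using ex'(8) imageI[OF that, of i] by auto
  have "\<forall>j. \<exists>y. j < m \<longrightarrow> y \<in> carrier Q \<and> p y = g j"
  proof
    fix j
    have "g j \<in> p ` carrier Q" if "j < m" unfolding ex'(7) using gc that by auto
    then show "\<exists>y. j < m \<longrightarrow> y \<in> carrier Q \<and> p y = g j" by (metis imageE)
  qed
  then obtain q where q: "\<forall>j. j < m \<longrightarrow> q j \<in> carrier Q \<and> p (q j) = g j" by (rule choice[THEN exE])
  have qc: "q \<in> {..<m} \<rightarrow> carrier Q" using q by (intro funcsetI) simp
  have igc: "(\<lambda>t. i (gN t)) \<in> {..<n} \<rightarrow> carrier Q" using gNc ic by (intro funcsetI) auto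
  have p_lin: "p (lincomb Q m b q) = lincomb P m b g" if "b \<in> carrier (F m)" for b
  proof -
    have "p (lincomb Q m b q) = lincomb P m b (\<lambda>j. p (q j))"
      by (rule hom_lincomb[OF ex'(2,3,5) F_closed[OF that] qc])
    also have "\<dots> = lincomb P m b g"
      by (rule P.lincomb_cong[OF F_closed[OF that] gc]) (use q in auto)
    finally show ?thesis .
  qed
  have i_lin: "i (lincomb N n a gN) = lincomb Q n a (\<lambda>t. i (gN t))" if "a \<in> carrier (F n)" for a
    by (rule hom_lincomb[OF ex'(1,2,4) F_closed[OF that] gNc])
  have lq: "lincomb Q m b q \<in> carrier Q" if "b \<in> carrier (F m)" for b
    by (rule Q.lincomb_closed[OF F_closed[OF that] qc])
  have lg: "lincomb Q n a (\<lambda>t. i (gN t)) \<in> carrier Q" if "a \<in> carrier (F n)" for a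
    by (rule Q.lincomb_closed[OF F_closed[OF that] igc])
  have lN: "lincomb N n a gN \<in> carrier N" if "a \<in> carrier (F n)" for a
    by (rule N.lincomb_closed[OF F_closed[OF that] gNc])
  define gQ where "gQ = join n (\<lambda>t. i (gN t)) q"
  have join_F: "join n a b \<in> carrier (F (n + m))" if "a \<in> carrier (F n)" "b \<in> carrier (F m)" for a b
  proof -
    have "join n a b t \<in> carrier A" for t using F_closed[OF that(1)] F_closed[OF that(2)] by (simp add: join_def)
    moreover have "join n a b t = \<zero>" if "n + m \<le> t" for t
      using \<open>b \<in> carrier (F m)\<close> that by (simp add: F_carrier join_def)
    ultimately show ?thesis by (simp only: F_carrier) blast
  qed
  have lin_join: "lincomb Q (n + m) (join n a b) gQ = lincomb Q n a (\<lambda>t. i (gN t)) \<oplus>\<^bsub>Q\<^esub> lincomb Q m b q"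
    if "a \<in> carrier (F n)" "b \<in> carrier (F m)" for a b
    unfolding gQ_def by (rule Q.lincomb_join[OF F_closed[OF that(1)] F_closed[OF that(2)] igc qc])
  have gQc: "gQ \<in> {..<n + m} \<rightarrow> carrier Q"
  proof (rule funcsetI)
    fix t assume t: "t \<in> {..<n + m}"
    show "gQ t \<in> carrier Q"
      using funcset_mem[OF igc, of t] funcset_mem[OF qc, of "t - n"] t by (auto simp: gQ_def join_def)
  qed
  have genQ: "generates A Q (n + m) gQ"
    unfolding generates_def
  proof (intro conjI ballI gQc)
    fix x assume x: "x \<in> carrier Q"
    obtain b where b: "b \<in> carrier (F m)" "p x = lincomb P m b g"
      using g pc[OF x] unfolding generates_def by blast
    let ?y = "x \<oplus>\<^bsub>Q\<^esub> \<ominus>\<^bsub>Q\<^esub> lincomb Q m b q"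
    have "p ?y = p x \<oplus>\<^bsub>P\<^esub> p (\<ominus>\<^bsub>Q\<^esub> lincomb Q m b q)"
      by (rule hom_add[OF ex'(5) x]) (rule Q.M.a_inv_closed[OF lq[OF b(1)]])
    also have "p (\<ominus>\<^bsub>Q\<^esub> lincomb Q m b q) = \<ominus>\<^bsub>P\<^esub> p x"
      using hom_neg[OF ex'(2,3,5) lq[OF b(1)]] p_lin[OF b(1)] b(2) by simp
    also have "p x \<oplus>\<^bsub>P\<^esub> \<ominus>\<^bsub>P\<^esub> p x = \<zero>\<^bsub>P\<^esub>" by (rule P.M.r_neg[OF pc[OF x]])
    finally have "p ?y = \<zero>\<^bsub>P\<^esub>" .
    then obtain z where z: "z \<in> carrier N" "i z = ?y"
      using ker[of ?y] x lq[OF b(1)] by auto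
    obtain a where a: "a \<in> carrier (F n)" "z = lincomb N n a gN"
      using N z(1) unfolding generates_def by blast
    have "lincomb Q (n + m) (join n a b) gQ = ?y \<oplus>\<^bsub>Q\<^esub> lincomb Q m b q"
      using lin_join[OF a(1) b(1)] i_lin[OF a(1)] z(2) a(2) by simp
    also have "\<dots> = x" using x lq[OF b(1)] by (simp add: Q.M.a_assoc Q.M.l_neg)
    finally show "\<exists>c\<in>carrier (F (n + m)). x = lincomb Q (n + m) c gQ"
      using join_F[OF a(1) b(1)] by (intro bexI[of _ "join n a b"]) simp_all
  qed
  \<comment> \<open>The relation \<open>\<kappa> j\<close> of \<open>P\<close>, applied to the lifts
    \<open>q\<close>, gives an element of the kernel of \<open>p\<close>; its coordinates in
    \<open>N\<close> are \<open>T j\<close>.\<close>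
  have "\<forall>j. \<exists>t. j < l \<longrightarrow> t \<in> carrier (F n) \<and> lincomb Q n t (\<lambda>t. i (gN t)) = lincomb Q m (\<kappa> j) q"
  proof (rule allI, rule exists_if)
    fix j assume j: "j < l"
    have kj: "\<kappa> j \<in> carrier (F m)" "lincomb P m (\<kappa> j) g = \<zero>\<^bsub>P\<^esub>" using \<kappa>[OF j] by (simp_all add: rel_def)
    obtain z where z: "z \<in> carrier N" "i z = lincomb Q m (\<kappa> j) q"
      using ker[OF lq[OF kj(1)]] p_lin[OF kj(1)] kj(2) by auto
    obtain a where a: "a \<in> carrier (F n)" "z = lincomb N n a gN"
      using N z(1) unfolding generates_def by blast
    show "\<exists>t. t \<in> carrier (F n) \<and> lincomb Q n t (\<lambda>t. i (gN t)) = lincomb Q m (\<kappa> j) q"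
      using a i_lin[OF a(1)] z(2) by auto
  qed
  then obtain T where T: "\<forall>j. j < l \<longrightarrow> T j \<in> carrier (F n) \<and> lincomb Q n (T j) (\<lambda>t. i (gN t)) = lincomb Q m (\<kappa> j) q"
    by (rule choice[THEN exE])
  have Tc: "T \<in> {..<l} \<rightarrow> carrier (F n)" using T by (intro funcsetI) simp
  have \<kappa>c: "\<kappa> \<in> {..<l} \<rightarrow> carrier (F m)" using \<kappa> Kc by (intro funcsetI) simp
  have \<sigma>c: "\<sigma> x \<in> carrier (F l)" if "x \<in> ?K" for x using hom_closed[OF \<sigma>] that by simp
  \<comment> \<open>Coordinates chosen separately for every relation would not depend linearly on
    it. Going through the dual basis makes \<open>s\<close> a homomorphism.\<close>
  define s where "s = (\<lambda>x. lincomb (F n) l (\<sigma> x) T)"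
  have sc: "s x \<in> carrier (F n)" if "x \<in> ?K" for x
    unfolding s_def by (rule Fn.lincomb_closed[OF F_closed[OF \<sigma>c[OF that]] Tc])
  have s_hom: "s \<in> module_hom A ((F m)\<lparr>carrier := ?K\<rparr>) (F n)"
    unfolding module_hom_def
  proof (intro CollectI conjI ballI funcsetI)
    fix x assume x: "x \<in> carrier ((F m)\<lparr>carrier := ?K\<rparr>)"
    then have xK: "x \<in> ?K" by simp
    show "s x \<in> carrier (F n)" by (rule sc[OF xK])
    show "s (x \<oplus>\<^bsub>(F m)\<lparr>carrier := ?K\<rparr>\<^esub> y) = s x \<oplus>\<^bsub>F n\<^esub> s y"
      if y: "y \<in> carrier ((F m)\<lparr>carrier := ?K\<rparr>)" for y
    proof -
      have yK: "y \<in> ?K" using y by simp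
      have "\<sigma> (x \<oplus>\<^bsub>(F m)\<lparr>carrier := ?K\<rparr>\<^esub> y) = (\<lambda>t. \<sigma> x t \<oplus> \<sigma> y t)"
        using hom_add[OF \<sigma> x y] by simp
      then show ?thesis unfolding s_def
        using Fn.lincomb_add[OF F_closed[OF \<sigma>c[OF xK]] F_closed[OF \<sigma>c[OF yK]] Tc] by simp
    qed
    show "s (a \<odot>\<^bsub>(F m)\<lparr>carrier := ?K\<rparr>\<^esub> x) = a \<odot>\<^bsub>F n\<^esub> s x" if a: "a \<in> carrier A" for a
    proof -
      have "\<sigma> (a \<odot>\<^bsub>(F m)\<lparr>carrier := ?K\<rparr>\<^esub> x) = (\<lambda>t. a \<otimes> \<sigma> x t)"
        using hom_smult[OF \<sigma> a x] by simp
      then show ?thesis unfolding s_def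
        using Fn.lincomb_smult[OF F_closed[OF \<sigma>c[OF xK]] a Tc] by simp
    qed
  qed
  have s_lift: "lincomb Q n (s x) (\<lambda>t. i (gN t)) = lincomb Q m x q" if x: "x \<in> ?K" for x
  proof -
    note \<sigma>x = F_closed[OF \<sigma>c[OF x]]
    have "lincomb Q n (s x) (\<lambda>t. i (gN t)) = lincomb Q l (\<sigma> x) (\<lambda>j. lincomb Q n (T j) (\<lambda>t. i (gN t)))"
      unfolding s_def by (rule hom_lincomb[OF free_lmod ex'(2) lincomb_hom[OF ex'(2) igc] \<sigma>x Tc])
    also have "\<dots> = lincomb Q l (\<sigma> x) (\<lambda>j. lincomb Q m (\<kappa> j) q)"
      by (rule Q.lincomb_cong[OF \<sigma>x]) (use T lq \<kappa>c in \<open>auto simp: Pi_iff\<close>)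
    also have "\<dots> = lincomb Q m (lincomb (F m) l (\<sigma> x) \<kappa>) q"
      by (rule hom_lincomb[OF free_lmod ex'(2) lincomb_hom[OF ex'(2) qc] \<sigma>x \<kappa>c, symmetric])
    finally show ?thesis unfolding \<sigma>\<kappa>[OF x] .
  qed
  \<comment> \<open>As \<open>d\<close> kills the generators of \<open>P\<close>, the multiples by
    \<open>d\<close> of the unit vectors are relations, so \<open>s\<close> is defined on
    them.\<close>
  define D where "D = (\<lambda>j t. d \<otimes> std_vec A j t)"
  have DK: "D j \<in> ?K" if j: "j < m" for j
  proof -
    have "D j = d \<odot>\<^bsub>F m\<^esub> std_vec A j" by (simp add: D_def)
    then have "D j \<in> carrier (F m)" using Fm.smult_closed[OF dc std_vec_F[OF j]] by simp
    moreover have "lincomb P m (D j) g = d \<odot>\<^bsub>P\<^esub> lincomb P m (std_vec A j) g"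
      unfolding D_def by (rule P.lincomb_smult[OF F_closed[OF std_vec_F[OF j]] dc gc])
    moreover have "d \<odot>\<^bsub>P\<^esub> lincomb P m (std_vec A j) g = \<zero>\<^bsub>P\<^esub>"
      unfolding P.lincomb_std_vec[OF j gc] by (rule dg[OF j])
    ultimately show ?thesis by (simp add: rel_def)
  qed
  have Dc: "D \<in> {..<m} \<rightarrow> ?K" using DK by (intro funcsetI) simp
  define S where "S = (\<lambda>j. s (D j))"
  have Sc: "S \<in> {..<m} \<rightarrow> carrier (F n)" using DK sc by (intro funcsetI) (simp add: S_def)
  \<comment> \<open>\<open>d s(x) = s(d x)\<close>, and \<open>d x\<close> is the combination of the
    relations \<open>D t\<close> with coefficients \<open>x t\<close>. So \<open>d\<close> times
    \<open>s\<close> is multiplication by the matrix \<open>S\<close>.\<close>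
  have ds: "d \<otimes> s x j = (\<Oplus>t\<in>{..<m}. x t \<otimes> S t j)" if x: "x \<in> ?K" for x j
  proof -
    note xc = F_closed[OF Kc[OF x]]
    have "(\<lambda>t. d \<otimes> x t) = lincomb (F m) m x D"
    proof
      fix t
      have "lincomb (F m) m x D t = (\<Oplus>u\<in>{..<m}. x u \<otimes> D u t)"
        by (rule lincomb_F_apply[OF xc]) (use DK Kc in auto)
      also have "\<dots> = (\<Oplus>u\<in>{..<m}. if t = u then d \<otimes> x u else \<zero>)"
        by (rule finsum_cong') (use xc dc in \<open>auto simp: D_def std_vec_def m_comm\<close>)
      also have "\<dots> = d \<otimes> x t"
      proof (cases "t < m")
        case True
        then show ?thesis using finsum_singleton[of t "{..<m}" "\<lambda>u. d \<otimes> x u"] xc dc by auto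
      next
        case False
        then have "(\<Oplus>u\<in>{..<m}. if t = u then d \<otimes> x u else \<zero>) = (\<Oplus>u\<in>{..<m}. \<zero>)"
          by (intro finsum_cong') auto
        then show ?thesis using False Kc[OF x] dc by (simp add: F_carrier)
      qed
      finally show "d \<otimes> x t = lincomb (F m) m x D t" by simp
    qed
    also have "\<dots> = lincomb ((F m)\<lparr>carrier := ?K\<rparr>) m x D"
      by (rule Fm.lincomb_restrict[OF Ksub xc Dc, symmetric])
    finally have eq: "(\<lambda>t. d \<otimes> x t) = lincomb ((F m)\<lparr>carrier := ?K\<rparr>) m x D" .
    have "d \<otimes> s x j = s (\<lambda>t. d \<otimes> x t) j"
      using hom_smult[OF s_hom dc, of x] x by simp
    also have "\<dots> = lincomb (F n) m x S j"
      unfolding eq S_def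
      using hom_lincomb[OF Fm.submodule_lmod[OF Ksub] free_lmod s_hom xc, of D] Dc by simp
    also have "\<dots> = (\<Oplus>t\<in>{..<m}. x t \<otimes> S t j)" by (rule lincomb_F_apply[OF xc Sc])
    finally show ?thesis .
  qed
  let ?I = "ideal_prod A (Fitt A N) (Fitt A P)"
  note relN = N.rel_submodule[OF gNc]
  have FN: "Fitt A N = minor_ideal A n (rel A N n gN)" by (rule N.Fitt_rel[OF N])
  have FP: "Fitt A P = minor_ideal A m ?K" by (rule P.Fitt_rel[OF g])
  have FQ: "Fitt A Q = minor_ideal A (n + m) (rel A Q (n + m) gQ)" by (rule Q.Fitt_rel[OF genQ])
  have I: "ideal ?I A" by (rule ideal_prod_is_ideal[OF N.Fitt_ideal[OF N] P.Fitt_ideal[OF g]])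
  have rel_Q: "(\<lambda>t. if t < n then c t \<oplus> s (\<lambda>t. c (n + t)) t else \<zero>) \<in> rel A N n gN \<and> (\<lambda>t. c (n + t)) \<in> ?K"
    if c: "c \<in> rel A Q (n + m) gQ" for c
  proof -
    have cc: "c \<in> carrier (F (n + m))" and c0: "lincomb Q (n + m) c gQ = \<zero>\<^bsub>Q\<^esub>" using c by (simp_all add: rel_def)
    define a where "a = (\<lambda>t. if t < n then c t else \<zero>)"
    define b where "b = (\<lambda>t. c (n + t))"
    have a: "a \<in> carrier (F n)" and b: "b \<in> carrier (F m)" using cc by (simp_all add: a_def b_def F_carrier)
    have cj: "c = join n a b" by (rule ext) (simp add: join_def a_def b_def)
    have e: "lincomb Q n a (\<lambda>t. i (gN t)) \<oplus>\<^bsub>Q\<^esub> lincomb Q m b q = \<zero>\<^bsub>Q\<^esub>"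
      using c0 unfolding cj lin_join[OF a b] .
    have "p (lincomb Q n a (\<lambda>t. i (gN t)) \<oplus>\<^bsub>Q\<^esub> lincomb Q m b q) = \<zero>\<^bsub>P\<^esub>"
      unfolding e by (rule hom_zero[OF ex'(2,3,5)])
    moreover have "p (lincomb Q n a (\<lambda>t. i (gN t)) \<oplus>\<^bsub>Q\<^esub> lincomb Q m b q) = \<zero>\<^bsub>P\<^esub> \<oplus>\<^bsub>P\<^esub> lincomb P m b g"
      using hom_add[OF ex'(5) lg[OF a] lq[OF b]] pi0[OF lN[OF a]] i_lin[OF a] p_lin[OF b] by simp
    moreover have "lincomb P m b g \<in> carrier P" by (rule P.lincomb_closed[OF F_closed[OF b] gc])
    ultimately have "lincomb P m b g = \<zero>\<^bsub>P\<^esub>" by simp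
    then have bK: "b \<in> ?K" using b by (simp add: rel_def)
    let ?h = "\<lambda>t. a t \<oplus> s b t"
    have h: "?h \<in> carrier (F n)" using Fn.M.a_closed[OF a sc[OF bK]] by simp
    have "i (lincomb N n ?h gN) = lincomb Q n a (\<lambda>t. i (gN t)) \<oplus>\<^bsub>Q\<^esub> lincomb Q n (s b) (\<lambda>t. i (gN t))"
      unfolding i_lin[OF h] by (rule Q.lincomb_add[OF F_closed[OF a] F_closed[OF sc[OF bK]] igc])
    also have "\<dots> = \<zero>\<^bsub>Q\<^esub>" unfolding s_lift[OF bK] by (rule e)
    also have "\<dots> = i \<zero>\<^bsub>N\<^esub>" by (rule hom_zero[OF ex'(1,2,4), symmetric])
    finally have "lincomb N n ?h gN = \<zero>\<^bsub>N\<^esub>"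
      by (rule inj_onD[OF ex'(6) _ lN[OF h] N.M.zero_closed])
    then have "?h \<in> rel A N n gN" using h by (simp add: rel_def)
    moreover have "?h = (\<lambda>t. if t < n then c t \<oplus> s (\<lambda>t. c (n + t)) t else \<zero>)"
      using h by (auto simp: a_def b_def F_carrier)
    ultimately show ?thesis using bK by (simp add: b_def)
  qed
  have "minor_ideal A (n + m) (rel A Q (n + m) gQ) \<subseteq> ?I"
  proof (rule minor_ideal_subset[OF I])
    fix B assume B: "\<And>i. i < n + m \<Longrightarrow> B i \<in> rel A Q (n + m) gQ"
    define k where "k = (\<lambda>i t. B i (n + t))"
    define h where "h = (\<lambda>i t. if t < n then B i t \<oplus> s (k i) t else \<zero>)"
    have kK: "k i \<in> ?K" and hN: "h i \<in> rel A N n gN" if "i < n + m" for i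
    proof -
      have ki: "(\<lambda>t. B i (n + t)) = k i" by (simp add: k_def)
      show "k i \<in> ?K" "h i \<in> rel A N n gN"
        using rel_Q[OF B[OF that]] unfolding ki h_def by simp_all
    qed
    have hc: "h i \<in> carrier (F n)" if "i < n + m" for i using hN[OF that] by (simp add: rel_def)
    have Bm: "mat_in (n + m) (n + m) B"
      by (rule rows_mat_in) (use B in \<open>simp add: rel_def\<close>)
    have am: "mat_in (n + m) n B" using Bm by simp
    have km: "mat_in (n + m) m k" by (intro allI impI F_closed[OF Kc[OF kK]])
    have hm: "mat_in (n + m) n h" by (intro allI impI F_closed[OF hc])
    have Sm: "mat_in m n S" by (intro allI impI F_closed[OF funcset_mem[OF Sc]]) simp
    \<comment> \<open>The scaling lemma is used twice: with \<open>S\<close> on the original rows,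
      and with zero in place of \<open>S\<close> to take the scaling back from the corrected
      rows.\<close>
    have Zm: "mat_in m n (\<lambda>_ _. \<zero>)" by simp
    have hk: "mat_in (n + m) (n + m) (\<lambda>i j. if j < n then h i j else k i (j - n))"
      using hm km by auto
    have dnz: "d [^] n \<in> non_zero_divisors A" by (rule nzd_pow[OF d])
    have "d [^] n \<otimes> ring_det A (n + m) B =
      d [^] n \<otimes> ring_det A (n + m) (\<lambda>i j. if j < n then B i j else k i (j - n))"
      by (rule arg_cong[where f = "\<lambda>x. d [^] n \<otimes> x"], rule ring_det_cong[OF Bm, symmetric]) (simp add: k_def)
    also have "\<dots> = ring_det A (n + m) (\<lambda>i j. if j < n then d \<otimes> B i j \<oplus> (\<Oplus>l\<in>{..<m}. k i l \<otimes> S l j) else k i (j - n))"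
      by (rule ring_det_scale_columns[OF am km Sm dc, symmetric])
    also have "\<dots> = ring_det A (n + m) (\<lambda>i j. if j < n then d \<otimes> h i j \<oplus> (\<Oplus>l\<in>{..<m}. k i l \<otimes> \<zero>) else k i (j - n))"
    proof (rule ring_det_cong)
      fix i j assume ij: "i < n + m" "j < n + m"
      have z: "(\<Oplus>l\<in>{..<m}. k i l \<otimes> \<zero>) = \<zero>"
      proof -
        have "(\<Oplus>l\<in>{..<m}. k i l \<otimes> \<zero>) = (\<Oplus>l\<in>{..<m}. \<zero>)" by (rule finsum_cong') (use km ij in auto)
        then show ?thesis by simp
      qed
      have skc: "s (k i) j \<in> carrier A" by (rule F_closed[OF sc[OF kK[OF ij(1)]]])
      \<comment> \<open>The scaled and corrected original column is \<open>d\<close> times the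
        column of \<open>h\<close>, by the matrix form \<open>ds\<close> of the lift.\<close>
      have "d \<otimes> h i j = d \<otimes> B i j \<oplus> (\<Oplus>l\<in>{..<m}. k i l \<otimes> S l j)" if "j < n"
        using that Bm ij skc dc unfolding ds[OF kK[OF ij(1)], symmetric] by (simp add: h_def r_distr)
      moreover have "d \<otimes> h i j \<in> carrier A" if "j < n" using hm ij that dc by simp
      ultimately show "(if j < n then d \<otimes> B i j \<oplus> (\<Oplus>l\<in>{..<m}. k i l \<otimes> S l j) else k i (j - n)) =
        (if j < n then d \<otimes> h i j \<oplus> (\<Oplus>l\<in>{..<m}. k i l \<otimes> \<zero>) else k i (j - n))"
        by (simp add: z)
    next
      show "mat_in (n + m) (n + m) (\<lambda>i j. if j < n then d \<otimes> h i j \<oplus> (\<Oplus>l\<in>{..<m}. k i l \<otimes> \<zero>) else k i (j - n))"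
      proof (intro allI impI)
        fix i j assume ij: "i < n + m" "j < n + m"
        have "(\<Oplus>l\<in>{..<m}. k i l \<otimes> \<zero>) \<in> carrier A" by (rule finsum_closed) (use km ij in auto)
        moreover have "j - n < m" if "\<not> j < n" using that ij by simp
        ultimately show "(if j < n then d \<otimes> h i j \<oplus> (\<Oplus>l\<in>{..<m}. k i l \<otimes> \<zero>) else k i (j - n)) \<in> carrier A"
          using hm km ij dc by simp
      qed
    qed
    also have "\<dots> = d [^] n \<otimes> ring_det A (n + m) (\<lambda>i j. if j < n then h i j else k i (j - n))"
      by (rule ring_det_scale_columns[OF hm km Zm dc])
    finally have "ring_det A (n + m) B = ring_det A (n + m) (\<lambda>i j. if j < n then h i j else k i (j - n))"
      by (rule nzd_cancel[OF dnz ring_det_closed[OF Bm] ring_det_closed[OF hk]])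
    also have "\<dots> \<in> ?I"
    proof (rule det_two_blocks_mem[OF I relN Ksub _ hN kK])
      fix h k assume hh: "\<And>i. i < n \<Longrightarrow> h i \<in> rel A N n gN" and kk: "\<And>i. i < m \<Longrightarrow> k i \<in> ?K"
      show "ring_det A n h \<otimes> ring_det A m k \<in> ?I"
        unfolding FN FP
        by (rule ideal_prod.prod; rule minor_ideal_mem) (use hh kk N.rel_carrier P.rel_carrier in auto)
    qed
    finally show "ring_det A (n + m) B \<in> ?I" .
  qed
  moreover have "?I \<subseteq> minor_ideal A (n + m) (rel A Q (n + m) gQ)"
    unfolding FN FP minor_ideal_def[of A n] minor_ideal_def[of A m]
  proof (rule ideal_prod_genideal_subset[OF minor_ideal_ideal[OF Q.rel_carrier]
        minors_closed[OF N.rel_carrier] minors_closed[OF P.rel_carrier]])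
    fix x y
    assume "x \<in> {ring_det A n B |B. \<forall>i<n. B i \<in> rel A N n gN}" "y \<in> {ring_det A m B |B. \<forall>i<m. B i \<in> ?K}"
    then obtain h k where h: "\<forall>i<n. h i \<in> rel A N n gN" and k: "\<forall>i<m. k i \<in> ?K"
      and xy: "x = ring_det A n h" "y = ring_det A m k" by auto
    have hc: "h i \<in> carrier (F n)" "lincomb N n (h i) gN = \<zero>\<^bsub>N\<^esub>" if "i < n" for i
      using h that by (simp_all add: rel_def)
    have kc: "k i \<in> carrier (F m)" if "i < m" for i using k that by (simp add: rel_def)
    \<comment> \<open>The vectors \<open>s (k i)\<close> and \<open>k i\<close> represent the same
      element of \<open>Q\<close>, hence the sign in the lower rows.\<close>
    define M where "M = (\<lambda>i. if i < n then join n (h i) (\<lambda>_. \<zero>) else join n (\<lambda>j. \<ominus> s (k (i - n)) j) (k (i - n)))"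
    have zF: "(\<lambda>_. \<zero>) \<in> carrier (F m)" by (simp add: F_carrier)
    have MQ: "M r \<in> rel A Q (n + m) gQ" if r: "r < n + m" for r
    proof (cases "r < n")
      case True
      have "lincomb Q (n + m) (join n (h r) (\<lambda>_. \<zero>)) gQ = lincomb Q n (h r) (\<lambda>t. i (gN t)) \<oplus>\<^bsub>Q\<^esub> lincomb Q m (\<lambda>_. \<zero>) q"
        by (rule lin_join[OF hc(1)[OF True] zF])
      also have "lincomb Q m (\<lambda>_. \<zero>) q = \<zero>\<^bsub>Q\<^esub>" by (rule Q.lincomb_zero[OF qc refl])
      also have "lincomb Q n (h r) (\<lambda>t. i (gN t)) = \<zero>\<^bsub>Q\<^esub>"
        using i_lin[OF hc(1)[OF True]] hc(2)[OF True] hom_zero[OF ex'(1,2,4)] by simp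
      finally show ?thesis using True join_F[OF hc(1)[OF True] zF] by (simp add: M_def rel_def)
    next
      case False
      then have im: "r - n < m" using r by simp
      have kK: "k (r - n) \<in> ?K" using k im by simp
      note skc = sc[OF kK]
      have ms: "(\<lambda>j. \<ominus> s (k (r - n)) j) \<in> carrier (F n)" using skc by (simp add: F_carrier)
      have "lincomb Q (n + m) (M r) gQ = lincomb Q n (\<lambda>j. \<ominus> s (k (r - n)) j) (\<lambda>t. i (gN t)) \<oplus>\<^bsub>Q\<^esub> lincomb Q m (k (r - n)) q"
        using lin_join[OF ms kc[OF im]] False by (simp add: M_def)
      also have "lincomb Q n (\<lambda>j. \<ominus> s (k (r - n)) j) (\<lambda>t. i (gN t)) = \<ominus>\<^bsub>Q\<^esub> lincomb Q m (k (r - n)) q"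
        unfolding s_lift[OF kK, symmetric] by (rule Q.lincomb_neg[OF F_closed[OF skc] igc])
      also have "\<ominus>\<^bsub>Q\<^esub> lincomb Q m (k (r - n)) q \<oplus>\<^bsub>Q\<^esub> lincomb Q m (k (r - n)) q = \<zero>\<^bsub>Q\<^esub>"
        by (rule Q.M.l_neg[OF lq[OF kc[OF im]]])
      finally show ?thesis using False join_F[OF ms kc[OF im]] by (simp add: M_def rel_def)
    qed
    have Mm: "mat_in (n + m) (n + m) M"
      by (rule rows_mat_in) (use MQ in \<open>simp add: rel_def\<close>)
    have "ring_det A (n + m) M = ring_det A n M \<otimes> ring_det A m (\<lambda>i j. M (n + i) (n + j))"
      by (rule ring_det_block_lower[OF Mm]) (simp add: M_def join_def)
    also have "ring_det A n M = ring_det A n h"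
      by (rule ring_det_cong[OF rows_mat_in[OF hc(1)]]) (simp_all add: M_def join_def)
    also have "ring_det A m (\<lambda>i j. M (n + i) (n + j)) = ring_det A m k"
      by (rule ring_det_cong[OF rows_mat_in[OF kc]]) (simp_all add: M_def join_def)
    finally show "x \<otimes> y \<in> minor_ideal A (n + m) (rel A Q (n + m) gQ)"
      unfolding xy using minor_ideal_mem[OF Q.rel_carrier, of "n + m" M] MQ by simp
  qed
  ultimately show ?thesis using FQ genQ by blast
qed

end

section \<open>Quotient modules\<close>

context lmod
begin

lemma submodule_abelian: "submodule N A M \<Longrightarrow> abelian_subgroup N M"
  by (rule abelian_subgroupI3[OF additive_subgroupI M.abelian_group_axioms]) (simp add: submodule.axioms)

context
  fixes N assumes N: "submodule N A M"
begin

interpretation N: abelian_subgroup N M by (rule submodule_abelian[OF N])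

lemma quot_carrier: "X \<in> carrier (quotient_module M N) \<longleftrightarrow> (\<exists>x\<in>carrier M. X = N +>\<^bsub>M\<^esub> x)"
  by (auto simp: quotient_module_def A_RCOSETS_def')

lemma quot_coset: "x \<in> carrier M \<Longrightarrow> N +>\<^bsub>M\<^esub> x \<in> carrier (quotient_module M N)"
  by (auto simp: quot_carrier)

lemma quot_eq_iff:
  assumes "x \<in> carrier M" "y \<in> carrier M"
  shows "N +>\<^bsub>M\<^esub> x = N +>\<^bsub>M\<^esub> y \<longleftrightarrow> x \<ominus>\<^bsub>M\<^esub> y \<in> N"
proof -
  have "N +>\<^bsub>M\<^esub> x = N +>\<^bsub>M\<^esub> y \<longleftrightarrow> x \<in> N +>\<^bsub>M\<^esub> y"
    using N.a_rcos_self[OF assms(1)] N.a_repr_independence'[OF _ assms(2), of x] by auto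
  also have "\<dots> \<longleftrightarrow> x \<oplus>\<^bsub>M\<^esub> \<ominus>\<^bsub>M\<^esub> y \<in> N" by (rule N.a_rcos_module[OF assms(2,1)])
  finally show ?thesis by (simp add: M.minus_eq)
qed

lemma quot_add:
  "x \<in> carrier M \<Longrightarrow> y \<in> carrier M \<Longrightarrow>
     (N +>\<^bsub>M\<^esub> x) \<oplus>\<^bsub>quotient_module M N\<^esub> (N +>\<^bsub>M\<^esub> y) = N +>\<^bsub>M\<^esub> (x \<oplus>\<^bsub>M\<^esub> y)"
  by (simp add: quotient_module_def N.a_rcos_sum)

lemma quot_zero: "\<zero>\<^bsub>quotient_module M N\<^esub> = N"
  by (simp add: quotient_module_def)

lemma quot_zero': "N +>\<^bsub>M\<^esub> \<zero>\<^bsub>M\<^esub> = \<zero>\<^bsub>quotient_module M N\<^esub>"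
  by (simp add: quot_zero N.a_rcos_const)

lemma quot_zero_iff: 
  assumes "x \<in> carrier M" shows "N +>\<^bsub>M\<^esub> x = \<zero>\<^bsub>quotient_module M N\<^esub> \<longleftrightarrow> x \<in> N"
proof -
  have "\<ominus>\<^bsub>M\<^esub> \<zero>\<^bsub>M\<^esub> = \<zero>\<^bsub>M\<^esub>" using M.r_neg[OF M.zero_closed] M.l_zero[OF M.a_inv_closed[OF M.zero_closed]] by simp
  then have "x \<ominus>\<^bsub>M\<^esub> \<zero>\<^bsub>M\<^esub> = x" using assms by (simp add: a_minus_def)
  then show ?thesis using quot_eq_iff[OF assms M.zero_closed] by (simp add: quot_zero')
qed

text \<open>Representatives of one coset have multiples in one coset, so the union in the definition
  runs over a constant family.\<close>

lemma quot_smult: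
  assumes "a \<in> carrier A" "x \<in> carrier M"
  shows "a \<odot>\<^bsub>quotient_module M N\<^esub> (N +>\<^bsub>M\<^esub> x) = N +>\<^bsub>M\<^esub> (a \<odot>\<^bsub>M\<^esub> x)"
proof -
  have const: "N +>\<^bsub>M\<^esub> (a \<odot>\<^bsub>M\<^esub> y) = N +>\<^bsub>M\<^esub> (a \<odot>\<^bsub>M\<^esub> x)" if "y \<in> N +>\<^bsub>M\<^esub> x" for y
  proof -
    obtain h where h: "h \<in> N" "y = h \<oplus>\<^bsub>M\<^esub> x" using \<open>y \<in> N +>\<^bsub>M\<^esub> x\<close> by (auto simp: a_r_coset_def')
    have hM: "h \<in> carrier M" using h(1) N by (auto simp: submodule_iff)
    have "a \<odot>\<^bsub>M\<^esub> y \<ominus>\<^bsub>M\<^esub> a \<odot>\<^bsub>M\<^esub> x = a \<odot>\<^bsub>M\<^esub> h"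
      using h(2) hM assms by (simp add: smult_r_distr M.minus_eq M.a_assoc M.r_neg)
    also have "\<dots> \<in> N" using h(1) assms N by (simp add: submodule_iff)
    finally show ?thesis using quot_eq_iff[of "a \<odot>\<^bsub>M\<^esub> y" "a \<odot>\<^bsub>M\<^esub> x"] h(2) hM assms by simp
  qed
  have "N +>\<^bsub>M\<^esub> x \<noteq> {}" using N.a_rcos_self[OF assms(2)] by blast
  then have "(\<Union>y\<in>N +>\<^bsub>M\<^esub> x. N +>\<^bsub>M\<^esub> (a \<odot>\<^bsub>M\<^esub> y)) = N +>\<^bsub>M\<^esub> (a \<odot>\<^bsub>M\<^esub> x)"
    by (rule SUP_eq_const) (rule const)
  then show ?thesis by (simp add: quotient_module_def)
qed

lemma quotient_lmod: "lmod A (quotient_module M N)"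
proof (rule lmod_moduleI)
  show "cring A" by (rule R.is_cring)
  fix X assume "X \<in> carrier (quotient_module M N)"
  then obtain x where x: "x \<in> carrier M" "X = N +>\<^bsub>M\<^esub> x" by (auto simp: quot_carrier)
  show "\<zero>\<^bsub>quotient_module M N\<^esub> \<oplus>\<^bsub>quotient_module M N\<^esub> X = X"
    using x unfolding quot_zero'[symmetric] by (simp add: quot_add)
  have "(N +>\<^bsub>M\<^esub> (\<ominus>\<^bsub>M\<^esub> x)) \<oplus>\<^bsub>quotient_module M N\<^esub> X = \<zero>\<^bsub>quotient_module M N\<^esub>"
    using x unfolding quot_zero'[symmetric] by (simp add: quot_add M.l_neg)
  moreover have "N +>\<^bsub>M\<^esub> (\<ominus>\<^bsub>M\<^esub> x) \<in> carrier (quotient_module M N)" using x by (simp add: quot_coset)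
  ultimately show "\<exists>Y\<in>carrier (quotient_module M N). Y \<oplus>\<^bsub>quotient_module M N\<^esub> X = \<zero>\<^bsub>quotient_module M N\<^esub>" by blast
  show "\<one> \<odot>\<^bsub>quotient_module M N\<^esub> X = X" using x by (simp add: quot_smult)
  show "a \<odot>\<^bsub>quotient_module M N\<^esub> X \<in> carrier (quotient_module M N)" if "a \<in> carrier A" for a
    using x that by (simp add: quot_smult quot_coset)
  show "(a \<oplus> b) \<odot>\<^bsub>quotient_module M N\<^esub> X = a \<odot>\<^bsub>quotient_module M N\<^esub> X \<oplus>\<^bsub>quotient_module M N\<^esub> b \<odot>\<^bsub>quotient_module M N\<^esub> X"
    if "a \<in> carrier A" "b \<in> carrier A" for a b using x that by (simp add: quot_smult quot_add smult_l_distr)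
  show "(a \<otimes> b) \<odot>\<^bsub>quotient_module M N\<^esub> X = a \<odot>\<^bsub>quotient_module M N\<^esub> (b \<odot>\<^bsub>quotient_module M N\<^esub> X)"
    if "a \<in> carrier A" "b \<in> carrier A" for a b using x that by (simp add: quot_smult smult_assoc1)
  fix Y assume "Y \<in> carrier (quotient_module M N)"
  then obtain y where y: "y \<in> carrier M" "Y = N +>\<^bsub>M\<^esub> y" by (auto simp: quot_carrier)
  show "X \<oplus>\<^bsub>quotient_module M N\<^esub> Y \<in> carrier (quotient_module M N)" using x y by (simp add: quot_add quot_coset)
  show "X \<oplus>\<^bsub>quotient_module M N\<^esub> Y = Y \<oplus>\<^bsub>quotient_module M N\<^esub> X" using x y by (simp add: quot_add M.a_comm)
  show "a \<odot>\<^bsub>quotient_module M N\<^esub> (X \<oplus>\<^bsub>quotient_module M N\<^esub> Y) =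
      a \<odot>\<^bsub>quotient_module M N\<^esub> X \<oplus>\<^bsub>quotient_module M N\<^esub> a \<odot>\<^bsub>quotient_module M N\<^esub> Y" if "a \<in> carrier A" for a
    using x y that by (simp add: quot_add quot_smult smult_r_distr)
  fix Z assume "Z \<in> carrier (quotient_module M N)"
  then obtain z where z: "z \<in> carrier M" "Z = N +>\<^bsub>M\<^esub> z" by (auto simp: quot_carrier)
  show "X \<oplus>\<^bsub>quotient_module M N\<^esub> Y \<oplus>\<^bsub>quotient_module M N\<^esub> Z = X \<oplus>\<^bsub>quotient_module M N\<^esub> (Y \<oplus>\<^bsub>quotient_module M N\<^esub> Z)"
    using x y z by (simp add: quot_add M.a_assoc)
next
  show "\<zero>\<^bsub>quotient_module M N\<^esub> \<in> carrier (quotient_module M N)"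
    unfolding quot_zero'[symmetric] by (rule quot_coset) simp
qed

lemma quot_hom: "(\<lambda>x. N +>\<^bsub>M\<^esub> x) \<in> module_hom A M (quotient_module M N)"
  unfolding module_hom_def by (auto simp: quot_coset quot_add quot_smult)

lemma quot_induced:
  assumes P: "lmod A P" and f: "f \<in> module_hom A M P" and ker: "\<And>x. x \<in> N \<Longrightarrow> f x = \<zero>\<^bsub>P\<^esub>"
  obtains h where "h \<in> module_hom A (quotient_module M N) P" "\<And>x. x \<in> carrier M \<Longrightarrow> h (N +>\<^bsub>M\<^esub> x) = f x"
proof -
  interpret P: lmod A P by (rule P)
  define h where "h X = f (SOME x. x \<in> carrier M \<and> X = N +>\<^bsub>M\<^esub> x)" for X
  have h: "h (N +>\<^bsub>M\<^esub> x) = f x" if x: "x \<in> carrier M" for x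
  proof -
    define y where "y = (SOME y. y \<in> carrier M \<and> N +>\<^bsub>M\<^esub> x = N +>\<^bsub>M\<^esub> y)"
    have "y \<in> carrier M \<and> N +>\<^bsub>M\<^esub> x = N +>\<^bsub>M\<^esub> y" unfolding y_def by (rule someI[of _ x]) (simp add: x)
    then have y: "y \<in> carrier M" "x \<ominus>\<^bsub>M\<^esub> y \<in> N" using quot_eq_iff[OF x] by auto
    have "f x = f ((x \<ominus>\<^bsub>M\<^esub> y) \<oplus>\<^bsub>M\<^esub> y)" using x y(1) by (simp add: M.minus_eq M.a_assoc M.l_neg)
    also have "\<dots> = f (x \<ominus>\<^bsub>M\<^esub> y) \<oplus>\<^bsub>P\<^esub> f y" by (rule hom_add[OF f]) (use x y in auto)
    also have "\<dots> = f y" using ker[OF y(2)] hom_closed[OF f y(1)] by simp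
    finally show ?thesis unfolding h_def y_def[symmetric] by simp
  qed
  have "h \<in> module_hom A (quotient_module M N) P"
    unfolding module_hom_def
  proof (intro CollectI conjI ballI funcsetI)
    fix X assume "X \<in> carrier (quotient_module M N)"
    then obtain x where x: "x \<in> carrier M" "X = N +>\<^bsub>M\<^esub> x" by (auto simp: quot_carrier)
    show "h X \<in> carrier P" using x h hom_closed[OF f] by simp
    show "h (a \<odot>\<^bsub>quotient_module M N\<^esub> X) = a \<odot>\<^bsub>P\<^esub> h X" if "a \<in> carrier A" for a
      using x h that by (simp add: quot_smult hom_smult[OF f])
    fix Y assume "Y \<in> carrier (quotient_module M N)"
    then obtain y where y: "y \<in> carrier M" "Y = N +>\<^bsub>M\<^esub> y" by (auto simp: quot_carrier)
    show "h (X \<oplus>\<^bsub>quotient_module M N\<^esub> Y) = h X \<oplus>\<^bsub>P\<^esub> h Y"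
      using x y h by (simp add: quot_add hom_add[OF f])
  qed
  then show thesis using h by (rule that)
qed

end

lemma lincomb_add_right:
  assumes "\<And>i. i < n \<Longrightarrow> c i \<in> carrier A" "g \<in> {..<n} \<rightarrow> carrier M" "h \<in> {..<n} \<rightarrow> carrier M"
  shows "lincomb M n c (\<lambda>i. g i \<oplus>\<^bsub>M\<^esub> h i) = lincomb M n c g \<oplus>\<^bsub>M\<^esub> lincomb M n c h"
proof -
  have "lincomb M n c (\<lambda>i. g i \<oplus>\<^bsub>M\<^esub> h i) = (\<Oplus>\<^bsub>M\<^esub>i\<in>{..<n}. c i \<odot>\<^bsub>M\<^esub> g i \<oplus>\<^bsub>M\<^esub> c i \<odot>\<^bsub>M\<^esub> h i)"
    unfolding lincomb_def by (rule M.finsum_cong') (use assms in \<open>auto simp: smult_r_distr Pi_iff\<close>)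
  also have "\<dots> = lincomb M n c g \<oplus>\<^bsub>M\<^esub> lincomb M n c h"
    unfolding lincomb_def by (rule M.finsum_addf) (use assms in auto)
  finally show ?thesis .
qed

lemma lincomb_in_submodule:
  assumes N: "submodule N A M" and "\<And>i. i < n \<Longrightarrow> c i \<in> carrier A" "g \<in> {..<n} \<rightarrow> N"
  shows "lincomb M n c g \<in> N"
proof -
  interpret N: lmod A "M\<lparr>carrier := N\<rparr>" by (rule submodule_lmod[OF N])
  have "lincomb (M\<lparr>carrier := N\<rparr>) n c g \<in> N" using N.lincomb_closed[of n c g] assms(2,3) by simp
  moreover have "lincomb (M\<lparr>carrier := N\<rparr>) n c g = lincomb M n c g" by (rule lincomb_restrict) (use assms in auto)
  ultimately show ?thesis by simp
qed

lemma lincomb_range_submodule: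
  assumes g: "g \<in> {..<n} \<rightarrow> carrier M"
  shows "submodule ((\<lambda>c. lincomb M n c g) ` carrier (F n)) A M"
proof -
  interpret Fn: lmod A "F n" by (rule free_lmod)
  show ?thesis unfolding submodule_iff
  proof (intro conjI ballI)
    show "(\<lambda>c. lincomb M n c g) ` carrier (F n) \<subseteq> carrier M" using lincomb_closed[OF F_closed g] by auto
    show "\<zero>\<^bsub>M\<^esub> \<in> (\<lambda>c. lincomb M n c g) ` carrier (F n)"
      by (rule image_eqI[of _ _ "\<lambda>_. \<zero>"]) (simp_all add: lincomb_zero[OF g] F_carrier)
    fix x assume "x \<in> (\<lambda>c. lincomb M n c g) ` carrier (F n)"
    then obtain c where c: "c \<in> carrier (F n)" "x = lincomb M n c g" by auto
    show "a \<odot>\<^bsub>M\<^esub> x \<in> (\<lambda>c. lincomb M n c g) ` carrier (F n)" if a: "a \<in> carrier A" for a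
      by (rule image_eqI[of _ _ "\<lambda>i. a \<otimes> c i"])
        (use c(2) lincomb_smult[OF F_closed[OF c(1)] a g] Fn.smult_closed[OF a c(1)] in simp_all)
    fix y assume "y \<in> (\<lambda>c. lincomb M n c g) ` carrier (F n)"
    then obtain e where e: "e \<in> carrier (F n)" "y = lincomb M n e g" by auto
    show "x \<oplus>\<^bsub>M\<^esub> y \<in> (\<lambda>c. lincomb M n c g) ` carrier (F n)"
      by (rule image_eqI[of _ _ "\<lambda>i. c i \<oplus> e i"])
        (use c(2) e(2) lincomb_add[OF F_closed[OF c(1)] F_closed[OF e(1)] g] Fn.M.a_closed[OF c(1) e(1)] in simp_all)
  qed
qed

lemma span_finite:
  assumes "finite H" "H \<subseteq> carrier M"
  obtains n g where "g \<in> {..<n} \<rightarrow> H" "\<And>x. x \<in> span A M H \<Longrightarrow> \<exists>c\<in>carrier (F n). x = lincomb M n c g"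
proof -
  obtain hs where hs: "set hs = H" using finite_list[OF assms(1)] by blast
  define n where "n = length hs"
  define g where "g = (\<lambda>i. hs ! i)"
  have gH: "g \<in> {..<n} \<rightarrow> H" using hs by (auto simp: g_def n_def)
  then have gM: "g \<in> {..<n} \<rightarrow> carrier M" using assms(2) by auto
  have "H \<subseteq> (\<lambda>c. lincomb M n c g) ` carrier (F n)"
  proof
    fix x assume "x \<in> H"
    then obtain i where i: "i < n" "x = g i" using hs by (auto simp: g_def n_def in_set_conv_nth)
    then show "x \<in> (\<lambda>c. lincomb M n c g) ` carrier (F n)"
      by (intro image_eqI[of _ _ "std_vec A i"]) (simp_all add: lincomb_std_vec[OF _ gM] std_vec_F)
  qed
  then have "span A M H \<subseteq> (\<lambda>c. lincomb M n c g) ` carrier (F n)"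
    by (simp only: span_subset_iff[OF lincomb_range_submodule[OF gM]])
  then show thesis using that[OF gH] by auto
qed

end

section \<open>Kernels and finite generation\<close>

context plain_cring
begin

lemma kernel_submodule:
  assumes "lmod A M" "lmod A N" "f \<in> module_hom A M N"
  shows "submodule {x \<in> carrier M. f x = \<zero>\<^bsub>N\<^esub>} A M"
proof -
  interpret M: lmod A M by fact
  interpret N: lmod A N by fact
  show ?thesis unfolding M.submodule_iff
    by (auto simp: hom_zero[OF assms] hom_add[OF assms(3)] hom_smult[OF assms(3)])
qed

lemma kernel_short_exact:
  assumes "lmod A M" "lmod A N" "f \<in> module_hom A M N" "f ` carrier M = carrier N"
  shows "short_exact A (M\<lparr>carrier := {x \<in> carrier M. f x = \<zero>\<^bsub>N\<^esub>}\<rparr>) M N (\<lambda>x. x) f"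
proof -
  interpret M: lmod A M by fact
  interpret N: lmod A N by fact
  show ?thesis
    using M.submodule_lmod[OF kernel_submodule[OF assms(1-3)]] assms
    unfolding short_exact_def lmod_def by (auto simp: module_hom_def)
qed

lemma lifts_exist:
  assumes "p ` carrier Q = carrier P" "g \<in> {..<m} \<rightarrow> carrier P"
  obtains q where "q \<in> {..<m} \<rightarrow> carrier Q" "\<And>j. j < m \<Longrightarrow> p (q j) = g j"
proof -
  have "\<forall>j. \<exists>y. j < m \<longrightarrow> y \<in> carrier Q \<and> p y = g j"
  proof
    fix j
    have "g j \<in> p ` carrier Q" if "j < m" unfolding assms(1) using assms(2) that by auto
    then show "\<exists>y. j < m \<longrightarrow> y \<in> carrier Q \<and> p y = g j" by (metis imageE)
  qed
  then obtain q where q: "\<forall>j. j < m \<longrightarrow> q j \<in> carrier Q \<and> p (q j) = g j" by (rule choice[THEN exE])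
  show thesis by (rule that[of q]) (use q in auto)
qed

lemma hom_lincomb_eq:
  assumes "lmod A Q" "lmod A P" "p \<in> module_hom A Q P" "q \<in> {..<m} \<rightarrow> carrier Q"
    and "g \<in> {..<m} \<rightarrow> carrier P" "\<And>j. j < m \<Longrightarrow> p (q j) = g j" and b: "b \<in> carrier (F m)"
  shows "p (lincomb Q m b q) = lincomb P m b g"
proof -
  interpret P: lmod A P by fact
  have "p (lincomb Q m b q) = lincomb P m b (\<lambda>j. p (q j))"
    by (rule hom_lincomb[OF assms(1-3) F_closed[OF b] assms(4)])
  also have "\<dots> = lincomb P m b g"
    by (rule P.lincomb_cong[OF F_closed[OF b] assms(5)]) (use assms(6) in auto)
  finally show ?thesis .
qed

text \<open>With lifts \<open>y\<close> of the generators of \<open>P\<close>, the kernel is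
  generated by the differences \<open>z j\<close> between \<open>x j\<close> and a combination of
  the \<open>y\<close> with the same image, together with the values of the finitely many relations
  \<open>H\<close> on \<open>y\<close>. A combination of the \<open>x j\<close> is one of the
  \<open>z j\<close> plus one of the \<open>y\<close>; if it lies in the kernel, the coefficients of
  the latter are a relation of \<open>P\<close>.\<close>

lemma kernel_finitely_generated:
  assumes ex: "short_exact A N Q P i p" and Q: "generates A Q n x" and P: "finitely_presented A P"
  shows "\<exists>k z. generates A N k z"
proof -
  note ex' = short_exactD[OF ex]
  interpret N: lmod A N by (rule ex'(1))
  interpret Q: lmod A Q by (rule ex'(2))
  interpret P: lmod A P by (rule ex'(3))
  obtain t g H where H: "finite H" and pres: "presentation A P t g H"
    using P unfolding finitely_presented_def by blast
  have g: "generates A P t g" and HK: "span A (F t) H = rel A P t g" using pres unfolding presentation_iff by simp_all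
  note gc = P.generatesD[OF g] and xc = Q.generatesD[OF Q]
  interpret Ft: lmod A "F t" by (rule free_lmod)
  obtain y where yc: "y \<in> {..<t} \<rightarrow> carrier Q" and py: "\<And>j. j < t \<Longrightarrow> p (y j) = g j"
    by (rule lifts_exist[OF ex'(7) gc]) (rule that)
  have pxc: "p (x j) \<in> carrier P" if "j < n" for j using hom_closed[OF ex'(5)] xc that by auto
  obtain C where Cc: "\<And>j. j < n \<Longrightarrow> C j \<in> carrier (F t)" and pC: "\<And>j. j < n \<Longrightarrow> p (x j) = lincomb P t (C j) g"
  proof (rule P.generatesE[OF g, of n "\<lambda>j. p (x j)"])
    show "p (x j) \<in> carrier P" if "j < n" for j by (rule pxc[OF that])
  qed (rule that)
  let ?y = "\<lambda>b. lincomb Q t b y"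
  have y_hom: "?y \<in> module_hom A (F t) Q" by (rule lincomb_hom[OF ex'(2) yc])
  have yQ: "?y b \<in> carrier Q" if "b \<in> carrier (F t)" for b by (rule hom_closed[OF y_hom that])
  have p_y: "p (?y b) = lincomb P t b g" if "b \<in> carrier (F t)" for b
    by (rule hom_lincomb_eq[OF ex'(2,3,5) yc gc py that])
  define z where "z j = x j \<oplus>\<^bsub>Q\<^esub> \<ominus>\<^bsub>Q\<^esub> ?y (C j)" for j
  have xj: "x j \<in> carrier Q" if "j < n" for j using xc that by auto
  have zc: "z j \<in> carrier Q" if "j < n" for j
    unfolding z_def using xj[OF that] yQ[OF Cc[OF that]] by simp
  have pz: "p (z j) = \<zero>\<^bsub>P\<^esub>" if j: "j < n" for j
  proof -
    have "p (z j) = p (x j) \<oplus>\<^bsub>P\<^esub> p (\<ominus>\<^bsub>Q\<^esub> ?y (C j))"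
      unfolding z_def by (rule hom_add[OF ex'(5) xj[OF j]]) (rule Q.M.a_inv_closed[OF yQ[OF Cc[OF j]]])
    also have "p (\<ominus>\<^bsub>Q\<^esub> ?y (C j)) = \<ominus>\<^bsub>P\<^esub> p (x j)"
      using hom_neg[OF ex'(2,3,5) yQ[OF Cc[OF j]]] p_y[OF Cc[OF j]] pC[OF j] by simp
    finally show ?thesis using P.M.r_neg[OF pxc[OF j]] by simp
  qed
  let ?ker = "{x \<in> carrier Q. p x = \<zero>\<^bsub>P\<^esub>}"
  have ker_sub: "submodule ?ker A Q" by (rule kernel_submodule[OF ex'(2,3,5)])
  let ?G = "z ` {..<n} \<union> ?y ` H"
  have HH: "H \<subseteq> rel A P t g" unfolding HK[symmetric] by (rule hull_subset)
  have G_ker: "?G \<subseteq> ?ker"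
  proof (intro Un_least subsetI)
    fix u assume "u \<in> z ` {..<n}" then show "u \<in> ?ker" using zc pz by auto
  next
    fix u assume "u \<in> ?y ` H"
    then obtain h where h: "h \<in> H" "u = ?y h" by auto
    then have "h \<in> carrier (F t)" "lincomb P t h g = \<zero>\<^bsub>P\<^esub>" using HH by (auto simp: rel_def)
    then show "u \<in> ?ker" using h(2) yQ p_y by simp
  qed
  then have GQ: "?G \<subseteq> carrier Q" by auto
  have finG: "finite ?G" using H by simp
  let ?S = "span A Q ?G"
  have S: "submodule ?S A Q" by (rule Q.span_submodule[OF GQ])
  have GS: "?G \<subseteq> ?S" by (rule hull_subset)
  have relS: "?y b \<in> ?S" if b: "b \<in> rel A P t g" for b
  proof -
    \<comment> \<open>The vectors whose value on \<open>y\<close> lies in \<open>?S\<close> form a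
      submodule; containing \<open>H\<close>, it contains every relation.\<close>
    let ?T = "{b \<in> carrier (F t). ?y b \<in> ?S}"
    have "submodule ?T A (F t)"
      unfolding Ft.submodule_iff
    proof (intro conjI ballI)
      show "\<zero>\<^bsub>F t\<^esub> \<in> ?T"
        using hom_zero[OF free_lmod ex'(2) y_hom] S Ft.M.zero_closed unfolding Q.submodule_iff by auto
    qed (use S hom_add[OF y_hom] hom_smult[OF y_hom] Ft.M.a_closed Ft.smult_closed in \<open>auto simp: Q.submodule_iff[of ?S] simp del: free_simps\<close>)
    moreover have "H \<subseteq> ?T" using HH P.rel_carrier GS by auto
    ultimately have "span A (F t) H \<subseteq> ?T" by (simp only: Ft.span_subset_iff)
    then show ?thesis using b unfolding HK by auto
  qed
  have ker_S: "u \<in> ?S" if u: "u \<in> carrier Q" "p u = \<zero>\<^bsub>P\<^esub>" for u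
  proof -
    obtain a where a: "a \<in> carrier (F n)" "u = lincomb Q n a x" using Q u(1) unfolding generates_def by blast
    note ac = F_closed[OF a(1)]
    have zfun: "z \<in> {..<n} \<rightarrow> carrier Q" using zc by auto
    have yfun: "(\<lambda>j. ?y (C j)) \<in> {..<n} \<rightarrow> carrier Q" using yQ Cc by auto
    have Cfun: "C \<in> {..<n} \<rightarrow> carrier (F t)" using Cc by auto
    have "u = lincomb Q n a (\<lambda>j. z j \<oplus>\<^bsub>Q\<^esub> ?y (C j))"
      unfolding a(2)
    proof (rule Q.lincomb_cong[OF ac])
      show "(\<lambda>j. z j \<oplus>\<^bsub>Q\<^esub> ?y (C j)) \<in> {..<n} \<rightarrow> carrier Q" using zc yQ[OF Cc] by auto
      fix j assume j: "j < n"
      show "x j = z j \<oplus>\<^bsub>Q\<^esub> ?y (C j)"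
        unfolding z_def using xj[OF j] yQ[OF Cc[OF j]] by (simp add: Q.M.a_assoc Q.M.l_neg)
    qed simp
    also have "\<dots> = lincomb Q n a z \<oplus>\<^bsub>Q\<^esub> lincomb Q n a (\<lambda>j. ?y (C j))"
      by (rule Q.lincomb_add_right[OF ac zfun yfun])
    also have "lincomb Q n a (\<lambda>j. ?y (C j)) = ?y (lincomb (F t) n a C)"
      by (rule hom_lincomb[OF free_lmod ex'(2) y_hom ac Cfun, symmetric])
    finally have u_eq: "u = lincomb Q n a z \<oplus>\<^bsub>Q\<^esub> ?y (lincomb (F t) n a C)" .
    let ?b = "lincomb (F t) n a C"
    have bc: "?b \<in> carrier (F t)" by (rule Ft.lincomb_closed[OF ac Cfun])
    have azS: "lincomb Q n a z \<in> ?S"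
      by (rule Q.lincomb_in_submodule[OF S ac]) (use GS in auto)
    have az_ker: "lincomb Q n a z \<in> ?ker"
      by (rule Q.lincomb_in_submodule[OF ker_sub ac]) (use zc pz in auto)
    have "p u = p (lincomb Q n a z) \<oplus>\<^bsub>P\<^esub> p (?y ?b)"
      unfolding u_eq by (rule hom_add[OF ex'(5)]) (use az_ker yQ[OF bc] in auto)
    moreover have "p (lincomb Q n a z) = \<zero>\<^bsub>P\<^esub>" using az_ker by simp
    moreover have "lincomb P t ?b g \<in> carrier P" by (rule P.lincomb_closed[OF F_closed[OF bc] gc])
    ultimately have "lincomb P t ?b g = \<zero>\<^bsub>P\<^esub>" unfolding u(2) p_y[OF bc] by simp
    then have "?b \<in> rel A P t g" using bc by (simp add: rel_def)
    then have "?y ?b \<in> ?S" by (rule relS)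
    then show ?thesis unfolding u_eq using Q.submoduleE(5)[OF S azS] by simp
  qed
  obtain k f where f: "f \<in> {..<k} \<rightarrow> ?G" and fS: "\<And>u. u \<in> ?S \<Longrightarrow> \<exists>c\<in>carrier (F k). u = lincomb Q k c f"
    by (rule Q.span_finite[OF finG GQ]) (rule that)
  have f_im: "f j \<in> i ` carrier N" if "j < k" for j
  proof -
    have "f j \<in> ?G" using f that by auto
    then show ?thesis unfolding ex'(8) using G_ker by blast
  qed
  define w where "w j = inv_into (carrier N) i (f j)" for j
  have w: "w j \<in> carrier N" "i (w j) = f j" if "j < k" for j
    using inv_into_into[OF f_im[OF that]] f_inv_into_f[OF f_im[OF that]] by (simp_all add: w_def)
  have wfun: "w \<in> {..<k} \<rightarrow> carrier N" using w by auto
  have ffun: "f \<in> {..<k} \<rightarrow> carrier Q" by (rule funcsetI) (rule subsetD[OF GQ funcset_mem[OF f]])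
  have "generates A N k w"
    unfolding generates_def
  proof (intro conjI ballI wfun)
    fix u assume u: "u \<in> carrier N"
    have "i u \<in> ?ker" using u ex'(8) by blast
    then have "i u \<in> ?S" using ker_S by simp
    then obtain c where c: "c \<in> carrier (F k)" "i u = lincomb Q k c f" using fS by blast
    have "i (lincomb N k c w) = lincomb Q k c f"
      by (rule hom_lincomb_eq[OF ex'(1,2,4) wfun ffun w(2) c(1)])
    then have "i u = i (lincomb N k c w)" using c(2) by simp
    then have "u = lincomb N k c w"
      by (rule inj_onD[OF ex'(6) _ u N.lincomb_closed[OF F_closed[OF c(1)] wfun]])
    then show "\<exists>c\<in>carrier (F k). u = lincomb N k c w" using c(1) by blast
  qed
  then show ?thesis by blast
qed

end

section \<open>Free and projective modules\<close>

context plain_cring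
begin

definition free_vec :: "'s \<Rightarrow> 's \<Rightarrow> 'a" where
  "free_vec s t = (if t = s then \<one> else \<zero>)"

lemma free_vec_carrier: "s \<in> S \<Longrightarrow> free_vec s \<in> carrier (free_module A S)"
  by (auto simp: free_carrier free_vec_def)

lemma hom_free_eqI:
  assumes C: "lmod A C" and u: "u \<in> module_hom A (free_module A S) C" and v: "v \<in> module_hom A (free_module A S) C"
    and eq: "\<And>s. s \<in> S \<Longrightarrow> u (free_vec s) = v (free_vec s)" and f: "f \<in> carrier (free_module A S)"
  shows "u f = v f"
proof -
  interpret C: lmod A C by (rule C)
  have "finite T \<Longrightarrow> f \<in> carrier (free_module A S) \<Longrightarrow> {s. f s \<noteq> \<zero>} \<subseteq> T \<Longrightarrow> u f = v f" for T f
  proof (induction T arbitrary: f rule: finite_induct)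
    case empty
    then have "f = \<zero>\<^bsub>free_module A S\<^esub>" by auto
    then show ?case using hom_zero[OF free_lmod C u] hom_zero[OF free_lmod C v] by simp
  next
    case (insert s T)
    show ?case
    proof (cases "s \<in> S")
      case False
      then have "f s = \<zero>" using insert.prems(1) by (simp add: free_carrier)
      then have "{s. f s \<noteq> \<zero>} \<subseteq> T" using insert.prems(2) by auto
      then show ?thesis by (rule insert.IH[OF insert.prems(1)])
    next
      case True
      define f' where "f' = f(s := \<zero>)"
      have fc: "f t \<in> carrier A" for t using insert.prems(1) by (simp add: free_carrier)
      have f'c: "f' \<in> carrier (free_module A S)"
      proof -
        have "{t. f' t \<noteq> \<zero>} \<subseteq> {t. f t \<noteq> \<zero>}" by (auto simp: f'_def)
        moreover have "finite {t. f t \<noteq> \<zero>}" using insert.prems(1) by (simp only: free_carrier)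
        ultimately have "finite {t. f' t \<noteq> \<zero>}" by (rule finite_subset)
        then show ?thesis using insert.prems(1) by (simp add: free_carrier f'_def)
      qed
      interpret FS: lmod A "free_module A S" by (rule free_lmod)
      have sv: "f s \<odot>\<^bsub>free_module A S\<^esub> free_vec s \<in> carrier (free_module A S)"
        by (rule FS.smult_closed[OF fc free_vec_carrier[OF True]])
      have dec: "f = f' \<oplus>\<^bsub>free_module A S\<^esub> f s \<odot>\<^bsub>free_module A S\<^esub> free_vec s"
        using fc by (auto simp: f'_def free_vec_def)
      have IH: "u f' = v f'" by (rule insert.IH[OF f'c]) (use insert.prems(2) in \<open>auto simp: f'_def\<close>)
      have "w f = w f' \<oplus>\<^bsub>C\<^esub> f s \<odot>\<^bsub>C\<^esub> w (free_vec s)" if w: "w \<in> module_hom A (free_module A S) C" for w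
      proof -
        have "w f = w f' \<oplus>\<^bsub>C\<^esub> w (f s \<odot>\<^bsub>free_module A S\<^esub> free_vec s)"
          using hom_add[OF w f'c sv] dec by simp
        then show ?thesis using hom_smult[OF w fc free_vec_carrier[OF True]] by simp
      qed
      from this[OF u] this[OF v] show ?thesis using IH eq[OF True] by simp
    qed
  qed
  moreover have "finite {s. f s \<noteq> \<zero>}" using f by (simp only: free_carrier)
  ultimately show ?thesis using f by blast
qed

lemma hom_free_exists:
  assumes B: "lmod A B" and b: "\<And>s. s \<in> S \<Longrightarrow> b s \<in> carrier B"
  obtains w where "w \<in> module_hom A (free_module A S) B" "\<And>s. s \<in> S \<Longrightarrow> w (free_vec s) = b s"
proof -
  interpret B: lmod A B by (rule B)
  interpret FS: lmod A "free_module A S" by (rule free_lmod)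
  define w where "w f = (\<Oplus>\<^bsub>B\<^esub>s\<in>{s. f s \<noteq> \<zero>}. f s \<odot>\<^bsub>B\<^esub> b s)" for f
  \<comment> \<open>Summing over a larger finite set changes nothing and allows two functions with
    different supports to be added.\<close>
  have supp: "w f = (\<Oplus>\<^bsub>B\<^esub>s\<in>T. f s \<odot>\<^bsub>B\<^esub> b s)"
    if "f \<in> carrier (free_module A S)" "finite T" "{s. f s \<noteq> \<zero>} \<subseteq> T" "T \<subseteq> S" for f T
    unfolding w_def
  proof (rule B.M.add.finprod_mono_neutral_cong_left[OF that(2,3)])
    show "f i \<odot>\<^bsub>B\<^esub> b i = \<zero>\<^bsub>B\<^esub>" if "i \<in> T - {s. f s \<noteq> \<zero>}" for i
      using that b \<open>T \<subseteq> S\<close> by auto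
    show "(\<lambda>s. f s \<odot>\<^bsub>B\<^esub> b s) \<in> T \<rightarrow> carrier B"
      using b \<open>T \<subseteq> S\<close> that(1) by (auto simp: free_carrier)
  qed simp
  have fin: "finite {s. f s \<noteq> \<zero>}" "{s. f s \<noteq> \<zero>} \<subseteq> S" if "f \<in> carrier (free_module A S)" for f
    using that by (simp_all only: free_carrier) auto
  have w_hom: "w \<in> module_hom A (free_module A S) B"
    unfolding module_hom_def
  proof (intro CollectI conjI ballI funcsetI)
    fix f assume f: "f \<in> carrier (free_module A S)"
    have fc: "f s \<in> carrier A" for s using f by (simp add: free_carrier)
    let ?T = "{s. f s \<noteq> \<zero>}"
    show "w f \<in> carrier B" unfolding w_def
      by (rule B.M.finsum_closed) (use fin[OF f] fc b in auto)
    show "w (a \<odot>\<^bsub>free_module A S\<^esub> f) = a \<odot>\<^bsub>B\<^esub> w f" if a: "a \<in> carrier A" for a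
    proof -
      have "w (a \<odot>\<^bsub>free_module A S\<^esub> f) = (\<Oplus>\<^bsub>B\<^esub>s\<in>?T. (a \<odot>\<^bsub>free_module A S\<^esub> f) s \<odot>\<^bsub>B\<^esub> b s)"
        by (rule supp[OF FS.smult_closed[OF a f] fin(1)[OF f] _ fin(2)[OF f]]) (use a in auto)
      also have "\<dots> = (\<Oplus>\<^bsub>B\<^esub>s\<in>?T. a \<odot>\<^bsub>B\<^esub> (f s \<odot>\<^bsub>B\<^esub> b s))"
        by (rule B.M.finsum_cong') (use a fc b fin[OF f] in \<open>auto simp: B.smult_assoc1\<close>)
      also have "\<dots> = a \<odot>\<^bsub>B\<^esub> w f" unfolding w_def
        by (rule B.finsum_smult_ldistr[symmetric]) (use a fc b fin[OF f] in auto)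
      finally show ?thesis .
    qed
    fix g assume g: "g \<in> carrier (free_module A S)"
    have gc: "g s \<in> carrier A" for s using g by (simp add: free_carrier)
    let ?U = "?T \<union> {s. g s \<noteq> \<zero>}"
    have U: "finite ?U" "?U \<subseteq> S" using fin[OF f] fin[OF g] by simp_all
    have "w (f \<oplus>\<^bsub>free_module A S\<^esub> g) = (\<Oplus>\<^bsub>B\<^esub>s\<in>?U. (f \<oplus>\<^bsub>free_module A S\<^esub> g) s \<odot>\<^bsub>B\<^esub> b s)"
      by (rule supp[OF FS.M.a_closed[OF f g] U(1) _ U(2)]) auto
    also have "\<dots> = (\<Oplus>\<^bsub>B\<^esub>s\<in>?U. f s \<odot>\<^bsub>B\<^esub> b s \<oplus>\<^bsub>B\<^esub> g s \<odot>\<^bsub>B\<^esub> b s)"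
      by (rule B.M.finsum_cong') (use fc gc b U(2) in \<open>auto simp: B.smult_l_distr\<close>)
    also have "\<dots> = (\<Oplus>\<^bsub>B\<^esub>s\<in>?U. f s \<odot>\<^bsub>B\<^esub> b s) \<oplus>\<^bsub>B\<^esub> (\<Oplus>\<^bsub>B\<^esub>s\<in>?U. g s \<odot>\<^bsub>B\<^esub> b s)"
      by (rule B.M.finsum_addf) (use fc gc b U(2) in auto)
    also have "\<dots> = w f \<oplus>\<^bsub>B\<^esub> w g"
      using supp[OF f U(1) _ U(2)] supp[OF g U(1) _ U(2)] by simp
    finally show "w (f \<oplus>\<^bsub>free_module A S\<^esub> g) = w f \<oplus>\<^bsub>B\<^esub> w g" .
  qed
  have "w (free_vec s) = b s" if s: "s \<in> S" for s
  proof -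
    have "w (free_vec s) = (\<Oplus>\<^bsub>B\<^esub>t\<in>{s}. free_vec s t \<odot>\<^bsub>B\<^esub> b t)"
      by (rule supp[OF free_vec_carrier[OF s]]) (use s in \<open>auto simp: free_vec_def split: if_splits\<close>)
    then show ?thesis using b[OF s] by (simp add: free_vec_def)
  qed
  with w_hom show thesis by (rule that)
qed

lemma hom_comp: "f \<in> module_hom A M N \<Longrightarrow> g \<in> module_hom A N P \<Longrightarrow> (\<lambda>x. g (f x)) \<in> module_hom A M P"
  by (auto simp: module_hom_def Pi_iff)

text \<open>On a free module a lift may be prescribed on the basis. The map on \<open>P\<close> is
  lifted after composition with the retraction \<open>r\<close>, and the lift is restricted along
  the embedding \<open>j\<close>.\<close>

lemma projective_lift:
  fixes P :: "('a, 'p) module"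
  assumes P: "projective_module A P" and B: "lmod A B" and C: "lmod A C"
    and v: "v \<in> module_hom A B C" and u: "u \<in> module_hom A P C"
    and sur: "\<And>x. x \<in> carrier P \<Longrightarrow> u x \<in> v ` carrier B"
  obtains w where "w \<in> module_hom A P B" "\<And>x. x \<in> carrier P \<Longrightarrow> v (w x) = u x"
proof -
  obtain S :: "'p set" and j r where j: "j \<in> module_hom A P (free_module A S)" and r: "r \<in> module_hom A (free_module A S) P"
    and rj: "\<forall>x\<in>carrier P. r (j x) = x"
    using P unfolding projective_module_def by blast
  define b where "b s = inv_into (carrier B) v (u (r (free_vec s)))" for s
  have im: "u (r (free_vec s)) \<in> v ` carrier B" if "s \<in> S" for s
    by (rule sur[OF hom_closed[OF r free_vec_carrier[OF that]]])
  have bc: "b s \<in> carrier B" "v (b s) = u (r (free_vec s))" if "s \<in> S" for s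
    using inv_into_into[OF im[OF that]] f_inv_into_f[OF im[OF that]] by (simp_all add: b_def)
  obtain w where w: "w \<in> module_hom A (free_module A S) B" and wb: "\<And>s. s \<in> S \<Longrightarrow> w (free_vec s) = b s"
    by (rule hom_free_exists[OF B bc(1)]) (assumption, rule that)
  have eq: "v (w f) = u (r f)" if "f \<in> carrier (free_module A S)" for f
    by (rule hom_free_eqI[OF C hom_comp[OF w v] hom_comp[OF r u] _ that]) (simp add: wb bc(2))
  show thesis
  proof (rule that)
    show "(\<lambda>x. w (j x)) \<in> module_hom A P B" by (rule hom_comp[OF j w])
    show "v (w (j x)) = u x" if "x \<in> carrier P" for x
      using eq[OF hom_closed[OF j that]] rj that by simp
  qed
qed

text \<open>Non-zero-divisors are closed under multiplication, so the product of annihilators of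
  finitely many elements serves for all of them.\<close>

lemma torsion_annihilator:
  fixes m :: nat
  assumes P: "torsion_module A P" and g: "g \<in> {..<m} \<rightarrow> carrier P"
  shows "\<exists>d\<in>non_zero_divisors A. \<forall>j<m. d \<odot>\<^bsub>P\<^esub> g j = \<zero>\<^bsub>P\<^esub>"
  using g
proof (induction m)
  case 0
  show ?case using nzd_one by auto
next
  case (Suc m)
  interpret P: lmod A P using P by (intro lmodI) (simp add: torsion_module_def)
  obtain d where d: "d \<in> non_zero_divisors A" "\<forall>j<m. d \<odot>\<^bsub>P\<^esub> g j = \<zero>\<^bsub>P\<^esub>"
  proof -
    have "g \<in> {..<m} \<rightarrow> carrier P" using Suc.prems by auto
    from Suc.IH[OF this] show thesis using that by blast
  qed
  have gm: "g m \<in> carrier P" using Suc.prems by auto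
  then obtain e where e: "e \<in> non_zero_divisors A" "e \<odot>\<^bsub>P\<^esub> g m = \<zero>\<^bsub>P\<^esub>"
    using P unfolding torsion_module_def by blast
  have "(d \<otimes> e) \<odot>\<^bsub>P\<^esub> g j = \<zero>\<^bsub>P\<^esub>" if "j < Suc m" for j
  proof (cases "j = m")
    case True
    then show ?thesis using e d gm by (simp add: P.smult_assoc1 nzd_closed)
  next
    case False
    then have "j < m" using that by simp
    moreover have "g j \<in> carrier P" using Suc.prems that by auto
    ultimately show ?thesis using e d by (simp add: m_comm[of d e] P.smult_assoc1 nzd_closed)
  qed
  then show ?case using nzd_mult[OF d(1) e(1)] by blast
qed

text \<open>
  The relation module of a finitely presented module with a projective resolution of length one is
  projective: as in Schanuel's lemma it is a direct summand of \<open>P1 \<oplus> F m\<close>.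
\<close>

lemma class_P_resolved:
  assumes "class_P A P" shows "resolved A P"
proof -
  have fp: "finitely_presented A P" and tor: "torsion_module A P" and pd: "proj_dim_le_1 A P"
    using assms unfolding class_P_def by simp_all
  obtain m g H where H: "finite H" and pres: "presentation A P m g H"
    using fp unfolding finitely_presented_def by blast
  have g: "generates A P m g" and HK: "span A (F m) H = rel A P m g" using pres unfolding presentation_iff by simp_all
  obtain P1 P0 :: "('a, 'b \<Rightarrow> 'a) module" and i p where proj: "projective_module A P1" "projective_module A P0"
    and ex: "short_exact A P1 P0 P i p"
    using pd unfolding proj_dim_le_1_def by blast
  note ex' = short_exactD[OF ex]
  interpret P1: lmod A P1 by (rule ex'(1))
  interpret P0: lmod A P0 by (rule ex'(2))
  interpret P: lmod A P by (rule ex'(3))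
  note gc = P.generatesD[OF g]
  obtain d where d: "d \<in> non_zero_divisors A" "\<forall>j<m. d \<odot>\<^bsub>P\<^esub> g j = \<zero>\<^bsub>P\<^esub>"
    using torsion_annihilator[OF tor gc] by blast
  let ?K = "rel A P m g"
  interpret Fm: lmod A "F m" by (rule free_lmod)
  have Ksub: "submodule ?K A (F m)" by (rule P.rel_submodule[OF gc])
  have Kmod: "lmod A ((F m)\<lparr>carrier := ?K\<rparr>)" by (rule Fm.submodule_lmod[OF Ksub])
  interpret K: lmod A "(F m)\<lparr>carrier := ?K\<rparr>" by (rule Kmod)
  let ?q = "\<lambda>c. lincomb P m c g"
  have q: "?q \<in> module_hom A (F m) P" by (rule lincomb_hom[OF ex'(3) gc])
  have H_sub: "H \<subseteq> ?K" unfolding HK[symmetric] by (rule hull_subset)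
  have HF: "H \<subseteq> carrier (F m)" using H_sub P.rel_carrier by (rule order_trans)
  obtain l \<kappa> where \<kappa>H: "\<kappa> \<in> {..<l} \<rightarrow> H"
    and \<kappa>_gen: "\<And>x. x \<in> span A (F m) H \<Longrightarrow> \<exists>c\<in>carrier (F l). x = lincomb (F m) l c \<kappa>"
    by (rule Fm.span_finite[OF H HF]) (rule that)
  have \<kappa>K: "\<kappa> \<in> {..<l} \<rightarrow> ?K" by (rule funcsetI) (rule subsetD[OF H_sub funcset_mem[OF \<kappa>H]])
  interpret Fl: lmod A "F l" by (rule free_lmod)
  let ?v = "\<lambda>c. lincomb ((F m)\<lparr>carrier := ?K\<rparr>) l c \<kappa>"
  have \<kappa>K': "\<kappa> \<in> {..<l} \<rightarrow> carrier ((F m)\<lparr>carrier := ?K\<rparr>)" using \<kappa>K by simp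
  have v: "?v \<in> module_hom A (F l) ((F m)\<lparr>carrier := ?K\<rparr>)" by (rule lincomb_hom[OF Kmod \<kappa>K'])
  have v_eq: "?v c = lincomb (F m) l c \<kappa>" if "c \<in> carrier (F l)" for c
    by (rule Fm.lincomb_restrict[OF Ksub F_closed[OF that] \<kappa>K])
  have v_sur: "x \<in> ?v ` carrier (F l)" if x: "x \<in> ?K" for x
  proof -
    obtain c where c: "c \<in> carrier (F l)" "x = lincomb (F m) l c \<kappa>" using \<kappa>_gen[of x] x unfolding HK by blast
    then show ?thesis by (intro image_eqI[of _ _ c]) (simp_all only: v_eq)
  qed
  obtain y where y: "y \<in> {..<m} \<rightarrow> carrier P0" and py: "\<And>j. j < m \<Longrightarrow> p (y j) = g j"
    by (rule lifts_exist[OF ex'(7) gc]) (rule that)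
  \<comment> \<open>\<open>\<alpha>\<close> compares the presentation with the given resolution, and
    \<open>\<beta>\<close> below compares in the opposite direction; both are maps over
    \<open>P\<close>.\<close>
  define \<alpha> where "\<alpha> c = lincomb P0 m c y" for c
  have \<alpha>: "\<alpha> \<in> module_hom A (F m) P0" unfolding \<alpha>_def by (rule lincomb_hom[OF ex'(2) y])
  have p\<alpha>: "p (\<alpha> c) = ?q c" if "c \<in> carrier (F m)" for c
    unfolding \<alpha>_def by (rule hom_lincomb_eq[OF ex'(2,3,5) y gc, OF py that])
  have q_sur: "p x \<in> ?q ` carrier (F m)" if "x \<in> carrier P0" for x
    using g hom_closed[OF ex'(5) that] unfolding generates_def by blast
  obtain \<beta> where \<beta>: "\<beta> \<in> module_hom A P0 (F m)" and q\<beta>: "\<And>x. x \<in> carrier P0 \<Longrightarrow> ?q (\<beta> x) = p x"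
    by (rule projective_lift[OF proj(2) free_lmod ex'(3) q ex'(5) q_sur]) (assumption, rule that)
  have pi0: "p (i z) = \<zero>\<^bsub>P\<^esub>" if "z \<in> carrier P1" for z using ex'(8) imageI[OF that, of i] by auto
  have \<beta>i: "\<beta> (i x) \<in> ?K" if "x \<in> carrier P1" for x
    using hom_closed[OF \<beta> hom_closed[OF ex'(4) that]] q\<beta>[OF hom_closed[OF ex'(4) that]] pi0[OF that]
    by (simp add: rel_def)
  have u1: "(\<lambda>x. \<beta> (i x)) \<in> module_hom A P1 ((F m)\<lparr>carrier := ?K\<rparr>)"
    using hom_comp[OF ex'(4) \<beta>] \<beta>i by (simp add: module_hom_def Pi_iff)
  obtain w1 where w1: "w1 \<in> module_hom A P1 (F l)" and vw1: "\<And>x. x \<in> carrier P1 \<Longrightarrow> ?v (w1 x) = \<beta> (i x)"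
    by (rule projective_lift[OF proj(1) free_lmod Kmod v u1 v_sur[OF \<beta>i]]) (assumption, rule that)
  \<comment> \<open>The vectors \<open>c\<close> and \<open>\<beta> (\<alpha> c)\<close> have the
    same image in \<open>P\<close>, so their difference is a relation. If \<open>c\<close> is itself
    a relation, then \<open>\<alpha> c\<close> comes from an element \<open>j c\<close> of
    \<open>P1\<close>, and \<open>c = \<beta> (i (j c)) + u2 c\<close> factors the identity of the
    relation module through the sum of \<open>P1\<close> and \<open>F m\<close>.\<close>
  define u2 where "u2 c = c \<oplus>\<^bsub>F m\<^esub> \<ominus>\<^bsub>F m\<^esub> \<beta> (\<alpha> c)" for c
  have \<beta>\<alpha>: "(\<lambda>c. \<beta> (\<alpha> c)) \<in> module_hom A (F m) (F m)" by (rule hom_comp[OF \<alpha> \<beta>])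
  have u2K: "u2 c \<in> ?K" if c: "c \<in> carrier (F m)" for c
  proof -
    have bc: "\<beta> (\<alpha> c) \<in> carrier (F m)" by (rule hom_closed[OF \<beta>\<alpha> c])
    have "?q (u2 c) = ?q c \<oplus>\<^bsub>P\<^esub> ?q (\<ominus>\<^bsub>F m\<^esub> \<beta> (\<alpha> c))"
      unfolding u2_def by (rule hom_add[OF q c Fm.M.a_inv_closed[OF bc]])
    also have "?q (\<ominus>\<^bsub>F m\<^esub> \<beta> (\<alpha> c)) = \<ominus>\<^bsub>P\<^esub> ?q (\<beta> (\<alpha> c))" by (rule hom_neg[OF free_lmod ex'(3) q bc])
    also have "?q (\<beta> (\<alpha> c)) = ?q c" unfolding q\<beta>[OF hom_closed[OF \<alpha> c]] by (rule p\<alpha>[OF c])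
    finally have "?q (u2 c) = \<zero>\<^bsub>P\<^esub>" using P.M.r_neg[OF hom_closed[OF q c]] by simp
    moreover have "u2 c \<in> carrier (F m)" unfolding u2_def by (rule Fm.M.a_closed[OF c Fm.M.a_inv_closed[OF bc]])
    ultimately show ?thesis by (simp add: rel_def)
  qed
  have v_im: "?v ` carrier (F l) = carrier ((F m)\<lparr>carrier := ?K\<rparr>)"
    using v_sur hom_closed[OF v] by auto
  have uK: "(\<lambda>j. u2 (std_vec A j)) \<in> {..<m} \<rightarrow> carrier ((F m)\<lparr>carrier := ?K\<rparr>)"
    by (rule funcsetI) (simp add: u2K std_vec_F)
  obtain T where T: "T \<in> {..<m} \<rightarrow> carrier (F l)" and vT: "\<And>j. j < m \<Longrightarrow> ?v (T j) = u2 (std_vec A j)"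
    by (rule lifts_exist[OF v_im uK]) (rule that)
  define w2 where "w2 c = lincomb (F l) m c T" for c
  have w2: "w2 \<in> module_hom A (F m) (F l)" unfolding w2_def by (rule lincomb_hom[OF free_lmod T])
  have u2_hom: "u2 \<in> module_hom A (F m) ((F m)\<lparr>carrier := ?K\<rparr>)"
    unfolding module_hom_def
  proof (intro CollectI conjI ballI funcsetI)
    fix c assume c: "c \<in> carrier (F m)"
    note bc = hom_closed[OF \<beta>\<alpha> c]
    show "u2 c \<in> carrier ((F m)\<lparr>carrier := ?K\<rparr>)" using u2K[OF c] by simp
    have "u2 (a \<odot>\<^bsub>F m\<^esub> c) = a \<odot>\<^bsub>F m\<^esub> u2 c" if a: "a \<in> carrier A" for a
      unfolding u2_def hom_smult[OF \<beta>\<alpha> a c] Fm.smult_r_distr[OF a c Fm.M.a_inv_closed[OF bc]] Fm.smult_r_minus[OF a bc] ..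
    then show "u2 (a \<odot>\<^bsub>F m\<^esub> c) = a \<odot>\<^bsub>(F m)\<lparr>carrier := ?K\<rparr>\<^esub> u2 c" if "a \<in> carrier A" for a using that by simp
    fix e assume e: "e \<in> carrier (F m)"
    note be = hom_closed[OF \<beta>\<alpha> e]
    have "u2 (c \<oplus>\<^bsub>F m\<^esub> e) = (c \<oplus>\<^bsub>F m\<^esub> e) \<oplus>\<^bsub>F m\<^esub> (\<ominus>\<^bsub>F m\<^esub> \<beta> (\<alpha> c) \<oplus>\<^bsub>F m\<^esub> \<ominus>\<^bsub>F m\<^esub> \<beta> (\<alpha> e))"
      unfolding u2_def hom_add[OF \<beta>\<alpha> c e] Fm.M.minus_add[OF bc be] ..
    also have "\<dots> = u2 c \<oplus>\<^bsub>F m\<^esub> u2 e"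
      unfolding u2_def using c e Fm.M.a_inv_closed[OF bc] Fm.M.a_inv_closed[OF be]
      by (simp add: Fm.M.a_ac del: free_simps)
    finally show "u2 (c \<oplus>\<^bsub>F m\<^esub> e) = u2 c \<oplus>\<^bsub>(F m)\<lparr>carrier := ?K\<rparr>\<^esub> u2 e" by simp
  qed
  have vw2: "?v (w2 c) = u2 c" if c: "c \<in> carrier (F m)" for c
  proof -
    have "?v (w2 c) = lincomb ((F m)\<lparr>carrier := ?K\<rparr>) m c (\<lambda>j. u2 (std_vec A j))"
      unfolding w2_def by (rule hom_lincomb_eq[OF free_lmod Kmod v T uK, OF vT c])
    then show ?thesis unfolding hom_F_eq[OF Kmod u2_hom c] .
  qed
  define j where "j c = inv_into (carrier P1) i (\<alpha> c)" for c
  have j: "j c \<in> carrier P1" "i (j c) = \<alpha> c" if c: "c \<in> ?K" for c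
  proof -
    have cF: "c \<in> carrier (F m)" and c0: "?q c = \<zero>\<^bsub>P\<^esub>" using c by (simp_all add: rel_def)
    have "\<alpha> c \<in> i ` carrier P1" unfolding ex'(8) using hom_closed[OF \<alpha> cF] p\<alpha>[OF cF] c0 by simp
    then show "j c \<in> carrier P1" "i (j c) = \<alpha> c"
      unfolding j_def by (rule inv_into_into, rule f_inv_into_f)
  qed
  have KF: "c \<in> carrier (F m)" if "c \<in> ?K" for c using that by (simp add: rel_def)
  have j_hom: "j \<in> module_hom A ((F m)\<lparr>carrier := ?K\<rparr>) P1"
    unfolding module_hom_def
  proof (intro CollectI conjI ballI funcsetI)
    fix c assume "c \<in> carrier ((F m)\<lparr>carrier := ?K\<rparr>)"
    then have c: "c \<in> ?K" by simp
    show "j c \<in> carrier P1" by (rule j(1)[OF c])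
    show "j (a \<odot>\<^bsub>(F m)\<lparr>carrier := ?K\<rparr>\<^esub> c) = a \<odot>\<^bsub>P1\<^esub> j c" if a: "a \<in> carrier A" for a
    proof -
      have ac: "a \<odot>\<^bsub>F m\<^esub> c \<in> ?K" using Ksub a c unfolding Fm.submodule_iff by blast
      have "i (j (a \<odot>\<^bsub>F m\<^esub> c)) = i (a \<odot>\<^bsub>P1\<^esub> j c)"
        unfolding j(2)[OF ac] hom_smult[OF ex'(4) a j(1)[OF c]] j(2)[OF c] by (rule hom_smult[OF \<alpha> a KF[OF c]])
      then have "j (a \<odot>\<^bsub>F m\<^esub> c) = a \<odot>\<^bsub>P1\<^esub> j c"
        by (rule inj_onD[OF ex'(6) _ j(1)[OF ac] P1.smult_closed[OF a j(1)[OF c]]])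
      then show ?thesis by simp
    qed
    fix e assume "e \<in> carrier ((F m)\<lparr>carrier := ?K\<rparr>)"
    then have e: "e \<in> ?K" by simp
    have ce: "c \<oplus>\<^bsub>F m\<^esub> e \<in> ?K" using Ksub e c unfolding Fm.submodule_iff by blast
    have "i (j (c \<oplus>\<^bsub>F m\<^esub> e)) = i (j c \<oplus>\<^bsub>P1\<^esub> j e)"
      unfolding j(2)[OF ce] hom_add[OF ex'(4) j(1)[OF c] j(1)[OF e]] j(2)[OF c] j(2)[OF e] by (rule hom_add[OF \<alpha> KF[OF c] KF[OF e]])
    then have "j (c \<oplus>\<^bsub>F m\<^esub> e) = j c \<oplus>\<^bsub>P1\<^esub> j e"
      by (rule inj_onD[OF ex'(6) _ j(1)[OF ce] P1.M.a_closed[OF j(1)[OF c] j(1)[OF e]]])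
    then show "j (c \<oplus>\<^bsub>(F m)\<lparr>carrier := ?K\<rparr>\<^esub> e) = j c \<oplus>\<^bsub>P1\<^esub> j e" by simp
  qed
  \<comment> \<open>\<open>w1\<close> lifts the map from \<open>P1\<close> along \<open>?v\<close>,
    \<open>w2\<close> lifts \<open>u2\<close>; hence \<open>?v (\<sigma> c)\<close> is the
    decomposition of \<open>c\<close> above.\<close>
  define \<sigma> where "\<sigma> c = w1 (j c) \<oplus>\<^bsub>F l\<^esub> w2 c" for c
  have w1j: "(\<lambda>c. w1 (j c)) \<in> module_hom A ((F m)\<lparr>carrier := ?K\<rparr>) (F l)" by (rule hom_comp[OF j_hom w1])
  have \<sigma>_hom: "\<sigma> \<in> module_hom A ((F m)\<lparr>carrier := ?K\<rparr>) (F l)"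
    unfolding module_hom_def
  proof (intro CollectI conjI ballI funcsetI)
    fix c assume c': "c \<in> carrier ((F m)\<lparr>carrier := ?K\<rparr>)"
    then have c: "c \<in> carrier (F m)" using KF by simp
    show "\<sigma> c \<in> carrier (F l)" unfolding \<sigma>_def by (rule Fl.M.a_closed[OF hom_closed[OF w1j c'] hom_closed[OF w2 c]])
    have "\<sigma> (a \<odot>\<^bsub>F m\<^esub> c) = a \<odot>\<^bsub>F l\<^esub> \<sigma> c" if a: "a \<in> carrier A" for a
    proof -
      have "w1 (j (a \<odot>\<^bsub>F m\<^esub> c)) = a \<odot>\<^bsub>F l\<^esub> w1 (j c)" using hom_smult[OF w1j a c'] by simp
      then show ?thesis
        unfolding \<sigma>_def hom_smult[OF w2 a c] Fl.smult_r_distr[OF a hom_closed[OF w1j c'] hom_closed[OF w2 c]] by simp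
    qed
    then show "\<sigma> (a \<odot>\<^bsub>(F m)\<lparr>carrier := ?K\<rparr>\<^esub> c) = a \<odot>\<^bsub>F l\<^esub> \<sigma> c" if "a \<in> carrier A" for a using that by simp
    fix e assume e': "e \<in> carrier ((F m)\<lparr>carrier := ?K\<rparr>)"
    then have e: "e \<in> carrier (F m)" using KF by simp
    have "w1 (j (c \<oplus>\<^bsub>F m\<^esub> e)) = w1 (j c) \<oplus>\<^bsub>F l\<^esub> w1 (j e)" using hom_add[OF w1j c' e'] by simp
    then have "\<sigma> (c \<oplus>\<^bsub>F m\<^esub> e) = \<sigma> c \<oplus>\<^bsub>F l\<^esub> \<sigma> e"
      unfolding \<sigma>_def hom_add[OF w2 c e]
      using hom_closed[OF w1j c'] hom_closed[OF w1j e'] hom_closed[OF w2 c] hom_closed[OF w2 e]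
      by (simp add: Fl.M.a_ac del: free_simps)
    then show "\<sigma> (c \<oplus>\<^bsub>(F m)\<lparr>carrier := ?K\<rparr>\<^esub> e) = \<sigma> c \<oplus>\<^bsub>F l\<^esub> \<sigma> e" by simp
  qed
  have "lincomb (F m) l (\<sigma> c) \<kappa> = c" if c: "c \<in> ?K" for c
  proof -
    have c': "c \<in> carrier ((F m)\<lparr>carrier := ?K\<rparr>)" using c by simp
    note bc = hom_closed[OF \<beta>\<alpha> KF[OF c]]
    have "?v (\<sigma> c) = ?v (w1 (j c)) \<oplus>\<^bsub>(F m)\<lparr>carrier := ?K\<rparr>\<^esub> ?v (w2 c)"
      unfolding \<sigma>_def by (rule hom_add[OF v hom_closed[OF w1j c'] hom_closed[OF w2 KF[OF c]]])
    then have "?v (\<sigma> c) = \<beta> (\<alpha> c) \<oplus>\<^bsub>F m\<^esub> u2 c"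
      unfolding vw1[OF j(1)[OF c]] vw2[OF KF[OF c]] j(2)[OF c] by simp
    also have "\<dots> = c" unfolding u2_def
      using Fm.M.a_lcomm[OF bc KF[OF c] Fm.M.a_inv_closed[OF bc]] Fm.M.r_neg[OF bc] KF[OF c]
      by (simp del: free_simps)
    finally show ?thesis unfolding v_eq[OF hom_closed[OF \<sigma>_hom c']] .
  qed
  then have "resolved_by A P m g d l \<kappa> \<sigma>"
    unfolding resolved_by_def using g d \<kappa>K \<sigma>_hom by (simp add: Pi_iff)
  then show ?thesis unfolding resolved_def by blast
qed

end

section \<open>Square presentations and invertibility of Fitting ideals\<close>

context plain_cring
begin

text \<open>The multiples by \<open>d\<close> of the unit vectors are relations, hence the rows of a
  product of some matrix \<open>B\<close> with \<open>D\<close>. So \<open>d [^] m\<close> is a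
  multiple of \<open>det D\<close>, which makes \<open>det D\<close> a non-zero-divisor and the rows
  of \<open>D\<close> independent. Coordinates with respect to these rows are then unique and
  linear: they form the dual basis.\<close>

lemma square_presentation:
  assumes P: "lmod A P" and g: "generates A P m g" and d: "d \<in> non_zero_divisors A"
    and dg: "\<And>j. j < m \<Longrightarrow> d \<odot>\<^bsub>P\<^esub> g j = \<zero>\<^bsub>P\<^esub>" and D: "\<And>j. j < m \<Longrightarrow> D j \<in> rel A P m g"
    and sp: "\<And>x. x \<in> rel A P m g \<Longrightarrow> \<exists>c\<in>carrier (F m). x = lincomb (F m) m c D"
  shows "ring_det A m D \<in> non_zero_divisors A" "resolved A P" "Fitt A P = PIdl (ring_det A m D)"
    "presentation A P m g (D ` {..<m})"
proof -
  interpret P: lmod A P by (rule P)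
  interpret Fm: lmod A "F m" by (rule free_lmod)
  note gc = P.generatesD[OF g] and dc = nzd_closed[OF d]
  let ?K = "rel A P m g"
  have Ksub: "submodule ?K A (F m)" by (rule P.rel_submodule[OF gc])
  have Kc: "x \<in> carrier (F m)" if "x \<in> ?K" for x using that by (simp add: rel_def)
  have Dc: "D \<in> {..<m} \<rightarrow> carrier (F m)" by (rule funcsetI) (simp add: D Kc)
  have DK: "D \<in> {..<m} \<rightarrow> ?K" by (rule funcsetI) (simp add: D)
  have Dm: "mat_in m m D" by (intro allI impI F_closed[OF Kc[OF D]])
  let ?det = "ring_det A m D"
  have detc: "?det \<in> carrier A" by (rule ring_det_closed[OF Dm])
  have dK: "(\<lambda>s. d \<otimes> std_vec A j s) \<in> ?K" if j: "j < m" for j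
  proof -
    have "(\<lambda>s. d \<otimes> std_vec A j s) \<in> carrier (F m)" using Fm.smult_closed[OF dc std_vec_F[OF j]] by simp
    moreover have "lincomb P m (\<lambda>s. d \<otimes> std_vec A j s) g = \<zero>\<^bsub>P\<^esub>"
      using P.lincomb_smult[OF F_closed[OF std_vec_F[OF j]] dc gc] P.lincomb_std_vec[OF j gc] dg[OF j] by simp
    ultimately show ?thesis by (simp add: rel_def)
  qed
  have "\<forall>j. \<exists>c. j < m \<longrightarrow> c \<in> carrier (F m) \<and> (\<lambda>s. d \<otimes> std_vec A j s) = lincomb (F m) m c D"
  proof (rule allI, rule exists_if)
    fix j assume "j < m"
    from sp[OF dK[OF this]] show "\<exists>c. c \<in> carrier (F m) \<and> (\<lambda>s. d \<otimes> std_vec A j s) = lincomb (F m) m c D" by blast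
  qed
  then obtain B where B: "\<forall>j. j < m \<longrightarrow> B j \<in> carrier (F m) \<and> (\<lambda>s. d \<otimes> std_vec A j s) = lincomb (F m) m (B j) D"
    by (rule choice[THEN exE])
  have Bc: "B j \<in> carrier (F m)" if "j < m" for j using B that by simp
  have Bm: "mat_in m m B" by (intro allI impI F_closed[OF Bc])
  have "d [^] m = ring_det A m (\<lambda>i j. if i = j then d else \<zero>)" by (rule ring_det_diag[OF dc, symmetric])
  also have "\<dots> = ring_det A m (\<lambda>i j. \<Oplus>k\<in>{..<m}. B i k \<otimes> D k j)"
  proof (rule ring_det_cong)
    show "mat_in m m (\<lambda>i j. \<Oplus>k\<in>{..<m}. B i k \<otimes> D k j)"
      using Bm Dm by (auto intro!: finsum_closed)
    fix i j assume ij: "i < m" "j < m"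
    have "(\<Oplus>k\<in>{..<m}. B i k \<otimes> D k j) = lincomb (F m) m (B i) D j"
      by (rule lincomb_F_apply[OF F_closed[OF Bc[OF ij(1)]] Dc, symmetric])
    also have "\<dots> = d \<otimes> std_vec A i j" using B ij(1) by (simp add: fun_eq_iff)
    finally show "(if i = j then d else \<zero>) = (\<Oplus>k\<in>{..<m}. B i k \<otimes> D k j)"
      using dc by (simp add: std_vec_def)
  qed
  also have "\<dots> = ring_det A m B \<otimes> ?det" by (rule ring_det_mult[OF Bm Dm])
  finally have dm: "d [^] m = ring_det A m B \<otimes> ?det" .
  have detB: "ring_det A m B \<in> carrier A" by (rule ring_det_closed[OF Bm])
  show det_nzd: "?det \<in> non_zero_divisors A"
  proof -
    have "a = \<zero>" if a: "a \<in> carrier A" "?det \<otimes> a = \<zero>" for a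
    proof -
      have "d [^] m \<otimes> a = \<zero>" unfolding dm using a detc detB by (simp add: m_assoc)
      then show ?thesis using nzd_pow[OF d, of m] a(1) unfolding non_zero_divisors_def by blast
    qed
    then show ?thesis using detc unfolding non_zero_divisors_def by blast
  qed
  obtain adj where adj: "\<And>i j. adj i j \<in> carrier A"
    and adjD: "\<And>i k. i < m \<Longrightarrow> k < m \<Longrightarrow> (\<Oplus>j\<in>{..<m}. D i j \<otimes> adj j k) = (if i = k then ?det else \<zero>)"
    by (rule ring_det_adj[OF Dm]) (rule that)
  \<comment> \<open>The adjugate, cut off so that its rows lie in \<open>F m\<close>. Multiplying a
    vanishing combination of the rows of \<open>D\<close> by it shows that \<open>det D\<close>
    kills all coefficients.\<close>
  define ad where "ad j k = (if k < m then adj j k else \<zero>)" for j k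
  have adc: "ad \<in> {..<m} \<rightarrow> carrier (F m)" by (rule funcsetI) (simp add: ad_def F_carrier adj)
  have Dad: "lincomb (F m) m (D i) ad = (\<lambda>s. ?det \<otimes> std_vec A i s)" if i: "i < m" for i
  proof
    fix k
    have "lincomb (F m) m (D i) ad k = (\<Oplus>j\<in>{..<m}. D i j \<otimes> ad j k)"
      by (rule lincomb_F_apply[OF F_closed[OF Kc[OF D[OF i]]] adc])
    also have "\<dots> = ?det \<otimes> std_vec A i k"
    proof (cases "k < m")
      case True
      then show ?thesis using adjD[OF i True] detc by (simp add: ad_def std_vec_def)
    next
      case False
      have "(\<Oplus>j\<in>{..<m}. D i j \<otimes> ad j k) = (\<Oplus>j\<in>{..<m}. \<zero>)"
        by (rule finsum_cong') (use False F_closed[OF Kc[OF D[OF i]]] in \<open>auto simp: ad_def\<close>)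
      then show ?thesis using False i detc by (auto simp: std_vec_def)
    qed
    finally show "lincomb (F m) m (D i) ad k = ?det \<otimes> std_vec A i k" .
  qed
  have inj: "c = (\<lambda>_. \<zero>)" if c: "c \<in> carrier (F m)" and c0: "lincomb (F m) m c D = (\<lambda>_. \<zero>)" for c
  proof
    fix k
    note cc = F_closed[OF c]
    show "c k = \<zero>"
    proof (cases "k < m")
      case False then show ?thesis using c by (simp add: F_carrier)
    next
      case True
      have lhs: "lincomb (F m) m c (\<lambda>i. lincomb (F m) m (D i) ad) = (\<lambda>_. \<zero>)"
      proof -
        have "lincomb (F m) m c (\<lambda>i. lincomb (F m) m (D i) ad) = lincomb (F m) m (\<lambda>j. \<Oplus>i\<in>{..<m}. c i \<otimes> D i j) ad"
          by (rule Fm.lincomb_lincomb[OF cc Dm adc])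
        also have "(\<lambda>j. \<Oplus>i\<in>{..<m}. c i \<otimes> D i j) = (\<lambda>_. \<zero>)"
          using c0 lincomb_F_apply[OF cc Dc] by (simp add: fun_eq_iff)
        also have "lincomb (F m) m (\<lambda>_. \<zero>) ad = (\<lambda>_. \<zero>)" using Fm.lincomb_zero[OF adc refl] by simp
        finally show ?thesis .
      qed
      have sv: "(\<lambda>i s. ?det \<otimes> std_vec A i s) \<in> {..<m} \<rightarrow> carrier (F m)"
        using Fm.smult_closed[OF detc std_vec_F] by (intro funcsetI) simp
      have "lincomb (F m) m c (\<lambda>i. lincomb (F m) m (D i) ad) = lincomb (F m) m c (\<lambda>i s. ?det \<otimes> std_vec A i s)"
        by (rule Fm.lincomb_cong[OF cc sv refl Dad])
      then have "\<zero> = lincomb (F m) m c (\<lambda>i s. ?det \<otimes> std_vec A i s) k" unfolding lhs by (rule fun_cong)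
      also have "\<dots> = (\<Oplus>i\<in>{..<m}. c i \<otimes> (?det \<otimes> std_vec A i k))" by (rule lincomb_F_apply[OF cc sv])
      also have "\<dots> = (\<Oplus>i\<in>{..<m}. if k = i then ?det \<otimes> c i else \<zero>)"
        by (rule finsum_cong') (use cc detc in \<open>auto simp: std_vec_def m_comm\<close>)
      also have "\<dots> = ?det \<otimes> c k"
        using finsum_singleton[of k "{..<m}" "\<lambda>i. ?det \<otimes> c i"] True cc detc by auto
      finally have "?det \<otimes> c k = \<zero>" by simp
      then show ?thesis using det_nzd cc unfolding non_zero_divisors_def by blast
    qed
  qed
  have uniq: "c = e" if c: "c \<in> carrier (F m)" and e: "e \<in> carrier (F m)" and eq: "lincomb (F m) m c D = lincomb (F m) m e D" for c e
  proof -
    have ne: "(\<lambda>s. \<ominus> e s) \<in> carrier (F m)" using e by (simp add: F_carrier)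
    have d: "(\<lambda>s. c s \<oplus> \<ominus> e s) \<in> carrier (F m)" using Fm.M.a_closed[OF c ne] by simp
    have "lincomb (F m) m (\<lambda>s. c s \<oplus> \<ominus> e s) D = lincomb (F m) m c D \<oplus>\<^bsub>F m\<^esub> lincomb (F m) m (\<lambda>s. \<ominus> e s) D"
      by (rule Fm.lincomb_add[OF F_closed[OF c] F_closed[OF ne] Dc])
    also have "lincomb (F m) m (\<lambda>s. \<ominus> e s) D = \<ominus>\<^bsub>F m\<^esub> lincomb (F m) m e D"
      by (rule Fm.lincomb_neg[OF F_closed[OF e] Dc])
    also have "lincomb (F m) m c D \<oplus>\<^bsub>F m\<^esub> \<ominus>\<^bsub>F m\<^esub> lincomb (F m) m e D = \<zero>\<^bsub>F m\<^esub>"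
      unfolding eq by (rule Fm.M.r_neg[OF Fm.lincomb_closed[OF F_closed[OF e] Dc]])
    finally have "(\<lambda>s. c s \<oplus> \<ominus> e s) = (\<lambda>_. \<zero>)" by (intro inj[OF d]) simp
    then have z: "c s \<oplus> \<ominus> e s = \<zero>" for s by (rule fun_cong)
    show ?thesis
    proof
      fix s
      have "c s \<ominus> e s \<oplus> e s = e s" using z[of s] F_closed[OF e] by (simp add: minus_eq)
      then show "c s = e s" using F_closed[OF c] F_closed[OF e] by (simp add: minus_eq a_assoc l_neg)
    qed
  qed
  define \<sigma> where "\<sigma> x = (THE c. c \<in> carrier (F m) \<and> x = lincomb (F m) m c D)" for x
  have \<sigma>: "\<sigma> x \<in> carrier (F m) \<and> x = lincomb (F m) m (\<sigma> x) D" if "x \<in> ?K" for x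
  proof -
    have "\<exists>!c. c \<in> carrier (F m) \<and> x = lincomb (F m) m c D"
    proof (rule ex_ex1I)
      show "\<exists>c. c \<in> carrier (F m) \<and> x = lincomb (F m) m c D" using sp[OF that] by blast
      fix c e assume c: "c \<in> carrier (F m) \<and> x = lincomb (F m) m c D" and e: "e \<in> carrier (F m) \<and> x = lincomb (F m) m e D"
      show "c = e" by (rule uniq[OF conjunct1[OF c] conjunct1[OF e] trans[OF conjunct2[OF c, symmetric] conjunct2[OF e]]])
    qed
    from theI'[OF this] show ?thesis unfolding \<sigma>_def .
  qed
  have \<sigma>c: "\<sigma> x \<in> carrier (F m)" and \<sigma>l: "lincomb (F m) m (\<sigma> x) D = x" if "x \<in> ?K" for x
    using \<sigma>[OF that] by simp_all
  have \<sigma>_hom: "\<sigma> \<in> module_hom A ((F m)\<lparr>carrier := ?K\<rparr>) (F m)"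
    unfolding module_hom_def
  proof (intro CollectI conjI ballI funcsetI)
    fix x assume "x \<in> carrier ((F m)\<lparr>carrier := ?K\<rparr>)"
    then have x: "x \<in> ?K" by simp
    show "\<sigma> x \<in> carrier (F m)" by (rule \<sigma>c[OF x])
    note lh = lincomb_hom[OF free_lmod Dc]
    show "\<sigma> (a \<odot>\<^bsub>(F m)\<lparr>carrier := ?K\<rparr>\<^esub> x) = a \<odot>\<^bsub>F m\<^esub> \<sigma> x" if a: "a \<in> carrier A" for a
    proof -
      have ax: "a \<odot>\<^bsub>F m\<^esub> x \<in> ?K" using Ksub a x unfolding Fm.submodule_iff by blast
      have "lincomb (F m) m (\<sigma> (a \<odot>\<^bsub>F m\<^esub> x)) D = lincomb (F m) m (a \<odot>\<^bsub>F m\<^esub> \<sigma> x) D"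
        unfolding \<sigma>l[OF ax] hom_smult[OF lh a \<sigma>c[OF x]] \<sigma>l[OF x] ..
      then have "\<sigma> (a \<odot>\<^bsub>F m\<^esub> x) = a \<odot>\<^bsub>F m\<^esub> \<sigma> x" by (rule uniq[OF \<sigma>c[OF ax] Fm.smult_closed[OF a \<sigma>c[OF x]]])
      then show ?thesis by simp
    qed
    fix y assume "y \<in> carrier ((F m)\<lparr>carrier := ?K\<rparr>)"
    then have y: "y \<in> ?K" by simp
    have xy: "x \<oplus>\<^bsub>F m\<^esub> y \<in> ?K" using Ksub y x unfolding Fm.submodule_iff by blast
    have "lincomb (F m) m (\<sigma> (x \<oplus>\<^bsub>F m\<^esub> y)) D = lincomb (F m) m (\<sigma> x \<oplus>\<^bsub>F m\<^esub> \<sigma> y) D"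
      unfolding \<sigma>l[OF xy] hom_add[OF lh \<sigma>c[OF x] \<sigma>c[OF y]] \<sigma>l[OF x] \<sigma>l[OF y] ..
    then have "\<sigma> (x \<oplus>\<^bsub>F m\<^esub> y) = \<sigma> x \<oplus>\<^bsub>F m\<^esub> \<sigma> y" by (rule uniq[OF \<sigma>c[OF xy] Fm.M.a_closed[OF \<sigma>c[OF x] \<sigma>c[OF y]]])
    then show "\<sigma> (x \<oplus>\<^bsub>(F m)\<lparr>carrier := ?K\<rparr>\<^esub> y) = \<sigma> x \<oplus>\<^bsub>F m\<^esub> \<sigma> y" by simp
  qed
  have "resolved_by A P m g d m D \<sigma>"
    unfolding resolved_by_def using g d dg D \<sigma>_hom \<sigma>l by simp
  then show "resolved A P" unfolding resolved_def by blast
  let ?H = "D ` {..<m}"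
  have HK: "?H \<subseteq> ?K" using D by auto
  have HF: "?H \<subseteq> carrier (F m)" using D Kc by auto
  have "span A (F m) ?H = ?K"
  proof
    show "span A (F m) ?H \<subseteq> ?K" using HK by (simp only: Fm.span_subset_iff[OF Ksub])
    show "?K \<subseteq> span A (F m) ?H"
    proof
      fix x assume "x \<in> ?K"
      then obtain c where c: "c \<in> carrier (F m)" "x = lincomb (F m) m c D" using sp by blast
      have "D \<in> {..<m} \<rightarrow> span A (F m) ?H" by (intro funcsetI hull_inc) simp
      then show "x \<in> span A (F m) ?H"
        unfolding c(2) by (rule Fm.lincomb_in_submodule[OF Fm.span_submodule[OF HF] F_closed[OF c(1)]])
    qed
  qed
  then show pres: "presentation A P m g ?H" unfolding presentation_iff using g by simp
  have "minor_ideal A m ?H = PIdl ?det"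
  proof
    show "minor_ideal A m ?H \<subseteq> PIdl ?det"
    proof (rule minor_ideal_subset[OF cgenideal_ideal[OF detc]])
      fix C assume C: "\<And>i. i < m \<Longrightarrow> C i \<in> ?H"
      have "\<forall>i. \<exists>k. i < m \<longrightarrow> k < m \<and> C i = D k" using C by (auto simp: image_iff)
      then obtain f where f: "\<forall>i. i < m \<longrightarrow> f i < m \<and> C i = D (f i)" by (rule choice[THEN exE])
      have fm: "f i < m" if "i < m" for i using f that by simp
      obtain c where c: "c \<in> carrier A" "ring_det A m (\<lambda>i. D (f i)) = c \<otimes> ?det"
        by (rule ring_det_select_rows[OF Dm, of f]) (rule fm, assumption, rule that)
      have "mat_in m m (\<lambda>i. D (f i))" using Dm fm by auto
      then have "ring_det A m C = ring_det A m (\<lambda>i. D (f i))" by (rule ring_det_cong) (use f in simp)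
      then show "ring_det A m C \<in> PIdl ?det" using c unfolding cgenideal_def by auto
    qed
    have "?det \<in> minor_ideal A m ?H" by (rule minor_ideal_mem[OF HF]) simp
    then show "PIdl ?det \<subseteq> minor_ideal A m ?H" by (rule cgenideal_minimal[OF minor_ideal_ideal[OF HF]])
  qed
  then show "Fitt A P = PIdl ?det" unfolding P.Fitt_eq[OF pres] .
qed

lemma annihilator_generators:
  assumes P: "lmod A P" and g: "generates A P m g" and d: "d \<in> carrier A"
    and dg: "\<And>j. j < m \<Longrightarrow> d \<odot>\<^bsub>P\<^esub> g j = \<zero>\<^bsub>P\<^esub>" and x: "x \<in> carrier P"
  shows "d \<odot>\<^bsub>P\<^esub> x = \<zero>\<^bsub>P\<^esub>"
proof -
  interpret P: lmod A P by (rule P)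
  note gc = P.generatesD[OF g]
  have sub: "submodule {x \<in> carrier P. d \<odot>\<^bsub>P\<^esub> x = \<zero>\<^bsub>P\<^esub>} A P"
    unfolding P.submodule_iff
  proof (intro conjI ballI)
    fix x a assume x: "x \<in> {x \<in> carrier P. d \<odot>\<^bsub>P\<^esub> x = \<zero>\<^bsub>P\<^esub>}" and a: "a \<in> carrier A"
    have xc: "x \<in> carrier P" and dx: "d \<odot>\<^bsub>P\<^esub> x = \<zero>\<^bsub>P\<^esub>" using x by simp_all
    have "d \<odot>\<^bsub>P\<^esub> (a \<odot>\<^bsub>P\<^esub> x) = \<zero>\<^bsub>P\<^esub>"
      by (simp only: P.smult_assoc1[OF d a xc, symmetric] m_comm[OF d a] P.smult_assoc1[OF a d xc] dx P.smult_r_null[OF a])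
    then show "a \<odot>\<^bsub>P\<^esub> x \<in> {x \<in> carrier P. d \<odot>\<^bsub>P\<^esub> x = \<zero>\<^bsub>P\<^esub>}" using xc a by simp
  qed (use d in \<open>auto simp: P.smult_r_distr\<close>)
  obtain c where c: "c \<in> carrier (F m)" "x = lincomb P m c g" using g x unfolding generates_def by blast
  have "g \<in> {..<m} \<rightarrow> {x \<in> carrier P. d \<odot>\<^bsub>P\<^esub> x = \<zero>\<^bsub>P\<^esub>}" using gc dg by auto
  then have "x \<in> {x \<in> carrier P. d \<odot>\<^bsub>P\<^esub> x = \<zero>\<^bsub>P\<^esub>}"
    unfolding c(2) by (rule P.lincomb_in_submodule[OF sub F_closed[OF c(1)]])
  then show ?thesis by simp
qed

definition scaled :: "nat \<Rightarrow> 'a \<Rightarrow> (nat \<Rightarrow> 'a) set" where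
  "scaled m d = (\<lambda>c s. d \<otimes> c s) ` carrier (F m)"

text \<open>The \<open>m\<close>-th power of \<open>A / d A\<close>, written as a quotient of a free
  module so that its elements have the type prescribed by \<open>Fitt_shift\<close>. For a
  non-zero-divisor \<open>d\<close> it maps onto every module generated by \<open>m\<close> elements
  killed by \<open>d\<close> (\<open>tfq_onto\<close>).\<close>

definition torsion_free_quot :: "nat \<Rightarrow> 'a \<Rightarrow> ('a, (nat \<Rightarrow> 'a) set) module" where
  "torsion_free_quot m d = quotient_module (F m) (scaled m d)"

lemma scaled_submodule:
  assumes d: "d \<in> carrier A" shows "submodule (scaled m d) A (F m)"
proof -
  interpret Fm: lmod A "F m" by (rule free_lmod)
  have sc: "(\<lambda>s. d \<otimes> c s) = d \<odot>\<^bsub>F m\<^esub> c" for c by simp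
  show ?thesis
    unfolding Fm.submodule_iff scaled_def sc
  proof (intro conjI ballI)
    show "(\<lambda>c. d \<odot>\<^bsub>F m\<^esub> c) ` carrier (F m) \<subseteq> carrier (F m)" using Fm.smult_closed[OF d] by auto
    show "\<zero>\<^bsub>F m\<^esub> \<in> (\<lambda>c. d \<odot>\<^bsub>F m\<^esub> c) ` carrier (F m)"
      by (rule image_eqI[of _ _ "\<zero>\<^bsub>F m\<^esub>"]) (simp_all add: d F_carrier)
    fix x assume "x \<in> (\<lambda>c. d \<odot>\<^bsub>F m\<^esub> c) ` carrier (F m)"
    then obtain c where c: "c \<in> carrier (F m)" "x = d \<odot>\<^bsub>F m\<^esub> c" by blast
    show "a \<odot>\<^bsub>F m\<^esub> x \<in> (\<lambda>c. d \<odot>\<^bsub>F m\<^esub> c) ` carrier (F m)" if a: "a \<in> carrier A" for a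
    proof (rule image_eqI[OF _ Fm.smult_closed[OF a c(1)]])
      show "a \<odot>\<^bsub>F m\<^esub> x = d \<odot>\<^bsub>F m\<^esub> (a \<odot>\<^bsub>F m\<^esub> c)"
        unfolding c(2) using a d c(1) by (simp only: Fm.smult_assoc1[symmetric] m_comm)
    qed
    fix y assume "y \<in> (\<lambda>c. d \<odot>\<^bsub>F m\<^esub> c) ` carrier (F m)"
    then obtain e where e: "e \<in> carrier (F m)" "y = d \<odot>\<^bsub>F m\<^esub> e" by blast
    show "x \<oplus>\<^bsub>F m\<^esub> y \<in> (\<lambda>c. d \<odot>\<^bsub>F m\<^esub> c) ` carrier (F m)"
      by (rule image_eqI[OF _ Fm.M.a_closed[OF c(1) e(1)]]) (simp only: c(2) e(2) Fm.smult_r_distr[OF d c(1) e(1)])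
  qed
qed

context
  fixes m :: nat and d assumes d: "d \<in> non_zero_divisors A"
begin

interpretation Fm: lmod A "F m" by (rule free_lmod)

lemmas U = scaled_submodule[OF nzd_closed[OF d], of m]

definition quot_gen :: "nat \<Rightarrow> (nat \<Rightarrow> 'a) set" where
  "quot_gen j = scaled m d +>\<^bsub>F m\<^esub> std_vec A j"

lemma tfq_lmod: "lmod A (torsion_free_quot m d)"
  unfolding torsion_free_quot_def by (rule Fm.quotient_lmod[OF U])

lemma tfq_lincomb:
  assumes "c \<in> carrier (F m)"
  shows "lincomb (torsion_free_quot m d) m c quot_gen = scaled m d +>\<^bsub>F m\<^esub> c"
  unfolding quot_gen_def torsion_free_quot_def
  by (rule hom_F_eq[OF Fm.quotient_lmod[OF U] Fm.quot_hom[OF U] assms, symmetric])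

lemma quot_gen_carrier: "quot_gen \<in> {..<m} \<rightarrow> carrier (torsion_free_quot m d)"
  unfolding quot_gen_def torsion_free_quot_def
  by (rule funcsetI) (simp add: Fm.quot_coset[OF U] std_vec_F)

lemma tfq_generates: "generates A (torsion_free_quot m d) m quot_gen"
  unfolding generates_def
proof (intro conjI ballI quot_gen_carrier)
  fix X assume "X \<in> carrier (torsion_free_quot m d)"
  then obtain c where "c \<in> carrier (F m)" "X = scaled m d +>\<^bsub>F m\<^esub> c"
    unfolding torsion_free_quot_def Fm.quot_carrier[OF U] by blast
  then show "\<exists>c\<in>carrier (F m). X = lincomb (torsion_free_quot m d) m c quot_gen"
    using tfq_lincomb by auto
qed

lemma tfq_rel: "rel A (torsion_free_quot m d) m quot_gen = scaled m d"
proof (rule Set.set_eqI)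
  fix c
  show "c \<in> rel A (torsion_free_quot m d) m quot_gen \<longleftrightarrow> c \<in> scaled m d"
  proof (cases "c \<in> carrier (F m)")
    case True
    then show ?thesis
      using Fm.quot_zero_iff[OF U True] by (simp add: rel_def tfq_lincomb[OF True, unfolded torsion_free_quot_def] torsion_free_quot_def)
  next
    case False
    then have "c \<notin> scaled m d" using U unfolding Fm.submodule_iff by blast
    then show ?thesis using False by (simp add: rel_def)
  qed
qed

lemma tfq_annihilated: "j < m \<Longrightarrow> d \<odot>\<^bsub>torsion_free_quot m d\<^esub> quot_gen j = \<zero>\<^bsub>torsion_free_quot m d\<^esub>"
  unfolding quot_gen_def torsion_free_quot_def Fm.quot_smult[OF U nzd_closed[OF d] std_vec_F]
    Fm.quot_zero_iff[OF U Fm.smult_closed[OF nzd_closed[OF d] std_vec_F]]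
  by (simp add: scaled_def std_vec_F)

text \<open>The relations are the multiples by \<open>d\<close>, so the scalar matrix
  \<open>d\<close> is a square presentation.\<close>

lemma tfq_square:
  "ring_det A m (\<lambda>j s. d \<otimes> std_vec A j s) \<in> non_zero_divisors A" "resolved A (torsion_free_quot m d)"
  "Fitt A (torsion_free_quot m d) = PIdl (ring_det A m (\<lambda>j s. d \<otimes> std_vec A j s))"
  "presentation A (torsion_free_quot m d) m quot_gen ((\<lambda>j s. d \<otimes> std_vec A j s) ` {..<m})"
proof -
  have DK: "(\<lambda>s. d \<otimes> std_vec A j s) \<in> rel A (torsion_free_quot m d) m quot_gen" if "j < m" for j
    unfolding tfq_rel scaled_def using std_vec_F[OF that] by blast
  have sp: "\<exists>c\<in>carrier (F m). x = lincomb (F m) m c (\<lambda>j s. d \<otimes> std_vec A j s)"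
    if "x \<in> rel A (torsion_free_quot m d) m quot_gen" for x
  proof -
    obtain c where c: "c \<in> carrier (F m)" "x = d \<odot>\<^bsub>F m\<^esub> c" using \<open>x \<in> _\<close> unfolding tfq_rel scaled_def by auto
    have hom: "(\<lambda>c. d \<odot>\<^bsub>F m\<^esub> c) \<in> module_hom A (F m) (F m)"
      unfolding module_hom_def
    proof (intro CollectI conjI ballI funcsetI)
      fix c a assume "c \<in> carrier (F m)" "a \<in> carrier A"
      then show "d \<odot>\<^bsub>F m\<^esub> (a \<odot>\<^bsub>F m\<^esub> c) = a \<odot>\<^bsub>F m\<^esub> (d \<odot>\<^bsub>F m\<^esub> c)"
        using nzd_closed[OF d] by (simp only: Fm.smult_assoc1[symmetric] m_comm)
    qed (use nzd_closed[OF d] Fm.smult_closed Fm.smult_r_distr in \<open>simp_all del: free_simps\<close>)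
    have "x = lincomb (F m) m c (\<lambda>i. d \<odot>\<^bsub>F m\<^esub> std_vec A i)"
      unfolding c(2) by (rule hom_F_eq[OF free_lmod hom c(1)])
    then show ?thesis using c(1) by auto
  qed
  note sq = square_presentation[OF tfq_lmod tfq_generates d tfq_annihilated DK sp]
  show "ring_det A m (\<lambda>j s. d \<otimes> std_vec A j s) \<in> non_zero_divisors A" "resolved A (torsion_free_quot m d)"
    "Fitt A (torsion_free_quot m d) = PIdl (ring_det A m (\<lambda>j s. d \<otimes> std_vec A j s))"
    "presentation A (torsion_free_quot m d) m quot_gen ((\<lambda>j s. d \<otimes> std_vec A j s) ` {..<m})"
    by (rule sq; assumption)+
qed

lemma tfq_onto:
  assumes P: "lmod A P" and g: "generates A P m g" and dg: "\<And>j. j < m \<Longrightarrow> d \<odot>\<^bsub>P\<^esub> g j = \<zero>\<^bsub>P\<^esub>"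
  obtains h where "h \<in> module_hom A (torsion_free_quot m d) P" "h ` carrier (torsion_free_quot m d) = carrier P"
proof -
  interpret P: lmod A P by (rule P)
  note gc = P.generatesD[OF g] and dc = nzd_closed[OF d]
  note lh = lincomb_hom[OF P gc]
  have ker: "lincomb P m x g = \<zero>\<^bsub>P\<^esub>" if x: "x \<in> scaled m d" for x
  proof -
    obtain c where c: "c \<in> carrier (F m)" "x = d \<odot>\<^bsub>F m\<^esub> c" using x unfolding scaled_def by auto
    show ?thesis unfolding c(2) hom_smult[OF lh dc c(1)]
      by (rule annihilator_generators[OF P g dc dg hom_closed[OF lh c(1)]])
  qed
  obtain h where h: "h \<in> module_hom A (quotient_module (F m) (scaled m d)) P"
    and hc: "\<And>x. x \<in> carrier (F m) \<Longrightarrow> h (scaled m d +>\<^bsub>F m\<^esub> x) = lincomb P m x g"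
    by (rule Fm.quot_induced[OF U P lh ker]) (assumption, rule that)
  have "h ` carrier (quotient_module (F m) (scaled m d)) = carrier P"
  proof
    show "h ` carrier (quotient_module (F m) (scaled m d)) \<subseteq> carrier P" using hom_closed[OF h] by blast
    show "carrier P \<subseteq> h ` carrier (quotient_module (F m) (scaled m d))"
    proof
      fix x assume "x \<in> carrier P"
      then obtain c where c: "c \<in> carrier (F m)" "x = lincomb P m c g" using g unfolding generates_def by blast
      show "x \<in> h ` carrier (quotient_module (F m) (scaled m d))"
        by (rule image_eqI[OF _ Fm.quot_coset[OF U c(1)]]) (simp add: hc[OF c(1)] c(2))
    qed
  qed
  with h show thesis using that unfolding torsion_free_quot_def by blast
qed

end

text \<open>A power of \<open>A / d A\<close> maps onto \<open>P\<close>. The product formula for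
  this map writes a principal ideal generated by a non-zero-divisor as the Fitting ideal of the
  kernel times that of \<open>P\<close>.\<close>

lemma Fitt_invertible:
  assumes P: "lmod A P" and res: "resolved A P" and fp: "finitely_presented A P"
  shows "\<exists>J e. ideal J A \<and> e \<in> non_zero_divisors A \<and> ideal_prod A J (Fitt A P) = PIdl e"
proof -
  from res obtain m g d l \<kappa> \<sigma> where r: "resolved_by A P m g d l \<kappa> \<sigma>" unfolding resolved_def by (elim exE) (rule that)
  then have g: "generates A P m g" and d: "d \<in> non_zero_divisors A" and dg: "\<And>j. j < m \<Longrightarrow> d \<odot>\<^bsub>P\<^esub> g j = \<zero>\<^bsub>P\<^esub>"
    unfolding resolved_by_def by simp_all
  let ?T = "torsion_free_quot m d"
  obtain h where h: "h \<in> module_hom A ?T P" "h ` carrier ?T = carrier P"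
    by (rule tfq_onto[OF d P g dg]) (assumption, rule that)
  note ex = kernel_short_exact[OF tfq_lmod[OF d] P h]
  obtain k z where N: "generates A (?T\<lparr>carrier := {x \<in> carrier ?T. h x = \<zero>\<^bsub>P\<^esub>}\<rparr>) k z"
    using kernel_finitely_generated[OF ex tfq_generates[OF d] fp] by blast
  have "Fitt A ?T = ideal_prod A (Fitt A (?T\<lparr>carrier := {x \<in> carrier ?T. h x = \<zero>\<^bsub>P\<^esub>}\<rparr>)) (Fitt A P)"
    using Fitt_short_exact[OF ex N res] by (rule conjunct1)
  moreover have "ideal (Fitt A (?T\<lparr>carrier := {x \<in> carrier ?T. h x = \<zero>\<^bsub>P\<^esub>}\<rparr>)) A"
    by (rule lmod.Fitt_ideal[OF short_exactD(1)[OF ex] N])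
  ultimately show ?thesis using tfq_square(1,3)[OF d, of m] by (intro exI conjI) (assumption | simp)+
qed

end

section \<open>Fibre products, and modules of prescribed carrier type\<close>

definition fibre_module ::
  "('a, 'p) module \<Rightarrow> ('a, 'q) module \<Rightarrow> ('p \<Rightarrow> 'm) \<Rightarrow> ('q \<Rightarrow> 'm) \<Rightarrow> ('a, 'p \<times> 'q) module" where
  "fibre_module P P' p p' =
     \<lparr>carrier = {(x, y). x \<in> carrier P \<and> y \<in> carrier P' \<and> p x = p' y}, monoid.mult = undefined, one = undefined,
      zero = (\<zero>\<^bsub>P\<^esub>, \<zero>\<^bsub>P'\<^esub>), add = (\<lambda>x y. (fst x \<oplus>\<^bsub>P\<^esub> fst y, snd x \<oplus>\<^bsub>P'\<^esub> snd y)),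
      module.smult = (\<lambda>a x. (a \<odot>\<^bsub>P\<^esub> fst x, a \<odot>\<^bsub>P'\<^esub> snd x))\<rparr>"

context plain_cring
begin

lemma fibre_lmod:
  assumes P: "lmod A P" and P': "lmod A P'" and M: "lmod A M" and p: "p \<in> module_hom A P M" and p': "p' \<in> module_hom A P' M"
  shows "lmod A (fibre_module P P' p p')"
proof -
  interpret P: lmod A P by (rule P)
  interpret P': lmod A P' by (rule P')
  show ?thesis
  proof (rule lmod_moduleI)
    fix x assume x: "x \<in> carrier (fibre_module P P' p p')"
    have "(\<ominus>\<^bsub>P\<^esub> fst x, \<ominus>\<^bsub>P'\<^esub> snd x) \<in> carrier (fibre_module P P' p p')"
      using x by (auto simp: fibre_module_def hom_neg[OF P M p] hom_neg[OF P' M p'])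
    then show "\<exists>y\<in>carrier (fibre_module P P' p p'). y \<oplus>\<^bsub>fibre_module P P' p p'\<^esub> x = \<zero>\<^bsub>fibre_module P P' p p'\<^esub>"
      using x by (intro bexI[of _ "(\<ominus>\<^bsub>P\<^esub> fst x, \<ominus>\<^bsub>P'\<^esub> snd x)"]) (auto simp: fibre_module_def P.M.l_neg P'.M.l_neg)
  qed (auto simp: fibre_module_def is_cring hom_add[OF p] hom_add[OF p'] hom_smult[OF p] hom_smult[OF p']
      hom_zero[OF P M p] hom_zero[OF P' M p'] P.M.a_assoc P'.M.a_assoc P.M.a_lcomm P'.M.a_lcomm P.M.a_comm P'.M.a_comm
      P.smult_l_distr P'.smult_l_distr P.smult_r_distr P'.smult_r_distr P.smult_assoc1 P'.smult_assoc1)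
qed

text \<open>A pair with second component zero is an element of \<open>P\<close> killed by
  \<open>p\<close>, hence comes from \<open>N\<close>; the projection is onto because
  \<open>p\<close> is. The second sequence is the mirror image.\<close>

lemma fibre_short_exact:
  assumes ex: "short_exact A N P M i p" and ex': "short_exact A N' P' M i' p'"
  shows "short_exact A N (fibre_module P P' p p') P' (\<lambda>n. (i n, \<zero>\<^bsub>P'\<^esub>)) snd"
    and "short_exact A N' (fibre_module P P' p p') P (\<lambda>n. (\<zero>\<^bsub>P\<^esub>, i' n)) fst"
proof -
  note e = short_exactD[OF ex] and e' = short_exactD[OF ex']
  interpret P: lmod A P by (rule e(2))
  interpret P': lmod A P' by (rule e'(2))
  have Q: "lmod A (fibre_module P P' p p')" by (rule fibre_lmod[OF e(2) e'(2) e(3) e(5) e'(5)])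
  have p0: "p \<zero>\<^bsub>P\<^esub> = \<zero>\<^bsub>M\<^esub>" "p' \<zero>\<^bsub>P'\<^esub> = \<zero>\<^bsub>M\<^esub>" using hom_zero[OF e(2,3,5)] hom_zero[OF e'(2,3,5)] by simp_all
  have i0: "p (i z) = \<zero>\<^bsub>M\<^esub>" "i z \<in> carrier P" if "z \<in> carrier N" for z using e(8) imageI[OF that, of i] by auto
  have i0': "p' (i' z) = \<zero>\<^bsub>M\<^esub>" "i' z \<in> carrier P'" if "z \<in> carrier N'" for z using e'(8) imageI[OF that, of i'] by auto
  have ker: "x \<in> i ` carrier N" if "x \<in> carrier P" "p x = \<zero>\<^bsub>M\<^esub>" for x unfolding e(8) using that by simp
  have ker': "x \<in> i' ` carrier N'" if "x \<in> carrier P'" "p' x = \<zero>\<^bsub>M\<^esub>" for x unfolding e'(8) using that by simp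
  have sur: "\<exists>x\<in>carrier P. p x = p' y" if "y \<in> carrier P'" for y
  proof -
    have "p' y \<in> p ` carrier P" unfolding e(7) using hom_closed[OF e'(5) that] .
    then show ?thesis by auto
  qed
  have sur': "\<exists>y\<in>carrier P'. p x = p' y" if "x \<in> carrier P" for x
  proof -
    have "p x \<in> p' ` carrier P'" unfolding e'(7) using hom_closed[OF e(5) that] .
    then show ?thesis by auto
  qed
  show "short_exact A N (fibre_module P P' p p') P' (\<lambda>n. (i n, \<zero>\<^bsub>P'\<^esub>)) snd"
    unfolding short_exact_def
  proof (intro conjI)
    show "Module.module A N" "Module.module A (fibre_module P P' p p')" "Module.module A P'"
      using e(1) Q e'(2) by (simp_all add: lmod_def)
    show "(\<lambda>n. (i n, \<zero>\<^bsub>P'\<^esub>)) \<in> module_hom A N (fibre_module P P' p p')"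
      unfolding module_hom_def by (auto simp: fibre_module_def i0 p0 hom_add[OF e(4)] hom_smult[OF e(4)])
    show "snd \<in> module_hom A (fibre_module P P' p p') P'"
      unfolding module_hom_def by (auto simp: fibre_module_def)
    show "inj_on (\<lambda>n. (i n, \<zero>\<^bsub>P'\<^esub>)) (carrier N)" using e(6) by (auto simp: inj_on_def)
    show "snd ` carrier (fibre_module P P' p p') = carrier P'"
      using sur by (force simp: fibre_module_def image_iff)
    show "(\<lambda>n. (i n, \<zero>\<^bsub>P'\<^esub>)) ` carrier N = {x \<in> carrier (fibre_module P P' p p'). snd x = \<zero>\<^bsub>P'\<^esub>}"
    proof (intro equalityI subsetI)
      fix x assume x: "x \<in> {x \<in> carrier (fibre_module P P' p p'). snd x = \<zero>\<^bsub>P'\<^esub>}"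
      then have "fst x \<in> carrier P" "p (fst x) = \<zero>\<^bsub>M\<^esub>" "x = (fst x, \<zero>\<^bsub>P'\<^esub>)"
        using p0 by (auto simp: fibre_module_def)
      moreover obtain n where "n \<in> carrier N" "fst x = i n" using ker[OF calculation(1,2)] by blast
      ultimately show "x \<in> (\<lambda>n. (i n, \<zero>\<^bsub>P'\<^esub>)) ` carrier N" by (intro image_eqI[of _ _ n]) simp_all
    qed (use i0 p0 in \<open>auto simp: fibre_module_def\<close>)
  qed
  show "short_exact A N' (fibre_module P P' p p') P (\<lambda>n. (\<zero>\<^bsub>P\<^esub>, i' n)) fst"
    unfolding short_exact_def
  proof (intro conjI)
    show "Module.module A N'" "Module.module A (fibre_module P P' p p')" "Module.module A P"
      using e'(1) Q e(2) by (simp_all add: lmod_def)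
    show "(\<lambda>n. (\<zero>\<^bsub>P\<^esub>, i' n)) \<in> module_hom A N' (fibre_module P P' p p')"
      unfolding module_hom_def by (auto simp: fibre_module_def i0' p0 hom_add[OF e'(4)] hom_smult[OF e'(4)])
    show "fst \<in> module_hom A (fibre_module P P' p p') P"
      unfolding module_hom_def by (auto simp: fibre_module_def)
    show "inj_on (\<lambda>n. (\<zero>\<^bsub>P\<^esub>, i' n)) (carrier N')" using e'(6) by (auto simp: inj_on_def)
    show "fst ` carrier (fibre_module P P' p p') = carrier P"
      using sur' by (force simp: fibre_module_def image_iff)
    show "(\<lambda>n. (\<zero>\<^bsub>P\<^esub>, i' n)) ` carrier N' = {x \<in> carrier (fibre_module P P' p p'). fst x = \<zero>\<^bsub>P\<^esub>}"
    proof (intro equalityI subsetI)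
      fix x assume x: "x \<in> {x \<in> carrier (fibre_module P P' p p'). fst x = \<zero>\<^bsub>P\<^esub>}"
      then have "snd x \<in> carrier P'" "p' (snd x) = \<zero>\<^bsub>M\<^esub>" "x = (\<zero>\<^bsub>P\<^esub>, snd x)"
        using p0 by (auto simp: fibre_module_def)
      moreover obtain n where "n \<in> carrier N'" "snd x = i' n" using ker'[OF calculation(1,2)] by blast
      ultimately show "x \<in> (\<lambda>n. (\<zero>\<^bsub>P\<^esub>, i' n)) ` carrier N'" by (intro image_eqI[of _ _ n]) simp_all
    qed (use i0' p0 in \<open>auto simp: fibre_module_def\<close>)
  qed
qed

text \<open>The fibre product is the middle term of two sequences, and both compute its Fitting
  ideal. This is the independence of the shift with denominators cleared.\<close>

lemma Fitt_cross:
  assumes ex: "short_exact A N P M i p" and ex': "short_exact A N' P' M i' p'"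
    and "resolved A P" "resolved A P'" and N: "generates A N n g" and N': "generates A N' n' g'"
  shows "ideal_prod A (Fitt A N) (Fitt A P') = ideal_prod A (Fitt A N') (Fitt A P)"
proof -
  note fs = fibre_short_exact[OF ex ex']
  have "Fitt A (fibre_module P P' p p') = ideal_prod A (Fitt A N) (Fitt A P')"
    using Fitt_short_exact[OF fs(1) N assms(4)] by (rule conjunct1)
  moreover have "Fitt A (fibre_module P P' p p') = ideal_prod A (Fitt A N') (Fitt A P)"
    using Fitt_short_exact[OF fs(2) N' assms(3)] by (rule conjunct1)
  ultimately show ?thesis by simp
qed

text \<open>Projectivity and projective dimension are defined with index sets of a prescribed type;
  these mutually inverse maps transport free modules to such index sets.\<close>

lemma reindex_homs:
  assumes E: "inj_on E S"
  shows "(\<lambda>f s. if s \<in> S then f (E s) else \<zero>) \<in> module_hom A (free_module A (E ` S)) (free_module A S)"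
    and "(\<lambda>f t. if t \<in> E ` S then f (inv_into S E t) else \<zero>) \<in> module_hom A (free_module A S) (free_module A (E ` S))"
    and "\<And>f. f \<in> carrier (free_module A S) \<Longrightarrow>
      (\<lambda>s. if s \<in> S then (if E s \<in> E ` S then f (inv_into S E (E s)) else \<zero>) else \<zero>) = f"
    and "\<And>f. f \<in> carrier (free_module A (E ` S)) \<Longrightarrow>
      (\<lambda>t. if t \<in> E ` S then (if inv_into S E t \<in> S then f (E (inv_into S E t)) else \<zero>) else \<zero>) = f"
proof -
  have "(\<lambda>s. if s \<in> S then f (E s) else \<zero>) \<in> carrier (free_module A S)" if f: "f \<in> carrier (free_module A (E ` S))" for f
  proof -
    have fin: "finite {t. f t \<noteq> \<zero>}" using f by (simp only: free_carrier)
    have "{s. (if s \<in> S then f (E s) else \<zero>) \<noteq> \<zero>} = {s \<in> S. f (E s) \<noteq> \<zero>}" by auto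
    moreover have "finite {s \<in> S. f (E s) \<noteq> \<zero>}"
    proof (rule inj_on_finite[OF _ _ fin])
      show "inj_on E {s \<in> S. f (E s) \<noteq> \<zero>}" by (rule inj_on_subset[OF E]) auto
    qed auto
    ultimately show ?thesis using f by (simp add: free_carrier)
  qed
  then show "(\<lambda>f s. if s \<in> S then f (E s) else \<zero>) \<in> module_hom A (free_module A (E ` S)) (free_module A S)"
    unfolding module_hom_def by auto
  have "(\<lambda>t. if t \<in> E ` S then f (inv_into S E t) else \<zero>) \<in> carrier (free_module A (E ` S))" if f: "f \<in> carrier (free_module A S)" for f
  proof -
    have fin: "finite {t. f t \<noteq> \<zero>}" using f by (simp only: free_carrier)
    have "{t. (if t \<in> E ` S then f (inv_into S E t) else \<zero>) \<noteq> \<zero>} \<subseteq> E ` {s. f s \<noteq> \<zero>}"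
    proof
      fix t assume "t \<in> {t. (if t \<in> E ` S then f (inv_into S E t) else \<zero>) \<noteq> \<zero>}"
      then have "t \<in> E ` S" "f (inv_into S E t) \<noteq> \<zero>" by (auto split: if_splits)
      then show "t \<in> E ` {s. f s \<noteq> \<zero>}" by (intro image_eqI[of _ _ "inv_into S E t"]) (simp_all add: f_inv_into_f)
    qed
    then have "finite {t. (if t \<in> E ` S then f (inv_into S E t) else \<zero>) \<noteq> \<zero>}"
      using fin by (rule finite_subset[OF _ finite_imageI])
    then show ?thesis using f by (simp add: free_carrier)
  qed
  then show "(\<lambda>f t. if t \<in> E ` S then f (inv_into S E t) else \<zero>) \<in> module_hom A (free_module A S) (free_module A (E ` S))"
    unfolding module_hom_def by auto
  show "(\<lambda>s. if s \<in> S then (if E s \<in> E ` S then f (inv_into S E (E s)) else \<zero>) else \<zero>) = f"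
    if f: "f \<in> carrier (free_module A S)" for f
    using f by (auto simp: fun_eq_iff free_carrier inv_into_f_f[OF E])
  show "(\<lambda>t. if t \<in> E ` S then (if inv_into S E t \<in> S then f (E (inv_into S E t)) else \<zero>) else \<zero>) = f"
    if f: "f \<in> carrier (free_module A (E ` S))" for f
  proof
    fix t
    show "(if t \<in> E ` S then (if inv_into S E t \<in> S then f (E (inv_into S E t)) else \<zero>) else \<zero>) = f t"
      using f inv_into_into[of t E S] f_inv_into_f[of t E S] by (simp add: free_carrier)
  qed
qed

text \<open>The definition of projectivity asks for a basis indexed by elements of the carrier type,
  here functions into the ring type. Two distinct values of that type encode an index
  \<open>s\<close> as the function that singles out \<open>s\<close>.\<close>

lemma projective_free:
  fixes S :: "'s set"
  assumes ab: "(a0 :: 'a) \<noteq> b0"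
  shows "projective_module A (free_module A S)"
proof -
  define E where "E s = (\<lambda>t :: 's. if t = s then a0 else b0)" for s
  have E: "inj_on E S"
  proof (rule inj_onI)
    fix x y assume "E x = E y"
    then have "E x x = E y x" by simp
    then show "x = y" using ab by (auto simp: E_def split: if_splits)
  qed
  note r = reindex_homs[OF E]
  show ?thesis unfolding projective_module_def
    using lmodD[OF free_lmod] r(2) r(1) r(3) by blast
qed

text \<open>Multiplication by \<open>d\<close> on a free module of rank \<open>m\<close> is a free
  resolution of length one. Its basis has to be indexed by sets of functions, which the singletons
  \<open>J i\<close> provide.\<close>

lemma class_P_tfq:
  assumes d: "d \<in> non_zero_divisors A" and ab: "(a0 :: 'a) \<noteq> b0"
  shows "class_P A (torsion_free_quot m d)"
  unfolding class_P_def
proof (intro conjI)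
  let ?T = "torsion_free_quot m d"
  note dc = nzd_closed[OF d]
  interpret T: lmod A ?T by (rule tfq_lmod[OF d])
  interpret Fm: lmod A "F m" by (rule free_lmod)
  note U = scaled_submodule[OF dc, of m]
  show "finitely_presented A ?T"
    unfolding finitely_presented_def using lmodD[OF tfq_lmod[OF d]] tfq_square(4)[OF d, of m] by blast
  show "torsion_module A ?T"
    unfolding torsion_module_def
    using lmodD[OF tfq_lmod[OF d]] annihilator_generators[OF tfq_lmod[OF d] tfq_generates[OF d] dc tfq_annihilated[OF d]] d by blast
  define J where "J i = {\<lambda>k :: nat. if k = i then a0 else b0}" for i :: nat
  have J: "inj_on J {..<m}"
  proof (rule inj_onI)
    fix x y assume "J x = J y"
    then have "(\<lambda>k. if k = x then a0 else b0) = (\<lambda>k. if k = y then a0 else b0)"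
      unfolding J_def by (rule singleton_inject)
    from fun_cong[OF this, of x] show "x = y" using ab by (simp split: if_splits)
  qed
  let ?S = "J ` {..<m}"
  define \<rho> where "\<rho> = (\<lambda>f s. if s \<in> {..<m} then f (J s) else \<zero>)"
  define \<rho>' where "\<rho>' = (\<lambda>f t. if t \<in> ?S then f (inv_into {..<m} J t) else \<zero>)"
  note r = reindex_homs[OF J]
  have r1: "\<rho> \<in> module_hom A (free_module A ?S) (F m)" unfolding \<rho>_def by (rule r(1))
  have r2: "\<rho>' \<in> module_hom A (F m) (free_module A ?S)" unfolding \<rho>'_def by (rule r(2))
  interpret FS: lmod A "free_module A ?S" by (rule free_lmod)
  have rr: "\<rho> (\<rho>' c) = c" if "c \<in> carrier (F m)" for c unfolding \<rho>_def \<rho>'_def by (rule r(3)[OF that])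
  have rr': "\<rho>' (\<rho> f) = f" if "f \<in> carrier (free_module A ?S)" for f unfolding \<rho>_def \<rho>'_def by (rule r(4)[OF that])
  let ?i = "\<lambda>f. d \<odot>\<^bsub>free_module A ?S\<^esub> f"
  let ?p = "\<lambda>f. scaled m d +>\<^bsub>F m\<^esub> \<rho> f"
  have p: "?p \<in> module_hom A (free_module A ?S) ?T"
    unfolding torsion_free_quot_def by (rule hom_comp[OF r1 Fm.quot_hom[OF U]])
  have i: "?i \<in> module_hom A (free_module A ?S) (free_module A ?S)"
    unfolding module_hom_def
  proof (intro CollectI conjI ballI funcsetI)
    fix c a assume "c \<in> carrier (free_module A ?S)" "a \<in> carrier A"
    then show "?i (a \<odot>\<^bsub>free_module A ?S\<^esub> c) = a \<odot>\<^bsub>free_module A ?S\<^esub> (?i c)"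
      using dc by (simp only: FS.smult_assoc1[symmetric] m_comm)
  qed (use dc FS.smult_closed FS.smult_r_distr in \<open>simp_all del: free_simps\<close>)
  have "short_exact A (free_module A ?S) (free_module A ?S) ?T ?i ?p"
    unfolding short_exact_def
  proof (intro conjI lmodD[OF free_lmod] lmodD[OF tfq_lmod[OF d]] i p)
    show "inj_on ?i (carrier (free_module A ?S))"
    proof (rule inj_onI)
      fix f f' assume f: "f \<in> carrier (free_module A ?S)" "f' \<in> carrier (free_module A ?S)" "?i f = ?i f'"
      have "d \<otimes> f s = d \<otimes> f' s" for s using f(3) by (simp add: fun_eq_iff)
      then have "f s = f' s" for s
        using nzd_cancel[OF d, of "f s" "f' s"] f(1,2) by (simp add: free_carrier)
      then show "f = f'" by auto
    qed
    show "?p ` carrier (free_module A ?S) = carrier ?T"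
    proof
      show "?p ` carrier (free_module A ?S) \<subseteq> carrier ?T" using hom_closed[OF p] by blast
      show "carrier ?T \<subseteq> ?p ` carrier (free_module A ?S)"
      proof
        fix X assume "X \<in> carrier ?T"
        then obtain c where c: "c \<in> carrier (F m)" "X = scaled m d +>\<^bsub>F m\<^esub> c"
          unfolding torsion_free_quot_def Fm.quot_carrier[OF U] by blast
        show "X \<in> ?p ` carrier (free_module A ?S)"
          by (rule image_eqI[OF _ hom_closed[OF r2 c(1)]]) (simp only: rr[OF c(1)] c(2))
      qed
    qed
    show "?i ` carrier (free_module A ?S) = {x \<in> carrier (free_module A ?S). ?p x = \<zero>\<^bsub>?T\<^esub>}"
    proof
      show "?i ` carrier (free_module A ?S) \<subseteq> {x \<in> carrier (free_module A ?S). ?p x = \<zero>\<^bsub>?T\<^esub>}"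
      proof
        fix x assume "x \<in> ?i ` carrier (free_module A ?S)"
        then obtain f where f: "f \<in> carrier (free_module A ?S)" "x = ?i f" by blast
        have "\<rho> x = d \<odot>\<^bsub>F m\<^esub> \<rho> f" unfolding f(2) by (rule hom_smult[OF r1 dc f(1)])
        then have "\<rho> x \<in> scaled m d" unfolding scaled_def using hom_closed[OF r1 f(1)] by auto
        moreover have x: "x \<in> carrier (free_module A ?S)" unfolding f(2) by (rule FS.smult_closed[OF dc f(1)])
        ultimately show "x \<in> {x \<in> carrier (free_module A ?S). ?p x = \<zero>\<^bsub>?T\<^esub>}"
          using Fm.quot_zero_iff[OF U hom_closed[OF r1 x]] by (simp only: torsion_free_quot_def mem_Collect_eq)
      qed
      show "{x \<in> carrier (free_module A ?S). ?p x = \<zero>\<^bsub>?T\<^esub>} \<subseteq> ?i ` carrier (free_module A ?S)"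
      proof
        fix x assume "x \<in> {x \<in> carrier (free_module A ?S). ?p x = \<zero>\<^bsub>?T\<^esub>}"
        then have x: "x \<in> carrier (free_module A ?S)" and px: "?p x = \<zero>\<^bsub>?T\<^esub>" by simp_all
        have "\<rho> x \<in> scaled m d"
          using px Fm.quot_zero_iff[OF U hom_closed[OF r1 x]] by (simp only: torsion_free_quot_def)
        then obtain c where c: "c \<in> carrier (F m)" "\<rho> x = d \<odot>\<^bsub>F m\<^esub> c" unfolding scaled_def by auto
        have "x = \<rho>' (\<rho> x)" by (rule rr'[OF x, symmetric])
        also have "\<dots> = ?i (\<rho>' c)" by (simp only: c(2) hom_smult[OF r2 dc c(1)])
        finally have xe: "x = ?i (\<rho>' c)" .
        show "x \<in> ?i ` carrier (free_module A ?S)"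
          unfolding xe by (rule imageI[OF hom_closed[OF r2 c(1)]])
      qed
    qed
  qed
  then show "proj_dim_le_1 A ?T"
    unfolding proj_dim_le_1_def using projective_free[OF ab] by blast
qed

end

section \<open>Fractional ideals and the shifted Fitting ideal\<close>

context plain_cring
begin

abbreviation "nzd \<equiv> non_zero_divisors A"

lemma fraction_mem: "(b, t) \<in> fraction A a s \<longleftrightarrow> b \<in> carrier A \<and> t \<in> nzd \<and> a \<otimes> t = b \<otimes> s"
  by (simp add: fraction_def)

lemma fraction_self: "a \<in> carrier A \<Longrightarrow> s \<in> nzd \<Longrightarrow> (a, s) \<in> fraction A a s"
  by (simp add: fraction_mem)

text \<open>Transitivity of the equality of fractions: the two sides agree after multiplication by
  \<open>s\<close>, which cancels.\<close>

lemma fraction_subset: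
  assumes "a \<in> carrier A" "b \<in> carrier A" "s \<in> nzd" "t \<in> nzd" "a \<otimes> t = b \<otimes> s"
  shows "fraction A a s \<subseteq> fraction A b t"
proof (rule subrelI)
  fix c u assume "(c, u) \<in> fraction A a s"
  then have c: "c \<in> carrier A" "u \<in> nzd" "a \<otimes> u = c \<otimes> s" by (simp_all add: fraction_mem)
  note cl = assms(1,2) c(1) nzd_closed[OF assms(3)] nzd_closed[OF assms(4)] nzd_closed[OF c(2)]
  have "s \<otimes> (b \<otimes> u) = (b \<otimes> s) \<otimes> u" using cl by (simp add: m_ac)
  also have "\<dots> = (a \<otimes> u) \<otimes> t" unfolding assms(5)[symmetric] using cl by (simp add: m_ac)
  also have "\<dots> = s \<otimes> (c \<otimes> t)" unfolding c(3) using cl by (simp add: m_ac)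
  finally have eq: "s \<otimes> (b \<otimes> u) = s \<otimes> (c \<otimes> t)" .
  have "b \<otimes> u = c \<otimes> t" by (rule nzd_cancel[OF assms(3) _ _ eq]) (use cl in auto)
  then show "(c, u) \<in> fraction A b t" using c by (simp add: fraction_mem)
qed

lemma fraction_eq_iff:
  assumes "a \<in> carrier A" "b \<in> carrier A" "s \<in> nzd" "t \<in> nzd"
  shows "fraction A a s = fraction A b t \<longleftrightarrow> a \<otimes> t = b \<otimes> s"
proof
  assume "fraction A a s = fraction A b t"
  then have "(a, s) \<in> fraction A b t" using fraction_self[OF assms(1,3)] by simp
  then show "a \<otimes> t = b \<otimes> s" by (simp add: fraction_mem)
next
  assume "a \<otimes> t = b \<otimes> s"
  then show "fraction A a s = fraction A b t"
    using fraction_subset[OF assms(1,2,3,4)] fraction_subset[OF assms(2,1,4,3)] by simp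
qed

lemma Frac_carrier: "x \<in> carrier (Frac A) \<longleftrightarrow> (\<exists>a s. a \<in> carrier A \<and> s \<in> nzd \<and> x = fraction A a s)"
  by (auto simp: Frac_def)

lemma Frac_carrierI: "a \<in> carrier A \<Longrightarrow> s \<in> nzd \<Longrightarrow> fraction A a s \<in> carrier (Frac A)"
  by (auto simp: Frac_carrier)

text \<open>The operations of \<open>Frac\<close> are unions over all representatives. Independence
  of the representatives makes the family constant and collapses the union.\<close>

lemma Frac_binop:
  assumes x: "a \<in> carrier A" "s \<in> nzd" and y: "b \<in> carrier A" "t \<in> nzd"
    and const: "\<And>a' s' b' t'. a' \<in> carrier A \<Longrightarrow> s' \<in> nzd \<Longrightarrow> a \<otimes> s' = a' \<otimes> s \<Longrightarrow>
      b' \<in> carrier A \<Longrightarrow> t' \<in> nzd \<Longrightarrow> b \<otimes> t' = b' \<otimes> t \<Longrightarrow> f a' s' b' t' = f a s b t"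
  shows "(\<Union>(a', s') \<in> fraction A a s. \<Union>(b', t') \<in> fraction A b t. f a' s' b' t') = f a s b t"
proof -
  have "(\<Union>(b', t') \<in> fraction A b t. f a' s' b' t') = f a s b t" if "(a', s') \<in> fraction A a s" for a' s'
  proof (rule SUP_eq_const)
    show "fraction A b t \<noteq> {}" using fraction_self[OF y] by blast
    fix i assume "i \<in> fraction A b t"
    then show "(case i of (b', t') \<Rightarrow> f a' s' b' t') = f a s b t"
      using that const[of a' s'] by (cases i) (simp add: fraction_mem)
  qed
  note inner = this
  show ?thesis
  proof (rule SUP_eq_const)
    show "fraction A a s \<noteq> {}" using fraction_self[OF x] by blast
    fix i assume "i \<in> fraction A a s"
    then show "(case i of (a', s') \<Rightarrow> \<Union>(b', t') \<in> fraction A b t. f a' s' b' t') = f a s b t"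
      using inner by (cases i) simp
  qed
qed

lemma Frac_mult:
  assumes x: "a \<in> carrier A" "s \<in> nzd" and y: "b \<in> carrier A" "t \<in> nzd"
  shows "fraction A a s \<otimes>\<^bsub>Frac A\<^esub> fraction A b t = fraction A (a \<otimes> b) (s \<otimes> t)"
proof -
  have "(\<Union>(a', s') \<in> fraction A a s. \<Union>(b', t') \<in> fraction A b t. fraction A (a' \<otimes> b') (s' \<otimes> t')) = fraction A (a \<otimes> b) (s \<otimes> t)"
  proof (rule Frac_binop[OF x y])
    fix a' s' b' t' assume h: "a' \<in> carrier A" "s' \<in> nzd" "a \<otimes> s' = a' \<otimes> s" "b' \<in> carrier A" "t' \<in> nzd" "b \<otimes> t' = b' \<otimes> t"
    note cl = x(1) y(1) h(1,4) nzd_closed[OF x(2)] nzd_closed[OF y(2)] nzd_closed[OF h(2)] nzd_closed[OF h(5)]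
    have "a' \<otimes> b' \<otimes> (s \<otimes> t) = (a' \<otimes> s) \<otimes> (b' \<otimes> t)" using cl by (simp add: m_ac)
    also have "\<dots> = (a \<otimes> s') \<otimes> (b \<otimes> t')" by (simp only: h(3,6))
    also have "\<dots> = a \<otimes> b \<otimes> (s' \<otimes> t')" using cl by (simp add: m_ac)
    finally show "fraction A (a' \<otimes> b') (s' \<otimes> t') = fraction A (a \<otimes> b) (s \<otimes> t)"
      using cl nzd_mult[OF h(2,5)] nzd_mult[OF x(2) y(2)] by (subst fraction_eq_iff) simp_all
  qed
  then show ?thesis by (simp add: Frac_def)
qed

lemma Frac_add:
  assumes x: "a \<in> carrier A" "s \<in> nzd" and y: "b \<in> carrier A" "t \<in> nzd"
  shows "fraction A a s \<oplus>\<^bsub>Frac A\<^esub> fraction A b t = fraction A (a \<otimes> t \<oplus> b \<otimes> s) (s \<otimes> t)"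
proof -
  have "(\<Union>(a', s') \<in> fraction A a s. \<Union>(b', t') \<in> fraction A b t. fraction A (a' \<otimes> t' \<oplus> b' \<otimes> s') (s' \<otimes> t')) =
      fraction A (a \<otimes> t \<oplus> b \<otimes> s) (s \<otimes> t)"
  proof (rule Frac_binop[OF x y])
    fix a' s' b' t' assume h: "a' \<in> carrier A" "s' \<in> nzd" "a \<otimes> s' = a' \<otimes> s" "b' \<in> carrier A" "t' \<in> nzd" "b \<otimes> t' = b' \<otimes> t"
    note cl = x(1) y(1) h(1,4) nzd_closed[OF x(2)] nzd_closed[OF y(2)] nzd_closed[OF h(2)] nzd_closed[OF h(5)]
    have "(a' \<otimes> t' \<oplus> b' \<otimes> s') \<otimes> (s \<otimes> t) = (a' \<otimes> s) \<otimes> (t \<otimes> t') \<oplus> (b' \<otimes> t) \<otimes> (s \<otimes> s')"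
      using cl by (simp add: l_distr r_distr m_ac)
    also have "\<dots> = (a \<otimes> s') \<otimes> (t \<otimes> t') \<oplus> (b \<otimes> t') \<otimes> (s \<otimes> s')" by (simp only: h(3,6))
    also have "\<dots> = (a \<otimes> t \<oplus> b \<otimes> s) \<otimes> (s' \<otimes> t')" using cl by (simp add: l_distr r_distr m_ac)
    finally show "fraction A (a' \<otimes> t' \<oplus> b' \<otimes> s') (s' \<otimes> t') = fraction A (a \<otimes> t \<oplus> b \<otimes> s) (s \<otimes> t)"
      using cl nzd_mult[OF h(2,5)] nzd_mult[OF x(2) y(2)] by (subst fraction_eq_iff) simp_all
  qed
  then show ?thesis by (simp add: Frac_def)
qed

lemma Frac_zero: "\<zero>\<^bsub>Frac A\<^esub> = fraction A \<zero> \<one>" and Frac_one: "\<one>\<^bsub>Frac A\<^esub> = fraction A \<one> \<one>"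
  by (simp_all add: Frac_def)

lemma Frac_cring: "cring (Frac A)"
proof (rule cringI)
  show "abelian_group (Frac A)"
  proof (rule abelian_groupI)
    show "\<zero>\<^bsub>Frac A\<^esub> \<in> carrier (Frac A)" unfolding Frac_zero by (rule Frac_carrierI[OF zero_closed nzd_one])
    fix x assume "x \<in> carrier (Frac A)"
    then obtain a s where x: "a \<in> carrier A" "s \<in> nzd" "x = fraction A a s" unfolding Frac_carrier by blast
    note sc = nzd_closed[OF x(2)]
    show "\<zero>\<^bsub>Frac A\<^esub> \<oplus>\<^bsub>Frac A\<^esub> x = x"
      unfolding x(3) Frac_zero Frac_add[OF zero_closed nzd_one x(1,2)] using x(1) sc by simp
    have "fraction A (\<ominus> a) s \<oplus>\<^bsub>Frac A\<^esub> x = \<zero>\<^bsub>Frac A\<^esub>"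
      unfolding x(3) Frac_zero Frac_add[OF a_inv_closed[OF x(1)] x(2) x(1,2)]
      using x(1) sc by (subst fraction_eq_iff) (simp_all add: nzd_mult[OF x(2) x(2)] nzd_one l_minus l_neg)
    then show "\<exists>y\<in>carrier (Frac A). y \<oplus>\<^bsub>Frac A\<^esub> x = \<zero>\<^bsub>Frac A\<^esub>"
      using Frac_carrierI[OF a_inv_closed[OF x(1)] x(2)] by blast
    fix y assume "y \<in> carrier (Frac A)"
    then obtain b t where y: "b \<in> carrier A" "t \<in> nzd" "y = fraction A b t" unfolding Frac_carrier by blast
    note tc = nzd_closed[OF y(2)] and st = nzd_mult[OF x(2) y(2)]
    have xyc: "a \<otimes> t \<oplus> b \<otimes> s \<in> carrier A" using x(1) y(1) sc tc by simp
    show "x \<oplus>\<^bsub>Frac A\<^esub> y \<in> carrier (Frac A)"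
      unfolding x(3) y(3) Frac_add[OF x(1,2) y(1,2)] by (rule Frac_carrierI[OF xyc st])
    show "x \<oplus>\<^bsub>Frac A\<^esub> y = y \<oplus>\<^bsub>Frac A\<^esub> x"
      unfolding x(3) y(3) Frac_add[OF x(1,2) y(1,2)] Frac_add[OF y(1,2) x(1,2)]
      using x(1) y(1) sc tc by (simp add: m_comm[of s t] a_comm)
    fix z assume "z \<in> carrier (Frac A)"
    then obtain c u where z: "c \<in> carrier A" "u \<in> nzd" "z = fraction A c u" unfolding Frac_carrier by blast
    note uc = nzd_closed[OF z(2)] and tu = nzd_mult[OF y(2) z(2)]
    have yzc: "b \<otimes> u \<oplus> c \<otimes> t \<in> carrier A" using z(1) y(1) uc tc by simp
    show "x \<oplus>\<^bsub>Frac A\<^esub> y \<oplus>\<^bsub>Frac A\<^esub> z = x \<oplus>\<^bsub>Frac A\<^esub> (y \<oplus>\<^bsub>Frac A\<^esub> z)"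
      unfolding x(3) y(3) z(3) Frac_add[OF x(1,2) y(1,2)] Frac_add[OF y(1,2) z(1,2)]
        Frac_add[OF xyc st z(1,2)] Frac_add[OF x(1,2) yzc tu]
      using x(1) y(1) z(1) sc tc uc by (simp add: l_distr r_distr m_ac a_ac)
  qed
  show "comm_monoid (Frac A)"
  proof (rule comm_monoidI)
    show "\<one>\<^bsub>Frac A\<^esub> \<in> carrier (Frac A)" unfolding Frac_one by (rule Frac_carrierI[OF one_closed nzd_one])
    fix x assume "x \<in> carrier (Frac A)"
    then obtain a s where x: "a \<in> carrier A" "s \<in> nzd" "x = fraction A a s" unfolding Frac_carrier by blast
    note sc = nzd_closed[OF x(2)]
    show "\<one>\<^bsub>Frac A\<^esub> \<otimes>\<^bsub>Frac A\<^esub> x = x"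
      unfolding x(3) Frac_one Frac_mult[OF one_closed nzd_one x(1,2)] using x(1) sc by simp
    fix y assume "y \<in> carrier (Frac A)"
    then obtain b t where y: "b \<in> carrier A" "t \<in> nzd" "y = fraction A b t" unfolding Frac_carrier by blast
    note tc = nzd_closed[OF y(2)] and st = nzd_mult[OF x(2) y(2)]
    show "x \<otimes>\<^bsub>Frac A\<^esub> y \<in> carrier (Frac A)"
      unfolding x(3) y(3) Frac_mult[OF x(1,2) y(1,2)] by (rule Frac_carrierI[OF m_closed[OF x(1) y(1)] st])
    show "x \<otimes>\<^bsub>Frac A\<^esub> y = y \<otimes>\<^bsub>Frac A\<^esub> x"
      unfolding x(3) y(3) Frac_mult[OF x(1,2) y(1,2)] Frac_mult[OF y(1,2) x(1,2)]
      using x(1) y(1) sc tc by (simp add: m_comm)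
    fix z assume "z \<in> carrier (Frac A)"
    then obtain c u where z: "c \<in> carrier A" "u \<in> nzd" "z = fraction A c u" unfolding Frac_carrier by blast
    note uc = nzd_closed[OF z(2)] and tu = nzd_mult[OF y(2) z(2)]
    show "x \<otimes>\<^bsub>Frac A\<^esub> y \<otimes>\<^bsub>Frac A\<^esub> z = x \<otimes>\<^bsub>Frac A\<^esub> (y \<otimes>\<^bsub>Frac A\<^esub> z)"
      unfolding x(3) y(3) z(3) Frac_mult[OF x(1,2) y(1,2)] Frac_mult[OF y(1,2) z(1,2)]
        Frac_mult[OF m_closed[OF x(1) y(1)] st z(1,2)] Frac_mult[OF x(1,2) m_closed[OF y(1) z(1)] tu]
      using x(1) y(1) z(1) sc tc uc by (simp add: m_ac)
  qed
  fix x y z assume "x \<in> carrier (Frac A)" "y \<in> carrier (Frac A)" "z \<in> carrier (Frac A)"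
  then obtain a s b t c u where x: "a \<in> carrier A" "s \<in> nzd" "x = fraction A a s"
    and y: "b \<in> carrier A" "t \<in> nzd" "y = fraction A b t"
    and z: "c \<in> carrier A" "u \<in> nzd" "z = fraction A c u" unfolding Frac_carrier by blast
  note sc = nzd_closed[OF x(2)] and tc = nzd_closed[OF y(2)] and uc = nzd_closed[OF z(2)]
  note st = nzd_mult[OF x(2) y(2)] and su = nzd_mult[OF x(2) z(2)] and tu = nzd_mult[OF y(2) z(2)]
  have xyc: "a \<otimes> t \<oplus> b \<otimes> s \<in> carrier A" using x(1) y(1) sc tc by simp
  show "(x \<oplus>\<^bsub>Frac A\<^esub> y) \<otimes>\<^bsub>Frac A\<^esub> z = x \<otimes>\<^bsub>Frac A\<^esub> z \<oplus>\<^bsub>Frac A\<^esub> y \<otimes>\<^bsub>Frac A\<^esub> z"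
    unfolding x(3) y(3) z(3) Frac_add[OF x(1,2) y(1,2)] Frac_mult[OF xyc st z(1,2)] Frac_mult[OF x(1,2) z(1,2)] Frac_mult[OF y(1,2) z(1,2)]
      Frac_add[OF m_closed[OF x(1) z(1)] su m_closed[OF y(1) z(1)] tu]
  proof (subst fraction_eq_iff)
    show "(a \<otimes> t \<oplus> b \<otimes> s) \<otimes> c \<otimes> (s \<otimes> u \<otimes> (t \<otimes> u)) = (a \<otimes> c \<otimes> (t \<otimes> u) \<oplus> b \<otimes> c \<otimes> (s \<otimes> u)) \<otimes> (s \<otimes> t \<otimes> u)"
      using x(1) y(1) z(1) sc tc uc by (simp add: l_distr r_distr m_ac)
  qed (use x(1) y(1) z(1) sc tc uc nzd_mult[OF st z(2)] nzd_mult[OF su tu] in simp_all)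
qed

interpretation Q: cring "Frac A" by (rule Frac_cring)

lemma to_Frac_closed [simp]: "a \<in> carrier A \<Longrightarrow> to_Frac A a \<in> carrier (Frac A)"
  unfolding to_Frac_def by (rule Frac_carrierI[OF _ nzd_one])

lemma to_Frac_add: "a \<in> carrier A \<Longrightarrow> b \<in> carrier A \<Longrightarrow> to_Frac A (a \<oplus> b) = to_Frac A a \<oplus>\<^bsub>Frac A\<^esub> to_Frac A b"
  by (simp add: to_Frac_def Frac_add nzd_one)

lemma to_Frac_mult: "a \<in> carrier A \<Longrightarrow> b \<in> carrier A \<Longrightarrow> to_Frac A (a \<otimes> b) = to_Frac A a \<otimes>\<^bsub>Frac A\<^esub> to_Frac A b"
  by (simp add: to_Frac_def Frac_mult nzd_one)

lemma to_Frac_one: "to_Frac A \<one> = \<one>\<^bsub>Frac A\<^esub>"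
  by (simp add: to_Frac_def Frac_one)

lemma to_Frac_zero: "to_Frac A \<zero> = \<zero>\<^bsub>Frac A\<^esub>"
  by (simp add: to_Frac_def Frac_zero)

lemma to_Frac_neg: "a \<in> carrier A \<Longrightarrow> to_Frac A (\<ominus> a) = \<ominus>\<^bsub>Frac A\<^esub> to_Frac A a"
  using to_Frac_add[of "\<ominus> a" a] by (intro Q.minus_equality[symmetric]) (simp_all add: l_neg to_Frac_zero)

section \<open>The monoid of fractional ideals\<close>

abbreviation "FI \<equiv> fractional_ideals A"
abbreviation "QQ \<equiv> Frac A"

lemma FI_carrier:
  "J \<in> carrier FI \<longleftrightarrow> J \<subseteq> carrier QQ \<and> \<zero>\<^bsub>QQ\<^esub> \<in> J \<and> (\<forall>x\<in>J. \<forall>y\<in>J. x \<oplus>\<^bsub>QQ\<^esub> y \<in> J) \<and>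
     (\<forall>a\<in>carrier A. \<forall>x\<in>J. to_Frac A a \<otimes>\<^bsub>QQ\<^esub> x \<in> J) \<and>
     (\<exists>d\<in>nzd. \<forall>x\<in>J. to_Frac A d \<otimes>\<^bsub>QQ\<^esub> x \<in> to_Frac A ` carrier A)" (is "?L \<longleftrightarrow> ?R")
proof
  assume L: ?L
  then have sg: "subgroup J (add_monoid QQ)" by (simp add: fractional_ideals_def)
  have "J \<subseteq> carrier QQ" "\<zero>\<^bsub>QQ\<^esub> \<in> J" "\<forall>x\<in>J. \<forall>y\<in>J. x \<oplus>\<^bsub>QQ\<^esub> y \<in> J"
    using subgroup.subset[OF sg] subgroup.one_closed[OF sg] subgroup.m_closed[OF sg] by simp_all
  then show ?R using L by (simp add: fractional_ideals_def)
next
  assume R: ?R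
  have "subgroup J (add_monoid QQ)"
  proof (rule Q.add.subgroupI)
    fix x assume x: "x \<in> J"
    then have xc: "x \<in> carrier QQ" using R by blast
    have "to_Frac A (\<ominus> \<one>) \<otimes>\<^bsub>QQ\<^esub> x = \<ominus>\<^bsub>QQ\<^esub> x"
      using xc by (simp add: to_Frac_neg to_Frac_one Q.l_minus)
    moreover have "to_Frac A (\<ominus> \<one>) \<otimes>\<^bsub>QQ\<^esub> x \<in> J" using R x by simp
    ultimately show "\<ominus>\<^bsub>QQ\<^esub> x \<in> J" by simp
  qed (use R in auto)
  then show ?L using R by (simp add: fractional_ideals_def)
qed

lemma FI_simps [simp]: "I \<otimes>\<^bsub>FI\<^esub> J = ideal_prod QQ I J" "\<one>\<^bsub>FI\<^esub> = to_Frac A ` carrier A"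
  by (simp_all add: fractional_ideals_def)

lemma to_Frac_image_add: "x \<in> to_Frac A ` carrier A \<Longrightarrow> y \<in> to_Frac A ` carrier A \<Longrightarrow> x \<oplus>\<^bsub>QQ\<^esub> y \<in> to_Frac A ` carrier A"
  using to_Frac_add by (auto simp: image_iff)

lemma to_Frac_image_mult: "x \<in> to_Frac A ` carrier A \<Longrightarrow> y \<in> to_Frac A ` carrier A \<Longrightarrow> x \<otimes>\<^bsub>QQ\<^esub> y \<in> to_Frac A ` carrier A"
  using to_Frac_mult by (auto simp: image_iff)

lemma FI_subset: "J \<in> carrier FI \<Longrightarrow> x \<in> J \<Longrightarrow> x \<in> carrier QQ"
  unfolding FI_carrier by blast

lemma ideal_prod_least:
  assumes "\<And>x y. x \<in> I \<Longrightarrow> y \<in> J \<Longrightarrow> x \<otimes>\<^bsub>QQ\<^esub> y \<in> K" "\<And>x y. x \<in> K \<Longrightarrow> y \<in> K \<Longrightarrow> x \<oplus>\<^bsub>QQ\<^esub> y \<in> K"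
  shows "ideal_prod QQ I J \<subseteq> K"
proof
  fix z assume "z \<in> ideal_prod QQ I J"
  then show "z \<in> K" by (induction rule: ideal_prod.induct) (auto intro: assms)
qed

lemma FI_prod_carrier:
  assumes I: "I \<in> carrier FI" and J: "J \<in> carrier FI"
  shows "ideal_prod QQ I J \<subseteq> carrier QQ"
  by (rule ideal_prod_least) (use FI_subset[OF I] FI_subset[OF J] in auto)

lemma FI_prod_closed:
  assumes I: "I \<in> carrier FI" and J: "J \<in> carrier FI"
  shows "ideal_prod QQ I J \<in> carrier FI"
  unfolding FI_carrier
proof (intro conjI ballI)
  note sub = FI_prod_carrier[OF I J]
  show "ideal_prod QQ I J \<subseteq> carrier QQ" by (rule sub)
  have "\<zero>\<^bsub>QQ\<^esub> \<in> I" "\<zero>\<^bsub>QQ\<^esub> \<in> J" using I J unfolding FI_carrier by blast+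
  then have "\<zero>\<^bsub>QQ\<^esub> \<otimes>\<^bsub>QQ\<^esub> \<zero>\<^bsub>QQ\<^esub> \<in> ideal_prod QQ I J" by (rule ideal_prod.prod)
  then show "\<zero>\<^bsub>QQ\<^esub> \<in> ideal_prod QQ I J" by simp
  show "x \<oplus>\<^bsub>QQ\<^esub> y \<in> ideal_prod QQ I J" if "x \<in> ideal_prod QQ I J" "y \<in> ideal_prod QQ I J" for x y
    using that by (rule ideal_prod.sum)
  show "to_Frac A a \<otimes>\<^bsub>QQ\<^esub> x \<in> ideal_prod QQ I J" if a: "a \<in> carrier A" and x: "x \<in> ideal_prod QQ I J" for a x
    using x
  proof (induction rule: ideal_prod.induct)
    case (prod i j)
    have "to_Frac A a \<otimes>\<^bsub>QQ\<^esub> (i \<otimes>\<^bsub>QQ\<^esub> j) = (to_Frac A a \<otimes>\<^bsub>QQ\<^esub> i) \<otimes>\<^bsub>QQ\<^esub> j"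
      using a FI_subset[OF I prod(1)] FI_subset[OF J prod(2)] by (simp add: Q.m_assoc)
    moreover have "to_Frac A a \<otimes>\<^bsub>QQ\<^esub> i \<in> I" using I a prod(1) unfolding FI_carrier by blast
    ultimately show ?case using prod(2) by (simp add: ideal_prod.prod)
  next
    case (sum s1 s2)
    have "to_Frac A a \<otimes>\<^bsub>QQ\<^esub> (s1 \<oplus>\<^bsub>QQ\<^esub> s2) = to_Frac A a \<otimes>\<^bsub>QQ\<^esub> s1 \<oplus>\<^bsub>QQ\<^esub> to_Frac A a \<otimes>\<^bsub>QQ\<^esub> s2"
      using a subsetD[OF sub sum(1)] subsetD[OF sub sum(2)] by (simp add: Q.r_distr)
    then show ?case using sum(3,4) by (simp add: ideal_prod.sum)
  qed
  obtain d where d: "d \<in> nzd" "\<forall>x\<in>I. to_Frac A d \<otimes>\<^bsub>QQ\<^esub> x \<in> to_Frac A ` carrier A" using I unfolding FI_carrier by blast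
  obtain e where e: "e \<in> nzd" "\<forall>x\<in>J. to_Frac A e \<otimes>\<^bsub>QQ\<^esub> x \<in> to_Frac A ` carrier A" using J unfolding FI_carrier by blast
  note dc = nzd_closed[OF d(1)] and ec = nzd_closed[OF e(1)]
  have "to_Frac A (d \<otimes> e) \<otimes>\<^bsub>QQ\<^esub> x \<in> to_Frac A ` carrier A" if "x \<in> ideal_prod QQ I J" for x
    using that
  proof (induction rule: ideal_prod.induct)
    case (prod i j)
    have "to_Frac A (d \<otimes> e) \<otimes>\<^bsub>QQ\<^esub> (i \<otimes>\<^bsub>QQ\<^esub> j) = (to_Frac A d \<otimes>\<^bsub>QQ\<^esub> i) \<otimes>\<^bsub>QQ\<^esub> (to_Frac A e \<otimes>\<^bsub>QQ\<^esub> j)"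
      using dc ec FI_subset[OF I prod(1)] FI_subset[OF J prod(2)] by (simp add: to_Frac_mult Q.m_ac)
    then show ?case using d(2) e(2) prod by (simp add: to_Frac_image_mult)
  next
    case (sum s1 s2)
    have "to_Frac A (d \<otimes> e) \<otimes>\<^bsub>QQ\<^esub> (s1 \<oplus>\<^bsub>QQ\<^esub> s2) = to_Frac A (d \<otimes> e) \<otimes>\<^bsub>QQ\<^esub> s1 \<oplus>\<^bsub>QQ\<^esub> to_Frac A (d \<otimes> e) \<otimes>\<^bsub>QQ\<^esub> s2"
      using dc ec subsetD[OF sub sum(1)] subsetD[OF sub sum(2)] by (simp add: Q.r_distr)
    then show ?case using sum(3,4) by (simp add: to_Frac_image_add)
  qed
  then show "\<exists>d\<in>nzd. \<forall>x\<in>ideal_prod QQ I J. to_Frac A d \<otimes>\<^bsub>QQ\<^esub> x \<in> to_Frac A ` carrier A"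
    using nzd_mult[OF d(1) e(1)] by blast
qed

lemma to_Frac_ideal:
  assumes I: "ideal I A" shows "to_Frac A ` I \<in> carrier FI"
  unfolding FI_carrier
proof (intro conjI ballI)
  note add = ideal.axioms(1)[OF I]
  have Ic: "x \<in> carrier A" if "x \<in> I" for x using that additive_subgroup.a_subset[OF add] by blast
  show "to_Frac A ` I \<subseteq> carrier QQ" using Ic by auto
  show "\<zero>\<^bsub>QQ\<^esub> \<in> to_Frac A ` I" unfolding to_Frac_zero[symmetric] by (rule imageI[OF additive_subgroup.zero_closed[OF add]])
  fix x assume "x \<in> to_Frac A ` I"
  then obtain u where u: "u \<in> I" "x = to_Frac A u" by blast
  show "to_Frac A a \<otimes>\<^bsub>QQ\<^esub> x \<in> to_Frac A ` I" if "a \<in> carrier A" for a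
    unfolding u(2) to_Frac_mult[OF that Ic[OF u(1)], symmetric] by (rule imageI[OF ideal.I_l_closed[OF I u(1) that]])
  fix y assume "y \<in> to_Frac A ` I"
  then obtain v where v: "v \<in> I" "y = to_Frac A v" by blast
  show "x \<oplus>\<^bsub>QQ\<^esub> y \<in> to_Frac A ` I"
    unfolding u(2) v(2) to_Frac_add[OF Ic[OF u(1)] Ic[OF v(1)], symmetric]
    by (rule imageI[OF additive_subgroup.a_closed[OF add u(1) v(1)]])
next
  have "\<forall>x\<in>to_Frac A ` I. to_Frac A \<one> \<otimes>\<^bsub>QQ\<^esub> x \<in> to_Frac A ` carrier A"
    using additive_subgroup.a_subset[OF ideal.axioms(1)[OF I]] by (auto simp: to_Frac_one)
  then show "\<exists>d\<in>nzd. \<forall>x\<in>to_Frac A ` I. to_Frac A d \<otimes>\<^bsub>QQ\<^esub> x \<in> to_Frac A ` carrier A" using nzd_one by blast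
qed

lemma FI_comm_monoid: "comm_monoid FI"
proof (rule comm_monoidI)
  show "\<one>\<^bsub>FI\<^esub> \<in> carrier FI" using to_Frac_ideal[OF oneideal] by simp
  fix I J assume I: "I \<in> carrier FI" and J: "J \<in> carrier FI"
  show "I \<otimes>\<^bsub>FI\<^esub> J \<in> carrier FI" using FI_prod_closed[OF I J] by simp
  have comm: "ideal_prod QQ I J \<subseteq> ideal_prod QQ J I" if I: "I \<in> carrier FI" and J: "J \<in> carrier FI" for I J
  proof (rule ideal_prod_least)
    fix x y assume xy: "x \<in> I" "y \<in> J"
    then have "y \<otimes>\<^bsub>QQ\<^esub> x \<in> ideal_prod QQ J I" by (simp add: ideal_prod.prod)
    then show "x \<otimes>\<^bsub>QQ\<^esub> y \<in> ideal_prod QQ J I" using Q.m_comm[OF FI_subset[OF I xy(1)] FI_subset[OF J xy(2)]] by simp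
  qed (rule ideal_prod.sum)
  show "I \<otimes>\<^bsub>FI\<^esub> J = J \<otimes>\<^bsub>FI\<^esub> I" using comm[OF I J] comm[OF J I] by simp
  have assoc: "ideal_prod QQ (ideal_prod QQ I J) K \<subseteq> ideal_prod QQ I (ideal_prod QQ J K)"
    if I: "I \<in> carrier FI" and J: "J \<in> carrier FI" and K: "K \<in> carrier FI" for I J K
  proof (rule ideal_prod_least)
    fix x k assume x: "x \<in> ideal_prod QQ I J" and k: "k \<in> K"
    note sub = FI_prod_carrier[OF I J]
    show "x \<otimes>\<^bsub>QQ\<^esub> k \<in> ideal_prod QQ I (ideal_prod QQ J K)" using x
    proof (induction rule: ideal_prod.induct)
      case (prod i j)
      have "i \<otimes>\<^bsub>QQ\<^esub> j \<otimes>\<^bsub>QQ\<^esub> k = i \<otimes>\<^bsub>QQ\<^esub> (j \<otimes>\<^bsub>QQ\<^esub> k)"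
        using FI_subset[OF I prod(1)] FI_subset[OF J prod(2)] FI_subset[OF K k] by (rule Q.m_assoc)
      then show ?case using ideal_prod.prod[OF prod(1) ideal_prod.prod[OF prod(2) k]] by simp
    next
      case (sum s1 s2)
      have "(s1 \<oplus>\<^bsub>QQ\<^esub> s2) \<otimes>\<^bsub>QQ\<^esub> k = s1 \<otimes>\<^bsub>QQ\<^esub> k \<oplus>\<^bsub>QQ\<^esub> s2 \<otimes>\<^bsub>QQ\<^esub> k"
        using subsetD[OF sub sum(1)] subsetD[OF sub sum(2)] FI_subset[OF K k] by (rule Q.l_distr)
      then show ?case using sum(3,4) by (simp add: ideal_prod.sum)
    qed
  qed (rule ideal_prod.sum)
  fix K assume K: "K \<in> carrier FI"
  \<comment> \<open>The reverse inclusion is the first one with the factors in opposite order, by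
    commutativity.\<close>
  have "ideal_prod QQ I (ideal_prod QQ J K) = ideal_prod QQ (ideal_prod QQ K J) I"
    using comm[OF I FI_prod_closed[OF J K]] comm[OF FI_prod_closed[OF J K] I] comm[OF J K] comm[OF K J] by auto
  also have "\<dots> \<subseteq> ideal_prod QQ K (ideal_prod QQ J I)" by (rule assoc[OF K J I])
  also have "\<dots> = ideal_prod QQ (ideal_prod QQ I J) K"
    using comm[OF K FI_prod_closed[OF I J]] comm[OF FI_prod_closed[OF I J] K] comm[OF J I] comm[OF I J] by auto
  finally show "I \<otimes>\<^bsub>FI\<^esub> J \<otimes>\<^bsub>FI\<^esub> K = I \<otimes>\<^bsub>FI\<^esub> (J \<otimes>\<^bsub>FI\<^esub> K)" using assoc[OF I J K] by auto
next
  fix J assume J: "J \<in> carrier FI"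
  have "ideal_prod QQ (to_Frac A ` carrier A) J \<subseteq> J"
    by (rule ideal_prod_least) (use J in \<open>auto simp: FI_carrier\<close>)
  moreover have "J \<subseteq> ideal_prod QQ (to_Frac A ` carrier A) J"
  proof
    fix x assume x: "x \<in> J"
    have "to_Frac A \<one> \<otimes>\<^bsub>QQ\<^esub> x \<in> ideal_prod QQ (to_Frac A ` carrier A) J"
      by (rule ideal_prod.prod[OF imageI[OF one_closed] x])
    then show "x \<in> ideal_prod QQ (to_Frac A ` carrier A) J" using FI_subset[OF J x] by (simp add: to_Frac_one)
  qed
  ultimately show "\<one>\<^bsub>FI\<^esub> \<otimes>\<^bsub>FI\<^esub> J = J" by simp
qed

lemma to_Frac_prod:
  assumes I: "ideal I A" and J: "ideal J A"
  shows "to_Frac A ` ideal_prod A I J = ideal_prod QQ (to_Frac A ` I) (to_Frac A ` J)"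
proof
  have Ic: "x \<in> carrier A" if "x \<in> I" for x using that additive_subgroup.a_subset[OF ideal.axioms(1)[OF I]] by blast
  have Jc: "x \<in> carrier A" if "x \<in> J" for x using that additive_subgroup.a_subset[OF ideal.axioms(1)[OF J]] by blast
  note pc = ideal_prod_in_carrier[OF I J]
  show "to_Frac A ` ideal_prod A I J \<subseteq> ideal_prod QQ (to_Frac A ` I) (to_Frac A ` J)"
  proof
    fix z assume "z \<in> to_Frac A ` ideal_prod A I J"
    then obtain w where w: "w \<in> ideal_prod A I J" "z = to_Frac A w" by blast
    have "to_Frac A w \<in> ideal_prod QQ (to_Frac A ` I) (to_Frac A ` J)" using w(1)
    proof (induction rule: ideal_prod.induct)
      case (prod i j)
      then show ?case using to_Frac_mult[OF Ic Jc] by (simp add: ideal_prod.prod)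
    next
      case (sum s1 s2)
      then show ?case using to_Frac_add[OF subsetD[OF pc sum(1)] subsetD[OF pc sum(2)]] by (simp add: ideal_prod.sum)
    qed
    then show "z \<in> ideal_prod QQ (to_Frac A ` I) (to_Frac A ` J)" using w(2) by simp
  qed
  show "ideal_prod QQ (to_Frac A ` I) (to_Frac A ` J) \<subseteq> to_Frac A ` ideal_prod A I J"
  proof (rule ideal_prod_least)
    fix x y assume "x \<in> to_Frac A ` I" "y \<in> to_Frac A ` J"
    then obtain u v where uv: "u \<in> I" "v \<in> J" "x = to_Frac A u" "y = to_Frac A v" by blast
    show "x \<otimes>\<^bsub>QQ\<^esub> y \<in> to_Frac A ` ideal_prod A I J"
      unfolding uv(3,4) to_Frac_mult[OF Ic[OF uv(1)] Jc[OF uv(2)], symmetric] by (rule imageI[OF ideal_prod.prod[OF uv(1,2)]])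
  next
    fix x y assume "x \<in> to_Frac A ` ideal_prod A I J" "y \<in> to_Frac A ` ideal_prod A I J"
    then obtain u v where uv: "u \<in> ideal_prod A I J" "v \<in> ideal_prod A I J" "x = to_Frac A u" "y = to_Frac A v" by blast
    show "x \<oplus>\<^bsub>QQ\<^esub> y \<in> to_Frac A ` ideal_prod A I J"
      unfolding uv(3,4) to_Frac_add[OF subsetD[OF pc uv(1)] subsetD[OF pc uv(2)], symmetric] by (rule imageI[OF ideal_prod.sum[OF uv(1,2)]])
  qed
qed

interpretation FI: comm_monoid FI by (rule FI_comm_monoid)

lemma principal_invertible:
  assumes e: "e \<in> nzd" shows "\<exists>L\<in>carrier FI. L \<otimes>\<^bsub>FI\<^esub> to_Frac A ` (PIdl e) = \<one>\<^bsub>FI\<^esub>"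
proof -
  note ec = nzd_closed[OF e]
  \<comment> \<open>The fractional ideal of all multiples of the inverse of
    \<open>e\<close>.\<close>
  define L where "L = (\<lambda>a. fraction A a e) ` carrier A"
  have key: "to_Frac A b \<otimes>\<^bsub>QQ\<^esub> fraction A a e = fraction A (b \<otimes> a) e" if "a \<in> carrier A" "b \<in> carrier A" for a b
    unfolding to_Frac_def using that ec by (simp add: Frac_mult[OF that(2) nzd_one that(1) e])
  have cancel: "fraction A (a \<otimes> e) e = to_Frac A a" if "a \<in> carrier A" for a
    unfolding to_Frac_def using that ec by (subst fraction_eq_iff) (simp_all add: e nzd_one)
  have L: "L \<in> carrier FI"
    unfolding FI_carrier
  proof (intro conjI ballI)
    show "L \<subseteq> carrier QQ" unfolding L_def using Frac_carrierI[OF _ e] by blast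
    have "\<zero>\<^bsub>QQ\<^esub> = fraction A \<zero> e" unfolding Frac_zero using ec by (subst fraction_eq_iff) (simp_all add: e nzd_one)
    then show "\<zero>\<^bsub>QQ\<^esub> \<in> L" unfolding L_def by blast
    fix x assume "x \<in> L"
    then obtain a where a: "a \<in> carrier A" "x = fraction A a e" unfolding L_def by blast
    show "to_Frac A b \<otimes>\<^bsub>QQ\<^esub> x \<in> L" if "b \<in> carrier A" for b
      unfolding a(2) key[OF a(1) that] L_def using a(1) that by blast
    fix y assume "y \<in> L"
    then obtain b where b: "b \<in> carrier A" "y = fraction A b e" unfolding L_def by blast
    have "x \<oplus>\<^bsub>QQ\<^esub> y = fraction A (a \<oplus> b) e"
      unfolding a(2) b(2) Frac_add[OF a(1) e b(1) e]
      using a(1) b(1) ec by (subst fraction_eq_iff) (simp_all add: e nzd_mult[OF e e] l_distr r_distr m_ac)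
    then show "x \<oplus>\<^bsub>QQ\<^esub> y \<in> L" unfolding L_def using a(1) b(1) by blast
  next
    have "to_Frac A e \<otimes>\<^bsub>QQ\<^esub> x \<in> to_Frac A ` carrier A" if "x \<in> L" for x
    proof -
      obtain a where a: "a \<in> carrier A" "x = fraction A a e" using \<open>x \<in> L\<close> unfolding L_def by blast
      have "to_Frac A e \<otimes>\<^bsub>QQ\<^esub> x = to_Frac A a"
        unfolding a(2) key[OF a(1) ec] m_comm[OF ec a(1)] by (rule cancel[OF a(1)])
      then show ?thesis using a(1) by simp
    qed
    then show "\<exists>d\<in>nzd. \<forall>x\<in>L. to_Frac A d \<otimes>\<^bsub>QQ\<^esub> x \<in> to_Frac A ` carrier A" using e by blast
  qed
  have prod1: "fraction A a e \<otimes>\<^bsub>QQ\<^esub> to_Frac A (b \<otimes> e) = to_Frac A (a \<otimes> b)" if "a \<in> carrier A" "b \<in> carrier A" for a b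
  proof -
    have "fraction A a e \<otimes>\<^bsub>QQ\<^esub> to_Frac A (b \<otimes> e) = to_Frac A (b \<otimes> e) \<otimes>\<^bsub>QQ\<^esub> fraction A a e"
      by (rule Q.m_comm) (use that ec Frac_carrierI[OF _ e] in simp_all)
    also have "\<dots> = fraction A (b \<otimes> e \<otimes> a) e" by (rule key) (use that ec in simp_all)
    also have "b \<otimes> e \<otimes> a = a \<otimes> b \<otimes> e" using that ec by (simp add: m_ac)
    also have "fraction A (a \<otimes> b \<otimes> e) e = to_Frac A (a \<otimes> b)" by (rule cancel) (use that in simp)
    finally show ?thesis .
  qed
  have "ideal_prod QQ L (to_Frac A ` (PIdl e)) = to_Frac A ` carrier A"
  proof
    show "ideal_prod QQ L (to_Frac A ` (PIdl e)) \<subseteq> to_Frac A ` carrier A"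
    proof (rule ideal_prod_least)
      fix x y assume "x \<in> L" "y \<in> to_Frac A ` (PIdl e)"
      then obtain a b where ab: "a \<in> carrier A" "x = fraction A a e" "b \<in> carrier A" "y = to_Frac A (b \<otimes> e)"
        unfolding L_def cgenideal_def by blast
      show "x \<otimes>\<^bsub>QQ\<^esub> y \<in> to_Frac A ` carrier A" unfolding ab(2,4) prod1[OF ab(1,3)] using ab(1,3) by simp
    qed (rule to_Frac_image_add)
    show "to_Frac A ` carrier A \<subseteq> ideal_prod QQ L (to_Frac A ` (PIdl e))"
    proof
      fix x assume "x \<in> to_Frac A ` carrier A"
      then obtain a where a: "a \<in> carrier A" "x = to_Frac A a" by blast
      have "fraction A a e \<otimes>\<^bsub>QQ\<^esub> to_Frac A (\<one> \<otimes> e) \<in> ideal_prod QQ L (to_Frac A ` (PIdl e))"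
        by (rule ideal_prod.prod) (use a(1) in \<open>auto simp: L_def cgenideal_def\<close>)
      then show "x \<in> ideal_prod QQ L (to_Frac A ` (PIdl e))" unfolding prod1[OF a(1) one_closed] using a by simp
    qed
  qed
  then show ?thesis using L by auto
qed

text \<open>A divisor of an invertible ideal is invertible: some multiple of the Fitting ideal is
  generated by a non-zero-divisor. This gives the inverse in the definition of the shift its
  intended meaning.\<close>

lemma Fitt_unit:
  assumes P: "lmod A P" and res: "resolved A P" and fp: "finitely_presented A P"
  shows "to_Frac A ` Fitt A P \<in> Units FI"
proof -
  obtain n g H where "presentation A P n g H" using fp unfolding finitely_presented_def by blast
  then have g: "generates A P n g" unfolding presentation_iff by simp
  note FP = lmod.Fitt_ideal[OF P g]
  obtain J e where J: "ideal J A" and e: "e \<in> nzd" and JP: "ideal_prod A J (Fitt A P) = PIdl e"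
    using Fitt_invertible[OF P res fp] by blast
  obtain L where L: "L \<in> carrier FI" "L \<otimes>\<^bsub>FI\<^esub> to_Frac A ` (PIdl e) = \<one>\<^bsub>FI\<^esub>" using principal_invertible[OF e] by blast
  have "L \<otimes>\<^bsub>FI\<^esub> to_Frac A ` J \<otimes>\<^bsub>FI\<^esub> to_Frac A ` Fitt A P = L \<otimes>\<^bsub>FI\<^esub> (to_Frac A ` J \<otimes>\<^bsub>FI\<^esub> to_Frac A ` Fitt A P)"
    by (rule FI.m_assoc[OF L(1) to_Frac_ideal[OF J] to_Frac_ideal[OF FP]])
  also have "to_Frac A ` J \<otimes>\<^bsub>FI\<^esub> to_Frac A ` Fitt A P = to_Frac A ` (PIdl e)"
    using to_Frac_prod[OF J FP] JP by simp
  finally have inv: "L \<otimes>\<^bsub>FI\<^esub> to_Frac A ` J \<otimes>\<^bsub>FI\<^esub> to_Frac A ` Fitt A P = \<one>\<^bsub>FI\<^esub>" using L(2) by simp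
  have LJ: "L \<otimes>\<^bsub>FI\<^esub> to_Frac A ` J \<in> carrier FI" by (rule FI.m_closed[OF L(1) to_Frac_ideal[OF J]])
  have "to_Frac A ` Fitt A P \<otimes>\<^bsub>FI\<^esub> (L \<otimes>\<^bsub>FI\<^esub> to_Frac A ` J) = \<one>\<^bsub>FI\<^esub>"
    using inv FI.m_comm[OF LJ to_Frac_ideal[OF FP]] by simp
  then show ?thesis using inv LJ to_Frac_ideal[OF FP] unfolding Units_def by blast
qed

section \<open>The shift, computed from an arbitrary resolved sequence\<close>

lemma finitely_presented_generates: "finitely_presented A P \<Longrightarrow> \<exists>n g. generates A P n g"
  unfolding finitely_presented_def presentation_iff by blast

lemma Fitt_shift_mult:
  fixes M :: "('a, 'm) module"
  assumes ab: "(a0 :: 'a) \<noteq> b0" and fpM: "finitely_presented A M" and tor: "torsion_module A M"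
    and ex1: "short_exact A N1 P1 M i1 p1" and res1: "resolved A P1" and fp1: "finitely_presented A P1"
  shows "to_Frac A ` Fitt A P1 \<otimes>\<^bsub>FI\<^esub> Fitt_shift A M = to_Frac A ` Fitt A N1" "Fitt_shift A M \<in> carrier FI"
proof -
  let ?K = "\<lambda>I. to_Frac A ` I"
  obtain n1 g1 where gN1: "generates A N1 n1 g1"
    using finitely_presented_generates[OF fp1] kernel_finitely_generated[OF ex1 _ fpM] by blast
  note U1 = Fitt_unit[OF short_exactD(2)[OF ex1] res1 fp1]
  note FN1 = lmod.Fitt_ideal[OF short_exactD(1)[OF ex1] gN1]
  note P1c = FI.Units_closed[OF U1]
  have any: "inv\<^bsub>FI\<^esub> (?K (Fitt A P)) \<otimes>\<^bsub>FI\<^esub> ?K (Fitt A N) = inv\<^bsub>FI\<^esub> (?K (Fitt A P1)) \<otimes>\<^bsub>FI\<^esub> ?K (Fitt A N1)"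
    if cP: "class_P A P" and ex: "short_exact A N P M i p" for N P :: "('a, (nat \<Rightarrow> 'a) set) module" and i p
  proof -
    have fp: "finitely_presented A P" using cP by (simp add: class_P_def)
    have res: "resolved A P" by (rule class_P_resolved[OF cP])
    obtain n g where gN: "generates A N n g"
      using finitely_presented_generates[OF fp] kernel_finitely_generated[OF ex _ fpM] by blast
    obtain n' g' where gP: "generates A P n' g'" using finitely_presented_generates[OF fp] by blast
    obtain n'' g'' where gP1: "generates A P1 n'' g''" using finitely_presented_generates[OF fp1] by blast
    note FN = lmod.Fitt_ideal[OF short_exactD(1)[OF ex] gN]
    note FP = lmod.Fitt_ideal[OF short_exactD(2)[OF ex] gP]
    note FP1 = lmod.Fitt_ideal[OF short_exactD(2)[OF ex1] gP1]
    note U = Fitt_unit[OF short_exactD(2)[OF ex] res fp]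
    have cross: "?K (Fitt A N) \<otimes>\<^bsub>FI\<^esub> ?K (Fitt A P1) = ?K (Fitt A N1) \<otimes>\<^bsub>FI\<^esub> ?K (Fitt A P)"
      using Fitt_cross[OF ex ex1 res res1 gN gN1] to_Frac_prod[OF FN FP1] to_Frac_prod[OF FN1 FP] by simp
    note c = to_Frac_ideal[OF FN] to_Frac_ideal[OF FN1] to_Frac_ideal[OF FP] to_Frac_ideal[OF FP1]
      FI.Units_inv_closed[OF U] FI.Units_inv_closed[OF U1]
    have "inv\<^bsub>FI\<^esub> (?K (Fitt A P)) \<otimes>\<^bsub>FI\<^esub> ?K (Fitt A N)
      = inv\<^bsub>FI\<^esub> (?K (Fitt A P)) \<otimes>\<^bsub>FI\<^esub> (?K (Fitt A N) \<otimes>\<^bsub>FI\<^esub> (?K (Fitt A P1) \<otimes>\<^bsub>FI\<^esub> inv\<^bsub>FI\<^esub> (?K (Fitt A P1))))"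
      unfolding FI.Units_r_inv[OF U1] using c by (simp del: FI_simps)
    also have "\<dots> = inv\<^bsub>FI\<^esub> (?K (Fitt A P)) \<otimes>\<^bsub>FI\<^esub> ((?K (Fitt A N) \<otimes>\<^bsub>FI\<^esub> ?K (Fitt A P1)) \<otimes>\<^bsub>FI\<^esub> inv\<^bsub>FI\<^esub> (?K (Fitt A P1)))"
      using c by (simp add: FI.m_assoc del: FI_simps)
    also have "\<dots> = (inv\<^bsub>FI\<^esub> (?K (Fitt A P)) \<otimes>\<^bsub>FI\<^esub> ?K (Fitt A P)) \<otimes>\<^bsub>FI\<^esub> (inv\<^bsub>FI\<^esub> (?K (Fitt A P1)) \<otimes>\<^bsub>FI\<^esub> ?K (Fitt A N1))"
      unfolding cross using c by (simp add: FI.m_ac del: FI_simps)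
    also have "\<dots> = inv\<^bsub>FI\<^esub> (?K (Fitt A P1)) \<otimes>\<^bsub>FI\<^esub> ?K (Fitt A N1)"
      unfolding FI.Units_l_inv[OF U] using c by (simp del: FI_simps)
    finally show ?thesis .
  qed
  \<comment> \<open>The definite description also needs one witness of the prescribed type: a power
    of \<open>A / d A\<close> mapping onto \<open>M\<close>, with \<open>d\<close> a common
    annihilator of its generators.\<close>
  have "\<exists>(N :: ('a, (nat \<Rightarrow> 'a) set) module) (P :: ('a, (nat \<Rightarrow> 'a) set) module) i p. class_P A P \<and> short_exact A N P M i p"
  proof -
    have M: "lmod A M" by (rule short_exactD(3)[OF ex1])
    obtain m g where g: "generates A M m g" using finitely_presented_generates[OF fpM] by blast
    obtain d where d: "d \<in> nzd" "\<forall>j<m. d \<odot>\<^bsub>M\<^esub> g j = \<zero>\<^bsub>M\<^esub>"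
      using torsion_annihilator[OF tor lmod.generatesD[OF M g]] by blast
    have dg: "d \<odot>\<^bsub>M\<^esub> g j = \<zero>\<^bsub>M\<^esub>" if "j < m" for j using d(2) that by simp
    obtain h where h: "h \<in> module_hom A (torsion_free_quot m d) M" "h ` carrier (torsion_free_quot m d) = carrier M"
      by (rule tfq_onto[OF d(1) M g dg]) (assumption, rule that)
    show ?thesis
      using class_P_tfq[OF d(1) ab, of m] kernel_short_exact[OF tfq_lmod[OF d(1)] M h] by blast
  qed
  then obtain N P :: "('a, (nat \<Rightarrow> 'a) set) module" and i p where NP: "class_P A P" "short_exact A N P M i p" by blast
  have eq: "Fitt_shift A M = inv\<^bsub>FI\<^esub> (?K (Fitt A P1)) \<otimes>\<^bsub>FI\<^esub> ?K (Fitt A N1)"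
    unfolding Fitt_shift_def
  proof (rule the_equality)
    show "\<exists>(N :: ('a, (nat \<Rightarrow> 'a) set) module) (P :: ('a, (nat \<Rightarrow> 'a) set) module) i p.
       class_P A P \<and> short_exact A N P M i p \<and>
       inv\<^bsub>FI\<^esub> (?K (Fitt A P1)) \<otimes>\<^bsub>FI\<^esub> ?K (Fitt A N1) = inv\<^bsub>FI\<^esub> (?K (Fitt A P)) \<otimes>\<^bsub>FI\<^esub> ?K (Fitt A N)"
      using NP any[OF NP, symmetric] by blast
    fix J assume "\<exists>(N :: ('a, (nat \<Rightarrow> 'a) set) module) (P :: ('a, (nat \<Rightarrow> 'a) set) module) i p.
       class_P A P \<and> short_exact A N P M i p \<and> J = inv\<^bsub>FI\<^esub> (?K (Fitt A P)) \<otimes>\<^bsub>FI\<^esub> ?K (Fitt A N)"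
    then show "J = inv\<^bsub>FI\<^esub> (?K (Fitt A P1)) \<otimes>\<^bsub>FI\<^esub> ?K (Fitt A N1)" using any by blast
  qed
  note N1c = to_Frac_ideal[OF FN1] and ic = FI.Units_inv_closed[OF U1]
  show "Fitt_shift A M \<in> carrier FI" unfolding eq by (rule FI.m_closed[OF ic N1c])
  have "?K (Fitt A P1) \<otimes>\<^bsub>FI\<^esub> (inv\<^bsub>FI\<^esub> (?K (Fitt A P1)) \<otimes>\<^bsub>FI\<^esub> ?K (Fitt A N1)) =
      (?K (Fitt A P1) \<otimes>\<^bsub>FI\<^esub> inv\<^bsub>FI\<^esub> (?K (Fitt A P1))) \<otimes>\<^bsub>FI\<^esub> ?K (Fitt A N1)"
    by (rule FI.m_assoc[OF P1c ic N1c, symmetric])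
  then show "to_Frac A ` Fitt A P1 \<otimes>\<^bsub>FI\<^esub> Fitt_shift A M = to_Frac A ` Fitt A N1"
    unfolding eq FI.Units_r_inv[OF U1] using FI.l_one[OF N1c] by (simp only:)
qed

text \<open>Translates the scalar multiple in the theorem into the product of fractional ideals in
  which the shift is computed.\<close>

lemma principal_mult:
  assumes z: "z \<in> carrier A" and J: "J \<in> carrier FI"
  shows "to_Frac A z <#\<^bsub>QQ\<^esub> J = to_Frac A ` (PIdl z) \<otimes>\<^bsub>FI\<^esub> J"
proof -
  have "ideal_prod QQ (to_Frac A ` (PIdl z)) J \<subseteq> to_Frac A z <#\<^bsub>QQ\<^esub> J"
  proof (rule ideal_prod_least)
    fix x y assume "x \<in> to_Frac A ` (PIdl z)" and y: "y \<in> J"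
    then obtain a where a: "a \<in> carrier A" "x = to_Frac A (a \<otimes> z)" unfolding cgenideal_def by blast
    have "x \<otimes>\<^bsub>QQ\<^esub> y = to_Frac A z \<otimes>\<^bsub>QQ\<^esub> (to_Frac A a \<otimes>\<^bsub>QQ\<^esub> y)"
      unfolding a(2) using a(1) z FI_subset[OF J y] by (simp add: to_Frac_mult Q.m_ac)
    moreover have "to_Frac A a \<otimes>\<^bsub>QQ\<^esub> y \<in> J" using J a(1) y unfolding FI_carrier by blast
    ultimately show "x \<otimes>\<^bsub>QQ\<^esub> y \<in> to_Frac A z <#\<^bsub>QQ\<^esub> J" unfolding l_coset_def by blast
  next
    fix x y assume "x \<in> to_Frac A z <#\<^bsub>QQ\<^esub> J" "y \<in> to_Frac A z <#\<^bsub>QQ\<^esub> J"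
    then obtain u v where uv: "u \<in> J" "v \<in> J" "x = to_Frac A z \<otimes>\<^bsub>QQ\<^esub> u" "y = to_Frac A z \<otimes>\<^bsub>QQ\<^esub> v"
      unfolding l_coset_def by blast
    have "x \<oplus>\<^bsub>QQ\<^esub> y = to_Frac A z \<otimes>\<^bsub>QQ\<^esub> (u \<oplus>\<^bsub>QQ\<^esub> v)"
      unfolding uv(3,4) using z FI_subset[OF J uv(1)] FI_subset[OF J uv(2)] by (simp add: Q.r_distr)
    moreover have "u \<oplus>\<^bsub>QQ\<^esub> v \<in> J" using J uv(1,2) unfolding FI_carrier by blast
    ultimately show "x \<oplus>\<^bsub>QQ\<^esub> y \<in> to_Frac A z <#\<^bsub>QQ\<^esub> J" unfolding l_coset_def by blast
  qed
  moreover have "to_Frac A z <#\<^bsub>QQ\<^esub> J \<subseteq> ideal_prod QQ (to_Frac A ` (PIdl z)) J"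
  proof
    fix x assume "x \<in> to_Frac A z <#\<^bsub>QQ\<^esub> J"
    then obtain u where u: "u \<in> J" "x = to_Frac A z \<otimes>\<^bsub>QQ\<^esub> u" unfolding l_coset_def by blast
    have "z \<in> PIdl z" by (rule cgenideal_self[OF z])
    then show "x \<in> ideal_prod QQ (to_Frac A ` (PIdl z)) J" unfolding u(2) by (intro ideal_prod.prod imageI u(1))
  qed
  ultimately show ?thesis by simp
qed

end

section \<open>Group rings\<close>

text \<open>Multiplication in a group ring and its action on divisors are both of this form.\<close>

definition conv :: "('g \<Rightarrow> 'h \<Rightarrow> 'k) \<Rightarrow> ('g \<Rightarrow>\<^sub>0 int) \<Rightarrow> ('h \<Rightarrow>\<^sub>0 int) \<Rightarrow> ('k \<Rightarrow>\<^sub>0 int)" where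
  "conv f x y = frag_extend (\<lambda>g. frag_extend (\<lambda>h. frag_of (f g h)) y) x"

lemma frag_extend_fun_diff: "frag_extend (\<lambda>g. a g - b g) x = frag_extend a x - frag_extend b x"
proof -
  have "frag_cmul c (u - v) = frag_cmul c u - frag_cmul c v" for c and u v :: "'a \<Rightarrow>\<^sub>0 int"
    by (rule poly_mapping_eqI) (simp add: lookup_minus right_diff_distrib)
  then show ?thesis by (simp add: frag_extend_def sum_subtractf)
qed

lemma conv_diff_left: "conv f (x - y) z = conv f x z - conv f y z"
  by (simp add: conv_def frag_extend_diff)

lemma conv_diff_right: "conv f x (y - z) = conv f x y - conv f x z"
  by (simp add: conv_def frag_extend_diff frag_extend_fun_diff)

lemma conv_zero [simp]: "conv f 0 y = 0" "conv f x 0 = 0"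
  by (simp_all add: conv_def frag_extend_eq_0)

lemma conv_add_left: "conv f (x + y) z = conv f x z + conv f y z"
  by (simp add: conv_def frag_extend_add)

lemma conv_add_right: "conv f x (y + z) = conv f x y + conv f x z"
  using conv_diff_right[of f x "y + z" z] by simp

lemma conv_of_left: "conv f (frag_of g) y = frag_extend (\<lambda>h. frag_of (f g h)) y"
  by (simp add: conv_def)

lemma conv_of_of [simp]: "conv f (frag_of g) (frag_of h) = frag_of (f g h)"
  by (simp add: conv_def)

lemma conv_sum_right: "finite S \<Longrightarrow> conv f x (\<Sum>s\<in>S. y s) = (\<Sum>s\<in>S. conv f x (y s))"
  by (induction S rule: finite_induct) (simp_all add: conv_add_right)

text \<open>The four operations are kept apart so that one argument covers associativity in the
  group ring and compatibility of its action on divisors.\<close>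

lemma conv_assoc:
  assumes "\<And>g h w. g \<in> S \<Longrightarrow> h \<in> T \<Longrightarrow> w \<in> W \<Longrightarrow> f (m g h) w = f' g (f'' h w)"
    and x: "Poly_Mapping.keys x \<subseteq> S" and y: "Poly_Mapping.keys y \<subseteq> T" and z: "Poly_Mapping.keys z \<subseteq> W"
  shows "conv f (conv m x y) z = conv f' x (conv f'' y z)"
  using x
proof (induction x rule: frag_induction)
  case (one g)
  note g = one
  show ?case using y
  proof (induction y rule: frag_induction)
    case (one h)
    note h = one
    show ?case using z
      by (induction z rule: frag_induction) (simp_all add: assms(1)[OF g h] conv_diff_right)
  qed (simp_all add: conv_diff_left conv_diff_right)
qed (simp_all add: conv_diff_left)

lemma conv_comm:
  assumes "\<And>g h. g \<in> S \<Longrightarrow> h \<in> T \<Longrightarrow> f g h = f' h g"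
    and x: "Poly_Mapping.keys x \<subseteq> S" and y: "Poly_Mapping.keys y \<subseteq> T"
  shows "conv f x y = conv f' y x"
  using x
proof (induction x rule: frag_induction)
  case (one g)
  note g = one
  show ?case using y
    by (induction y rule: frag_induction) (simp_all add: assms(1)[OF g] conv_diff_right conv_diff_left)
qed (simp_all add: conv_diff_left conv_diff_right)

lemma conv_unit:
  assumes "\<And>h. h \<in> T \<Longrightarrow> f e h = h" "Poly_Mapping.keys y \<subseteq> T"
  shows "conv f (frag_of e) y = y"
  using assms(2) by (induction y rule: frag_induction) (simp_all add: assms(1) conv_diff_right)

lemma conv_keys:
  assumes "\<And>g h. g \<in> S \<Longrightarrow> h \<in> T \<Longrightarrow> f g h \<in> W" "Poly_Mapping.keys x \<subseteq> S" "Poly_Mapping.keys y \<subseteq> T"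
  shows "Poly_Mapping.keys (conv f x y) \<subseteq> W"
proof -
  have "Poly_Mapping.keys (frag_extend (\<lambda>h. frag_of (f g h)) y) \<subseteq> W" if "g \<in> S" for g
    using keys_frag_extend[of "\<lambda>h. frag_of (f g h)" y] assms(1)[OF that] assms(3) by fastforce
  then show ?thesis
    unfolding conv_def using keys_frag_extend[of "\<lambda>g. frag_extend (\<lambda>h. frag_of (f g h)) y" x] assms(2) by blast
qed

text \<open>Sending every basis element to one point makes the degree the single remaining
  coefficient, so additivity comes from \<open>frag_extend\<close>.\<close>

lemma frag_deg_lookup: "frag_deg x = Poly_Mapping.lookup (frag_extend (\<lambda>_. frag_of ()) x) ()"
  by (simp add: frag_deg_def frag_extend_def lookup_sum)

lemma frag_deg_simps [simp]: "frag_deg 0 = 0" "frag_deg (x + y) = frag_deg x + frag_deg y"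
    "frag_deg (x - y) = frag_deg x - frag_deg y" "frag_deg (- x) = - frag_deg x" "frag_deg (frag_of a) = 1"
    "frag_deg (frag_cmul k x) = k * frag_deg x"
  by (simp_all add: frag_deg_lookup frag_extend_add frag_extend_diff frag_extend_minus frag_extend_cmul lookup_add lookup_minus)

lemma frag_deg_sum: "frag_deg (\<Sum>s\<in>S. y s) = (\<Sum>s\<in>S. frag_deg (y s))"
  by (induction S rule: infinite_finite_induct) simp_all

lemma frag_deg_extend:
  assumes "\<And>s. s \<in> Poly_Mapping.keys x \<Longrightarrow> frag_deg (f s) = c" shows "frag_deg (frag_extend f x) = c * frag_deg x"
proof -
  have "frag_deg (frag_extend f x) = (\<Sum>i\<in>Poly_Mapping.keys x. Poly_Mapping.lookup x i * frag_deg (f i))"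
    by (simp add: frag_extend_def frag_deg_sum)
  also have "\<dots> = (\<Sum>i\<in>Poly_Mapping.keys x. Poly_Mapping.lookup x i * c)" by (rule sum.cong) (simp_all add: assms)
  finally show ?thesis by (simp add: frag_deg_def[of x] sum_distrib_left mult.commute)
qed

lemma frag_deg_conv: "frag_deg (conv f x y) = frag_deg x * frag_deg y"
proof -
  have "frag_deg (frag_extend (\<lambda>h. frag_of (f g h)) y) = frag_deg y" for g
    by (subst frag_deg_extend[where c = 1]) simp_all
  then show ?thesis unfolding conv_def by (subst frag_deg_extend[where c = "frag_deg y"]) simp_all
qed

lemma frag_cmul_conv: "frag_cmul k (conv f x y) = conv f (frag_cmul k x) y"
  by (simp add: conv_def frag_extend_cmul)

lemma group_ring_simps [simp]:
  "x \<otimes>\<^bsub>group_ring G\<^esub> y = conv (monoid.mult G) x y" "x \<oplus>\<^bsub>group_ring G\<^esub> y = x + y" "\<zero>\<^bsub>group_ring G\<^esub> = 0"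
  "\<one>\<^bsub>group_ring G\<^esub> = frag_of \<one>\<^bsub>G\<^esub>" "x \<in> carrier (group_ring G) \<longleftrightarrow> Poly_Mapping.keys x \<subseteq> carrier G"
  by (simp_all add: group_ring_def conv_def)

section \<open>The group ring modulo its norm element\<close>

locale fin_comm_group = comm_group G for G :: "'g monoid" (structure) +
  assumes fin: "finite (carrier G)"
begin

abbreviation "R \<equiv> group_ring G"
abbreviation "Nm \<equiv> norm_element G"

lemma group_ring_cring: "cring R"
proof (rule cringI)
  show "abelian_group R"
  proof (rule abelian_groupI)
    fix x y assume "x \<in> carrier R" "y \<in> carrier R"
    then show "x \<oplus>\<^bsub>R\<^esub> y \<in> carrier R" using keys_add[of x y] by simp blast
  next
    fix x assume "x \<in> carrier R"
    then show "\<exists>y\<in>carrier R. y \<oplus>\<^bsub>R\<^esub> x = \<zero>\<^bsub>R\<^esub>" by (intro bexI[of _ "- x"]) simp_all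
  qed (simp_all add: add.assoc add.commute)
  show "comm_monoid R"
  proof (rule comm_monoidI)
    fix x y z assume xyz: "x \<in> carrier R" "y \<in> carrier R" "z \<in> carrier R"
    show "x \<otimes>\<^bsub>R\<^esub> y \<in> carrier R"
      using xyz by simp (rule conv_keys[where S = "carrier G" and T = "carrier G"], auto)
    show "x \<otimes>\<^bsub>R\<^esub> y \<otimes>\<^bsub>R\<^esub> z = x \<otimes>\<^bsub>R\<^esub> (y \<otimes>\<^bsub>R\<^esub> z)"
      using xyz by simp (rule conv_assoc[where S = "carrier G" and T = "carrier G" and W = "carrier G"], auto simp: m_assoc)
    show "x \<otimes>\<^bsub>R\<^esub> y = y \<otimes>\<^bsub>R\<^esub> x"
      using xyz by simp (rule conv_comm[where S = "carrier G" and T = "carrier G"], auto simp: m_comm)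
    show "\<one>\<^bsub>R\<^esub> \<otimes>\<^bsub>R\<^esub> x = x"
      using xyz by simp (rule conv_unit[where T = "carrier G"], auto)
  qed simp
qed (simp add: conv_add_left)

sublocale R: plain_cring R
  unfolding plain_cring_def by (rule group_ring_cring)

lemma R_neg: "x \<in> carrier R \<Longrightarrow> \<ominus>\<^bsub>R\<^esub> x = - x"
  by (rule R.minus_equality) simp_all

lemma R_minus: "x \<in> carrier R \<Longrightarrow> y \<in> carrier R \<Longrightarrow> x \<ominus>\<^bsub>R\<^esub> y = x - y"
  by (simp add: a_minus_def R_neg)

lemma frag_cmul_R: "x \<in> carrier R \<Longrightarrow> frag_cmul k x \<in> carrier R"
  using keys_cmul[of k x] by simp

lemma norm_closed: "Nm \<in> carrier R"
proof -
  have "Poly_Mapping.keys Nm \<subseteq> (\<Union>g\<in>carrier G. Poly_Mapping.keys (frag_of g :: _ \<Rightarrow>\<^sub>0 int))"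
    unfolding norm_element_def by (rule keys_sum)
  then show ?thesis by simp
qed

lemma lookup_norm: "g \<in> carrier G \<Longrightarrow> Poly_Mapping.lookup Nm g = 1"
  by (simp add: norm_element_def lookup_sum fin)

lemma frag_deg_norm: "frag_deg Nm = int (card (carrier G))"
  by (simp add: norm_element_def frag_deg_sum)

text \<open>Multiplication by a group element permutes the summands of the norm. Consequently the
  norm ideal consists of the integer multiples of the norm.\<close>

lemma mult_norm:
  assumes "x \<in> carrier R" shows "x \<otimes>\<^bsub>R\<^esub> Nm = frag_cmul (frag_deg x) Nm"
proof -
  have "Poly_Mapping.keys x \<subseteq> carrier G" using assms by simp
  then have "conv (monoid.mult G) x Nm = frag_cmul (frag_deg x) Nm"
  proof (induction x rule: frag_induction)
    case (one g)
    have "conv (monoid.mult G) (frag_of g) Nm = (\<Sum>h\<in>carrier G. frag_of (g \<otimes> h))"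
      by (simp add: norm_element_def conv_sum_right fin)
    also have "\<dots> = (\<Sum>h\<in>(\<otimes>) g ` carrier G. frag_of h)"
      by (rule sum.reindex_cong[where l = "(\<otimes>) g", symmetric]) (use one in \<open>auto simp: inj_on_def\<close>)
    also have "(\<otimes>) g ` carrier G = carrier G" using one surj_const_mult by simp
    finally show ?case by (simp add: norm_element_def)
  qed (simp_all add: conv_diff_left frag_cmul_diff_distrib)
  then show ?thesis by simp
qed

abbreviation "I \<equiv> PIdl\<^bsub>R\<^esub> Nm"
abbreviation "B \<equiv> R Quot I"
abbreviation "pr \<equiv> (\<lambda>r. I +>\<^bsub>R\<^esub> r)"

lemma norm_ideal: "ideal I R"
  by (rule R.cgenideal_ideal[OF norm_closed])

lemma mem_norm_ideal: "x \<in> I \<longleftrightarrow> (\<exists>k. x = frag_cmul k Nm)"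
proof
  assume "x \<in> I"
  then obtain r where "r \<in> carrier R" "x = r \<otimes>\<^bsub>R\<^esub> Nm" unfolding cgenideal_def by blast
  then show "\<exists>k. x = frag_cmul k Nm" using mult_norm by blast
next
  assume "\<exists>k. x = frag_cmul k Nm"
  then obtain k where k: "x = frag_cmul k Nm" by blast
  have c: "frag_cmul k \<one>\<^bsub>R\<^esub> \<in> carrier R" by (rule frag_cmul_R) simp
  have "frag_cmul k \<one>\<^bsub>R\<^esub> \<otimes>\<^bsub>R\<^esub> Nm = x" unfolding mult_norm[OF c] k by simp
  then show "x \<in> I" using c unfolding cgenideal_def by blast
qed

sublocale B: plain_cring B
  unfolding plain_cring_def by (rule ideal.quotient_is_cring[OF norm_ideal group_ring_cring])

lemma pr_hom: "pr \<in> Ring.ring_hom R B"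
  by (rule ideal.rcos_ring_hom[OF norm_ideal])

lemma pr_surj: "pr ` carrier R = carrier B"
  by (auto simp: FactRing_def A_RCOSETS_def')

lemma pr_eq_iff: "x \<in> carrier R \<Longrightarrow> y \<in> carrier R \<Longrightarrow> pr x = pr y \<longleftrightarrow> x - y \<in> I"
  using R.quotient_eq_iff_same_a_r_cos[OF norm_ideal, of x y] R_minus by simp

lemma pr_zero: "pr 0 = \<zero>\<^bsub>B\<^esub>"
  using ring_hom_zero[OF pr_hom R.ring_axioms B.ring_axioms] by simp

lemma pr_eq_zero_iff: "x \<in> carrier R \<Longrightarrow> pr x = \<zero>\<^bsub>B\<^esub> \<longleftrightarrow> x \<in> I"
  using pr_eq_iff[of x 0] pr_zero by simp

text \<open>If \<open>k\<close> times \<open>x\<close> is an integer multiple of the norm, all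
  coefficients of \<open>x\<close> over the group agree, because \<open>k\<close> cancels in the
  integers. So \<open>x\<close> is itself a multiple of the norm.\<close>

lemma integer_nzd:
  assumes k: "k \<noteq> 0" shows "pr (frag_cmul k \<one>\<^bsub>R\<^esub>) \<in> non_zero_divisors B"
proof -
  have c: "frag_cmul k \<one>\<^bsub>R\<^esub> \<in> carrier R" by (rule frag_cmul_R) simp
  have "b = \<zero>\<^bsub>B\<^esub>" if b: "b \<in> carrier B" and z: "pr (frag_cmul k \<one>\<^bsub>R\<^esub>) \<otimes>\<^bsub>B\<^esub> b = \<zero>\<^bsub>B\<^esub>" for b
  proof -
    obtain x where x: "x \<in> carrier R" "b = pr x" using b pr_surj by blast
    have e: "frag_cmul k \<one>\<^bsub>R\<^esub> \<otimes>\<^bsub>R\<^esub> x = frag_cmul k x"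
      using R.l_one[OF x(1)] by (simp add: frag_cmul_conv[symmetric])
    have "pr (frag_cmul k x) = \<zero>\<^bsub>B\<^esub>" using ring_hom_mult[OF pr_hom c x(1)] z unfolding x(2) e by simp
    then obtain l where l: "frag_cmul k x = frag_cmul l Nm"
      using pr_eq_zero_iff[OF frag_cmul_R[OF x(1)]] mem_norm_ideal by blast
    have coeff: "k * Poly_Mapping.lookup x g = l" if "g \<in> carrier G" for g
      using arg_cong[OF l, of "\<lambda>z. Poly_Mapping.lookup z g"] lookup_norm[OF that] by simp
    have "x = frag_cmul (Poly_Mapping.lookup x \<one>) Nm"
    proof (rule poly_mapping_eqI)
      fix g
      show "Poly_Mapping.lookup x g = Poly_Mapping.lookup (frag_cmul (Poly_Mapping.lookup x \<one>) Nm) g"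
      proof (cases "g \<in> carrier G")
        case True
        have "k * Poly_Mapping.lookup x g = k * Poly_Mapping.lookup x \<one>" using coeff True by simp
        then show ?thesis using k lookup_norm[OF True] by simp
      next
        case False
        then have "g \<notin> Poly_Mapping.keys x" "g \<notin> Poly_Mapping.keys Nm" using x(1) norm_closed by auto
        then show ?thesis by (simp add: in_keys_iff)
      qed
    qed
    then have "x \<in> I" using mem_norm_ideal by blast
    then show ?thesis using pr_eq_zero_iff[OF x(1)] x(2) by simp
  qed
  moreover have "pr (frag_cmul k \<one>\<^bsub>R\<^esub>) \<in> carrier B" by (rule ring_hom_closed[OF pr_hom c])
  ultimately show ?thesis unfolding non_zero_divisors_def by blast
qed

end

section \<open>Change of rings along a quotient\<close>

lemma (in lmod) eq_if_minus_zero: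
  assumes "x \<in> carrier M" "y \<in> carrier M" "x \<ominus>\<^bsub>M\<^esub> y = \<zero>\<^bsub>M\<^esub>" shows "x = y"
proof -
  have "x = (x \<ominus>\<^bsub>M\<^esub> y) \<oplus>\<^bsub>M\<^esub> y" using assms(1,2) by (simp add: a_minus_def M.a_assoc M.l_neg)
  then show ?thesis using assms by simp
qed

locale ring_quotient = R: plain_cring R + B: plain_cring B
  for R :: "'r ring" and B :: "'b ring" and \<phi> :: "'r \<Rightarrow> 'b" +
  assumes hom: "\<phi> \<in> Ring.ring_hom R B" and surj: "\<phi> ` carrier R = carrier B"
begin

lemmas hom_simps = ring_hom_closed[OF hom] ring_hom_add[OF hom] ring_hom_mult[OF hom] ring_hom_one[OF hom]

text \<open>As \<open>\<theta>\<close> and \<open>\<phi>\<close> are onto, every module axiom for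
  \<open>Q\<close> is the image of one for \<open>M\<close>.\<close>

lemma lmod_transfer:
  assumes M: "lmod R M" and \<theta>: "\<theta> ` carrier M = carrier Q"
    and add: "\<And>x y. x \<in> carrier M \<Longrightarrow> y \<in> carrier M \<Longrightarrow> \<theta> (x \<oplus>\<^bsub>M\<^esub> y) = \<theta> x \<oplus>\<^bsub>Q\<^esub> \<theta> y"
    and zero: "\<theta> \<zero>\<^bsub>M\<^esub> = \<zero>\<^bsub>Q\<^esub>"
    and smult: "\<And>a x. a \<in> carrier R \<Longrightarrow> x \<in> carrier M \<Longrightarrow> \<theta> (a \<odot>\<^bsub>M\<^esub> x) = \<phi> a \<odot>\<^bsub>Q\<^esub> \<theta> x"
  shows "lmod B Q"
proof -
  interpret M: lmod R M by (rule M)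
  have ex: "\<exists>x\<in>carrier M. q = \<theta> x" if "q \<in> carrier Q" for q using that \<theta> by blast
  have exB: "\<exists>a\<in>carrier R. b = \<phi> a" if "b \<in> carrier B" for b using that surj by blast
  have cl: "\<theta> x \<in> carrier Q" if "x \<in> carrier M" for x using that \<theta> by blast
  show ?thesis
  proof (rule lmod_moduleI)
    show "cring B" by (rule B.is_cring)
    show "\<zero>\<^bsub>Q\<^esub> \<in> carrier Q" using cl[OF M.zero_closed] zero by simp
    fix p assume "p \<in> carrier Q"
    then obtain x where x: "x \<in> carrier M" "p = \<theta> x" using ex by blast
    show "\<zero>\<^bsub>Q\<^esub> \<oplus>\<^bsub>Q\<^esub> p = p" unfolding x(2) zero[symmetric] using x(1) by (simp add: add[symmetric])
    show "\<exists>q\<in>carrier Q. q \<oplus>\<^bsub>Q\<^esub> p = \<zero>\<^bsub>Q\<^esub>"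
      unfolding x(2) zero[symmetric] using x(1) cl[of "\<ominus>\<^bsub>M\<^esub> x"]
      by (intro bexI[of _ "\<theta> (\<ominus>\<^bsub>M\<^esub> x)"]) (simp_all add: add[symmetric] M.l_neg)
    show "\<one>\<^bsub>B\<^esub> \<odot>\<^bsub>Q\<^esub> p = p"
      unfolding x(2) using x(1) smult[OF R.one_closed x(1)] by (simp add: hom_simps)
    fix q assume "q \<in> carrier Q"
    then obtain y where y: "y \<in> carrier M" "q = \<theta> y" using ex by blast
    show "p \<oplus>\<^bsub>Q\<^esub> q \<in> carrier Q" unfolding x(2) y(2) using x(1) y(1) cl by (simp add: add[symmetric])
    show "p \<oplus>\<^bsub>Q\<^esub> q = q \<oplus>\<^bsub>Q\<^esub> p"
      unfolding x(2) y(2) using x(1) y(1) M.a_comm by (simp add: add[symmetric])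
    fix r assume "r \<in> carrier Q"
    then obtain z where z: "z \<in> carrier M" "r = \<theta> z" using ex by blast
    show "p \<oplus>\<^bsub>Q\<^esub> q \<oplus>\<^bsub>Q\<^esub> r = p \<oplus>\<^bsub>Q\<^esub> (q \<oplus>\<^bsub>Q\<^esub> r)"
      unfolding x(2) y(2) z(2) using x(1) y(1) z(1) M.a_assoc by (simp add: add[symmetric])
  next
    fix b p assume "b \<in> carrier B" "p \<in> carrier Q"
    then obtain a x where a: "a \<in> carrier R" "b = \<phi> a" and x: "x \<in> carrier M" "p = \<theta> x" using ex exB by blast
    show "b \<odot>\<^bsub>Q\<^esub> p \<in> carrier Q" unfolding a(2) x(2) using a(1) x(1) cl by (simp add: smult[symmetric])
    show "b \<odot>\<^bsub>Q\<^esub> (p \<oplus>\<^bsub>Q\<^esub> q) = (b \<odot>\<^bsub>Q\<^esub> p) \<oplus>\<^bsub>Q\<^esub> (b \<odot>\<^bsub>Q\<^esub> q)" if q: "q \<in> carrier Q" for q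
    proof -
      obtain y where y: "y \<in> carrier M" "q = \<theta> y" using ex[OF q] by blast
      show ?thesis unfolding a(2) x(2) y(2) using a(1) x(1) y(1)
        by (simp add: smult[symmetric] add[symmetric] M.smult_r_distr)
    qed
    fix c assume "c \<in> carrier B"
    then obtain d where d: "d \<in> carrier R" "c = \<phi> d" using exB by blast
    show "(b \<oplus>\<^bsub>B\<^esub> c) \<odot>\<^bsub>Q\<^esub> p = (b \<odot>\<^bsub>Q\<^esub> p) \<oplus>\<^bsub>Q\<^esub> (c \<odot>\<^bsub>Q\<^esub> p)"
      unfolding a(2) d(2) x(2) using a(1) d(1) x(1)
      by (simp add: smult[symmetric] add[symmetric] M.smult_l_distr ring_hom_add[OF hom, symmetric])
    show "(b \<otimes>\<^bsub>B\<^esub> c) \<odot>\<^bsub>Q\<^esub> p = b \<odot>\<^bsub>Q\<^esub> (c \<odot>\<^bsub>Q\<^esub> p)"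
      unfolding a(2) d(2) x(2) using a(1) d(1) x(1)
      by (simp add: smult[symmetric] M.smult_assoc1 ring_hom_mult[OF hom, symmetric])
  qed
qed

end

lemma (in plain_cring) ring_quotient_Quot:
  assumes "ideal I A" shows "ring_quotient A (A Quot I) (\<lambda>r. I +> r)"
proof (intro ring_quotient.intro ring_quotient_axioms.intro plain_cring.intro plain_cring_axioms)
  show "cring A" by (rule is_cring)
  show "cring (A Quot I)" by (rule ideal.quotient_is_cring[OF assms is_cring])
  show "(+>) I \<in> Ring.ring_hom A (A Quot I)" by (rule ideal.rcos_ring_hom[OF assms])
  show "(+>) I ` carrier A = carrier (A Quot I)" by (auto simp: FactRing_def A_RCOSETS_def')
qed

lemma descend_simps [simp]:
  "carrier (descend_module M) = carrier M" "x \<oplus>\<^bsub>descend_module M\<^esub> y = x \<oplus>\<^bsub>M\<^esub> y" "\<zero>\<^bsub>descend_module M\<^esub> = \<zero>\<^bsub>M\<^esub>"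
  by (simp_all add: descend_module_def)

text \<open>The ideal kills the module, so all elements of a coset act alike and
  \<open>the_elem\<close> extracts their common value.\<close>

lemma (in plain_cring) descend:
  assumes I: "ideal I A" and M: "lmod A M" and ann: "\<And>a x. a \<in> I \<Longrightarrow> x \<in> carrier M \<Longrightarrow> a \<odot>\<^bsub>M\<^esub> x = \<zero>\<^bsub>M\<^esub>"
  shows descend_smult: "\<And>a x. a \<in> carrier A \<Longrightarrow> x \<in> carrier M \<Longrightarrow> (I +> a) \<odot>\<^bsub>descend_module M\<^esub> x = a \<odot>\<^bsub>M\<^esub> x"
    and descend_lmod: "lmod (A Quot I) (descend_module M)"
proof -
  interpret M: lmod A M by (rule M)
  interpret I: ideal I A by (rule I)
  interpret Q: ring_quotient A "A Quot I" "\<lambda>r. I +> r" by (rule ring_quotient_Quot[OF I])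
  show sm: "(I +> a) \<odot>\<^bsub>descend_module M\<^esub> x = a \<odot>\<^bsub>M\<^esub> x" if a: "a \<in> carrier A" and x: "x \<in> carrier M" for a x
  proof -
    have "(\<lambda>a. a \<odot>\<^bsub>M\<^esub> x) ` (I +> a) = {a \<odot>\<^bsub>M\<^esub> x}"
    proof -
      have "(i \<oplus> a) \<odot>\<^bsub>M\<^esub> x = a \<odot>\<^bsub>M\<^esub> x" if "i \<in> I" for i
        using that a x I.Icarr by (simp add: M.smult_l_distr ann)
      moreover have "I +> a = (\<lambda>i. i \<oplus> a) ` I" by (auto simp: a_r_coset_def')
      moreover have "I \<noteq> {}" using I.zero_closed by blast
      ultimately show ?thesis by (auto simp: image_image)
    qed
    then show ?thesis by (simp add: descend_module_def)
  qed
  show "lmod (A Quot I) (descend_module M)"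
    by (rule Q.lmod_transfer[OF M, where \<theta> = "\<lambda>x. x"]) (simp_all add: sm)
qed

section \<open>Extension of scalars along a surjection\<close>

context ring_quotient
begin

context
  fixes M :: "('r, 'm) module"
  assumes M: "lmod R M"
begin

interpretation M: lmod R M by (rule M)

private abbreviation "S \<equiv> generate (free_Abelian_group (carrier B \<times> carrier M)) (tensor_relations R B \<phi> M)"
private abbreviation "Fm \<equiv> carrier (free_Abelian_group (carrier B \<times> carrier M))"
private abbreviation "T \<equiv> base_change R B \<phi> M"
private abbreviation "sm b \<equiv> frag_extend (\<lambda>(c, m). frag_of (b \<otimes>\<^bsub>B\<^esub> c, m))"

private lemma rel_carrier: "tensor_relations R B \<phi> M \<subseteq> Fm"
proof
  have diff: "x - y \<in> Fm" if "x \<in> Fm" "y \<in> Fm" for x y using that keys_diff[of x y] by auto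
  fix x assume "x \<in> tensor_relations R B \<phi> M"
  then show "x \<in> Fm" unfolding tensor_relations_def
    by (elim UnE CollectE exE conjE) (auto intro!: diff simp del: carrier_free_Abelian_group_iff simp: hom_simps)
qed

private lemma S_sub: "subgroup S (free_Abelian_group (carrier B \<times> carrier M))"
  by (rule group.generate_is_subgroup[OF _ rel_carrier]) simp

private lemma S_carrier: "x \<in> S \<Longrightarrow> x \<in> Fm"
  using subgroup.subset[OF S_sub] by blast

private lemma S_zero: "0 \<in> S" using subgroup.one_closed[OF S_sub] by simp
private lemma S_add: "x \<in> S \<Longrightarrow> y \<in> S \<Longrightarrow> x + y \<in> S" using subgroup.m_closed[OF S_sub] by simp
private lemma S_minus: "x \<in> S \<Longrightarrow> - x \<in> S" 
  using subgroup.m_inv_closed[OF S_sub, of x] S_carrier[of x] by simp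
private lemma S_diff: "x \<in> S \<Longrightarrow> y \<in> S \<Longrightarrow> x - y \<in> S" using S_add[OF _ S_minus, of x y] by simp

private lemma S_add_right: 
  "b \<in> carrier B \<Longrightarrow> m \<in> carrier M \<Longrightarrow> l \<in> carrier M \<Longrightarrow> frag_of (b, m \<oplus>\<^bsub>M\<^esub> l) - frag_of (b, m) - frag_of (b, l) \<in> S"
  by (rule generate.incl) (unfold tensor_relations_def, blast)

private lemma S_balance: 
  "a \<in> carrier R \<Longrightarrow> b \<in> carrier B \<Longrightarrow> m \<in> carrier M \<Longrightarrow> frag_of (b \<otimes>\<^bsub>B\<^esub> \<phi> a, m) - frag_of (b, a \<odot>\<^bsub>M\<^esub> m) \<in> S"
  by (rule generate.incl) (unfold tensor_relations_def, blast)

private lemma S_add_left: 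
  "b \<in> carrier B \<Longrightarrow> c \<in> carrier B \<Longrightarrow> m \<in> carrier M \<Longrightarrow> frag_of (b \<oplus>\<^bsub>B\<^esub> c, m) - frag_of (b, m) - frag_of (c, m) \<in> S"
  by (rule generate.incl) (unfold tensor_relations_def, blast)

text \<open>Multiplying first components by \<open>b\<close> sends each kind of tensor relation to a
  relation of the same kind.\<close>

private lemma rel_sm:
  assumes b: "b \<in> carrier B" and h: "h \<in> tensor_relations R B \<phi> M" shows "sm b h \<in> S"
proof -
  have "h \<in> {frag_of (b \<oplus>\<^bsub>B\<^esub> c, m) - frag_of (b, m) - frag_of (c, m) | b c m. b \<in> carrier B \<and> c \<in> carrier B \<and> m \<in> carrier M} \<union>
     {frag_of (b, m \<oplus>\<^bsub>M\<^esub> l) - frag_of (b, m) - frag_of (b, l) | b m l. b \<in> carrier B \<and> m \<in> carrier M \<and> l \<in> carrier M} \<union>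
     {frag_of (b \<otimes>\<^bsub>B\<^esub> \<phi> a, m) - frag_of (b, a \<odot>\<^bsub>M\<^esub> m) | a b m. a \<in> carrier R \<and> b \<in> carrier B \<and> m \<in> carrier M}"
    using h unfolding tensor_relations_def .
  then show ?thesis
  proof (elim UnE CollectE exE conjE)
    fix c d m assume h: "h = frag_of (c \<oplus>\<^bsub>B\<^esub> d, m) - frag_of (c, m) - frag_of (d, m)" and c: "c \<in> carrier B" "d \<in> carrier B" "m \<in> carrier M"
    show ?thesis unfolding h using S_add_left[of "b \<otimes>\<^bsub>B\<^esub> c" "b \<otimes>\<^bsub>B\<^esub> d" m] b c by (simp add: frag_extend_diff B.r_distr)
  next
    fix c m l assume h: "h = frag_of (c, m \<oplus>\<^bsub>M\<^esub> l) - frag_of (c, m) - frag_of (c, l)" and c: "c \<in> carrier B" "m \<in> carrier M" "l \<in> carrier M"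
    show ?thesis unfolding h using S_add_right[of "b \<otimes>\<^bsub>B\<^esub> c" m l] b c by (simp add: frag_extend_diff)
  next
    fix a c m assume h: "h = frag_of (c \<otimes>\<^bsub>B\<^esub> \<phi> a, m) - frag_of (c, a \<odot>\<^bsub>M\<^esub> m)" and c: "a \<in> carrier R" "c \<in> carrier B" "m \<in> carrier M"
    show ?thesis unfolding h using S_balance[of a "b \<otimes>\<^bsub>B\<^esub> c" m] b c by (simp add: frag_extend_diff B.m_assoc hom_simps)
  qed
qed

private lemma S_sm:
  assumes b: "b \<in> carrier B" and x: "x \<in> S" shows "sm b x \<in> S"
  using x
proof (induction x rule: generate.induct)
  case one
  then show ?case using S_zero by simp
next
  case (incl h)
  then show ?case by (rule rel_sm[OF b])
next
  case (inv h)
  moreover have "h \<in> Fm" using inv rel_carrier by blast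
  ultimately show ?case using S_minus rel_sm[OF b, of h] by (simp add: frag_extend_minus)
next
  case (eng h1 h2)
  then show ?case using S_add by (simp add: frag_extend_add)
qed

text \<open>The free abelian group on pairs is not a \<open>B\<close>-module: additivity in the
  scalar holds only modulo the relations. The results on quotients of modules do not apply to it,
  and the cosets are treated directly.\<close>

definition tensor_coset :: "('b \<times> 'm \<Rightarrow>\<^sub>0 int) \<Rightarrow> ('b \<times> 'm \<Rightarrow>\<^sub>0 int) set" where
  "tensor_coset x = (\<lambda>s. s + x) ` S"

private lemma coset_eq_iff: "tensor_coset x = tensor_coset y \<longleftrightarrow> x - y \<in> S"
proof
  assume "tensor_coset x = tensor_coset y"
  moreover have "x \<in> tensor_coset x" unfolding tensor_coset_def using S_zero by force
  ultimately obtain s where "s \<in> S" "x = s + y" unfolding tensor_coset_def by blast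
  then show "x - y \<in> S" by simp
next
  have sub: "tensor_coset x \<subseteq> tensor_coset y" if "x - y \<in> S" for x y
  proof
    fix z assume "z \<in> tensor_coset x"
    then obtain s where s: "s \<in> S" "z = s + x" unfolding tensor_coset_def by blast
    have "z = (s + (x - y)) + y" using s by simp
    then show "z \<in> tensor_coset y" unfolding tensor_coset_def using S_add[OF s(1) that] by blast
  qed
  assume "x - y \<in> S"
  then show "tensor_coset x = tensor_coset y" using sub[of x y] sub[of y x] S_minus[of "x - y"] by simp
qed

private lemma T_carrier: "carrier T = tensor_coset ` Fm"
  by (auto simp: base_change_def quotient_module_def A_RCOSETS_def' a_r_coset_def' tensor_coset_def)

private lemma T_zero: "\<zero>\<^bsub>T\<^esub> = tensor_coset 0"
  by (simp add: base_change_def quotient_module_def tensor_coset_def)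

private lemma T_add: "tensor_coset x \<oplus>\<^bsub>T\<^esub> tensor_coset y = tensor_coset (x + y)"
proof -
  have "tensor_coset x \<oplus>\<^bsub>T\<^esub> tensor_coset y = (\<Union>h\<in>tensor_coset x. \<Union>k\<in>tensor_coset y. {h + k})"
    by (simp add: base_change_def quotient_module_def set_add_def set_mult_def)
  also have "\<dots> = tensor_coset (x + y)"
  proof (intro Set.set_eqI iffI)
    fix z assume "z \<in> (\<Union>h\<in>tensor_coset x. \<Union>k\<in>tensor_coset y. {h + k})"
    then obtain s t where "s \<in> S" "t \<in> S" "z = (s + x) + (t + y)" unfolding tensor_coset_def by blast
    then have "s + t \<in> S" "z = (s + t) + (x + y)" by (simp_all add: S_add algebra_simps)
    then show "z \<in> tensor_coset (x + y)" unfolding tensor_coset_def by blast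
  next
    fix z assume "z \<in> tensor_coset (x + y)"
    then obtain s where s: "s \<in> S" "z = s + (x + y)" unfolding tensor_coset_def by blast
    have "z = (s + x) + (0 + y)" using s by (simp add: algebra_simps)
    then show "z \<in> (\<Union>h\<in>tensor_coset x. \<Union>k\<in>tensor_coset y. {h + k})"
      unfolding tensor_coset_def using s(1) S_zero by blast
  qed
  finally show ?thesis .
qed

private lemma T_smult:
  assumes b: "b \<in> carrier B" shows "b \<odot>\<^bsub>T\<^esub> tensor_coset x = tensor_coset (sm b x)"
proof -
  have "b \<odot>\<^bsub>T\<^esub> tensor_coset x = (\<Union>y\<in>tensor_coset x. tensor_coset (sm b y))"
    by (auto simp: base_change_def quotient_module_def tensor_coset_def a_r_coset_def')
  also have "\<dots> = tensor_coset (sm b x)"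
  proof (rule SUP_eq_const)
    show "tensor_coset x \<noteq> {}" unfolding tensor_coset_def using S_zero by blast
    fix y assume "y \<in> tensor_coset x"
    then obtain s where s: "s \<in> S" "y = s + x" unfolding tensor_coset_def by blast
    show "tensor_coset (sm b y) = tensor_coset (sm b x)"
      unfolding coset_eq_iff using S_sm[OF b s(1)] s(2) by (simp add: frag_extend_add)
  qed
  finally show ?thesis .
qed

definition unit_tensor :: "'m \<Rightarrow> ('b \<times> 'm \<Rightarrow>\<^sub>0 int) set" where
  "unit_tensor m = tensor_coset (frag_of (\<one>\<^bsub>B\<^esub>, m))"

lemma unit_tensor_add:
  "x \<in> carrier M \<Longrightarrow> y \<in> carrier M \<Longrightarrow> unit_tensor (x \<oplus>\<^bsub>M\<^esub> y) = unit_tensor x \<oplus>\<^bsub>T\<^esub> unit_tensor y"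
  using S_add_right[OF B.one_closed, of x y] by (simp add: unit_tensor_def T_add coset_eq_iff diff_diff_add)

lemma unit_tensor_zero: "unit_tensor \<zero>\<^bsub>M\<^esub> = \<zero>\<^bsub>T\<^esub>"
  using S_add_right[OF B.one_closed M.zero_closed M.zero_closed] S_minus
  by (force simp: unit_tensor_def T_zero coset_eq_iff)

lemma unit_tensor_smult:
  assumes "a \<in> carrier R" "x \<in> carrier M" shows "unit_tensor (a \<odot>\<^bsub>M\<^esub> x) = \<phi> a \<odot>\<^bsub>T\<^esub> unit_tensor x"
  using S_minus[OF S_balance[OF assms(1) B.one_closed assms(2)]] assms
  by (simp add: unit_tensor_def T_smult hom_simps coset_eq_iff)

text \<open>Since \<open>\<phi>\<close> is onto, a scalar in the first component moves to the
  second: the tensor of \<open>\<phi> a\<close> and \<open>m\<close> is that of 1 and the multiple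
  of \<open>m\<close> by \<open>a\<close>. Differences of such tensors are again of this
  form.\<close>

lemma unit_tensor_surj: "unit_tensor ` carrier M = carrier T"
proof
  show "unit_tensor ` carrier M \<subseteq> carrier T" unfolding T_carrier unit_tensor_def by auto
  show "carrier T \<subseteq> unit_tensor ` carrier M"
  proof
    fix t assume "t \<in> carrier T"
    then obtain x where x: "Poly_Mapping.keys x \<subseteq> carrier B \<times> carrier M" "t = tensor_coset x" unfolding T_carrier by auto
    from x(1) have "\<exists>j\<in>carrier M. x - frag_of (\<one>\<^bsub>B\<^esub>, j) \<in> S"
    proof (induction x rule: frag_induction)
      case zero
      show ?case using unit_tensor_zero unfolding unit_tensor_def T_zero coset_eq_iff using S_minus
        by (intro bexI[OF _ M.zero_closed]) force
    next
      case (one bm)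
      then obtain b m where bm: "bm = (b, m)" "b \<in> carrier B" "m \<in> carrier M" by blast
      then obtain a where a: "a \<in> carrier R" "b = \<phi> a" using surj by blast
      show ?case using S_balance[OF a(1) B.one_closed bm(3)] a bm
        by (intro bexI[OF _ M.smult_closed[OF a(1) bm(3)]]) (simp add: hom_simps)
    next
      case (diff x y)
      then obtain j l where j: "j \<in> carrier M" "x - frag_of (\<one>\<^bsub>B\<^esub>, j) \<in> S" and l: "l \<in> carrier M" "y - frag_of (\<one>\<^bsub>B\<^esub>, l) \<in> S"
        by blast
      have jl: "j \<ominus>\<^bsub>M\<^esub> l \<in> carrier M" using j l by simp
      have e: "(j \<ominus>\<^bsub>M\<^esub> l) \<oplus>\<^bsub>M\<^esub> l = j" using j(1) l(1) by (simp add: a_minus_def M.a_assoc M.l_neg)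
      have "(x - frag_of (\<one>\<^bsub>B\<^esub>, j)) - (y - frag_of (\<one>\<^bsub>B\<^esub>, l)) +
          (frag_of (\<one>\<^bsub>B\<^esub>, (j \<ominus>\<^bsub>M\<^esub> l) \<oplus>\<^bsub>M\<^esub> l) - frag_of (\<one>\<^bsub>B\<^esub>, j \<ominus>\<^bsub>M\<^esub> l) - frag_of (\<one>\<^bsub>B\<^esub>, l)) \<in> S"
        by (rule S_add[OF S_diff[OF j(2) l(2)] S_add_right[OF B.one_closed jl l(1)]])
      then show ?case unfolding e by (intro bexI[OF _ jl]) (simp add: algebra_simps)
    qed
    then show "t \<in> unit_tensor ` carrier M" unfolding x(2) unit_tensor_def using coset_eq_iff by blast
  qed
qed

lemma base_change_lmod: "lmod B T"
  by (rule lmod_transfer[OF M unit_tensor_surj]) (simp_all add: unit_tensor_add unit_tensor_zero unit_tensor_smult)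

text \<open>
  Since every tensor is of the form \<open>1 \<otimes> m\<close>, the map induced by \<open>f\<close> on the base change is
  injective as soon as each element of the kernel of \<open>f\<close> is a multiple by the kernel of \<open>\<phi>\<close>.
\<close>

lemma base_change_embedding:
  assumes P: "lmod B P" and f: "\<And>x. x \<in> carrier M \<Longrightarrow> f x \<in> carrier P"
    and f_add: "\<And>x y. x \<in> carrier M \<Longrightarrow> y \<in> carrier M \<Longrightarrow> f (x \<oplus>\<^bsub>M\<^esub> y) = f x \<oplus>\<^bsub>P\<^esub> f y"
    and f_smult: "\<And>a x. a \<in> carrier R \<Longrightarrow> x \<in> carrier M \<Longrightarrow> f (a \<odot>\<^bsub>M\<^esub> x) = \<phi> a \<odot>\<^bsub>P\<^esub> f x"
    and ker: "\<And>x. x \<in> carrier M \<Longrightarrow> f x = \<zero>\<^bsub>P\<^esub> \<Longrightarrow> \<exists>a\<in>carrier R. \<exists>m\<in>carrier M. \<phi> a = \<zero>\<^bsub>B\<^esub> \<and> x = a \<odot>\<^bsub>M\<^esub> m"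
  obtains i where "i \<in> module_hom B T P" "inj_on i (carrier T)" "i ` carrier T = f ` carrier M"
proof -
  interpret P: lmod B P by (rule P)
  interpret T: lmod B T by (rule base_change_lmod)
  have u_cl: "unit_tensor x \<in> carrier T" if "x \<in> carrier M" for x using that unit_tensor_surj by blast
  \<comment> \<open>The balanced map sending a pair to the multiple of \<open>f m\<close> by
    \<open>b\<close> extends to the free abelian group and kills the tensor relations; this makes
    the values on unit tensors well defined.\<close>
  have "(\<lambda>(b, m). b \<odot>\<^bsub>P\<^esub> f m) ` (carrier B \<times> carrier M) \<subseteq> carrier (add_monoid P)" using f by auto
  then obtain h where h: "h \<in> hom (free_Abelian_group (carrier B \<times> carrier M)) (add_monoid P)"
    "\<And>x. x \<in> carrier B \<times> carrier M \<Longrightarrow> h (frag_of x) = (\<lambda>(b, m). b \<odot>\<^bsub>P\<^esub> f m) x"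
    by (rule comm_group.free_Abelian_group_universal[OF P.a_comm_group]) (rule that)
  interpret H: group_hom "free_Abelian_group (carrier B \<times> carrier M)" "add_monoid P" h
    by (intro group_hom.intro group_hom_axioms.intro h(1) comm_group.axioms(2)[OF P.a_comm_group]) simp
  have hof: "h (frag_of (b, m)) = b \<odot>\<^bsub>P\<^esub> f m" if "b \<in> carrier B" "m \<in> carrier M" for b m
    using h(2) that by simp
  have h_diff: "h (x - y) = h x \<ominus>\<^bsub>P\<^esub> h y" if "x \<in> Fm" "y \<in> Fm" for x y
    using H.hom_mult[of x "- y"] H.hom_inv[of y] that by (simp add: a_minus_def a_inv_def)
  have hc: "h x \<in> carrier P" if "x \<in> Fm" for x using H.hom_closed[OF that] by simp
  have diff: "x - y \<in> Fm" if "x \<in> Fm" "y \<in> Fm" for x y using that keys_diff[of x y] by auto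
  have cancel: "(p \<oplus>\<^bsub>P\<^esub> q) \<ominus>\<^bsub>P\<^esub> p \<ominus>\<^bsub>P\<^esub> q = \<zero>\<^bsub>P\<^esub>" if "p \<in> carrier P" "q \<in> carrier P" for p q
  proof -
    have "(p \<oplus>\<^bsub>P\<^esub> q) \<ominus>\<^bsub>P\<^esub> p \<ominus>\<^bsub>P\<^esub> q = (p \<oplus>\<^bsub>P\<^esub> q) \<oplus>\<^bsub>P\<^esub> (\<ominus>\<^bsub>P\<^esub> (p \<oplus>\<^bsub>P\<^esub> q))"
      using that by (simp add: a_minus_def P.minus_add P.a_assoc)
    then show ?thesis using that by (simp only: P.r_neg P.a_closed)
  qed
  have hrel: "h x = \<zero>\<^bsub>P\<^esub>" if "x \<in> tensor_relations R B \<phi> M" for x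
    using that unfolding tensor_relations_def
  proof (elim UnE CollectE exE conjE)
    fix b c m assume x: "x = frag_of (b \<oplus>\<^bsub>B\<^esub> c, m) - frag_of (b, m) - frag_of (c, m)" and c: "b \<in> carrier B" "c \<in> carrier B" "m \<in> carrier M"
    have "h x = (b \<odot>\<^bsub>P\<^esub> f m \<oplus>\<^bsub>P\<^esub> c \<odot>\<^bsub>P\<^esub> f m) \<ominus>\<^bsub>P\<^esub> b \<odot>\<^bsub>P\<^esub> f m \<ominus>\<^bsub>P\<^esub> c \<odot>\<^bsub>P\<^esub> f m"
      unfolding x using c f by (simp add: h_diff diff hof P.smult_l_distr del: carrier_free_Abelian_group_iff)
    then show ?thesis using c f by (simp add: cancel)
  next
    fix b m l assume x: "x = frag_of (b, m \<oplus>\<^bsub>M\<^esub> l) - frag_of (b, m) - frag_of (b, l)" and c: "b \<in> carrier B" "m \<in> carrier M" "l \<in> carrier M"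
    have "h x = (b \<odot>\<^bsub>P\<^esub> f m \<oplus>\<^bsub>P\<^esub> b \<odot>\<^bsub>P\<^esub> f l) \<ominus>\<^bsub>P\<^esub> b \<odot>\<^bsub>P\<^esub> f m \<ominus>\<^bsub>P\<^esub> b \<odot>\<^bsub>P\<^esub> f l"
      unfolding x using c f by (simp add: h_diff diff hof f_add P.smult_r_distr del: carrier_free_Abelian_group_iff)
    then show ?thesis using c f by (simp add: cancel)
  next
    fix a b m assume x: "x = frag_of (b \<otimes>\<^bsub>B\<^esub> \<phi> a, m) - frag_of (b, a \<odot>\<^bsub>M\<^esub> m)" and c: "a \<in> carrier R" "b \<in> carrier B" "m \<in> carrier M"
    then show ?thesis using f
      by (simp add: h_diff hof f_smult P.smult_assoc1 hom_simps a_minus_def P.r_neg del: carrier_free_Abelian_group_iff)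
  qed
  have hS: "h x = \<zero>\<^bsub>P\<^esub>" if "x \<in> S" for x
  proof -
    have "tensor_relations R B \<phi> M \<subseteq> kernel (free_Abelian_group (carrier B \<times> carrier M)) (add_monoid P) h"
      using hrel rel_carrier by (auto simp: kernel_def simp del: carrier_free_Abelian_group_iff)
    then have "S \<subseteq> kernel (free_Abelian_group (carrier B \<times> carrier M)) (add_monoid P) h"
      by (rule group.generate_subgroup_incl[OF group_free_Abelian_group _ H.subgroup_kernel])
    then show ?thesis using that by (auto simp: kernel_def)
  qed
  have f1: "h (frag_of (\<one>\<^bsub>B\<^esub>, m)) = f m" if "m \<in> carrier M" for m using hof that f by simp
  have wd: "f x = f y" if "x \<in> carrier M" "y \<in> carrier M" "unit_tensor x = unit_tensor y" for x y
  proof -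
    have "frag_of (\<one>\<^bsub>B\<^esub>, x) - frag_of (\<one>\<^bsub>B\<^esub>, y) \<in> S" using that(3) unfolding unit_tensor_def coset_eq_iff .
    from hS[OF this] have "f x \<ominus>\<^bsub>P\<^esub> f y = \<zero>\<^bsub>P\<^esub>" using that by (simp add: h_diff f1 del: carrier_free_Abelian_group_iff add: frag_of_in_free_Abelian_group)
    then show ?thesis by (rule P.eq_if_minus_zero[OF f[OF that(1)] f[OF that(2)]])
  qed
  define i where "i t = f (SOME m. m \<in> carrier M \<and> unit_tensor m = t)" for t
  have i: "i (unit_tensor m) = f m" if m: "m \<in> carrier M" for m
  proof -
    have "(SOME l. l \<in> carrier M \<and> unit_tensor l = unit_tensor m) \<in> carrier M \<and>
        unit_tensor (SOME l. l \<in> carrier M \<and> unit_tensor l = unit_tensor m) = unit_tensor m"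
      by (rule someI[of "\<lambda>l. l \<in> carrier M \<and> unit_tensor l = unit_tensor m" m]) (use m in simp)
    then show ?thesis unfolding i_def by (intro wd m) simp_all
  qed
  have exT: "\<exists>x\<in>carrier M. t = unit_tensor x" if "t \<in> carrier T" for t using that unit_tensor_surj by blast
  have ihom: "i \<in> module_hom B T P"
    unfolding module_hom_def
  proof (intro CollectI conjI ballI funcsetI)
    fix s assume "s \<in> carrier T"
    then obtain x where x: "x \<in> carrier M" "s = unit_tensor x" using exT by blast
    show "i s \<in> carrier P" using x i f by simp
    show "i (b \<odot>\<^bsub>T\<^esub> s) = b \<odot>\<^bsub>P\<^esub> i s" if "b \<in> carrier B" for b
    proof -
      obtain a where a: "a \<in> carrier R" "b = \<phi> a" using \<open>b \<in> carrier B\<close> surj by blast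
      show ?thesis unfolding a(2) x(2) unit_tensor_smult[OF a(1) x(1), symmetric]
        using i[OF M.smult_closed[OF a(1) x(1)]] i[OF x(1)] f_smult[OF a(1) x(1)] by simp
    qed
    fix t assume "t \<in> carrier T"
    then obtain y where y: "y \<in> carrier M" "t = unit_tensor y" using exT by blast
    show "i (s \<oplus>\<^bsub>T\<^esub> t) = i s \<oplus>\<^bsub>P\<^esub> i t"
      unfolding x(2) y(2) unit_tensor_add[OF x(1) y(1), symmetric] using x(1) y(1) i f_add by simp
  qed
  have ker0: "t = \<zero>\<^bsub>T\<^esub>" if t: "t \<in> carrier T" "i t = \<zero>\<^bsub>P\<^esub>" for t
  proof -
    obtain x where x: "x \<in> carrier M" "t = unit_tensor x" using exT[OF t(1)] by blast
    then have "f x = \<zero>\<^bsub>P\<^esub>" using i t(2) by simp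
    from ker[OF x(1) this] obtain a m where a: "a \<in> carrier R" "m \<in> carrier M" "\<phi> a = \<zero>\<^bsub>B\<^esub>" "x = a \<odot>\<^bsub>M\<^esub> m" by blast
    show ?thesis unfolding x(2) a(4) unit_tensor_smult[OF a(1,2)] a(3) by (rule T.smult_l_null[OF u_cl[OF a(2)]])
  qed
  have "inj_on i (carrier T)"
  proof (rule inj_onI)
    fix s t assume st: "s \<in> carrier T" "t \<in> carrier T" "i s = i t"
    have ic: "i s \<in> carrier P" using ihom st(1) by (auto simp: module_hom_def)
    have "i (s \<ominus>\<^bsub>T\<^esub> t) = i s \<ominus>\<^bsub>P\<^esub> i t"
      using B.hom_add[OF ihom st(1) T.a_inv_closed[OF st(2)]] B.hom_neg[OF base_change_lmod P ihom st(2)] by (simp add: a_minus_def)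
    also have "\<dots> = \<zero>\<^bsub>P\<^esub>" using st(3) ic by (simp add: a_minus_def P.r_neg)
    finally have "s \<ominus>\<^bsub>T\<^esub> t = \<zero>\<^bsub>T\<^esub>" using ker0[OF T.minus_closed[OF st(1,2)]] by simp
    then show "s = t" by (rule T.eq_if_minus_zero[OF st(1,2)])
  qed
  moreover have "i ` carrier T = f ` carrier M"
    unfolding unit_tensor_surj[symmetric] image_image using i by (rule image_cong[OF refl])
  ultimately show thesis using ihom that by blast
qed

end

end

section \<open>Determinants of endomorphisms\<close>

context plain_cring
begin

text \<open>If \<open>n < m\<close>, zero columns and zero rows make both matrices square without
  changing the product. The first factor then has determinant zero, whereas the product is the
  identity.\<close>

lemma matrix_product_size:
  assumes P: "mat_in m n P" and Q: "mat_in n m Q" and nontriv: "\<one> \<noteq> \<zero>"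
    and PQ: "\<And>j k. j < m \<Longrightarrow> k < m \<Longrightarrow> (\<Oplus>i\<in>{..<n}. P j i \<otimes> Q i k) = (if j = k then \<one> else \<zero>)"
  shows "m \<le> n"
proof (rule ccontr)
  assume "\<not> m \<le> n"
  then have nm: "n < m" by simp
  define P' where "P' j i = (if i < n then P j i else \<zero>)" for j i
  define Q' where "Q' i k = (if i < n then Q i k else \<zero>)" for i k
  have P'm: "mat_in m m P'" and Q'm: "mat_in m m Q'" using P Q by (auto simp: P'_def Q'_def)
  have "\<one> = ring_det A m (\<lambda>j k. if j = k then \<one> else \<zero>)" using ring_det_diag[of \<one> m] by simp
  also have "\<dots> = ring_det A m (\<lambda>j k. \<Oplus>i\<in>{..<m}. P' j i \<otimes> Q' i k)"
  proof (rule ring_det_cong)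
    show "mat_in m m (\<lambda>j k. \<Oplus>i\<in>{..<m}. P' j i \<otimes> Q' i k)" using P'm Q'm by (auto intro!: finsum_closed)
    fix j k assume jk: "j < m" "k < m"
    have "(\<Oplus>i\<in>{..<n}. P j i \<otimes> Q i k) = (\<Oplus>i\<in>{..<m}. P' j i \<otimes> Q' i k)"
      by (rule add.finprod_mono_neutral_cong_left) (use nm jk P Q P'm Q'm in \<open>auto simp: P'_def Q'_def\<close>)
    then show "(if j = k then \<one> else \<zero>) = (\<Oplus>i\<in>{..<m}. P' j i \<otimes> Q' i k)" using PQ[OF jk] by simp
  qed
  also have "\<dots> = ring_det A m P' \<otimes> ring_det A m Q'" by (rule ring_det_mult[OF P'm Q'm])
  also have "ring_det A m P' = \<zero>"
    by (rule ring_det_zero_block[OF P'm, of "{..<m}" "{..<n}"]) (use nm in \<open>auto simp: P'_def\<close>)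
  finally show False using ring_det_closed[OF Q'm] nontriv by simp
qed

text \<open>A polynomial lift of the entries, followed by \<open>h\<close>, is a lift of their
  images.\<close>

lemma ring_det_hom:
  assumes B: "cring B" and h: "h \<in> Ring.ring_hom A B" and M: "mat_in n n M"
  shows "ring_det B n (\<lambda>i j. h (M i j)) = h (ring_det A n M)"
proof -
  interpret B: plain_cring B by (rule plain_cring.intro[OF B])
  obtain e N where e: "eval_hom A e" "\<And>i j. i < n \<Longrightarrow> j < n \<Longrightarrow> M i j = e (N i j)" by (rule eval_hom_matrix[OF M]) (rule that)
  have "eval_hom B (\<lambda>x. h (e x))"
    using e(1) ring_hom_closed[OF h] ring_hom_add[OF h] ring_hom_mult[OF h] ring_hom_one[OF h]
    by (simp add: eval_hom_def)
  from B.ring_det_eval[OF this] have "ring_det B n (\<lambda>i j. h (M i j)) = h (e (detf n N))" using e(2) by simp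
  then show ?thesis using ring_det_eval[OF e(1)] e(2) by simp
qed

end

context lmod
begin

lemma basis_unique:
  assumes b: "is_basis A M n b" and c: "\<And>i. i < n \<Longrightarrow> c i \<in> carrier A" and d: "\<And>i. i < n \<Longrightarrow> d i \<in> carrier A"
    and eq: "lincomb M n c b = lincomb M n d b" and i: "i < n"
  shows "c i = d i"
proof -
  have bc: "b \<in> {..<n} \<rightarrow> carrier M" using b by (simp add: is_basis_def)
  define c' where "c' i = (if i < n then c i else \<zero>)" for i
  define d' where "d' i = (if i < n then d i else \<zero>)" for i
  have c': "c' \<in> carrier (F n)" "lincomb M n c' b = lincomb M n c b"
    using c by (auto simp: c'_def F_carrier intro!: lincomb_cong[OF c bc])
  have d': "d' \<in> carrier (F n)" "lincomb M n d' b = lincomb M n d b"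
    using d by (auto simp: d'_def F_carrier intro!: lincomb_cong[OF d bc])
  have "\<forall>x\<in>carrier M. \<exists>!e. e \<in> carrier (F n) \<and> x = lincomb M n e b"
    using b by (simp add: is_basis_def)
  from bspec[OF this lincomb_closed[OF c bc]] have ex1: "\<exists>!e. e \<in> carrier (F n) \<and> lincomb M n c b = lincomb M n e b" by simp
  obtain e where e': "\<forall>y. y \<in> carrier (F n) \<and> lincomb M n c b = lincomb M n y b \<longrightarrow> y = e"
    using ex1 by (rule ex1E) (rule that)
  have e: "y = e" if "y \<in> carrier (F n)" "lincomb M n c b = lincomb M n y b" for y
    using e'[THEN spec, of y] that by simp
  have "c' = e" by (rule e[OF c'(1) c'(2)[symmetric]])
  moreover have "d' = e" by (rule e[OF d'(1)]) (simp add: d'(2) eq)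
  ultimately have "c' = d'" by simp
  from fun_cong[OF this, of i] show ?thesis using i by (simp add: c'_def d'_def)
qed

lemma basis_coords:
  assumes b: "is_basis A M n b" and f: "f \<in> {..<m} \<rightarrow> carrier M"
  obtains P where "mat_in m n P" "\<And>j. j < m \<Longrightarrow> f j = lincomb M n (P j) b"
proof -
  have "\<forall>j. \<exists>c. j < m \<longrightarrow> c \<in> carrier (F n) \<and> f j = lincomb M n c b"
  proof (rule allI)
    fix j show "\<exists>c. j < m \<longrightarrow> c \<in> carrier (F n) \<and> f j = lincomb M n c b"
    proof (cases "j < m")
      case True
      then have "f j \<in> carrier M" using f by auto
      then have "\<exists>!c. c \<in> carrier (F n) \<and> f j = lincomb M n c b" using b unfolding is_basis_def by blast
      then obtain c where "c \<in> carrier (F n) \<and> f j = lincomb M n c b" by (elim ex1E)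
      then show ?thesis by (intro exI[of _ c]) simp
    qed simp
  qed
  then obtain P where P: "\<forall>j. j < m \<longrightarrow> P j \<in> carrier (F n) \<and> f j = lincomb M n (P j) b"
    by (rule choice[THEN exE])
  show thesis by (rule that[of P]) (use P in \<open>auto simp: F_carrier\<close>)
qed

text \<open>The matrices \<open>P\<close> and \<open>Q\<close> of the change of basis are inverse to
  each other, so the bases have equal length. The transposed matrices of \<open>f\<close> are
  conjugate by \<open>P\<close>; they are transposed because images of basis elements stand in
  columns while coordinate vectors are rows.\<close>

lemma endo_matrix_det_unique:
  assumes f: "f \<in> module_hom A M M" and nontriv: "\<one>\<^bsub>A\<^esub> \<noteq> \<zero>\<^bsub>A\<^esub>"
    and b: "is_basis A M n b" and C: "mat_in n n C" and fb: "\<And>j. j < n \<Longrightarrow> f (b j) = lincomb M n (\<lambda>i. C i j) b"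
    and b': "is_basis A M m b'" and C': "mat_in m m C'" and fb': "\<And>j. j < m \<Longrightarrow> f (b' j) = lincomb M m (\<lambda>i. C' i j) b'"
  shows "ring_det A m C' = ring_det A n C"
proof -
  have bc: "b \<in> {..<n} \<rightarrow> carrier M" and bc': "b' \<in> {..<m} \<rightarrow> carrier M" using b b' by (simp_all add: is_basis_def)
  obtain P where P: "mat_in m n P" "\<And>j. j < m \<Longrightarrow> b' j = lincomb M n (P j) b" using basis_coords[OF b bc'] by blast
  obtain Q where Q: "mat_in n m Q" "\<And>j. j < n \<Longrightarrow> b j = lincomb M m (Q j) b'" using basis_coords[OF b' bc] by blast
  have lself: "lincomb M k (\<lambda>i. if j = i then \<one>\<^bsub>A\<^esub> else \<zero>\<^bsub>A\<^esub>) e = e j" if "j < k" "e \<in> {..<k} \<rightarrow> carrier M" for j k e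
    using lincomb_std_vec[OF that] by (simp add: std_vec_def[abs_def] eq_commute)
  have comp: "(\<Oplus>i\<in>{..<n1}. P1 j i \<otimes> Q1 i k) = (if j = k then \<one>\<^bsub>A\<^esub> else \<zero>\<^bsub>A\<^esub>)"
    if e: "is_basis A M m1 e" and e': "e' \<in> {..<n1} \<rightarrow> carrier M" and P1: "mat_in m1 n1 P1" "\<And>j. j < m1 \<Longrightarrow> e j = lincomb M n1 (P1 j) e'"
      and Q1: "mat_in n1 m1 Q1" "\<And>j. j < n1 \<Longrightarrow> e' j = lincomb M m1 (Q1 j) e" and jk: "j < m1" "k < m1"
    for m1 n1 e e' P1 Q1 j k
  proof (rule basis_unique[OF e _ _ _ jk(2)])
    have ec: "e \<in> {..<m1} \<rightarrow> carrier M" using e by (simp add: is_basis_def)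
    show "(\<Oplus>i\<in>{..<n1}. P1 j i \<otimes> Q1 i k) \<in> carrier A" if "k < m1" for k
      using P1(1) Q1(1) jk(1) that by (auto intro!: R.finsum_closed)
    have "lincomb M m1 (\<lambda>k. \<Oplus>i\<in>{..<n1}. P1 j i \<otimes> Q1 i k) e = lincomb M n1 (P1 j) (\<lambda>i. lincomb M m1 (Q1 i) e)"
      by (rule lincomb_lincomb[symmetric]) (use P1(1) Q1(1) jk ec in auto)
    also have "\<dots> = lincomb M n1 (P1 j) e'"
      by (rule lincomb_cong) (use P1(1) Q1(2) jk e' in auto)
    also have "\<dots> = lincomb M m1 (\<lambda>k. if j = k then \<one>\<^bsub>A\<^esub> else \<zero>\<^bsub>A\<^esub>) e"
      using P1(2)[OF jk(1)] lself[OF jk(1) ec] by simp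
    finally show "lincomb M m1 (\<lambda>k. \<Oplus>i\<in>{..<n1}. P1 j i \<otimes> Q1 i k) e = lincomb M m1 (\<lambda>k. if j = k then \<one>\<^bsub>A\<^esub> else \<zero>\<^bsub>A\<^esub>) e" .
  qed auto
  note PQ = comp[OF b' bc P Q] and QP = comp[OF b bc' Q P]
  have mn: "m = n" using matrix_product_size[OF P(1) Q(1) nontriv PQ] matrix_product_size[OF Q(1) P(1) nontriv QP] by simp
  have Pn: "mat_in n n P" and Qn: "mat_in n n Q" and Cn': "mat_in n n C'" using P(1) Q(1) C' unfolding mn by auto
  define Ct where "Ct = (\<lambda>i j. C j i)"
  define Ct' where "Ct' = (\<lambda>i j. C' j i)"
  have Ctm: "mat_in n n Ct" "mat_in n n Ct'" using C Cn' by (auto simp: Ct_def Ct'_def)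
  have fbc: "(\<lambda>i. f (b i)) \<in> {..<n} \<rightarrow> carrier M" using bc hom_closed[OF f] by auto
  have inter: "(\<Oplus>i\<in>{..<n}. P j i \<otimes> Ct i k) = (\<Oplus>l\<in>{..<n}. Ct' j l \<otimes> P l k)" if jk: "j < n" "k < n" for j k
  proof (rule basis_unique[OF b _ _ _ jk(2)])
    show "(\<Oplus>i\<in>{..<n}. P j i \<otimes> Ct i k) \<in> carrier A" "(\<Oplus>l\<in>{..<n}. Ct' j l \<otimes> P l k) \<in> carrier A" if "k < n" for k
      using Pn Ctm jk(1) that by (auto intro!: R.finsum_closed)
    have "lincomb M n (\<lambda>k. \<Oplus>i\<in>{..<n}. P j i \<otimes> Ct i k) b = lincomb M n (P j) (\<lambda>i. lincomb M n (Ct i) b)"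
      by (rule lincomb_lincomb[symmetric]) (use Pn Ctm jk bc in auto)
    also have "\<dots> = lincomb M n (P j) (\<lambda>i. f (b i))"
      by (rule lincomb_cong[OF _ fbc]) (use Pn jk fb in \<open>auto simp: Ct_def\<close>)
    also have "\<dots> = f (lincomb M n (P j) b)"
      by (rule hom_lincomb[OF lmod_axioms lmod_axioms f, symmetric]) (use Pn jk bc in auto)
    also have "\<dots> = lincomb M n (Ct' j) b'" using fb'[of j] P(2)[of j] jk unfolding mn Ct'_def by simp
    also have "\<dots> = lincomb M n (Ct' j) (\<lambda>l. lincomb M n (P l) b)"
      by (rule lincomb_cong[symmetric]) (use Ctm jk bc' P(2) mn in auto)
    also have "\<dots> = lincomb M n (\<lambda>k. \<Oplus>l\<in>{..<n}. Ct' j l \<otimes> P l k) b"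
      by (rule lincomb_lincomb) (use Pn Ctm jk bc in auto)
    finally show "lincomb M n (\<lambda>k. \<Oplus>i\<in>{..<n}. P j i \<otimes> Ct i k) b = lincomb M n (\<lambda>k. \<Oplus>l\<in>{..<n}. Ct' j l \<otimes> P l k) b" .
  qed
  let ?d = "ring_det A n"
  note dc = ring_det_closed[OF Pn] ring_det_closed[OF Qn] ring_det_closed[OF C] ring_det_closed[OF Cn']
  have "?d P \<otimes> ?d C = ?d P \<otimes> ?d Ct" using ring_det_transpose[OF C] by (simp add: Ct_def)
  also have "\<dots> = ?d (\<lambda>j k. \<Oplus>i\<in>{..<n}. P j i \<otimes> Ct i k)" by (rule ring_det_mult[OF Pn Ctm(1), symmetric])
  also have "\<dots> = ?d (\<lambda>j k. \<Oplus>l\<in>{..<n}. Ct' j l \<otimes> P l k)"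
    by (rule ring_det_cong) (use Pn Ctm inter in \<open>auto intro!: R.finsum_closed\<close>)
  also have "\<dots> = ?d Ct' \<otimes> ?d P" by (rule ring_det_mult[OF Ctm(2) Pn])
  also have "\<dots> = ?d C' \<otimes> ?d P" using ring_det_transpose[OF Cn'] by (simp add: Ct'_def)
  finally have e1: "?d P \<otimes> ?d C = ?d C' \<otimes> ?d P" .
  have "?d P \<otimes> ?d Q = ?d (\<lambda>j k. \<Oplus>i\<in>{..<n}. P j i \<otimes> Q i k)" by (rule ring_det_mult[OF Pn Qn, symmetric])
  also have "\<dots> = ?d (\<lambda>j k. if j = k then \<one>\<^bsub>A\<^esub> else \<zero>\<^bsub>A\<^esub>)"
    by (rule ring_det_cong) (use PQ mn in auto)
  also have "\<dots> = \<one>\<^bsub>A\<^esub>" using ring_det_diag[of "\<one>\<^bsub>A\<^esub>" n] by simp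
  finally have e2: "?d P \<otimes> ?d Q = \<one>\<^bsub>A\<^esub>" .
  have "?d C' = ?d C' \<otimes> (?d P \<otimes> ?d Q)" using e2 dc by simp
  also have "\<dots> = (?d C' \<otimes> ?d P) \<otimes> ?d Q" using dc by (simp add: R.m_assoc)
  also have "\<dots> = (?d P \<otimes> ?d C) \<otimes> ?d Q" unfolding e1 ..
  also have "\<dots> = ?d C \<otimes> (?d P \<otimes> ?d Q)" using dc by (simp add: R.m_ac)
  also have "\<dots> = ?d C" using e2 dc by simp
  finally show ?thesis unfolding mn .
qed

lemma endo_det_eq:
  assumes f: "f \<in> module_hom A M M" and nontriv: "\<one>\<^bsub>A\<^esub> \<noteq> \<zero>\<^bsub>A\<^esub>"
    and b: "is_basis A M n b" and C: "mat_in n n C" and fb: "\<And>j. j < n \<Longrightarrow> f (b j) = lincomb M n (\<lambda>i. C i j) b"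
  shows "endo_det A M f = ring_det A n C"
  unfolding endo_det_def
proof (rule the_equality)
  show "\<exists>n' b' C'. is_basis A M n' b' \<and> (\<forall>i<n'. \<forall>j<n'. C' i j \<in> carrier A) \<and>
      (\<forall>j<n'. f (b' j) = lincomb M n' (\<lambda>i. C' i j) b') \<and> ring_det A n C = ring_det A n' C'"
    using b C fb by (intro exI[of _ n] exI[of _ b] exI[of _ C]) simp
  fix d assume "\<exists>n' b' C'. is_basis A M n' b' \<and> (\<forall>i<n'. \<forall>j<n'. C' i j \<in> carrier A) \<and>
      (\<forall>j<n'. f (b' j) = lincomb M n' (\<lambda>i. C' i j) b') \<and> d = ring_det A n' C'"
  then obtain m b' C' where "is_basis A M m b'" "mat_in m m C'" "\<forall>j<m. f (b' j) = lincomb M m (\<lambda>i. C' i j) b'"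
    "d = ring_det A m C'" by blast
  then show "d = ring_det A n C" using endo_matrix_det_unique[OF f nontriv b C fb] by simp
qed

end

text \<open>The constant is the determinant of the system and the adjugate supplies the solutions. A
  vanishing determinant would give a non-trivial integral solution of the homogeneous
  system.\<close>

lemma integer_system:
  fixes a :: "'v \<Rightarrow> 'v \<Rightarrow> int"
  assumes V: "finite V" and inj: "\<And>x. \<forall>v\<in>V. (\<Sum>u\<in>V. a v u * x u) = 0 \<Longrightarrow> \<forall>v\<in>V. x v = 0"
  obtains m where "m \<noteq> 0" "\<And>d. \<exists>x. \<forall>v\<in>V. (\<Sum>u\<in>V. a v u * x u) = m * d v"
proof -
  define k where "k = card V"
  obtain e where e: "bij_betw e {0..<k} V" using ex_bij_betw_nat_finite[OF V] unfolding k_def by blast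
  define e' where "e' = the_inv_into {0..<k} e"
  have e': "e' v < k" "e (e' v) = v" if "v \<in> V" for v
    using that e f_the_inv_into_f_bij_betw[OF e, of v] the_inv_into_into[of e "{0..<k}" v "{0..<k}"]
    unfolding e'_def bij_betw_def by auto
  have ee: "e' (e i) = i" "e i \<in> V" if "i < k" for i
    using that e the_inv_into_f_f[of e "{0..<k}" i] unfolding e'_def bij_betw_def by auto
  have sum_e: "(\<Sum>i\<in>{0..<k}. g (e i)) = (\<Sum>u\<in>V. g u)" for g :: "'v \<Rightarrow> int"
    by (rule sum.reindex_bij_betw[OF e])
  define T where "T = mat k k (\<lambda>(i, j). a (e i) (e j))"
  have T: "T \<in> carrier_mat k k" by (simp add: T_def)
  have row: "(T *\<^sub>v w) $ i = (\<Sum>u\<in>V. a (e i) u * w $ e' u)" if "w \<in> carrier_vec k" "i < k" for w i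
  proof -
    have "(T *\<^sub>v w) $ i = (\<Sum>j\<in>{0..<k}. a (e i) (e j) * w $ e' (e j))"
      using that by (auto simp: T_def scalar_prod_def ee intro!: sum.cong)
    then show ?thesis using sum_e[of "\<lambda>u. a (e i) u * w $ e' u"] by simp
  qed
  show thesis
  proof (rule that)
    show "det T \<noteq> 0"
    proof
      assume "det T = 0"
      then obtain w where w: "w \<in> carrier_vec k" "w \<noteq> 0\<^sub>v k" "T *\<^sub>v w = 0\<^sub>v k" using det_0_iff_vec_prod_zero[OF T] by blast
      have "\<forall>v\<in>V. w $ e' v = 0"
      proof (rule inj, rule ballI)
        fix v assume v: "v \<in> V"
        show "(\<Sum>u\<in>V. a v u * w $ e' u) = 0" using row[OF w(1) e'(1)[OF v]] w(3) e'[OF v] by simp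
      qed
      then have "w $ i = 0" if "i < k" for i using ee[OF that] by metis
      then have "w = 0\<^sub>v k" using w(1) by (intro eq_vecI) auto
      then show False using w(2) by simp
    qed
    fix d :: "'v \<Rightarrow> int"
    define y where "y = adj_mat T *\<^sub>v vec k (\<lambda>i. d (e i))"
    have adj: "adj_mat T \<in> carrier_mat k k" by (rule adj_mat(1)[OF T])
    have y: "y \<in> carrier_vec k" unfolding y_def using adj by simp
    have "T *\<^sub>v y = (T * adj_mat T) *\<^sub>v vec k (\<lambda>i. d (e i))" unfolding y_def using T adj by simp
    also have "\<dots> = det T \<cdot>\<^sub>v vec k (\<lambda>i. d (e i))" unfolding adj_mat(2)[OF T] by (rule eq_vecI) (simp_all add: scalar_prod_def if_distrib if_distribR sum.delta row_def cong: if_cong)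
    finally have Ty: "T *\<^sub>v y = det T \<cdot>\<^sub>v vec k (\<lambda>i. d (e i))" .
    have "\<forall>v\<in>V. (\<Sum>u\<in>V. a v u * y $ e' u) = det T * d v"
    proof
      fix v assume v: "v \<in> V"
      show "(\<Sum>u\<in>V. a v u * y $ e' u) = det T * d v" using row[OF y e'(1)[OF v]] Ty e'[OF v] by simp
    qed
    then show "\<exists>x. \<forall>v\<in>V. (\<Sum>u\<in>V. a v u * x u) = det T * d v" by (rule exI[of _ "\<lambda>u. y $ e' u"])
  qed
qed

section \<open>Coverings and divisors\<close>

text \<open>A step against the direction of an edge is a step along its inverse
  \<open>rv e\<close>.\<close>

lemma connected_graph_induct:
  assumes Y: "connected_graph Y rv" and u: "u \<in> verts Y" "Q u" and v: "v \<in> verts Y"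
    and step: "\<And>e. e \<in> arcs Y \<Longrightarrow> Q (tail Y e) \<Longrightarrow> Q (head Y e)"
  shows "Q v"
proof -
  interpret bidirected_digraph Y rv using Y by (simp add: connected_graph_def)
  have "(u, v) \<in> rtrancl_on (verts Y) ((arcs_ends Y)\<^sup>s)"
    using Y u v unfolding connected_graph_def connected_conv by blast
  then show ?thesis
  proof (induction rule: rtrancl_on_induct)
    case base
    show ?case by (rule u(2))
  next
    case (step x y)
    then obtain e where e: "e \<in> arcs Y" "(tail Y e = x \<and> head Y e = y) \<or> (tail Y e = y \<and> head Y e = x)"
      by (auto simp: symcl_def arcs_ends_conv)
    then show ?case
    proof (elim disjE conjE)
      assume "tail Y e = x" "head Y e = y"
      then show ?thesis using assms(5)[OF e(1)] step by simp
    next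
      assume "tail Y e = y" "head Y e = x"
      then show ?thesis using assms(5)[of "rv e"] step e(1) by simp
    qed
  qed
qed

lemma Div_simps [simp]:
  "carrier (Div Y) = {d. Poly_Mapping.keys d \<subseteq> verts Y}" "\<zero>\<^bsub>Div Y\<^esub> = 0" "x \<oplus>\<^bsub>Div Y\<^esub> y = x + y"
  "r \<odot>\<^bsub>Div Y\<^esub> d = conv fst r d"
  by (auto simp: Div_def conv_def)

lemma laplacian_arith:
  "laplacian Y (x + y) = laplacian Y x + laplacian Y y" "laplacian Y (x - y) = laplacian Y x - laplacian Y y"
  "laplacian Y 0 = 0" "laplacian Y (frag_cmul k x) = frag_cmul k (laplacian Y x)"
  by (simp_all add: laplacian_def frag_extend_add frag_extend_diff frag_extend_cmul)

lemma laplacian_frag_of: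
  "laplacian Y (frag_of w) = frag_cmul (int (card (out_arcs Y w))) (frag_of w) - (\<Sum>e \<in> out_arcs Y w. frag_of (head Y e))"
  by (simp add: laplacian_def)

lemma frag_deg_laplacian: "frag_deg (laplacian Y d) = 0"
  unfolding laplacian_def by (subst frag_deg_extend[where c = 0]) (simp_all add: frag_deg_sum)

section \<open>The Laplacian of a connected graph\<close>

context
  fixes Y :: "('w, 'f) pre_digraph" and invY :: "'f \<Rightarrow> 'f"
  assumes Y: "connected_graph Y invY"
begin

interpretation Y: bidirected_digraph Y invY using Y by (simp add: connected_graph_def)
interpretation Y: fin_digraph Y using Y by (simp add: connected_graph_def)

lemma fin_out: "finite (out_arcs Y a)"
  by (rule finite_subset[OF _ Y.finite_arcs]) auto

lemma laplacian_Div: "d \<in> carrier (Div Y) \<Longrightarrow> laplacian Y d \<in> carrier (Div Y)"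
proof -
  assume d: "d \<in> carrier (Div Y)"
  have "Poly_Mapping.keys (frag_cmul (int (card (out_arcs Y w))) (frag_of w) - (\<Sum>e \<in> out_arcs Y w. frag_of (head Y e))) \<subseteq> verts Y"
    if "w \<in> verts Y" for w
  proof -
    have "Poly_Mapping.keys (\<Sum>e \<in> out_arcs Y w. frag_of (head Y e) :: 'w \<Rightarrow>\<^sub>0 int) \<subseteq> verts Y"
      using keys_sum[of "\<lambda>e. frag_of (head Y e)" "out_arcs Y w"] by fastforce
    then show ?thesis
      using that keys_diff[of "frag_cmul (int (card (out_arcs Y w))) (frag_of w)" "\<Sum>e \<in> out_arcs Y w. frag_of (head Y e)"]
        keys_cmul[of "int (card (out_arcs Y w))" "frag_of w"] by auto
  qed
  note key = this
  have "Poly_Mapping.keys (laplacian Y d) \<subseteq> (\<Union>w\<in>Poly_Mapping.keys d. Poly_Mapping.keys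
      (frag_cmul (int (card (out_arcs Y w))) (frag_of w) - (\<Sum>e \<in> out_arcs Y w. frag_of (head Y e))))"
    unfolding laplacian_def by (rule keys_frag_extend)
  also have "\<dots> \<subseteq> verts Y" by (rule UN_least) (use key d in auto)
  finally show ?thesis by simp
qed

text \<open>The Laplacian is symmetric: edge inversion matches the edges from \<open>u\<close> to
  \<open>v\<close> with those from \<open>v\<close> to \<open>u\<close>. So the coefficient at
  \<open>v\<close> is a sum over the edges leaving \<open>v\<close>.\<close>

lemma lookup_laplacian:
  assumes "d \<in> carrier (Div Y)"
  shows "Poly_Mapping.lookup (laplacian Y d) v =
    (\<Sum>e\<in>out_arcs Y v. Poly_Mapping.lookup d v - Poly_Mapping.lookup d (head Y e))"
proof -
  have "Poly_Mapping.keys d \<subseteq> verts Y" using assms by simp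
  then show ?thesis
  proof (induction d rule: frag_induction)
    case zero
    show ?case by (simp add: laplacian_arith)
  next
    case (one u)
    have "bij_betw invY {e\<in>out_arcs Y u. head Y e = v} {e\<in>out_arcs Y v. head Y e = u}"
      by (rule bij_betw_byWitness[where f' = invY]) auto
    then have c: "card {e\<in>out_arcs Y u. head Y e = v} = card {e\<in>out_arcs Y v. head Y e = u}" by (rule bij_betw_same_card)
    have cnt: "(\<Sum>e\<in>out_arcs Y a. if head Y e = b then 1 else 0 :: int) = int (card {e\<in>out_arcs Y a. head Y e = b})" for a b
      using sum.inter_filter[OF fin_out, of "\<lambda>_. 1 :: int" a "\<lambda>e. head Y e = b"] by simp
    have "Poly_Mapping.lookup (laplacian Y (frag_of u)) v =
        int (card (out_arcs Y u)) * (if v = u then 1 else 0) - (\<Sum>e\<in>out_arcs Y u. if head Y e = v then 1 else 0)"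
      by (simp add: laplacian_frag_of lookup_minus lookup_sum eq_commute)
    also have "\<dots> = int (card (out_arcs Y v)) * (if v = u then 1 else 0) - (\<Sum>e\<in>out_arcs Y v. if head Y e = u then 1 else 0)"
      unfolding cnt c by simp
    also have "\<dots> = (\<Sum>e\<in>out_arcs Y v. Poly_Mapping.lookup (frag_of u) v - Poly_Mapping.lookup (frag_of u) (head Y e))"
      by (simp add: sum_subtractf)
    finally show ?case .
  next
    case (diff a b)
    then show ?case by (simp add: laplacian_arith lookup_minus sum_subtractf algebra_simps)
  qed
qed

definition div_of :: "('w \<Rightarrow> int) \<Rightarrow> ('w \<Rightarrow>\<^sub>0 int)" where
  "div_of x = (\<Sum>u\<in>verts Y. frag_cmul (x u) (frag_of u))"

lemma lookup_div_of: "v \<in> verts Y \<Longrightarrow> Poly_Mapping.lookup (div_of x) v = x v"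
  by (simp add: div_of_def lookup_sum if_distrib[of "(*) _"] sum.delta cong: if_cong)

lemma div_of_Div: "div_of x \<in> carrier (Div Y)"
proof -
  have "Poly_Mapping.keys (div_of x) \<subseteq> (\<Union>u\<in>verts Y. Poly_Mapping.keys (frag_cmul (x u) (frag_of u)))"
    unfolding div_of_def by (rule keys_sum)
  then show ?thesis by (auto split: if_splits)
qed

lemma frag_deg_verts: "d \<in> carrier (Div Y) \<Longrightarrow> frag_deg d = (\<Sum>u\<in>verts Y. Poly_Mapping.lookup d u)"
  unfolding frag_deg_def by (rule sum.mono_neutral_left) (auto simp: in_keys_iff)

lemma Div_eqI:
  "x \<in> carrier (Div Y) \<Longrightarrow> y \<in> carrier (Div Y) \<Longrightarrow>
    (\<And>v. v \<in> verts Y \<Longrightarrow> Poly_Mapping.lookup x v = Poly_Mapping.lookup y v) \<Longrightarrow> x = y"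
proof (rule poly_mapping_eqI)
  fix k assume h: "x \<in> carrier (Div Y)" "y \<in> carrier (Div Y)" "\<And>v. v \<in> verts Y \<Longrightarrow> Poly_Mapping.lookup x v = Poly_Mapping.lookup y v"
  show "Poly_Mapping.lookup x k = Poly_Mapping.lookup y k"
  proof (cases "k \<in> verts Y")
    case False
    then have "k \<notin> Poly_Mapping.keys x" "k \<notin> Poly_Mapping.keys y" using h by auto
    then show ?thesis by (simp add: in_keys_iff)
  qed (rule h)
qed

text \<open>At a vertex where \<open>d\<close> is maximal, all neighbours attain the maximum as well.\<close>

lemma laplacian_kernel:
  assumes d: "d \<in> carrier (Div Y)" and L: "laplacian Y d = 0" and u: "u \<in> verts Y" and v: "v \<in> verts Y"
  shows "Poly_Mapping.lookup d u = Poly_Mapping.lookup d v"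
proof -
  define M where "M = Max (Poly_Mapping.lookup d ` verts Y)"
  have le: "Poly_Mapping.lookup d w \<le> M" if "w \<in> verts Y" for w using that by (simp add: M_def)
  have "M \<in> Poly_Mapping.lookup d ` verts Y" unfolding M_def using u by (intro Max_in) auto
  then obtain w where w: "w \<in> verts Y" "Poly_Mapping.lookup d w = M" by auto
  have "Poly_Mapping.lookup d z = M" if z: "z \<in> verts Y" for z
  proof (rule connected_graph_induct[where Q = "\<lambda>z. Poly_Mapping.lookup d z = M", OF Y w z])
    fix e assume e: "e \<in> arcs Y" "Poly_Mapping.lookup d (tail Y e) = M"
    have "(\<Sum>e'\<in>out_arcs Y (tail Y e). M - Poly_Mapping.lookup d (head Y e')) = 0"
      using lookup_laplacian[OF d, of "tail Y e"] L e(2) by simp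
    then have "\<forall>e'\<in>out_arcs Y (tail Y e). M - Poly_Mapping.lookup d (head Y e') = 0"
      by (subst (asm) sum_nonneg_eq_0_iff) (use le in auto)
    then show "Poly_Mapping.lookup d (head Y e) = M" using e(1) by auto
  qed
  then show ?thesis using u v by simp
qed

lemma verts_nonempty: "verts Y \<noteq> {}"
  using Y by (auto simp: connected_graph_def connected_conv)

text \<open>The Laplacian is singular, so the matrix \<open>a\<close> adds 1 to every entry. Its
  equations, summed over all vertices, determine the sum of the unknowns because the column sums of
  the Laplacian vanish. For a right-hand side of sum zero the unknowns have sum zero and the added
  part disappears. In the homogeneous case the solution is moreover constant, hence zero.\<close>

lemma laplacian_torsion:
  obtains m where "m \<noteq> 0"
    "\<And>d. d \<in> carrier (Div Y) \<Longrightarrow> frag_deg d = 0 \<Longrightarrow> \<exists>x\<in>carrier (Div Y). frag_cmul m d = laplacian Y x"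
proof -
  define a where "a v u = Poly_Mapping.lookup (laplacian Y (frag_of u)) v + 1" for v u
  have ax: "(\<Sum>u\<in>verts Y. a v u * x u) = Poly_Mapping.lookup (laplacian Y (div_of x)) v + (\<Sum>u\<in>verts Y. x u)" for x v
  proof -
    have "laplacian Y (div_of x) = (\<Sum>u\<in>verts Y. frag_cmul (x u) (laplacian Y (frag_of u)))"
      unfolding div_of_def laplacian_def by (simp add: frag_extend_sum frag_extend_cmul)
    then show ?thesis by (simp add: a_def lookup_sum algebra_simps sum.distrib)
  qed
  have total: "(\<Sum>v\<in>verts Y. Poly_Mapping.lookup (laplacian Y (div_of x)) v) = 0" for x
    using frag_deg_verts[OF laplacian_Div[OF div_of_Div], of x] frag_deg_laplacian[of Y "div_of x"] by simp
  have pos: "int (card (verts Y)) \<noteq> 0" using verts_nonempty by simp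
  have inj: "\<forall>v\<in>verts Y. x v = 0" if x0: "\<forall>v\<in>verts Y. (\<Sum>u\<in>verts Y. a v u * x u) = 0" for x
  proof -
    note x = bspec[OF x0]
    have "(\<Sum>v\<in>verts Y. \<Sum>u\<in>verts Y. a v u * x u) = int (card (verts Y)) * (\<Sum>u\<in>verts Y. x u)"
      unfolding ax by (simp add: sum.distrib total)
    then have s0: "(\<Sum>u\<in>verts Y. x u) = 0" using x pos by simp
    have "laplacian Y (div_of x) = 0"
      by (rule Div_eqI) (use laplacian_Div[OF div_of_Div, of x] x s0 in \<open>auto simp: ax\<close>)
    note const = laplacian_kernel[OF div_of_Div this]
    show ?thesis
    proof
      fix v assume v: "v \<in> verts Y"
      have "(\<Sum>u\<in>verts Y. x u) = (\<Sum>u\<in>verts Y. x v)"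
      proof (rule sum.cong[OF refl])
        fix u assume u: "u \<in> verts Y"
        show "x u = x v" using const[OF u v] lookup_div_of[OF u] lookup_div_of[OF v] by simp
      qed
      then show "x v = 0" using s0 pos by simp
    qed
  qed
  obtain m where m: "m \<noteq> 0" "\<And>d. \<exists>x. \<forall>v\<in>verts Y. (\<Sum>u\<in>verts Y. a v u * x u) = m * d v"
  proof (rule integer_system[of "verts Y" a, OF Y.finite_verts])
    fix x assume "\<forall>v\<in>verts Y. (\<Sum>u\<in>verts Y. a v u * x u) = 0"
    then show "\<forall>v\<in>verts Y. x v = 0" by (rule inj)
  next
    fix m assume "m \<noteq> 0" "\<And>d. \<exists>x. \<forall>v\<in>verts Y. (\<Sum>u\<in>verts Y. a v u * x u) = m * d v"
    then show thesis by (rule that)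
  qed
  show thesis
  proof (rule that[OF m(1)])
    fix d assume d: "d \<in> carrier (Div Y)" "frag_deg d = 0"
    obtain x where x: "\<forall>v\<in>verts Y. (\<Sum>u\<in>verts Y. a v u * x u) = m * Poly_Mapping.lookup d v" using m(2) by blast
    have "int (card (verts Y)) * (\<Sum>u\<in>verts Y. x u) = (\<Sum>v\<in>verts Y. \<Sum>u\<in>verts Y. a v u * x u)"
      unfolding ax by (simp add: sum.distrib total)
    also have "\<dots> = m * frag_deg d" using x by (simp add: frag_deg_verts[OF d(1)] sum_distrib_left)
    finally have s0: "(\<Sum>u\<in>verts Y. x u) = 0" using pos d(2) by simp
    have "frag_cmul m d = laplacian Y (div_of x)"
    proof (rule Div_eqI)
      show "frag_cmul m d \<in> carrier (Div Y)" using d(1) keys_cmul[of m d] by auto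
      show "laplacian Y (div_of x) \<in> carrier (Div Y)" by (rule laplacian_Div[OF div_of_Div])
      fix v assume "v \<in> verts Y"
      then show "Poly_Mapping.lookup (frag_cmul m d) v = Poly_Mapping.lookup (laplacian Y (div_of x)) v"
        using x ax[of v x] s0 by simp
    qed
    then show "\<exists>x\<in>carrier (Div Y). frag_cmul m d = laplacian Y x" using div_of_Div by blast
  qed
qed

end

section \<open>The Galois action on divisors\<close>

locale abelian_cover =
  fixes Y :: "('w, 'f) pre_digraph" and invY :: "'f \<Rightarrow> 'f"
    and X :: "('v, 'e) pre_digraph" and invX :: "'e \<Rightarrow> 'e"
    and pV :: "'w \<Rightarrow> 'v" and pE :: "'f \<Rightarrow> 'e"
  assumes cover: "abelian_covering Y invY X invX pV pE"
begin

abbreviation "\<Gamma> \<equiv> galois_group Y invY pV pE"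

lemma connY: "connected_graph Y invY" and connX: "connected_graph X invX"
  using cover by (simp_all add: abelian_covering_def graph_covering_def)

sublocale Y: bidirected_digraph Y invY using connY by (simp add: connected_graph_def)
sublocale Y: fin_digraph Y using connY by (simp add: connected_graph_def)
sublocale X: fin_digraph X using connX by (simp add: connected_graph_def)

lemma fibre_card: "v \<in> verts X \<Longrightarrow> card (carrier \<Gamma>) = card {w \<in> verts Y. pV w = v}"
  using cover by (simp add: abelian_covering_def)

lemma fibre_nonempty: "v \<in> verts X \<Longrightarrow> \<exists>w\<in>verts Y. pV w = v"
proof -
  assume "v \<in> verts X"
  then have "v \<in> pV ` verts Y" using cover by (simp add: abelian_covering_def graph_covering_def)
  then show ?thesis by blast
qed

lemma pV_verts: "w \<in> verts Y \<Longrightarrow> pV w \<in> verts X"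
  using cover by (auto simp: abelian_covering_def graph_covering_def)

lemma card_Gamma_pos: "card (carrier \<Gamma>) > 0"
proof -
  obtain v where v: "v \<in> verts X" using verts_nonempty[OF connX] by blast
  then have "{w \<in> verts Y. pV w = v} \<noteq> {}" using fibre_nonempty by blast
  then show ?thesis unfolding fibre_card[OF v] by (simp add: card_gt_0_iff)
qed

sublocale G: fin_comm_group \<Gamma>
proof (intro fin_comm_group.intro fin_comm_group_axioms.intro)
  show "comm_group \<Gamma>" using cover by (simp add: abelian_covering_def)
  show "finite (carrier \<Gamma>)" using card_Gamma_pos by (rule card_ge_0_finite)
qed

lemma Gamma_carrier:
  assumes "g \<in> carrier \<Gamma>"
  shows "bij_betw (fst g) (verts Y) (verts Y)" "bij_betw (snd g) (arcs Y) (arcs Y)"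
    "fst g \<in> extensional (verts Y)" "snd g \<in> extensional (arcs Y)"
    "\<And>w. w \<in> verts Y \<Longrightarrow> pV (fst g w) = pV w" "\<And>e. e \<in> arcs Y \<Longrightarrow> pE (snd g e) = pE e"
    "\<And>e. e \<in> arcs Y \<Longrightarrow> tail Y (snd g e) = fst g (tail Y e)" "\<And>e. e \<in> arcs Y \<Longrightarrow> head Y (snd g e) = fst g (head Y e)"
  using assms by (auto simp: galois_group_def Bij_def graph_morphism_def)

lemma act_closed: "g \<in> carrier \<Gamma> \<Longrightarrow> w \<in> verts Y \<Longrightarrow> fst g w \<in> verts Y"
  using bij_betwE[OF Gamma_carrier(1)] by blast

lemma arc_closed: "g \<in> carrier \<Gamma> \<Longrightarrow> e \<in> arcs Y \<Longrightarrow> snd g e \<in> arcs Y"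
  using bij_betwE[OF Gamma_carrier(2)] by blast

lemma act_mult: "g \<in> carrier \<Gamma> \<Longrightarrow> h \<in> carrier \<Gamma> \<Longrightarrow> w \<in> verts Y \<Longrightarrow> fst (g \<otimes>\<^bsub>\<Gamma>\<^esub> h) w = fst g (fst h w)"
  by (auto simp: galois_group_def BijGroup_def DirProd_def compose_def)

lemma act_one: "w \<in> verts Y \<Longrightarrow> fst \<one>\<^bsub>\<Gamma>\<^esub> w = w"
  by (simp add: galois_group_def BijGroup_def DirProd_def)

text \<open>An automorphism fixing a vertex fixes the edges leaving it, because it preserves their
  images in \<open>X\<close> and \<open>pE\<close> is injective on them. Hence it fixes the
  neighbours, and connectedness spreads this over \<open>Y\<close>.\<close>

lemma act_free:
  assumes g: "g \<in> carrier \<Gamma>" and w: "w \<in> verts Y" "fst g w = w"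
  shows "g = \<one>\<^bsub>\<Gamma>\<^esub>"
proof -
  have arc: "snd g e = e" if e: "e \<in> arcs Y" "fst g (tail Y e) = tail Y e" for e
  proof -
    have "inj_on pE (out_arcs Y (tail Y e))"
      using cover e(1) by (auto simp: abelian_covering_def graph_covering_def bij_betw_def)
    moreover have "snd g e \<in> out_arcs Y (tail Y e)" "e \<in> out_arcs Y (tail Y e)"
      using e Gamma_carrier(7)[OF g e(1)] arc_closed[OF g e(1)] by simp_all
    ultimately show ?thesis using Gamma_carrier(6)[OF g e(1)] by (simp add: inj_on_def)
  qed
  have fixed: "fst g v = v" if v: "v \<in> verts Y" for v
  proof (rule connected_graph_induct[where Q = "\<lambda>v. fst g v = v", OF connY w v])
    fix e assume e: "e \<in> arcs Y" "fst g (tail Y e) = tail Y e"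
    show "fst g (head Y e) = head Y e" using Gamma_carrier(8)[OF g e(1)] arc[OF e] by simp
  qed
  have "fst g = (\<lambda>v\<in>verts Y. v)" by (rule extensionalityI[OF Gamma_carrier(3)[OF g]]) (simp_all add: fixed)
  moreover have "snd g = (\<lambda>e\<in>arcs Y. e)"
    by (rule extensionalityI[OF Gamma_carrier(4)[OF g]]) (simp_all add: arc fixed)
  ultimately show ?thesis by (cases g) (simp add: galois_group_def BijGroup_def DirProd_def)
qed

lemma act_inj:
  assumes g: "g \<in> carrier \<Gamma>" and h: "h \<in> carrier \<Gamma>" and w: "w \<in> verts Y" "fst g w = fst h w"
  shows "g = h"
proof -
  have ih: "inv\<^bsub>\<Gamma>\<^esub> h \<in> carrier \<Gamma>" using h by simp
  have "fst (inv\<^bsub>\<Gamma>\<^esub> h \<otimes>\<^bsub>\<Gamma>\<^esub> g) w = fst (inv\<^bsub>\<Gamma>\<^esub> h \<otimes>\<^bsub>\<Gamma>\<^esub> h) w"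
    using act_mult[OF ih g w(1)] act_mult[OF ih h w(1)] w(2) by simp
  also have "\<dots> = w" using h act_one[OF w(1)] by simp
  finally have "inv\<^bsub>\<Gamma>\<^esub> h \<otimes>\<^bsub>\<Gamma>\<^esub> g = \<one>\<^bsub>\<Gamma>\<^esub>" by (rule act_free[OF G.m_closed[OF ih g] w(1)])
  from G.inv_equality[OF this g ih] have "inv\<^bsub>\<Gamma>\<^esub> (inv\<^bsub>\<Gamma>\<^esub> g) = inv\<^bsub>\<Gamma>\<^esub> (inv\<^bsub>\<Gamma>\<^esub> h)" by (simp only:)
  then show ?thesis by (simp only: G.inv_inv[OF g] G.inv_inv[OF h])
qed

text \<open>By freeness an orbit has as many elements as the group, which is the size of the fibre
  containing it.\<close>

lemma act_transitive:
  assumes w: "w \<in> verts Y" and u: "u \<in> verts Y" "pV u = pV w"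
  shows "\<exists>g\<in>carrier \<Gamma>. u = fst g w"
proof -
  have sub: "(\<lambda>g. fst g w) ` carrier \<Gamma> \<subseteq> {u \<in> verts Y. pV u = pV w}"
    using act_closed Gamma_carrier(5) w by auto
  have "card ((\<lambda>g. fst g w) ` carrier \<Gamma>) = card (carrier \<Gamma>)"
    by (rule card_image, rule inj_onI, rule act_inj[OF _ _ w])
  also have "\<dots> = card {u \<in> verts Y. pV u = pV w}" by (rule fibre_card[OF pV_verts[OF w]])
  finally have "(\<lambda>g. fst g w) ` carrier \<Gamma> = {u \<in> verts Y. pV u = pV w}"
    by (rule card_subset_eq[OF _ sub, rotated]) simp
  then show ?thesis using u by blast
qed

lemma Div_lmod: "lmod G.R (Div Y)"
proof (rule lmod_moduleI)
  show "cring G.R" by (rule G.group_ring_cring)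
  fix x assume x: "x \<in> carrier (Div Y)"
  then show "\<exists>y\<in>carrier (Div Y). y \<oplus>\<^bsub>Div Y\<^esub> x = \<zero>\<^bsub>Div Y\<^esub>" by (intro bexI[of _ "- x"]) simp_all
  show "\<one>\<^bsub>G.R\<^esub> \<odot>\<^bsub>Div Y\<^esub> x = x"
    using x by simp (rule conv_unit[where T = "verts Y"], auto simp: act_one)
  show "x \<oplus>\<^bsub>Div Y\<^esub> y \<in> carrier (Div Y)" if "y \<in> carrier (Div Y)" for y using that x keys_add[of x y] by simp blast
  fix a assume a: "a \<in> carrier G.R"
  show "a \<odot>\<^bsub>Div Y\<^esub> x \<in> carrier (Div Y)"
    using a x by simp (rule conv_keys[where S = "carrier \<Gamma>" and T = "verts Y"], auto simp: act_closed)
  fix b assume b: "b \<in> carrier G.R"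
  show "(a \<otimes>\<^bsub>G.R\<^esub> b) \<odot>\<^bsub>Div Y\<^esub> x = a \<odot>\<^bsub>Div Y\<^esub> (b \<odot>\<^bsub>Div Y\<^esub> x)"
    using a b x by simp (rule conv_assoc[where S = "carrier \<Gamma>" and T = "carrier \<Gamma>" and W = "verts Y"], auto simp: act_mult)
qed (simp_all add: add.assoc add.commute conv_add_left conv_add_right)

sublocale D: lmod G.R "Div Y" by (rule Div_lmod)

lemma laplacian_act:
  assumes g: "g \<in> carrier \<Gamma>" and w: "w \<in> verts Y"
  shows "laplacian Y (frag_of (fst g w)) = conv fst (frag_of g) (laplacian Y (frag_of w))"
proof -
  have bij: "bij_betw (snd g) (out_arcs Y w) (out_arcs Y (fst g w))"
    unfolding bij_betw_def
  proof
    have inj: "inj_on (snd g) (arcs Y)" using Gamma_carrier(2)[OF g] by (simp add: bij_betw_def)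
    then show "inj_on (snd g) (out_arcs Y w)" by (rule inj_on_subset) auto
    show "snd g ` out_arcs Y w = out_arcs Y (fst g w)"
    proof
      show "snd g ` out_arcs Y w \<subseteq> out_arcs Y (fst g w)" using Gamma_carrier(7)[OF g] arc_closed[OF g] by auto
      show "out_arcs Y (fst g w) \<subseteq> snd g ` out_arcs Y w"
      proof
        fix e' assume e': "e' \<in> out_arcs Y (fst g w)"
        then obtain e where e: "e \<in> arcs Y" "e' = snd g e" using Gamma_carrier(2)[OF g] by (auto simp: bij_betw_def)
        have "fst g (tail Y e) = fst g w" using e' e Gamma_carrier(7)[OF g e(1)] by simp
        then have "tail Y e = w" using Gamma_carrier(1)[OF g] e(1) w by (auto simp: bij_betw_def inj_on_def)
        then show "e' \<in> snd g ` out_arcs Y w" using e by auto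
      qed
    qed
  qed
  have "(\<Sum>e\<in>out_arcs Y (fst g w). frag_of (head Y e) :: 'w \<Rightarrow>\<^sub>0 int) = (\<Sum>e\<in>out_arcs Y w. frag_of (head Y (snd g e)))"
    by (rule sum.reindex_bij_betw[OF bij, symmetric])
  also have "\<dots> = (\<Sum>e\<in>out_arcs Y w. conv fst (frag_of g) (frag_of (head Y e)))"
    by (rule sum.cong) (use Gamma_carrier(8)[OF g] in auto)
  also have "\<dots> = conv fst (frag_of g) (\<Sum>e\<in>out_arcs Y w. frag_of (head Y e))"
    by (rule conv_sum_right[OF fin_out[OF connY], symmetric])
  finally show ?thesis
    unfolding laplacian_frag_of conv_diff_right bij_betw_same_card[OF bij]
    by (simp add: conv_of_left frag_extend_cmul)
qed

lemma laplacian_hom: "laplacian Y \<in> module_hom G.R (Div Y) (Div Y)"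
  unfolding module_hom_def
proof (intro CollectI conjI ballI funcsetI)
  fix x assume x: "x \<in> carrier (Div Y)"
  show "laplacian Y x \<in> carrier (Div Y)" by (rule laplacian_Div[OF connY x])
  show "laplacian Y (x \<oplus>\<^bsub>Div Y\<^esub> y) = laplacian Y x \<oplus>\<^bsub>Div Y\<^esub> laplacian Y y" for y by (simp add: laplacian_arith)
  fix r assume "r \<in> carrier G.R"
  then have "Poly_Mapping.keys r \<subseteq> carrier \<Gamma>" by simp
  then have "laplacian Y (conv fst r x) = conv fst r (laplacian Y x)"
  proof (induction r rule: frag_induction)
    case (one g)
    have "Poly_Mapping.keys x \<subseteq> verts Y" using x by simp
    then show ?case
      by (induction x rule: frag_induction) (simp_all add: laplacian_act[OF one] laplacian_arith conv_diff_right)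
  qed (simp_all add: laplacian_arith conv_diff_left)
  then show "laplacian Y (r \<odot>\<^bsub>Div Y\<^esub> x) = r \<odot>\<^bsub>Div Y\<^esub> laplacian Y x" by simp
qed

lemma lincomb_Div:
  "(\<And>i. i < n \<Longrightarrow> c i \<in> carrier G.R) \<Longrightarrow> (\<And>i. i < n \<Longrightarrow> g i \<in> carrier (Div Y)) \<Longrightarrow>
    lincomb (Div Y) n c g = (\<Sum>i<n. conv fst (c i) (g i))"
proof (induction n)
  case (Suc n)
  have "lincomb (Div Y) (Suc n) c g = c n \<odot>\<^bsub>Div Y\<^esub> g n \<oplus>\<^bsub>Div Y\<^esub> lincomb (Div Y) n c g"
    by (rule D.lincomb_Suc) (use Suc.prems in auto)
  then show ?case using Suc by simp
qed simp

lemma Div_basis: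
  obtains n w where "is_basis G.R (Div Y) n (\<lambda>i. frag_of (w i))" "\<And>i. i < n \<Longrightarrow> w i \<in> verts Y"
proof -
  obtain v where v: "bij_betw v {0..<card (verts X)} (verts X)"
    using ex_bij_betw_nat_finite[OF X.finite_verts] by blast
  define n where "n = card (verts X)"
  have vX: "v i \<in> verts X" if "i < n" for i using v that by (auto simp: bij_betw_def n_def)
  have "\<forall>i. \<exists>w. i < n \<longrightarrow> w \<in> verts Y \<and> pV w = v i" using fibre_nonempty vX by blast
  then obtain w where "\<forall>i. i < n \<longrightarrow> w i \<in> verts Y \<and> pV (w i) = v i" by (rule choice[THEN exE])
  then have w: "w i \<in> verts Y" "pV (w i) = v i" if "i < n" for i using that by auto
  have orbit: "\<exists>i<n. \<exists>g\<in>carrier \<Gamma>. u = fst g (w i)" if u: "u \<in> verts Y" for u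
  proof -
    obtain i where i: "i < n" "v i = pV u" 
    proof -
      have "pV u \<in> v ` {0..<n}" using pV_verts[OF u] v by (simp add: bij_betw_def n_def)
      then show thesis using that by auto
    qed
    show ?thesis using act_transitive[OF w(1)[OF i(1)] u] w(2)[OF i(1)] i by auto
  qed
  have sep: "i = j" if "i < n" "j < n" "g \<in> carrier \<Gamma>" "h \<in> carrier \<Gamma>" "fst g (w i) = fst h (w j)" for i j g h
  proof -
    have "v i = v j" using Gamma_carrier(5)[OF that(3) w(1)[OF that(1)]] Gamma_carrier(5)[OF that(4) w(1)[OF that(2)]] w(2) that by simp
    then show ?thesis using v that(1,2) by (auto simp: bij_betw_def inj_on_def n_def)
  qed
  have coord: "Poly_Mapping.lookup (conv fst c (frag_of (w i))) (fst g (w j)) = (if i = j then Poly_Mapping.lookup c g else 0)"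
    if c: "c \<in> carrier G.R" and ij: "i < n" "j < n" and g: "g \<in> carrier \<Gamma>" for c i j g
  proof -
    have "Poly_Mapping.keys c \<subseteq> carrier \<Gamma>" using c by simp
    then show ?thesis
    proof (induction c rule: frag_induction)
      case (one h)
      have "fst g (w j) = fst h (w i) \<longleftrightarrow> i = j \<and> g = h"
        using sep[OF ij(2,1) g one] act_inj[OF g one w(1)[OF ij(2)]] by auto
      then show ?case by simp
    qed (simp_all add: conv_diff_left lookup_minus)
  qed
  have wD: "frag_of (w i) \<in> carrier (Div Y)" if "i < n" for i using w that by simp
  \<comment> \<open>The coefficient at \<open>fst g (w j)\<close> isolates the coefficient of
    \<open>c j\<close> at \<open>g\<close>. Existence and uniqueness of coordinates both rest on
    this formula.\<close>
  have coords: "Poly_Mapping.lookup (lincomb (Div Y) n c (\<lambda>i. frag_of (w i))) (fst g (w j)) = Poly_Mapping.lookup (c j) g"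
    if c: "c \<in> carrier (G.R.F n)" and j: "j < n" and g: "g \<in> carrier \<Gamma>" for c j g
  proof -
    have "lincomb (Div Y) n c (\<lambda>i. frag_of (w i)) = (\<Sum>i<n. conv fst (c i) (frag_of (w i)))"
      by (rule lincomb_Div) (use G.R.F_closed[OF c] wD in auto)
    then have "Poly_Mapping.lookup (lincomb (Div Y) n c (\<lambda>i. frag_of (w i))) (fst g (w j)) =
        (\<Sum>i<n. if i = j then Poly_Mapping.lookup (c i) g else 0)"
      using coord[OF G.R.F_closed[OF c] _ j g] by (simp add: lookup_sum)
    then show ?thesis using j by simp
  qed
  have "is_basis G.R (Div Y) n (\<lambda>i. frag_of (w i))"
    unfolding is_basis_def
  proof (intro conjI ballI funcsetI)
    show "frag_of (w i) \<in> carrier (Div Y)" if "i \<in> {..<n}" for i using wD that by simp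
    fix x assume x: "x \<in> carrier (Div Y)"
    define c where "c i = (if i < n then \<Sum>g\<in>carrier \<Gamma>. frag_cmul (Poly_Mapping.lookup x (fst g (w i))) (frag_of g) else 0)" for i
    have cR: "c i \<in> carrier G.R" for i
    proof -
      have "Poly_Mapping.keys (\<Sum>g\<in>carrier \<Gamma>. frag_cmul (Poly_Mapping.lookup x (fst g (w i))) (frag_of g)) \<subseteq>
          (\<Union>g\<in>carrier \<Gamma>. Poly_Mapping.keys (frag_cmul (Poly_Mapping.lookup x (fst g (w i))) (frag_of g)))"
        by (rule keys_sum)
      then show ?thesis by (auto simp: c_def)
    qed
    have cF: "c \<in> carrier (G.R.F n)" using cR by (simp add: G.R.F_carrier c_def)
    have cl: "Poly_Mapping.lookup (c i) g = Poly_Mapping.lookup x (fst g (w i))" if "i < n" "g \<in> carrier \<Gamma>" for i g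
      using that G.fin by (simp add: c_def lookup_sum if_distrib[of "(*) _"] sum.delta cong: if_cong)
    have lc: "lincomb (Div Y) n c (\<lambda>i. frag_of (w i)) \<in> carrier (Div Y)"
      by (rule D.lincomb_closed) (use cR wD in auto)
    have "x = lincomb (Div Y) n c (\<lambda>i. frag_of (w i))"
    proof (rule Div_eqI[OF connY x lc])
      fix u assume "u \<in> verts Y"
      then obtain i g where i: "i < n" "g \<in> carrier \<Gamma>" "u = fst g (w i)" using orbit by blast
      then show "Poly_Mapping.lookup x u = Poly_Mapping.lookup (lincomb (Div Y) n c (\<lambda>i. frag_of (w i))) u"
        using coords[OF cF i(1,2)] cl by simp
    qed
    moreover have "c' = c" if c': "c' \<in> carrier (G.R.F n)" "x = lincomb (Div Y) n c' (\<lambda>i. frag_of (w i))" for c'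
    proof
      fix i show "c' i = c i"
      proof (cases "i < n")
        case True
        show ?thesis
        proof (rule poly_mapping_eqI)
          fix g show "Poly_Mapping.lookup (c' i) g = Poly_Mapping.lookup (c i) g"
          proof (cases "g \<in> carrier \<Gamma>")
            case g: True
            show ?thesis using coords[OF c'(1) True g] cl[OF True g] c'(2) by simp
          next
            case False
            then have "g \<notin> Poly_Mapping.keys (c' i)" "g \<notin> Poly_Mapping.keys (c i)"
              using G.R.F_closed[OF c'(1), of i] cR[of i] by auto
            then show ?thesis by (simp add: in_keys_iff)
          qed
        qed
      next
        case False
        then show ?thesis using c'(1) cF by (simp add: G.R.F_carrier)
      qed
    qed
    ultimately show "\<exists>!c. c \<in> carrier (G.R.F n) \<and> x = lincomb (Div Y) n c (\<lambda>i. frag_of (w i))"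
      using cF by (intro ex1I[of _ c]) auto
  qed
  then show thesis using w(1) by (rule that)
qed

end

section \<open>The cyclic module\<close>

definition int_coset :: "int \<Rightarrow> int \<Rightarrow> int set" where
  "int_coset k a = Idl\<^bsub>\<Z>\<^esub> {k} +>\<^bsub>\<Z>\<^esub> a"

lemma int_coset_hom: "int_coset k \<in> Ring.ring_hom \<Z> (ZFact k)"
  unfolding int_coset_def ZFact_def by (rule ideal.rcos_ring_hom[OF int.genideal_ideal]) simp

lemma int_coset_surj: "carrier (ZFact k) = range (int_coset k)"
  by (auto simp: ZFact_def FactRing_def A_RCOSETS_def' int_coset_def)

lemma int_coset_add: "int_coset k (a + b) = int_coset k a \<oplus>\<^bsub>ZFact k\<^esub> int_coset k b"
  using ring_hom_add[OF int_coset_hom, of a b] by simp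

lemma int_coset_zero: "int_coset k 0 = \<zero>\<^bsub>ZFact k\<^esub>"
  using ring_hom_zero[OF int_coset_hom int.ring_axioms cring.axioms(1)[OF ZFact_is_cring]] by simp

lemma int_coset_zero_iff: "int_coset k a = \<zero>\<^bsub>ZFact k\<^esub> \<longleftrightarrow> k dvd a"
proof -
  have "int_coset k a = int_coset k 0 \<longleftrightarrow> a - 0 \<in> Idl\<^bsub>\<Z>\<^esub> {k}"
    unfolding int_coset_def using int.quotient_eq_iff_same_a_r_cos[OF int.genideal_ideal, of "{k}" a 0] by simp
  also have "\<dots> \<longleftrightarrow> k dvd a" by (auto simp: int_Idl dvd_def mult.commute)
  finally show ?thesis by (simp add: int_coset_zero)
qed

lemma int_coset_add_pow: "[m] \<cdot>\<^bsub>ZFact k\<^esub> int_coset k a = int_coset k (m * a)"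
proof -
  interpret Z: cring "ZFact k" by (rule ZFact_is_cring)
  have cl: "int_coset k b \<in> carrier (ZFact k)" for b using int_coset_surj by blast
  have nat: "[j] \<cdot>\<^bsub>ZFact k\<^esub> int_coset k a = int_coset k (int j * a)" for j :: nat
  proof (induction j)
    case 0
    then show ?case by (simp add: int_coset_zero)
  next
    case (Suc j)
    have "[Suc j] \<cdot>\<^bsub>ZFact k\<^esub> int_coset k a = [j] \<cdot>\<^bsub>ZFact k\<^esub> int_coset k a \<oplus>\<^bsub>ZFact k\<^esub> int_coset k a"
      by (simp add: cl)
    then show ?case by (simp add: Suc int_coset_add[symmetric] algebra_simps)
  qed
  have neg: "\<ominus>\<^bsub>ZFact k\<^esub> int_coset k b = int_coset k (- b)" for b
    by (rule Z.minus_equality) (simp_all add: cl int_coset_add[symmetric] int_coset_zero)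
  show ?thesis
  proof (cases "m \<ge> 0")
    case True
    then show ?thesis using nat[of "nat m"] by (simp add: add_pow_int_ge)
  next
    case False
    then show ?thesis using nat[of "nat (- m)"] by (simp add: add_pow_int_lt neg)
  qed
qed

section \<open>The integers modulo the order, as a module over the reduced group ring\<close>

context fin_comm_group
begin

abbreviation "ord \<equiv> int (card (carrier G))"
abbreviation "T0 \<equiv> trivial_module (ZFact ord) :: ('g \<Rightarrow>\<^sub>0 int, int set) module"

lemma T0_simps [simp]:
  "carrier T0 = range (int_coset ord)" "\<zero>\<^bsub>T0\<^esub> = int_coset ord 0"
  "int_coset ord a \<oplus>\<^bsub>T0\<^esub> int_coset ord b = int_coset ord (a + b)"
  "r \<odot>\<^bsub>T0\<^esub> int_coset ord a = int_coset ord (frag_deg r * a)"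
  by (simp_all add: trivial_module_def int_coset_surj int_coset_zero int_coset_add int_coset_add_pow)

lemma T0_lmod: "lmod R T0"
proof (rule lmod_moduleI)
  show "cring R" by (rule group_ring_cring)
  fix x assume "x \<in> carrier T0"
  then obtain a where x: "x = int_coset ord a" by auto
  have "int_coset ord (- a) \<oplus>\<^bsub>T0\<^esub> x = \<zero>\<^bsub>T0\<^esub>" unfolding x by (simp del: T0_simps add: T0_simps(2,3))
  then show "\<exists>y\<in>carrier T0. y \<oplus>\<^bsub>T0\<^esub> x = \<zero>\<^bsub>T0\<^esub>" by auto
qed (auto simp: algebra_simps frag_deg_conv)

text \<open>The norm acts through its augmentation, the order of the group.\<close>

lemma T0_killed: "a \<in> I \<Longrightarrow> x \<in> carrier T0 \<Longrightarrow> a \<odot>\<^bsub>T0\<^esub> x = \<zero>\<^bsub>T0\<^esub>"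
proof -
  assume "a \<in> I" "x \<in> carrier T0"
  then obtain j b where a: "a = frag_cmul j Nm" and x: "x = int_coset ord b" unfolding mem_norm_ideal by auto
  show ?thesis unfolding a x using int_coset_zero_iff[of ord "j * ord * b"] int_coset_zero[of ord]
    by (simp add: frag_deg_norm)
qed

abbreviation "T \<equiv> descend_module T0"

lemma T_smult: "r \<in> carrier R \<Longrightarrow> x \<in> carrier T0 \<Longrightarrow> pr r \<odot>\<^bsub>T\<^esub> x = r \<odot>\<^bsub>T0\<^esub> x"
  by (rule R.descend_smult[OF norm_ideal T0_lmod]) (erule (1) T0_killed)

lemma T_lmod: "lmod B T"
  by (rule R.descend_lmod[OF norm_ideal T0_lmod]) (erule (1) T0_killed)

lemma ord_nonzero: "ord \<noteq> 0"
  using fin one_closed by auto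

lemma T_torsion: "torsion_module B T"
  unfolding torsion_module_def
proof (intro conjI ballI)
  show "Module.module B T" by (rule lmodD[OF T_lmod])
  fix x assume "x \<in> carrier T"
  then obtain a where x: "x = int_coset ord a" by auto
  have c: "frag_cmul ord \<one>\<^bsub>R\<^esub> \<in> carrier R" by (rule frag_cmul_R) simp
  have "pr (frag_cmul ord \<one>\<^bsub>R\<^esub>) \<odot>\<^bsub>T\<^esub> x = frag_cmul ord \<one>\<^bsub>R\<^esub> \<odot>\<^bsub>T0\<^esub> x"
    by (rule T_smult[OF c]) (simp add: x)
  also have "\<dots> = \<zero>\<^bsub>T\<^esub>" unfolding x using int_coset_zero_iff[of ord "ord * a"] int_coset_zero[of ord] by simp
  finally show "\<exists>s\<in>non_zero_divisors B. s \<odot>\<^bsub>T\<^esub> x = \<zero>\<^bsub>T\<^esub>"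
    using integer_nzd[OF ord_nonzero] by blast
qed

text \<open>
  Over \<open>B\<close> the module \<open>\<int>/ord\<close> has the single generator \<open>1\<close>, subject to the relations \<open>ord\<close> and
  \<open>g - 1\<close>, because \<open>r - frag_deg r\<close> is a combination of the latter.
\<close>

lemma T_finitely_presented: "finitely_presented B T"
proof -
  interpret T: lmod B T by (rule T_lmod)
  define E where "E r = (\<lambda>s::nat. if s = 0 then pr r else \<zero>\<^bsub>B\<^esub>)" for r
  define t where "t = (\<lambda>_::nat. int_coset ord 1)"
  define H where "H = insert (E (frag_cmul ord \<one>\<^bsub>R\<^esub>)) ((\<lambda>g. E (frag_of g - \<one>\<^bsub>R\<^esub>)) ` carrier G)"
  note pc = ring_hom_closed[OF pr_hom]
  have tc: "t \<in> {..<1} \<rightarrow> carrier T" by (auto simp: t_def)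
  have EF: "E r \<in> carrier (B.F 1)" if "r \<in> carrier R" for r
    using pc[OF that] by (auto simp: E_def B.F_carrier)
  have El: "lincomb T 1 (E r) t = int_coset ord (frag_deg r)" if r: "r \<in> carrier R" for r
  proof -
    have "lincomb T (Suc 0) (E r) t = pr r \<odot>\<^bsub>T\<^esub> int_coset ord 1 \<oplus>\<^bsub>T\<^esub> lincomb T 0 (E r) t"
      using T.lincomb_Suc[of 0 "E r" t] pc[OF r] by (simp add: E_def t_def)
    also have "pr r \<odot>\<^bsub>T\<^esub> int_coset ord 1 = int_coset ord (frag_deg r)"
      using T_smult[OF r, of "int_coset ord 1"] by simp
    finally show ?thesis by simp
  qed
  have Esurj: "\<exists>r\<in>carrier R. c = E r" if c: "c \<in> carrier (B.F 1)" for c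
  proof -
    have "c 0 \<in> pr ` carrier R" unfolding pr_surj by (rule B.F_closed[OF c])
    then obtain r where r: "r \<in> carrier R" "c 0 = pr r" by blast
    have "c = E r" using c r(2) by (auto simp: E_def B.F_carrier fun_eq_iff)
    then show ?thesis using r(1) by blast
  qed
  have rel_iff: "c \<in> rel B T 1 t \<longleftrightarrow> (\<exists>r\<in>carrier R. c = E r \<and> ord dvd frag_deg r)" for c
  proof
    assume "c \<in> rel B T 1 t"
    then have c: "c \<in> carrier (B.F 1)" "lincomb T 1 c t = \<zero>\<^bsub>T\<^esub>" by (simp_all add: rel_def)
    obtain r where r: "r \<in> carrier R" "c = E r" using Esurj[OF c(1)] by blast
    then have "int_coset ord (frag_deg r) = \<zero>\<^bsub>ZFact ord\<^esub>" using c(2) El[OF r(1)] int_coset_zero[of ord] by simp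
    then show "\<exists>r\<in>carrier R. c = E r \<and> ord dvd frag_deg r" using r int_coset_zero_iff by blast
  next
    assume "\<exists>r\<in>carrier R. c = E r \<and> ord dvd frag_deg r"
    then obtain r where r: "r \<in> carrier R" "c = E r" "ord dvd frag_deg r" by blast
    then show "c \<in> rel B T 1 t"
      using El[OF r(1)] EF[OF r(1)] int_coset_zero_iff[of ord "frag_deg r"] int_coset_zero[of ord] by (simp add: rel_def)
  qed
  have gR: "frag_of g - \<one>\<^bsub>R\<^esub> \<in> carrier R" if "g \<in> carrier G" for g
    using R.minus_closed[of "frag_of g" "\<one>\<^bsub>R\<^esub>"] R_minus[of "frag_of g" "\<one>\<^bsub>R\<^esub>"] that by simp
  have kR: "frag_cmul j \<one>\<^bsub>R\<^esub> \<in> carrier R" for j by (rule frag_cmul_R) simp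
  have Hrel: "H \<subseteq> rel B T 1 t"
  proof
    fix c assume "c \<in> H"
    then consider "c = E (frag_cmul ord \<one>\<^bsub>R\<^esub>)" | g where "g \<in> carrier G" "c = E (frag_of g - \<one>\<^bsub>R\<^esub>)" unfolding H_def by blast
    then show "c \<in> rel B T 1 t"
    proof cases
      case 1
      then show ?thesis unfolding rel_iff using kR by (intro bexI[of _ "frag_cmul ord \<one>\<^bsub>R\<^esub>"]) auto
    next
      case 2
      then show ?thesis unfolding rel_iff using gR[OF 2(1)] by (intro bexI[of _ "frag_of g - \<one>\<^bsub>R\<^esub>"]) auto
    qed
  qed
  interpret F1: lmod B "B.F 1" by (rule B.free_lmod)
  have relS: "submodule (rel B T 1 t) B (B.F 1)" by (rule T.rel_submodule[OF tc])
  have HF: "H \<subseteq> carrier (B.F 1)" using Hrel by (auto simp: rel_def)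
  define S where "S = span B (B.F 1) H"
  have S: "submodule S B (B.F 1)" unfolding S_def by (rule F1.span_submodule[OF HF])
  have HS: "H \<subseteq> S" unfolding S_def by (rule hull_subset)
  note Sx = S[unfolded F1.submodule_iff, THEN conjunct2]
  note S_zero = conjunct1[OF Sx] and S_add' = conjunct1[OF conjunct2[OF Sx]] and S_smult' = conjunct2[OF conjunct2[OF Sx]]
  have E_add: "E (x + y) = E x \<oplus>\<^bsub>B.F 1\<^esub> E y" if "x \<in> carrier R" "y \<in> carrier R" for x y
    using ring_hom_add[OF pr_hom that] by (auto simp: E_def fun_eq_iff)
  have E_smult: "E (x \<otimes>\<^bsub>R\<^esub> y) = pr x \<odot>\<^bsub>B.F 1\<^esub> E y" if "x \<in> carrier R" "y \<in> carrier R" for x y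
    using ring_hom_mult[OF pr_hom that] pc[OF that(1)] by (auto simp: E_def fun_eq_iff)
  have S_add: "x \<oplus>\<^bsub>B.F 1\<^esub> y \<in> S" if "x \<in> S" "y \<in> S" for x y by (rule bspec[OF bspec[OF S_add' that(1)] that(2)])
  have S_smult: "a \<odot>\<^bsub>B.F 1\<^esub> y \<in> S" if "a \<in> carrier B" "y \<in> S" for a y by (rule bspec[OF bspec[OF S_smult' that(1)] that(2)])
  have aug: "r - frag_cmul (frag_deg r) \<one>\<^bsub>R\<^esub> \<in> carrier R \<and> E (r - frag_cmul (frag_deg r) \<one>\<^bsub>R\<^esub>) \<in> S" if r: "r \<in> carrier R" for r
  proof -
    have "Poly_Mapping.keys r \<subseteq> carrier G" using r by simp
    then show ?thesis
    proof (induction r rule: frag_induction)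
      case zero
      have "E 0 = \<zero>\<^bsub>B.F 1\<^esub>" using pr_zero by (auto simp: E_def fun_eq_iff)
      then show ?case using S_zero by simp
    next
      case (one g)
      then show ?case using gR[OF one] HS unfolding H_def by auto
    next
      case (diff a b)
      let ?a = "a - frag_cmul (frag_deg a) \<one>\<^bsub>R\<^esub>" and ?b = "b - frag_cmul (frag_deg b) \<one>\<^bsub>R\<^esub>"
      \<comment> \<open>The span is closed under sums and scalar multiples, so the difference is
        written as a sum with a multiple by -1.\<close>
      have e: "a - b - frag_cmul (frag_deg (a - b)) \<one>\<^bsub>R\<^esub> = ?a + (frag_cmul (- 1) \<one>\<^bsub>R\<^esub>) \<otimes>\<^bsub>R\<^esub> ?b"
      proof -
        have "(frag_cmul (- 1) \<one>\<^bsub>R\<^esub>) \<otimes>\<^bsub>R\<^esub> ?b = - ?b"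
          using R.l_one[of ?b] diff by (simp add: frag_cmul_conv[of "- 1", symmetric] del: frag_cmul_minus_one group_ring_simps(4)) (simp)
        then show ?thesis by (simp add: frag_cmul_diff_distrib)
      qed
      have m: "(frag_cmul (- 1) \<one>\<^bsub>R\<^esub>) \<otimes>\<^bsub>R\<^esub> ?b \<in> carrier R" using R.m_closed[OF kR] diff by blast
      have "E ((frag_cmul (- 1) \<one>\<^bsub>R\<^esub>) \<otimes>\<^bsub>R\<^esub> ?b) \<in> S"
        using E_smult[OF kR[of "- 1"], of ?b] S_smult[OF pc[OF kR[of "- 1"]], of "E ?b"] diff by simp
      then have "E (?a + (frag_cmul (- 1) \<one>\<^bsub>R\<^esub>) \<otimes>\<^bsub>R\<^esub> ?b) \<in> S" using E_add[OF _ m, of ?a] diff S_add by simp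
      moreover have "?a + (frag_cmul (- 1) \<one>\<^bsub>R\<^esub>) \<otimes>\<^bsub>R\<^esub> ?b \<in> carrier R" using R.a_closed[OF _ m, of ?a] diff by simp
      ultimately show ?case unfolding e by blast
    qed
  qed
  have "rel B T 1 t \<subseteq> S"
  proof
    fix c assume "c \<in> rel B T 1 t"
    then obtain r where r: "r \<in> carrier R" "c = E r" "ord dvd frag_deg r" unfolding rel_iff by blast
    obtain j where j: "frag_deg r = ord * j" using r(3) by (auto simp: dvd_def)
    have e: "frag_cmul j \<one>\<^bsub>R\<^esub> \<otimes>\<^bsub>R\<^esub> frag_cmul ord \<one>\<^bsub>R\<^esub> = frag_cmul (frag_deg r) \<one>\<^bsub>R\<^esub>"
      using R.l_one[OF kR[of ord]] by (simp add: frag_cmul_conv[symmetric] j mult.commute)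
    have "E (frag_cmul (frag_deg r) \<one>\<^bsub>R\<^esub>) \<in> S"
      unfolding e[symmetric] E_smult[OF kR kR] by (rule S_smult[OF pc[OF kR]]) (use HS in \<open>auto simp: H_def\<close>)
    then have "E (frag_cmul (frag_deg r) \<one>\<^bsub>R\<^esub>) \<oplus>\<^bsub>B.F 1\<^esub> E (r - frag_cmul (frag_deg r) \<one>\<^bsub>R\<^esub>) \<in> S"
      using aug[OF r(1)] by (intro S_add) simp_all
    moreover have "E (frag_cmul (frag_deg r) \<one>\<^bsub>R\<^esub>) \<oplus>\<^bsub>B.F 1\<^esub> E (r - frag_cmul (frag_deg r) \<one>\<^bsub>R\<^esub>) = E (frag_cmul (frag_deg r) \<one>\<^bsub>R\<^esub> + (r - frag_cmul (frag_deg r) \<one>\<^bsub>R\<^esub>))"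
      by (rule E_add[OF kR conjunct1[OF aug[OF r(1)]], symmetric])
    moreover have "frag_cmul (frag_deg r) \<one>\<^bsub>R\<^esub> + (r - frag_cmul (frag_deg r) \<one>\<^bsub>R\<^esub>) = r" by simp
    ultimately show "c \<in> S" unfolding r(2) by (simp only:)
  qed
  moreover have "S \<subseteq> rel B T 1 t" unfolding S_def using F1.span_subset_iff[OF relS] Hrel by blast
  ultimately have span: "span B (B.F 1) H = rel B T 1 t" unfolding S_def by blast
  have gen: "generates B T 1 t"
    unfolding generates_def
  proof (intro conjI ballI tc)
    fix x assume "x \<in> carrier T"
    then obtain a where x: "x = int_coset ord a" by auto
    show "\<exists>c\<in>carrier (B.F 1). x = lincomb T 1 c t"
      using El[OF kR[of a]] EF[OF kR[of a]] unfolding x by (intro bexI[of _ "E (frag_cmul a \<one>\<^bsub>R\<^esub>)"]) simp_all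
  qed
  have "presentation B T 1 t H" unfolding presentation_iff using gen span by simp
  moreover have "finite H" using fin by (simp add: H_def)
  ultimately show ?thesis unfolding finitely_presented_def using lmodD[OF T_lmod] by blast
qed

end

section \<open>The Jacobian of an abelian covering\<close>

context abelian_cover
begin

abbreviation "L \<equiv> laplacian Y"
abbreviation "DY \<equiv> carrier (Div Y)"

text \<open>The quotient of \<open>DY\<close> by \<open>U\<close> is the base change to
  \<open>B\<close> of the cokernel of \<open>L\<close>, realised by dividing out the multiples of
  the norm.\<close>

definition U :: "('w \<Rightarrow>\<^sub>0 int) set" where
  "U = {L x + conv fst G.Nm y | x y. x \<in> DY \<and> y \<in> DY}"

lemmas smult_assoc = D.smult_assoc1[unfolded Div_simps(4) group_ring_simps(1)]
lemmas smult_closed = D.smult_closed[unfolded Div_simps(4)]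

lemma laplacian_smult: "r \<in> carrier G.R \<Longrightarrow> x \<in> DY \<Longrightarrow> L (conv fst r x) = conv fst r (L x)"
  using laplacian_hom by (simp add: module_hom_def)

lemma norm_smult_commute:
  assumes a: "a \<in> carrier G.R" and y: "y \<in> DY"
  shows "conv fst a (conv fst G.Nm y) = conv fst G.Nm (conv fst a y)"
  using smult_assoc[OF a G.norm_closed y] smult_assoc[OF G.norm_closed a y] G.R.m_comm[OF a G.norm_closed] by simp

lemma Div_add: "x \<in> DY \<Longrightarrow> y \<in> DY \<Longrightarrow> x + y \<in> DY"
  using D.M.a_closed[of x y] by simp

lemma U_sub: "submodule U G.R (Div Y)"
  unfolding D.submodule_iff
proof (intro conjI ballI subsetI)
  fix z assume "z \<in> U"
  then obtain x y where x: "x \<in> DY" and y: "y \<in> DY" and z: "z = L x + conv fst G.Nm y" unfolding U_def by blast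
  show "z \<in> DY" unfolding z by (rule Div_add[OF laplacian_Div[OF connY x] smult_closed[OF G.norm_closed y]])
  fix z' assume "z' \<in> U"
  then obtain x' y' where x': "x' \<in> DY" and y': "y' \<in> DY" and z': "z' = L x' + conv fst G.Nm y'" unfolding U_def by blast
  have "z \<oplus>\<^bsub>Div Y\<^esub> z' = L (x + x') + conv fst G.Nm (y + y')"
    unfolding z z' by (simp add: laplacian_arith conv_add_right)
  then show "z \<oplus>\<^bsub>Div Y\<^esub> z' \<in> U" unfolding U_def using Div_add[OF x x'] Div_add[OF y y'] by blast
next
  have "\<zero>\<^bsub>Div Y\<^esub> = L 0 + conv fst G.Nm 0" by (simp add: laplacian_arith)
  moreover have "0 \<in> DY" by simp
  ultimately show "\<zero>\<^bsub>Div Y\<^esub> \<in> U" unfolding U_def by blast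
next
  fix a z assume a: "a \<in> carrier G.R" and "z \<in> U"
  then obtain x y where x: "x \<in> DY" and y: "y \<in> DY" and z: "z = L x + conv fst G.Nm y" unfolding U_def by blast
  have "a \<odot>\<^bsub>Div Y\<^esub> z = L (conv fst a x) + conv fst G.Nm (conv fst a y)"
    unfolding z by (simp add: conv_add_right laplacian_smult[OF a x] norm_smult_commute[OF a y])
  then show "a \<odot>\<^bsub>Div Y\<^esub> z \<in> U" unfolding U_def using smult_closed[OF a x] smult_closed[OF a y] by blast
qed

lemma U_Div: "d \<in> U \<Longrightarrow> d \<in> DY"
  using U_sub[unfolded D.submodule_iff] by blast

abbreviation "P0 \<equiv> quotient_module (Div Y) U"
abbreviation "P \<equiv> descend_module P0"
abbreviation "cls d \<equiv> U +>\<^bsub>Div Y\<^esub> d"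

lemma P0_lmod: "lmod G.R P0" by (rule D.quotient_lmod[OF U_sub])

lemma norm_in_U: "y \<in> DY \<Longrightarrow> conv fst G.Nm y \<in> U"
proof -
  assume y: "y \<in> DY"
  have "conv fst G.Nm y = L 0 + conv fst G.Nm y" by (simp add: laplacian_arith)
  moreover have "0 \<in> DY" by simp
  ultimately show ?thesis unfolding U_def using y by blast
qed

lemma laplacian_in_U: "x \<in> DY \<Longrightarrow> L x \<in> U"
proof -
  assume x: "x \<in> DY"
  have "L x = L x + conv fst G.Nm 0" by simp
  moreover have "0 \<in> DY" by simp
  ultimately show ?thesis unfolding U_def using x by blast
qed

lemma P0_killed:
  assumes a: "a \<in> G.I" and z: "z \<in> carrier P0" shows "a \<odot>\<^bsub>P0\<^esub> z = \<zero>\<^bsub>P0\<^esub>"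
proof -
  obtain r where r: "r \<in> carrier G.R" "a = r \<otimes>\<^bsub>G.R\<^esub> G.Nm" using a unfolding cgenideal_def by blast
  obtain d where d: "d \<in> DY" "z = cls d" using z D.quot_carrier[OF U_sub] by blast
  have ac: "a \<in> carrier G.R" unfolding r(2) by (rule G.R.m_closed[OF r(1) G.norm_closed])
  have "a \<odot>\<^bsub>P0\<^esub> z = cls (a \<odot>\<^bsub>Div Y\<^esub> d)" unfolding d(2) by (rule D.quot_smult[OF U_sub ac d(1)])
  also have "a \<odot>\<^bsub>Div Y\<^esub> d = conv fst G.Nm (conv fst r d)"
    unfolding r(2) using smult_assoc[OF r(1) G.norm_closed d(1)] norm_smult_commute[OF r(1) d(1)] by simp
  also have "cls \<dots> = \<zero>\<^bsub>P0\<^esub>"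
    using D.quot_zero_iff[OF U_sub smult_closed[OF G.norm_closed smult_closed[OF r(1) d(1)]]]
      norm_in_U[OF smult_closed[OF r(1) d(1)]] by simp
  finally show ?thesis .
qed

lemma P_smult: "r \<in> carrier G.R \<Longrightarrow> x \<in> carrier P0 \<Longrightarrow> G.pr r \<odot>\<^bsub>P\<^esub> x = r \<odot>\<^bsub>P0\<^esub> x"
  by (rule G.R.descend_smult[OF G.norm_ideal P0_lmod]) (erule (1) P0_killed)

lemma P_lmod: "lmod G.B P"
  by (rule G.R.descend_lmod[OF G.norm_ideal P0_lmod]) (erule (1) P0_killed)

sublocale P: lmod G.B P by (rule P_lmod)

lemma cls_closed: "d \<in> DY \<Longrightarrow> cls d \<in> carrier P"
  using D.quot_coset[OF U_sub] by simp

lemma cls_add: "x \<in> DY \<Longrightarrow> y \<in> DY \<Longrightarrow> cls x \<oplus>\<^bsub>P\<^esub> cls y = cls (x + y)"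
  using D.quot_add[OF U_sub, of x y] by simp

lemma cls_zero_iff: "d \<in> DY \<Longrightarrow> cls d = \<zero>\<^bsub>P\<^esub> \<longleftrightarrow> d \<in> U"
  using D.quot_zero_iff[OF U_sub] by simp

lemma cls_smult: "r \<in> carrier G.R \<Longrightarrow> d \<in> DY \<Longrightarrow> G.pr r \<odot>\<^bsub>P\<^esub> cls d = cls (conv fst r d)"
  using P_smult[OF _ D.quot_coset[OF U_sub], of r d] D.quot_smult[OF U_sub, of r d] by simp

lemma cls_surj: "x \<in> carrier P \<Longrightarrow> \<exists>d\<in>DY. x = cls d"
  using D.quot_carrier[OF U_sub] by simp

lemma cls_lincomb:
  assumes "\<And>i. i < n \<Longrightarrow> c i \<in> carrier G.R" "\<And>i. i < n \<Longrightarrow> g i \<in> DY"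
  shows "lincomb P n (\<lambda>i. G.pr (c i)) (\<lambda>i. cls (g i)) = cls (lincomb (Div Y) n c g)"
  using assms
proof (induction n)
  case 0
  then show ?case using cls_zero_iff[of 0] norm_in_U[of 0] by simp
next
  case (Suc n)
  have gD: "lincomb (Div Y) n c g \<in> DY" by (rule D.lincomb_closed) (use Suc.prems in auto)
  have "lincomb P (Suc n) (\<lambda>i. G.pr (c i)) (\<lambda>i. cls (g i)) =
      G.pr (c n) \<odot>\<^bsub>P\<^esub> cls (g n) \<oplus>\<^bsub>P\<^esub> lincomb P n (\<lambda>i. G.pr (c i)) (\<lambda>i. cls (g i))"
    by (rule P.lincomb_Suc) (use Suc.prems ring_hom_closed[OF G.pr_hom] cls_closed in \<open>auto simp del: Div_simps group_ring_simps\<close>)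
  also have "lincomb P n (\<lambda>i. G.pr (c i)) (\<lambda>i. cls (g i)) = cls (lincomb (Div Y) n c g)" by (rule Suc.IH) (use Suc.prems in auto)
  also have "G.pr (c n) \<odot>\<^bsub>P\<^esub> cls (g n) = cls (conv fst (c n) (g n))" by (rule cls_smult) (use Suc.prems in auto)
  also have "cls (conv fst (c n) (g n)) \<oplus>\<^bsub>P\<^esub> cls (lincomb (Div Y) n c g) = cls (conv fst (c n) (g n) + lincomb (Div Y) n c g)"
    by (rule cls_add[OF smult_closed gD]) (use Suc.prems in auto)
  also have "conv fst (c n) (g n) + lincomb (Div Y) n c g = lincomb (Div Y) (Suc n) c g"
    using D.lincomb_Suc[of n c g] Suc.prems by auto
  finally show ?case .
qed

text \<open>The rows of the presentation are the coordinates of the \<open>L (b j)\<close>, reduced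
  modulo the norm. \<open>square_presentation\<close> turns this matrix into all the claims about
  \<open>P\<close>.\<close>

lemma P_presentation:
  defines "Z \<equiv> endo_det G.R (Div Y) L"
  shows "Z \<in> carrier G.R" "resolved G.B P" "finitely_presented G.B P" "Fitt G.B P = PIdl\<^bsub>G.B\<^esub> (G.pr Z)"
proof -
  obtain n w where basis: "is_basis G.R (Div Y) n (\<lambda>i. frag_of (w i))" and w: "\<And>i. i < n \<Longrightarrow> w i \<in> verts Y"
    by (rule Div_basis) (rule that)
  define b where "b = (\<lambda>i. frag_of (w i) :: 'w \<Rightarrow>\<^sub>0 int)"
  note basis = basis[folded b_def]
  have bD: "b i \<in> DY" if "i < n" for i using w[OF that] by (simp add: b_def)
  have bc: "b \<in> {..<n} \<rightarrow> DY" using bD by blast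
  have LbD: "(\<lambda>j. L (b j)) \<in> {..<n} \<rightarrow> DY" using laplacian_Div[OF connY bD] by blast
  obtain Ct where Ct: "\<forall>i<n. \<forall>j<n. Ct i j \<in> carrier G.R" "\<And>j. j < n \<Longrightarrow> L (b j) = lincomb (Div Y) n (Ct j) b"
    by (rule D.basis_coords[OF basis LbD]) (rule that)
  \<comment> \<open>\<open>endo_det\<close> takes the coordinates of the images as columns, a
    presentation takes them as rows; the two determinants agree by transposition.\<close>
  define C where "C = (\<lambda>i j. Ct j i)"
  have C: "\<forall>i<n. \<forall>j<n. C i j \<in> carrier G.R" using Ct(1) by (simp add: C_def del: group_ring_simps)
  have nontriv: "\<one>\<^bsub>G.R\<^esub> \<noteq> \<zero>\<^bsub>G.R\<^esub>" by simp
  have Z: "Z = ring_det G.R n C"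
    unfolding Z_def by (rule D.endo_det_eq[OF laplacian_hom nontriv basis C]) (simp add: Ct(2) C_def)
  show Zc: "Z \<in> carrier G.R" unfolding Z by (rule G.R.ring_det_closed[OF C])
  note pc = ring_hom_closed[OF G.pr_hom]
  define g where "g = (\<lambda>i. cls (b i))"
  define D' where "D' = (\<lambda>j i. if i < n then G.pr (Ct j i) else \<zero>\<^bsub>G.B\<^esub>)"
  have gP: "g \<in> {..<n} \<rightarrow> carrier P" unfolding g_def using cls_closed[OF bD] by blast
  have pr_lift: "\<exists>c. (\<forall>i. c i \<in> carrier G.R) \<and> (\<forall>i. x i = G.pr (c i))" if x: "\<And>i. x i \<in> carrier G.B" for x :: "nat \<Rightarrow> _"
  proof -
    have "\<forall>i. \<exists>r. r \<in> carrier G.R \<and> x i = G.pr r" using x G.pr_surj by blast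
    then obtain c where "\<forall>i. c i \<in> carrier G.R \<and> x i = G.pr (c i)" by (rule choice[THEN exE])
    then show ?thesis by (intro exI[of _ c]) simp
  qed
  have trunc: "lincomb P n (\<lambda>i. if i < n then G.pr (c i) else \<zero>\<^bsub>G.B\<^esub>) g = cls (lincomb (Div Y) n c b)"
    if c: "\<And>i. i < n \<Longrightarrow> c i \<in> carrier G.R" for c
  proof -
    have "lincomb P n (\<lambda>i. if i < n then G.pr (c i) else \<zero>\<^bsub>G.B\<^esub>) g = lincomb P n (\<lambda>i. G.pr (c i)) g"
      by (rule P.lincomb_cong[OF pc[OF c] gP]) simp_all
    then show ?thesis unfolding g_def using cls_lincomb[of n c b] c bD by simp
  qed
  have truncF: "(\<lambda>i. if i < n then G.pr (c i) else \<zero>\<^bsub>G.B\<^esub>) \<in> carrier (G.B.F n)"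
    if c: "\<And>i. i < n \<Longrightarrow> c i \<in> carrier G.R" for c
    using pc[OF c] by (simp add: G.B.F_carrier del: group_ring_simps)
  have gen: "generates G.B P n g"
    unfolding generates_def
  proof (intro conjI ballI gP)
    fix x assume "x \<in> carrier P"
    then obtain d where d: "d \<in> DY" "x = cls d" using cls_surj by blast
    have "\<forall>d\<in>DY. \<exists>!c. c \<in> carrier (G.R.F n) \<and> d = lincomb (Div Y) n c b" using basis by (simp add: is_basis_def del: Div_simps)
    then obtain c where c: "c \<in> carrier (G.R.F n)" "d = lincomb (Div Y) n c b" using d(1) by blast
    note cc = G.R.F_closed[OF c(1)]
    show "\<exists>c\<in>carrier (G.B.F n). x = lincomb P n c g"
      unfolding d(2) c(2) 
      by (rule bexI[of _ "\<lambda>i. if i < n then G.pr (c i) else \<zero>\<^bsub>G.B\<^esub>"], rule trunc[of c, OF cc, symmetric], rule truncF[of c, OF cc])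
  qed
  obtain m where m: "m \<noteq> 0" "\<And>d. d \<in> DY \<Longrightarrow> frag_deg d = 0 \<Longrightarrow> \<exists>x\<in>DY. frag_cmul m d = L x"
    by (rule laplacian_torsion[OF connY]) (rule that)
  \<comment> \<open>As \<open>b j\<close> has degree one, the order times \<open>b j\<close> minus
    the norm times \<open>b j\<close> has degree zero, and \<open>m\<close> times this difference is
    a Laplacian. So \<open>m * G.ord\<close> sends each generator into \<open>U\<close>.\<close>
  define \<delta> where "\<delta> = G.pr (frag_cmul (m * G.ord) \<one>\<^bsub>G.R\<^esub>)"
  have \<delta>: "\<delta> \<in> non_zero_divisors G.B" unfolding \<delta>_def by (rule G.integer_nzd) (use m(1) G.ord_nonzero in simp)
  have dg: "\<delta> \<odot>\<^bsub>P\<^esub> g j = \<zero>\<^bsub>P\<^esub>" if j: "j < n" for j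
  proof -
    have c1: "frag_cmul (m * G.ord) \<one>\<^bsub>G.R\<^esub> \<in> carrier G.R" by (rule G.frag_cmul_R) simp
    have o: "conv fst \<one>\<^bsub>G.R\<^esub> (b j) = b j" using D.smult_one[OF bD[OF j]] by (simp del: group_ring_simps)
    have s: "conv fst (frag_cmul (m * G.ord) \<one>\<^bsub>G.R\<^esub>) (b j) = frag_cmul (m * G.ord) (b j)"
      unfolding frag_cmul_conv[symmetric] o ..
    let ?d = "frag_cmul G.ord (b j) - conv fst G.Nm (b j)"
    have NbD: "conv fst G.Nm (b j) \<in> DY" by (rule smult_closed[OF G.norm_closed bD[OF j]])
    have dD: "?d \<in> DY"
      using keys_diff[of "frag_cmul G.ord (b j)" "conv fst G.Nm (b j)"] keys_cmul[of G.ord "b j"] NbD bD[OF j] by auto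
    have "frag_deg ?d = 0" by (simp add: frag_deg_conv G.frag_deg_norm b_def)
    then obtain x where x: "x \<in> DY" "frag_cmul m ?d = L x" using m(2)[OF dD] by blast
    have mb: "frag_cmul m \<one>\<^bsub>G.R\<^esub> \<in> carrier G.R" by (rule G.frag_cmul_R) simp
    have "frag_cmul m (conv fst G.Nm (b j)) = conv fst (frag_cmul m \<one>\<^bsub>G.R\<^esub>) (conv fst G.Nm (b j))"
      using D.smult_one[OF NbD] by (simp add: frag_cmul_conv[symmetric] del: group_ring_simps)
    also have "\<dots> = conv fst G.Nm (conv fst (frag_cmul m \<one>\<^bsub>G.R\<^esub>) (b j))" by (rule norm_smult_commute[OF mb bD[OF j]])
    finally have mN: "frag_cmul m (conv fst G.Nm (b j)) = conv fst G.Nm (conv fst (frag_cmul m \<one>\<^bsub>G.R\<^esub>) (b j))" .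
    have split: "frag_cmul m (u - v) = frag_cmul m u - frag_cmul m v" for u v :: "'w \<Rightarrow>\<^sub>0 int"
      by (rule poly_mapping_eqI) (simp add: lookup_minus right_diff_distrib)
    have "frag_cmul (m * G.ord) (b j) = L x + frag_cmul m (conv fst G.Nm (b j))"
      unfolding x(2)[symmetric] split by simp
    then have inU: "frag_cmul (m * G.ord) (b j) \<in> U"
      unfolding mN U_def using x(1) smult_closed[OF mb bD[OF j]] by blast
    show ?thesis
      unfolding \<delta>_def g_def cls_smult[OF c1 bD[OF j]] s by (rule iffD2[OF cls_zero_iff[OF U_Div[OF inU]] inU])
  qed
  have Ctc: "Ct j i \<in> carrier G.R" if "j < n" "i < n" for j i using Ct(1) that by blast
  have rel: "D' j \<in> rel G.B P n g" if j: "j < n" for j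
  proof -
    have "lincomb P n (D' j) g = cls (L (b j))"
      unfolding D'_def Ct(2)[OF j] by (rule trunc) (rule Ctc[OF j])
    also have "\<dots> = \<zero>\<^bsub>P\<^esub>" using cls_zero_iff[OF laplacian_Div[OF connY bD[OF j]]] laplacian_in_U[OF bD[OF j]] by simp
    finally show ?thesis using truncF[of "Ct j", OF Ctc[OF j]] by (simp add: rel_def D'_def)
  qed
  have D'F: "D' \<in> {..<n} \<rightarrow> carrier (G.B.F n)" using rel by (auto simp: rel_def)
  interpret H: ring_hom_cring G.R G.B G.pr
    by (intro ring_hom_cring.intro ring_hom_cring_axioms.intro G.group_ring_cring G.B.is_cring G.pr_hom)
  \<comment> \<open>A combination of the basis lying in \<open>U\<close> is of the form
    \<open>L y + N z\<close>. The coordinates of \<open>L y\<close> are combinations of the rows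
    \<open>Ct j\<close>, and those of the norm part vanish under \<open>G.pr\<close>.\<close>
  have sp: "\<exists>c\<in>carrier (G.B.F n). x = lincomb (G.B.F n) n c D'" if x: "x \<in> rel G.B P n g" for x
  proof -
    have xF: "x \<in> carrier (G.B.F n)" and x0: "lincomb P n x g = \<zero>\<^bsub>P\<^esub>" using x by (simp_all add: rel_def)
    from pr_lift[of x, OF G.B.F_closed[OF xF]] obtain c where c': "(\<forall>i. c i \<in> carrier G.R) \<and> (\<forall>i. x i = G.pr (c i))"
      by (rule exE)
    have c: "c i \<in> carrier G.R" "x i = G.pr (c i)" for i using c'[THEN conjunct1, THEN spec] c'[THEN conjunct2, THEN spec] .
    have cD: "lincomb (Div Y) n c b \<in> DY" by (rule D.lincomb_closed[OF c(1) bc])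
    have "x = (\<lambda>i. if i < n then G.pr (c i) else \<zero>\<^bsub>G.B\<^esub>)" using xF c(2) by (auto simp: G.B.F_carrier fun_eq_iff)
    then have "cls (lincomb (Div Y) n c b) = \<zero>\<^bsub>P\<^esub>" using trunc[OF c(1)] x0 by simp
    then have "lincomb (Div Y) n c b \<in> U" using cls_zero_iff[OF cD] by simp
    then obtain y z where y: "y \<in> DY" and z: "z \<in> DY" and yz: "lincomb (Div Y) n c b = L y + conv fst G.Nm z" unfolding U_def by blast
    have coords: "\<exists>e. (\<forall>i<n. e i \<in> carrier G.R) \<and> d = lincomb (Div Y) n e b" if d: "d \<in> DY" for d
    proof -
      have "(\<lambda>_::nat. d) \<in> {..<1::nat} \<rightarrow> DY" using d by simp
      then obtain Q where Q: "\<forall>i<1. \<forall>j<n. Q i j \<in> carrier G.R" "\<And>j. j < (1::nat) \<Longrightarrow> d = lincomb (Div Y) n (Q j) b"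
        by (rule D.basis_coords[OF basis]) (rule that)
      show ?thesis by (rule exI[of _ "Q 0"]) (use Q in simp)
    qed
    obtain e where e: "\<forall>i<n. e i \<in> carrier G.R" "y = lincomb (Div Y) n e b" using coords[OF y] by blast
    obtain f where f: "\<forall>i<n. f i \<in> carrier G.R" "z = lincomb (Div Y) n f b" using coords[OF z] by blast
    have ec: "e i \<in> carrier G.R" if "i < n" for i using e(1) that by blast
    have fc: "f i \<in> carrier G.R" if "i < n" for i using f(1) that by blast
    let ?e = "\<lambda>k. \<Oplus>\<^bsub>G.R\<^esub>j\<in>{..<n}. e j \<otimes>\<^bsub>G.R\<^esub> Ct j k"
    have eC: "?e k \<in> carrier G.R" if "k < n" for k
      by (rule G.R.finsum_closed) (use ec Ctc that in \<open>auto simp del: group_ring_simps\<close>)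
    have "L y = lincomb (Div Y) n e (\<lambda>j. L (b j))"
      unfolding e(2) by (rule G.R.hom_lincomb[OF Div_lmod Div_lmod laplacian_hom ec bc])
    also have "\<dots> = lincomb (Div Y) n e (\<lambda>j. lincomb (Div Y) n (Ct j) b)"
      by (rule D.lincomb_cong[OF ec LbD refl, symmetric, OF _ ]) (simp_all add: Ct(2))
    also have "\<dots> = lincomb (Div Y) n ?e b"
      by (rule D.lincomb_lincomb[OF ec Ct(1) bc])
    finally have Ly: "L y = lincomb (Div Y) n ?e b" .
    have Nz: "conv fst G.Nm z = lincomb (Div Y) n (\<lambda>i. G.Nm \<otimes>\<^bsub>G.R\<^esub> f i) b"
      unfolding f(2) using D.lincomb_smult[OF fc G.norm_closed bc] by simp
    have Nf: "G.Nm \<otimes>\<^bsub>G.R\<^esub> f i \<in> carrier G.R" if "i < n" for i by (rule G.R.m_closed[OF G.norm_closed fc[OF that]])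
    have "lincomb (Div Y) n c b = lincomb (Div Y) n (\<lambda>i. ?e i \<oplus>\<^bsub>G.R\<^esub> G.Nm \<otimes>\<^bsub>G.R\<^esub> f i) b"
      unfolding yz Ly Nz using D.lincomb_add[OF eC Nf bc] by simp
    note eq = D.basis_unique[OF basis c(1) _ this]
    have ci: "c i = ?e i \<oplus>\<^bsub>G.R\<^esub> G.Nm \<otimes>\<^bsub>G.R\<^esub> f i" if "i < n" for i
      by (rule eq[OF G.R.a_closed[OF eC Nf] that])
    have prN: "G.pr G.Nm = \<zero>\<^bsub>G.B\<^esub>"
      using G.pr_eq_zero_iff[OF G.norm_closed] G.R.cgenideal_self[OF G.norm_closed] by simp
    define e' where "e' = (\<lambda>i. if i < n then G.pr (e i) else \<zero>\<^bsub>G.B\<^esub>)"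
    have e'F: "e' \<in> carrier (G.B.F n)" unfolding e'_def by (rule truncF[OF ec])
    have "x = lincomb (G.B.F n) n e' D'"
    proof
      fix k
      have lk: "lincomb (G.B.F n) n e' D' k = (\<Oplus>\<^bsub>G.B\<^esub>j\<in>{..<n}. e' j \<otimes>\<^bsub>G.B\<^esub> D' j k)"
        by (rule G.B.lincomb_F_apply[OF G.B.F_closed[OF e'F] D'F])
      show "x k = lincomb (G.B.F n) n e' D' k"
      proof (cases "k < n")
        case True
        have "x k = G.pr (?e k) \<oplus>\<^bsub>G.B\<^esub> G.pr G.Nm \<otimes>\<^bsub>G.B\<^esub> G.pr (f k)"
          unfolding c(2) ci[OF True] ring_hom_add[OF G.pr_hom eC[OF True] Nf[OF True]]
            ring_hom_mult[OF G.pr_hom G.norm_closed fc[OF True]] ..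
        also have "\<dots> = G.pr (?e k)" unfolding prN using pc[OF eC[OF True]] pc[OF fc[OF True]] by simp
        also have "\<dots> = (\<Oplus>\<^bsub>G.B\<^esub>j\<in>{..<n}. G.pr (e j \<otimes>\<^bsub>G.R\<^esub> Ct j k))"
          by (rule H.hom_finsum[unfolded comp_def]) (use ec Ctc[OF _ True] in \<open>auto simp del: group_ring_simps\<close>)
        also have "\<dots> = (\<Oplus>\<^bsub>G.B\<^esub>j\<in>{..<n}. e' j \<otimes>\<^bsub>G.B\<^esub> D' j k)"
          by (rule G.B.finsum_cong') (use True pc ec Ctc[OF _ True] ring_hom_mult[OF G.pr_hom] in \<open>auto simp: e'_def D'_def simp del: group_ring_simps\<close>)
        finally show ?thesis unfolding lk .
      next
        case False
        have "(\<Oplus>\<^bsub>G.B\<^esub>j\<in>{..<n}. e' j \<otimes>\<^bsub>G.B\<^esub> D' j k) = (\<Oplus>\<^bsub>G.B\<^esub>j\<in>{..<n}. \<zero>\<^bsub>G.B\<^esub>)"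
          by (rule G.B.finsum_cong') (use False G.B.F_closed[OF e'F] in \<open>auto simp: D'_def\<close>)
        then show ?thesis unfolding lk using False xF by (simp add: G.B.F_carrier)
      qed
    qed
    then show ?thesis using e'F by (rule bexI)
  qed
  note sq = G.B.square_presentation[OF P_lmod gen \<delta> dg rel sp]
  have "ring_det G.B n D' = ring_det G.B n (\<lambda>i j. G.pr (Ct i j))"
  proof (rule G.B.ring_det_cong)
    show "\<forall>i<n. \<forall>j<n. G.pr (Ct i j) \<in> carrier G.B" using pc[OF Ctc] by blast
  qed (simp add: D'_def)
  also have "\<dots> = G.pr (ring_det G.R n Ct)"
    by (rule G.R.ring_det_hom[OF G.B.is_cring G.pr_hom Ct(1)])
  also have "ring_det G.R n Ct = Z" unfolding Z C_def by (rule G.R.ring_det_transpose[OF Ct(1), symmetric])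
  finally have det: "ring_det G.B n D' = G.pr Z" .
  show "resolved G.B P" by (rule sq(2))
  show "Fitt G.B P = PIdl\<^bsub>G.B\<^esub> (G.pr Z)" using sq(3) unfolding det .
  show "finitely_presented G.B P"
    unfolding finitely_presented_def using sq(4) lmodD[OF P_lmod] by blast
qed

end

section \<open>The exact sequence relating the Jacobian to the degree map\<close>

context abelian_cover
begin

abbreviation "D0 \<equiv> {d \<in> DY. frag_deg d = 0}"

lemma D0_sub: "submodule D0 G.R (Div Y)"
  unfolding D.submodule_iff
proof (intro conjI ballI)
  fix x assume x: "x \<in> D0"
  show "x \<oplus>\<^bsub>Div Y\<^esub> y \<in> D0" if "y \<in> D0" for y using x that Div_add[of x y] by simp
next
  fix a x assume a: "a \<in> carrier G.R" and x: "x \<in> D0"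
  then show "a \<odot>\<^bsub>Div Y\<^esub> x \<in> D0" using smult_closed[OF a, of x] by (simp add: frag_deg_conv)
qed auto

lemma Div0_simps [simp]:
  "carrier (Div0 Y) = D0" "\<zero>\<^bsub>Div0 Y\<^esub> = 0" "x \<oplus>\<^bsub>Div0 Y\<^esub> y = x + y" "r \<odot>\<^bsub>Div0 Y\<^esub> d = conv fst r d"
  by (simp_all add: Div0_def)

lemma Div0_lmod: "lmod G.R (Div0 Y)"
  using D.submodule_lmod[OF D0_sub] by (simp add: Div0_def)

sublocale D0: lmod G.R "Div0 Y" by (rule Div0_lmod)

lemma image_sub: "submodule (L ` DY) G.R (Div0 Y)"
  unfolding D0.submodule_iff
proof (intro conjI ballI)
  show "L ` DY \<subseteq> carrier (Div0 Y)" using laplacian_Div[OF connY] by (auto simp: frag_deg_laplacian)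
  have "0 \<in> DY" by simp
  then show "\<zero>\<^bsub>Div0 Y\<^esub> \<in> L ` DY" using laplacian_arith(3) by (metis Div0_simps(2) imageI)
  fix x y assume "x \<in> L ` DY" "y \<in> L ` DY"
  then obtain u v where u: "u \<in> DY" "x = L u" and v: "v \<in> DY" "y = L v" by blast
  have "x \<oplus>\<^bsub>Div0 Y\<^esub> y = L (u + v)" unfolding u(2) v(2) by (simp add: laplacian_arith)
  then show "x \<oplus>\<^bsub>Div0 Y\<^esub> y \<in> L ` DY" using Div_add[OF u(1) v(1)] by blast
next
  fix a x assume a: "a \<in> carrier G.R" and "x \<in> L ` DY"
  then obtain u where u: "u \<in> DY" "x = L u" by blast
  have "a \<odot>\<^bsub>Div0 Y\<^esub> x = L (conv fst a u)" unfolding u(2) using laplacian_smult[OF a u(1)] by simp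
  then show "a \<odot>\<^bsub>Div0 Y\<^esub> x \<in> L ` DY" using smult_closed[OF a u(1)] by blast
qed

lemma Jac_lmod: "lmod G.R (Jac Y)"
  unfolding Jac_def by (rule D0.quotient_lmod[OF image_sub])

lemma Jac_to_P:
  obtains h where "h \<in> module_hom G.R (Jac Y) P0" "\<And>d. d \<in> D0 \<Longrightarrow> h (L ` DY +>\<^bsub>Div0 Y\<^esub> d) = cls d"
proof -
  have hom: "(\<lambda>d. cls d) \<in> module_hom G.R (Div0 Y) P0"
    using D.quot_hom[OF U_sub] by (simp add: module_hom_def Pi_def)
  have ker: "cls x = \<zero>\<^bsub>P0\<^esub>" if x: "x \<in> L ` DY" for x
  proof -
    obtain u where u: "u \<in> DY" "x = L u" using x by blast
    show ?thesis unfolding u(2)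
      using cls_zero_iff[OF laplacian_Div[OF connY u(1)]] laplacian_in_U[OF u(1)] by simp
  qed
  obtain h where h: "h \<in> module_hom G.R (quotient_module (Div0 Y) (L ` DY)) P0"
    "\<And>d. d \<in> carrier (Div0 Y) \<Longrightarrow> h (L ` DY +>\<^bsub>Div0 Y\<^esub> d) = cls d"
    by (rule D0.quot_induced[OF image_sub P0_lmod hom ker]) (assumption, rule that)
  show thesis by (rule that[of h]) (use h in \<open>auto simp: Jac_def\<close>)
qed

text \<open>Laplacians have degree zero and the norm has degree \<open>G.ord\<close>, so the degrees
  of elements of \<open>U\<close> are multiples of the order.\<close>

lemma P_to_T:
  obtains p where "p \<in> module_hom G.B P G.T" "\<And>d. d \<in> DY \<Longrightarrow> p (cls d) = int_coset G.ord (frag_deg d)"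
proof -
  have hom: "(\<lambda>d. int_coset G.ord (frag_deg d)) \<in> module_hom G.R (Div Y) G.T0"
    by (simp add: module_hom_def frag_deg_conv)
  have ker: "int_coset G.ord (frag_deg x) = \<zero>\<^bsub>G.T0\<^esub>" if x: "x \<in> U" for x
  proof -
    obtain u v where "x = L u + conv fst G.Nm v" using x unfolding U_def by blast
    then have "frag_deg x = G.ord * frag_deg v" by (simp add: frag_deg_laplacian frag_deg_conv G.frag_deg_norm)
    then show ?thesis using int_coset_zero_iff[of G.ord "frag_deg x"] int_coset_zero[of G.ord] by simp
  qed
  obtain p where p: "p \<in> module_hom G.R P0 G.T0" "\<And>d. d \<in> DY \<Longrightarrow> p (cls d) = int_coset G.ord (frag_deg d)"
    by (rule D.quot_induced[OF U_sub G.T0_lmod hom ker]) (assumption, rule that)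
  have "p \<in> module_hom G.B P G.T"
    unfolding module_hom_def
  proof (intro CollectI conjI ballI)
    show "p \<in> carrier P \<rightarrow> carrier G.T" using p(1) by (simp add: module_hom_def)
    fix x assume x: "x \<in> carrier P"
    show "p (x \<oplus>\<^bsub>P\<^esub> y) = p x \<oplus>\<^bsub>G.T\<^esub> p y" if "y \<in> carrier P" for y
      using p(1) x that by (simp add: module_hom_def)
    fix b assume "b \<in> carrier G.B"
    then obtain r where r: "r \<in> carrier G.R" "b = G.pr r" using G.pr_surj by blast
    have x0: "x \<in> carrier P0" using x by simp
    have px: "p x \<in> carrier G.T0" using p(1) x0 by (auto simp: module_hom_def)
    have "p (r \<odot>\<^bsub>P0\<^esub> x) = r \<odot>\<^bsub>G.T0\<^esub> p x" using p(1) r(1) x0 unfolding module_hom_def by blast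
    then show "p (b \<odot>\<^bsub>P\<^esub> x) = b \<odot>\<^bsub>G.T\<^esub> p x"
      unfolding r(2) P_smult[OF r(1) x0] G.T_smult[OF r(1) px] .
  qed
  then show thesis using p(2) by (rule that)
qed

lemma Jac_exact_sequence:
  obtains i p where "short_exact G.B (base_change G.R G.B G.pr (Jac Y)) P G.T i p"
proof -
  interpret Q: ring_quotient G.R G.B G.pr by (rule G.R.ring_quotient_Quot[OF G.norm_ideal])
  obtain h where h: "h \<in> module_hom G.R (Jac Y) P0" "\<And>d. d \<in> D0 \<Longrightarrow> h (L ` DY +>\<^bsub>Div0 Y\<^esub> d) = cls d"
    by (rule Jac_to_P) (rule that)
  obtain p where p: "p \<in> module_hom G.B P G.T" "\<And>d. d \<in> DY \<Longrightarrow> p (cls d) = int_coset G.ord (frag_deg d)"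
    by (rule P_to_T) (rule that)
  have Jc: "\<exists>d\<in>D0. x = L ` DY +>\<^bsub>Div0 Y\<^esub> d" if "x \<in> carrier (Jac Y)" for x
    using that D0.quot_carrier[OF image_sub] unfolding Jac_def Div0_simps by blast
  have Jcl: "L ` DY +>\<^bsub>Div0 Y\<^esub> d \<in> carrier (Jac Y)" if "d \<in> D0" for d
    using D0.quot_coset[OF image_sub, of d] that unfolding Jac_def Div0_simps by blast
  have h_smult: "h (a \<odot>\<^bsub>Jac Y\<^esub> x) = G.pr a \<odot>\<^bsub>P\<^esub> h x" if "a \<in> carrier G.R" "x \<in> carrier (Jac Y)" for a x
  proof -
    have "h x \<in> carrier P0" using h(1) that(2) by (auto simp: module_hom_def)
    then show ?thesis using h(1) that P_smult[OF that(1), of "h x"] by (simp add: module_hom_def)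
  qed
  \<comment> \<open>The class of \<open>d = L u + N v\<close> in the Jacobian is the norm times the
    class of \<open>v\<close>, which exists there once \<open>v\<close> has degree zero. This is the
    form of kernel elements that \<open>base_change_embedding\<close> asks for, since
    \<open>G.pr\<close> kills the norm.\<close>
  have ker: "\<exists>a\<in>carrier G.R. \<exists>m\<in>carrier (Jac Y). G.pr a = \<zero>\<^bsub>G.B\<^esub> \<and> x = a \<odot>\<^bsub>Jac Y\<^esub> m"
    if x: "x \<in> carrier (Jac Y)" "h x = \<zero>\<^bsub>P\<^esub>" for x
  proof -
    obtain d where d: "d \<in> D0" "x = L ` DY +>\<^bsub>Div0 Y\<^esub> d" using Jc[OF x(1)] by blast
    then have "d \<in> U" using h(2)[OF d(1)] x(2) cls_zero_iff[of d] by simp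
    then obtain u v where u: "u \<in> DY" and v: "v \<in> DY" and e: "d = L u + conv fst G.Nm v" unfolding U_def by blast
    have "G.ord * frag_deg v = 0"
      using d(1) e by (simp add: frag_deg_laplacian frag_deg_conv G.frag_deg_norm)
    then have v0: "v \<in> D0" using v G.ord_nonzero by simp
    have Nv: "conv fst G.Nm v \<in> D0" using smult_closed[OF G.norm_closed v] v0 by (simp add: frag_deg_conv)
    have "d \<ominus>\<^bsub>Div0 Y\<^esub> conv fst G.Nm v = L u"
    proof -
      have "\<ominus>\<^bsub>Div0 Y\<^esub> conv fst G.Nm v = - conv fst G.Nm v"
        by (rule D0.M.minus_equality) (use Nv in simp_all)
      then show ?thesis by (simp add: a_minus_def e)
    qed
    then have "x = L ` DY +>\<^bsub>Div0 Y\<^esub> conv fst G.Nm v"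
      unfolding d(2) using D0.quot_eq_iff[OF image_sub, of d "conv fst G.Nm v"] d(1) Nv u by simp
    also have "\<dots> = G.Nm \<odot>\<^bsub>Jac Y\<^esub> (L ` DY +>\<^bsub>Div0 Y\<^esub> v)"
      using D0.quot_smult[OF image_sub G.norm_closed, of v] v0 unfolding Jac_def by simp
    finally have "x = G.Nm \<odot>\<^bsub>Jac Y\<^esub> (L ` DY +>\<^bsub>Div0 Y\<^esub> v)" .
    moreover have "G.pr G.Nm = \<zero>\<^bsub>G.B\<^esub>"
      using G.pr_eq_zero_iff[OF G.norm_closed] G.R.cgenideal_self[OF G.norm_closed] by simp
    ultimately show ?thesis using G.norm_closed Jcl[OF v0] by blast
  qed
  obtain i where i: "i \<in> module_hom G.B (base_change G.R G.B G.pr (Jac Y)) P"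
    "inj_on i (carrier (base_change G.R G.B G.pr (Jac Y)))"
    "i ` carrier (base_change G.R G.B G.pr (Jac Y)) = h ` carrier (Jac Y)"
  proof (rule Q.base_change_embedding[OF Jac_lmod P_lmod, of h])
    show "h x \<in> carrier P" if "x \<in> carrier (Jac Y)" for x using h(1) that by (auto simp: module_hom_def)
    show "h (x \<oplus>\<^bsub>Jac Y\<^esub> y) = h x \<oplus>\<^bsub>P\<^esub> h y" if "x \<in> carrier (Jac Y)" "y \<in> carrier (Jac Y)" for x y
      using h(1) that by (simp add: module_hom_def)
    show "h (a \<odot>\<^bsub>Jac Y\<^esub> x) = G.pr a \<odot>\<^bsub>P\<^esub> h x" if "a \<in> carrier G.R" "x \<in> carrier (Jac Y)" for a x
      by (rule h_smult[OF that])
    show "\<exists>a\<in>carrier G.R. \<exists>m\<in>carrier (Jac Y). G.pr a = \<zero>\<^bsub>G.B\<^esub> \<and> x = a \<odot>\<^bsub>Jac Y\<^esub> m"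
      if "x \<in> carrier (Jac Y)" "h x = \<zero>\<^bsub>P\<^esub>" for x
      by (rule ker[OF that])
  qed (rule that)
  obtain w where w: "w \<in> verts Y" using verts_nonempty[OF connY] by blast
  have mult_deg: "frag_cmul k (frag_of w) \<in> DY" for k using w keys_cmul[of k "frag_of w"] by auto
  have surj: "p ` carrier P = carrier G.T"
  proof
    show "p ` carrier P \<subseteq> carrier G.T" using p(1) by (auto simp: module_hom_def)
    show "carrier G.T \<subseteq> p ` carrier P"
    proof
      fix x assume "x \<in> carrier G.T"
      then obtain a where x: "x = int_coset G.ord a" by auto
      have "p (cls (frag_cmul a (frag_of w))) = x" unfolding x using p(2)[OF mult_deg[of a]] by simp
      then show "x \<in> p ` carrier P" using cls_closed[OF mult_deg[of a]] by blast
    qed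
  qed
  have ker_p: "h ` carrier (Jac Y) = {x \<in> carrier P. p x = \<zero>\<^bsub>G.T\<^esub>}"
  proof
    show "h ` carrier (Jac Y) \<subseteq> {x \<in> carrier P. p x = \<zero>\<^bsub>G.T\<^esub>}"
    proof
      fix y assume "y \<in> h ` carrier (Jac Y)"
      then obtain x where x: "x \<in> carrier (Jac Y)" "y = h x" by blast
      obtain d where d: "d \<in> D0" "x = L ` DY +>\<^bsub>Div0 Y\<^esub> d" using Jc[OF x(1)] by blast
      have y: "y = cls d" unfolding x(2) d(2) by (rule h(2)[OF d(1)])
      show "y \<in> {x \<in> carrier P. p x = \<zero>\<^bsub>G.T\<^esub>}"
        unfolding y using d(1) cls_closed[of d] p(2)[of d] by simp
    qed
    show "{x \<in> carrier P. p x = \<zero>\<^bsub>G.T\<^esub>} \<subseteq> h ` carrier (Jac Y)"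
    proof
      fix x assume x: "x \<in> {x \<in> carrier P. p x = \<zero>\<^bsub>G.T\<^esub>}"
      then obtain d where d: "d \<in> DY" "x = cls d" using cls_surj by blast
      then have "G.ord dvd frag_deg d"
        using x p(2)[OF d(1)] int_coset_zero_iff[of G.ord "frag_deg d"] int_coset_zero[of G.ord] by simp
      then obtain k where k: "frag_deg d = G.ord * k" by (auto simp: dvd_def)
      \<comment> \<open>A multiple of the norm of a vertex, of the same degree as \<open>d\<close>.
        Subtracting it leaves the class in \<open>P\<close> unchanged and brings \<open>d\<close> to
        degree zero.\<close>
      let ?n = "conv fst G.Nm (frag_cmul k (frag_of w))"
      have nD: "?n \<in> DY" by (rule smult_closed[OF G.norm_closed mult_deg])
      have "\<ominus>\<^bsub>Div Y\<^esub> ?n = - ?n" by (rule D.M.minus_equality) (use nD in simp_all)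
      then have mn: "u \<ominus>\<^bsub>Div Y\<^esub> ?n = u - ?n" for u by (simp add: a_minus_def)
      have "d - ?n \<in> DY" using D.M.minus_closed[OF d(1) nD] mn by simp
      then have d0: "d - ?n \<in> D0" using k by (simp add: frag_deg_conv G.frag_deg_norm)
      have neg: "\<ominus>\<^bsub>Div Y\<^esub> (d - ?n) = - (d - ?n)"
      proof (rule D.M.minus_equality)
        show "- (d - ?n) \<in> DY" using \<open>d - ?n \<in> DY\<close> by (simp only: Div_simps mem_Collect_eq keys_minus)
      qed (use \<open>d - ?n \<in> DY\<close> in simp_all)
      have "cls d = cls (d - ?n)"
        using D.quot_eq_iff[OF U_sub d(1) \<open>d - ?n \<in> DY\<close>] norm_in_U[OF mult_deg[of k]] by (simp add: a_minus_def neg)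
      then have "x = h (L ` DY +>\<^bsub>Div0 Y\<^esub> (d - ?n))" using h(2)[OF d0] d(2) by simp
      then show "x \<in> h ` carrier (Jac Y)" using Jcl[OF d0] by blast
    qed
  qed
  have "short_exact G.B (base_change G.R G.B G.pr (Jac Y)) P G.T i p"
    unfolding short_exact_def
    using lmodD[OF Q.base_change_lmod[OF Jac_lmod]] lmodD[OF P_lmod] lmodD[OF G.T_lmod] i(1) p(1) i(2) surj i(3)[unfolded ker_p]
    by simp
  then show thesis by (rule that)
qed

lemma Fitt_Jac:
  "to_Frac G.B ` Fitt G.B (base_change G.R G.B G.pr (Jac Y)) =
     to_Frac G.B (G.pr (endo_det G.R (Div Y) L)) <#\<^bsub>Frac G.B\<^esub> Fitt_shift G.B G.T"
proof -
  obtain i p where ex: "short_exact G.B (base_change G.R G.B G.pr (Jac Y)) P G.T i p"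
    by (rule Jac_exact_sequence) (rule that)
  \<comment> \<open>Two distinct values of the type of elements of \<open>B\<close>; the encoding of
    basis indices behind \<open>class_P_tfq\<close> needs them.\<close>
  have ne: "({} :: (('w \<Rightarrow> 'w) \<times> ('f \<Rightarrow> 'f) \<Rightarrow>\<^sub>0 int) set) \<noteq> UNIV" by simp
  note shift = G.B.Fitt_shift_mult[OF ne G.T_finitely_presented G.T_torsion ex P_presentation(2,3)]
  have Zc: "G.pr (endo_det G.R (Div Y) L) \<in> carrier G.B"
    by (rule ring_hom_closed[OF G.pr_hom P_presentation(1)])
  show ?thesis
    unfolding G.B.principal_mult[OF Zc shift(2)] shift(1)[symmetric] P_presentation(4) ..
qed

end

theorem theorem3p4:
  fixes Y :: "('w, 'f) pre_digraph" and invY :: "'f \<Rightarrow> 'f"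
    and X :: "('v, 'e) pre_digraph" and invX :: "'e \<Rightarrow> 'e"
    and pV :: "'w \<Rightarrow> 'v" and pE :: "'f \<Rightarrow> 'e"
  assumes "abelian_covering Y invY X invX pV pE"
  shows "let \<Gamma> = galois_group Y invY pV pE;
             R = group_ring \<Gamma>;
             I = PIdl\<^bsub>R\<^esub> (norm_element \<Gamma>);
             Rbar = R Quot I;
             \<pi> = (\<lambda>r. I +>\<^bsub>R\<^esub> r);
             Z = endo_det R (Div Y) (laplacian Y)
         in to_Frac Rbar ` Fitt Rbar (base_change R Rbar \<pi> (Jac Y)) =
            to_Frac Rbar (\<pi> Z) <#\<^bsub>Frac Rbar\<^esub>
              Fitt_shift Rbar (descend_module (trivial_module (ZFact (int (card (carrier \<Gamma>))))))"
proof -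
  interpret abelian_cover Y invY X invX pV pE by (rule abelian_cover.intro[OF assms])
  show ?thesis unfolding Let_def by (rule Fitt_Jac)
qed

end
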